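(* Let $p\ge m$. An irreducible $gl(p|q)\times gl(m|n)$-module $V^\lambda_{p|q}\otimes V^\lambda_{m|n}$ appears in $\mathbb{C}[\mathbf{x},\boldsymbol{\xi},\boldsymbol{\eta},\mathbf{y}]$ if and only if $\lambda_{m+1}\le n$ and $\lambda_{p+1}\le q$. The following are highest weight vectors corresponding to such a Young diagram $\lambda$ ($t$ is the length of $\lambda'$): (i) In the case when $\lambda_{m+1}=0$ it is given by $\prod_{i=1}^t\Delta_{\lambda'_i}$. (ii) In the case when $\lambda_{m+1}>0$ and $\lambda_{p+1}=0$ it is given by $\prod_{i=1}^r\Delta_{i,\lambda'_i}\prod_{i=r+1}^t\Delta_{\lambda'_i}$, where $0\le r\le n$ is defined by $\lambda'_r>m$ and $\lambda'_{r+1}\le m$. (iii) In the case when $\lambda_{p+1}>0$ it is given by $$\Gamma(\lambda_{p+1},\ldots,\lambda_{p+s})\prod_{i=r+1}^{r'}\Delta_{i,\lambda'_i}\prod_{i=r'+1}^t\Delta_{\lambda'_i},$$ where $p+s$ is the length of $\lambda$ and $r\le r'$ are determined by $\lambda'_r>p$, $\lambda'_{r+1}\le p$, and $\lambda'_{r'}>m$, $\lambda'_{r'+1}\le m$.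
   Context: $\mathbb{C}[\mathbf{x},\boldsymbol{\xi},\boldsymbol{\eta},\mathbf{y}]$ is the polynomial superalgebra over $\mathbb{C}$ in even variables $x_l^i$ ($1\le i\le p$, $1\le l\le m$), $y_k^j$ ($1\le j\le q$, $1\le k\le n$) and odd variables $\xi_l^j$ ($1\le j\le q$, $1\le l\le m$), $\eta_k^i$ ($1\le i\le p$, $1\le k\le n$). It is identified with the (super)symmetric algebra $S(\mathbb{C}^{p|q}\otimes\mathbb{C}^{m|n})$, with its natural $gl(p|q)\times gl(m|n)$-action, via $x_l^i=e_l\otimes e^i$, $\xi_l^j=e_l\otimes f^j$, $\eta_k^i=f_k\otimes e^i$, $y_k^j=f_k\otimes f^j$, where $e^i;f^j$ and $e_l;f_k$ are the standard (even; odd) bases of $\mathbb{C}^{p|q}$ and $\mathbb{C}^{m|n}$. Cartan subalgebras: for $gl(p|q)$, $\sum_{j=1}^m x_j^i\frac{\partial}{\partial x_j^i}+\sum_{j=1}^n\eta_j^i\frac{\partial}{\partial\eta_j^i}$ ($1\le i\le p$) and $\sum_{j=1}^m\xi_j^l\frac{\partial}{\partial\xi_j^l}+\sum_{j=1}^n y_j^l\frac{\partial}{\partial y_j^l}$ ($1\le l\le q$); for $gl(m|n)$, $\sum_{j=1}^p x_s^j\frac{\partial}{\partial x_s^j}+\sum_{j=1}^q\xi_s^j\frac{\partial}{\partial\xi_s^j}$ ($1\le s\le m$) and $\sum_{j=1}^p\eta_k^j\frac{\partial}{\partial\eta_k^j}+\sum_{j=1}^q y_k^j\frac{\partial}{\partial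 y_k^j}$ ($1\le k\le n$). Simple root vectors: for $gl(p|q)$, $\sum_j x_j^{i-1}\frac{\partial}{\partial x_j^i}+\sum_j\eta_j^{i-1}\frac{\partial}{\partial\eta_j^i}$ ($1<i\le p$), $\sum_j\xi_j^{l-1}\frac{\partial}{\partial\xi_j^l}+\sum_j y_j^{l-1}\frac{\partial}{\partial y_j^l}$ ($1<l\le q$), $\sum_j x_j^p\frac{\partial}{\partial\xi_j^1}+\sum_j\eta_j^p\frac{\partial}{\partial y_j^1}$; for $gl(m|n)$, $\sum_j x_{s-1}^j\frac{\partial}{\partial x_s^j}+\sum_j\xi_{s-1}^j\frac{\partial}{\partial\xi_s^j}$ ($1<s\le m$), $\sum_j\eta_{k-1}^j\frac{\partial}{\partial\eta_k^j}+\sum_j y_{k-1}^j\frac{\partial}{\partial y_k^j}$ ($1<k\le n$), $\sum_j x_m^j\frac{\partial}{\partial\eta_1^j}-\sum_j\xi_m^j\frac{\partial}{\partial y_1^j}$. A highest weight vector is a nonzero weight vector annihilated by all simple root vectors of both algebras. $V^\lambda_{p|q}$ and $V^\lambda_{m|n}$ are the irreducible modules of highest weights $(\lambda_1,\ldots,\lambda_p;\langle\lambda'_1-p\rangle,\ldots,\langle\lambda'_q-p\rangle)$ and $(\lambda_1,\ldots,\lambda_m;\langle\lambda'_1-m\rangle,\ldots,\langle\lambda'_n-m\rangle)$, where $\lambda'$ is the transpose and $\langle l\rangle=\max(l,0)$. A highest weight vector corresponds to $\lambda$ if it has these weights. Determinants of matrices with entries in a superalgebra ($a_i^j$ in row $i$,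 column $j$) are $\det=\sum_{\sigma}\mathrm{sgn}(\sigma)a_1^{\sigma(1)}a_2^{\sigma(2)}\cdots$ (row order). $\Delta_r=\det(x_l^i)_{1\le i,l\le r}$ for $1\le r\le m$. For $m\le r\le p$, $1\le k\le n$, $\Delta_{k,r}$ is the determinant of the $r\times r$ matrix with $l$-th row $(x_l^1,\ldots,x_l^r)$ for $1\le l\le m$ and last $r-m$ rows all equal to $(\eta_k^1,\ldots,\eta_k^r)$. Products are taken in increasing order of index. Definition of $\Gamma(\lambda_{p+1},\ldots,\lambda_{p+s})$ for $\min(q,n)\ge\lambda_{p+1}\ge\cdots\ge\lambda_{p+s}\ge1$. Introduce extra even variables $x_l^i$ ($1\le i\le p$, $m<l\le p$), and let $X$ be the $p\times p$ matrix with $l$-th row $(x_l^1,\ldots,x_l^p)$. For $I\subseteq\{1,\ldots,p\}$ let $X_j(I)$ be obtained from $X$ by replacing the $i$-th row by $(\eta_j^1,\ldots,\eta_j^p)$ for every $i\in I$. Let $D=(D_1,\ldots,D_s)$ be a collection of marked diagrams: $D_i$ is a rectangle of boxes with $m$ rows and $\lambda_{p+i}$ columns, some boxes marked, with at most one marked box in each column of each $D_i$, and such that no box position (row $k$, column $c$) is marked in two different $D_i$'s. $Y_{D_i}$ is obtained from the $\lambda_{p+i}\times\lambda_{p+i}$ matrix with $k$-th row $(y_k^1,\ldots,y_k^{\lambda_{p+i}})$ by replacing, for each marked box of $D_i$ in column $c$ and row $k$, the $c$-th row by $(\xi_k^1,\ldots,\xi_k^{\lambda_{p+i}})$; $\det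 Y_D:=\det Y_{D_1}\cdots\det Y_{D_s}$. For $1\le j\le\lambda_{p+1}$ let $I_j\subseteq\{1,\ldots,m\}$ be the set of rows $k$ such that the box in row $k$, column $j$ is marked in some $D_i$, and $\det X_D:=\det X_1(I_1)\cdots\det X_{\lambda_{p+1}}(I_{\lambda_{p+1}})$. Let $d_i$ be the number of marked boxes in $D_i$, $|D|=\sum_i d_i$, $e_j=|I_j|$. The sign $\epsilon_D$: assign anticommuting indeterminates $a_i^{kc}$ to the marked boxes (row $k$, column $c$ of $D_i$); the product of all of them in increasing lexicographic order of $(i,c,k)$ equals $\epsilon_D$ times their product in increasing lexicographic order of $(c,k,i)$. Let $Z=\prod_{j=1}^{\lambda_{p+1}}\det X_j(\{m+1,\ldots,p\})$ (increasing $j$). Then $$\Gamma(\lambda_{p+1},\ldots,\lambda_{p+s})=\sum_D(-1)^{\frac12(\sum_{i,j=1}^s d_id_j-|D|)}\frac{\epsilon_D}{e_1!\cdots e_{\lambda_{p+1}}!}(\det X)^{-\lambda_{p+1}}\,Z\,\det X_D\,\det Y_D,$$ which is a polynomial not involving the extra variables.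
   Formalization: As λ=(2,2) and (2,1) have equal weights for p=q=m=n=1, the literal "only if" fails; it is proved instead that V^λ⊗V^λ appears in degree |λ| iff the inequalities hold, and appears at all iff some diagram with the same two highest weights satisfies them. *)

theory Defs
  imports
    Complex_Main
    "HOL-Library.Poly_Mapping"
    "HOL-Library.FSet"
    "HOL-Library.Countable"
    "HOL-Combinatorics.Permutations"
begin

section \<open>The polynomial superalgebra\<close>

text \<open>
  \<open>X l i\<close>, \<open>Y k j\<close>, \<open>Xi l j\<close>, \<open>Eta k i\<close> name the variables
  \<open>x\<^sub>l\<^sup>i\<close>, \<open>y\<^sub>k\<^sup>j\<close>, \<open>\<xi>\<^sub>l\<^sup>j\<close>, \<open>\<eta>\<^sub>k\<^sup>i\<close>; all indices start at 1.  The types contain all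
  indices at once, so that the extra variables \<open>x\<^sub>l\<^sup>i\<close> with \<open>l > m\<close> are available.
  \<open>Mark i k c\<close> is the anticommuting indeterminate \<open>a\<^sub>i\<^sup>k\<^sup>c\<close> used only to define the sign
  \<open>\<epsilon>\<^sub>D\<close>.
\<close>

datatype evar = X nat nat | Y nat nat
datatype ovar = Xi nat nat | Eta nat nat | Mark nat nat nat

instance ovar :: countable
  by countable_datatype

text \<open>
  A total order on the odd variables, needed only to single out one representative among the
  reorderings of an odd monomial.
\<close>

instantiation ovar :: linorder
begin
definition less_eq_ovar :: "ovar \<Rightarrow> ovar \<Rightarrow> bool" where
  "less_eq_ovar u v \<longleftrightarrow> to_nat u \<le> to_nat v"
definition less_ovar :: "ovar \<Rightarrow> ovar \<Rightarrow> bool" where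
  "less_ovar u v \<longleftrightarrow> to_nat u < to_nat v"
instance
  by standard (auto simp: less_eq_ovar_def less_ovar_def)
end

text \<open>
  The monomial \<open>(a, A)\<close> is the product of the even variables with exponents \<open>a\<close> and of the odd
  variables in \<open>A\<close>, the latter in increasing order.
\<close>

type_synonym smono = "(evar \<Rightarrow>\<^sub>0 nat) \<times> ovar fset"

typedef spoly = "UNIV :: (smono \<Rightarrow>\<^sub>0 complex) set"
  morphisms coeffs Spoly ..

setup_lifting type_definition_spoly

definition shuffle_sign :: "ovar fset \<Rightarrow> ovar fset \<Rightarrow> complex" where
  "shuffle_sign A B =
     (if A |\<inter>| B = {||} then (-1) ^ card {(u, v). u |\<in>| A \<and> v |\<in>| B \<and> v < u} else 0)"

definition mono_times :: "smono \<Rightarrow> smono \<Rightarrow> complex \<Rightarrow> (smono \<Rightarrow>\<^sub>0 complex)" where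
  "mono_times k l c =
     Poly_Mapping.single (fst k + fst l, snd k |\<union>| snd l) (shuffle_sign (snd k) (snd l) * c)"

definition pm_times :: "(smono \<Rightarrow>\<^sub>0 complex) \<Rightarrow> (smono \<Rightarrow>\<^sub>0 complex) \<Rightarrow> (smono \<Rightarrow>\<^sub>0 complex)" where
  "pm_times f g = (\<Sum>k\<in>Poly_Mapping.keys f. \<Sum>l\<in>Poly_Mapping.keys g.
     mono_times k l (Poly_Mapping.lookup f k * Poly_Mapping.lookup g l))"

lemma mono_times_0 [simp]: "mono_times k l 0 = 0"
  by (simp add: mono_times_def)

lemma mono_times_add: "mono_times k l (c + d) = mono_times k l c + mono_times k l d"
  by (simp add: mono_times_def distrib_left single_add)

lemma pm_times_superset:
  assumes "finite S" "finite T" "Poly_Mapping.keys f \<subseteq> S" "Poly_Mapping.keys g \<subseteq> T"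
  shows "pm_times f g = (\<Sum>k\<in>S. \<Sum>l\<in>T.
           mono_times k l (Poly_Mapping.lookup f k * Poly_Mapping.lookup g l))"
proof -
  have "(\<Sum>k\<in>S. \<Sum>l\<in>T. mono_times k l (Poly_Mapping.lookup f k * Poly_Mapping.lookup g l))
      = (\<Sum>k\<in>S. \<Sum>l\<in>Poly_Mapping.keys g.
           mono_times k l (Poly_Mapping.lookup f k * Poly_Mapping.lookup g l))"
    by (intro sum.cong refl sum.mono_neutral_right) (use assms in \<open>auto simp: in_keys_iff\<close>)
  also have "\<dots> = pm_times f g"
    unfolding pm_times_def
    by (intro sum.mono_neutral_right) (use assms in \<open>auto simp: in_keys_iff\<close>)
  finally show ?thesis ..
qed

lemma pm_times_add_left: "pm_times (f + g) h = pm_times f h + pm_times g h"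
proof -
  let ?S = "Poly_Mapping.keys f \<union> Poly_Mapping.keys g"
  let ?T = "Poly_Mapping.keys h"
  have "Poly_Mapping.keys (f + g) \<subseteq> ?S"
    by (rule keys_add)
  then show ?thesis
    by (simp add: pm_times_superset[of ?S ?T] lookup_add distrib_right mono_times_add
        sum.distrib)
qed

lemma pm_times_add_right: "pm_times h (f + g) = pm_times h f + pm_times h g"
proof -
  let ?S = "Poly_Mapping.keys f \<union> Poly_Mapping.keys g"
  let ?T = "Poly_Mapping.keys h"
  have "Poly_Mapping.keys (f + g) \<subseteq> ?S"
    by (rule keys_add)
  then show ?thesis
    by (simp add: pm_times_superset[of ?T ?S] lookup_add distrib_left mono_times_add
        sum.distrib)
qed

lemma pm_times_single:
  "pm_times (Poly_Mapping.single k a) (Poly_Mapping.single l b) = mono_times k l (a * b)"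
  by (subst pm_times_superset[of "{k}" "{l}"]) (auto simp: lookup_single)

lemma pm_times_0 [simp]: "pm_times 0 f = 0" "pm_times f 0 = 0"
  by (simp_all add: pm_times_def)

lemma shuffle_sign_assoc:
  "shuffle_sign A B * shuffle_sign (A |\<union>| B) C = shuffle_sign A (B |\<union>| C) * shuffle_sign B C"
proof (cases "A |\<inter>| B = {||} \<and> A |\<inter>| C = {||} \<and> B |\<inter>| C = {||}")
  case False
  then show ?thesis
    by (auto simp: shuffle_sign_def)
next
  case True
  define N where "N A B = {(u, v). u |\<in>| A \<and> v |\<in>| B \<and> v < u}" for A B :: "ovar fset"
  have fin: "finite (N A B)" for A B
    by (rule finite_subset[of _ "fset A \<times> fset B"]) (auto simp: N_def)
  have "N (A |\<union>| B) C = N A C \<union> N B C" "N A C \<inter> N B C = {}"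
    using True by (auto simp: N_def)
  then have 1: "card (N (A |\<union>| B) C) = card (N A C) + card (N B C)"
    by (simp add: card_Un_disjoint fin)
  have "N A (B |\<union>| C) = N A B \<union> N A C" "N A B \<inter> N A C = {}"
    using True by (auto simp: N_def)
  then have 2: "card (N A (B |\<union>| C)) = card (N A B) + card (N A C)"
    by (simp add: card_Un_disjoint fin)
  have "(A |\<union>| B) |\<inter>| C = {||}" "A |\<inter>| (B |\<union>| C) = {||}"
    using True by auto
  moreover have "shuffle_sign A B = (-1) ^ card (N A B)" if "A |\<inter>| B = {||}" for A B
    using that by (simp only: shuffle_sign_def N_def simp_thms if_True)
  ultimately show ?thesis
    using True by (simp only: 1 2 power_add mult_ac)
qed

lemma pm_induct [case_names single sum]:
  fixes f :: "'a \<Rightarrow>\<^sub>0 'b::comm_monoid_add"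
  assumes single: "\<And>k a. P (Poly_Mapping.single k a)"
    and sum: "\<And>g h. P g \<Longrightarrow> P h \<Longrightarrow> P (g + h)"
  shows "P f"
proof (induction f rule: update_induct)
  case const
  show ?case
    using single[of undefined 0] by simp
next
  case (update f a b)
  have "Poly_Mapping.update a b f = Poly_Mapping.single a b + f"
    by (rule poly_mapping_eqI)
      (use update in \<open>auto simp: lookup_update lookup_add lookup_single when_def in_keys_iff\<close>)
  with update show ?case
    by (simp add: sum single)
qed

lemma pm_times_assoc: "pm_times (pm_times f g) h = pm_times f (pm_times g h)"
proof (induction f rule: pm_induct)
  case (single k a)
  show ?case
  proof (induction g rule: pm_induct)
    case (single l b)
    show ?case
    proof (induction h rule: pm_induct)
      case (single r c)
      have "shuffle_sign (snd k |\<union>| snd l) (snd r) * (shuffle_sign (snd k) (snd l) * (a * b) * c)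
          = shuffle_sign (snd k) (snd l |\<union>| snd r) * (a * (shuffle_sign (snd l) (snd r) * (b * c)))"
        using arg_cong[OF shuffle_sign_assoc[of "snd k" "snd l" "snd r"], of "\<lambda>z. z * (a * b * c)"]
        by (simp only: mult_ac)
      then show ?case
        by (simp only: pm_times_single mono_times_def[of k l] mono_times_def[of l r])
          (simp only: mono_times_def fst_conv snd_conv add.assoc funion_assoc)
    qed (simp add: pm_times_add_right)
  qed (simp add: pm_times_add_right pm_times_add_left)
qed (simp add: pm_times_add_left)

instantiation spoly :: ring_1
begin

lift_definition zero_spoly :: spoly is 0 .
lift_definition one_spoly :: spoly is "Poly_Mapping.single (0, {||}) 1" .
lift_definition plus_spoly :: "spoly \<Rightarrow> spoly \<Rightarrow> spoly" is "(+)" .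
lift_definition minus_spoly :: "spoly \<Rightarrow> spoly \<Rightarrow> spoly" is "(-)" .
lift_definition uminus_spoly :: "spoly \<Rightarrow> spoly" is uminus .
lift_definition times_spoly :: "spoly \<Rightarrow> spoly \<Rightarrow> spoly" is pm_times .

instance
proof
  fix f g h :: spoly
  show "f * g * h = f * (g * h)"
    by transfer (rule pm_times_assoc)
  show "(f + g) * h = f * h + g * h"
    by transfer (rule pm_times_add_left)
  show "f * (g + h) = f * g + f * h"
    by transfer (rule pm_times_add_right)
  show "1 * f = f"
  proof transfer
    fix f :: "smono \<Rightarrow>\<^sub>0 complex"
    show "pm_times (Poly_Mapping.single (0, {||}) 1) f = f"
      by (induction f rule: pm_induct)
        (simp_all add: pm_times_single mono_times_def shuffle_sign_def pm_times_add_right)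
  qed
  show "f * 1 = f"
  proof transfer
    fix f :: "smono \<Rightarrow>\<^sub>0 complex"
    show "pm_times f (Poly_Mapping.single (0, {||}) 1) = f"
      by (induction f rule: pm_induct)
        (simp_all add: pm_times_single mono_times_def shuffle_sign_def pm_times_add_left)
  qed
  show "(0::spoly) \<noteq> 1"
  proof transfer
    show "(0 :: smono \<Rightarrow>\<^sub>0 complex) \<noteq> Poly_Mapping.single (0, {||}) 1"
      by (rule notI, drule arg_cong[of _ _ "\<lambda>f. Poly_Mapping.lookup f (0, {||})"]) simp
  qed
  show "f + g + h = f + (g + h)"
    by transfer (rule add.assoc)
  show "f + g = g + f"
    by transfer (rule add.commute)
  show "0 + f = f"
    by transfer (rule add_0)
  show "- f + f = 0"
    by transfer (rule left_minus)
  show "f - g = f + - g"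
    by transfer (rule diff_conv_add_uminus)
qed

end

lift_definition smul :: "complex \<Rightarrow> spoly \<Rightarrow> spoly"
  is "\<lambda>c f. Poly_Mapping.map ((*) c) f" .

lemma lookup_map_times:
  "Poly_Mapping.lookup (Poly_Mapping.map ((*) c) f) k = (c :: complex) * Poly_Mapping.lookup f k"
  by (simp add: map.rep_eq when_def)

global_interpretation spoly: vector_space smul
proof
  fix a b :: complex and f g :: spoly
  show "smul a (f + g) = smul a f + smul a g"
    by transfer (rule poly_mapping_eqI, simp only: lookup_map_times lookup_add distrib_left)
  show "smul (a + b) f = smul a f + smul b f"
    by transfer (rule poly_mapping_eqI, simp only: lookup_map_times lookup_add distrib_right)
  show "smul a (smul b f) = smul (a * b) f"
    by transfer (rule poly_mapping_eqI, simp only: lookup_map_times mult.assoc)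
  show "smul 1 f = f"
    by transfer (rule poly_mapping_eqI, simp only: lookup_map_times mult_1)
qed

lift_definition gen :: "evar + ovar \<Rightarrow> spoly" is
  "case_sum (\<lambda>v. Poly_Mapping.single (Poly_Mapping.single v 1, {||}) 1)
            (\<lambda>v. Poly_Mapping.single (0, {|v|}) 1)" .

text \<open>
  Partial derivatives; for an odd variable this is the left derivative
  (an odd superderivation).
\<close>

lift_definition even_deriv :: "evar \<Rightarrow> spoly \<Rightarrow> spoly" is
  "\<lambda>v f. \<Sum>k\<in>Poly_Mapping.keys f.
     Poly_Mapping.single (fst k - Poly_Mapping.single v 1, snd k)
       (of_nat (Poly_Mapping.lookup (fst k) v) * Poly_Mapping.lookup f k)" .

lift_definition odd_deriv :: "ovar \<Rightarrow> spoly \<Rightarrow> spoly" is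
  "\<lambda>v f. \<Sum>k\<in>{k \<in> Poly_Mapping.keys f. v |\<in>| snd k}.
     Poly_Mapping.single (fst k, snd k |-| {|v|})
       ((-1) ^ card {u. u |\<in>| snd k \<and> u < v} * Poly_Mapping.lookup f k)" .

definition pdiff :: "evar + ovar \<Rightarrow> spoly \<Rightarrow> spoly" where
  "pdiff = case_sum even_deriv odd_deriv"


section \<open>General linear Lie superalgebras and their modules\<close>

text \<open>
  \<open>Inl i\<close> stands for the even and \<open>Inr j\<close> for the odd standard basis vector of
  \<open>\<complex>\<^sup>p\<^sup>|\<^sup>q\<close>.  Parities are truth values (\<open>True\<close> for odd), added by \<open>\<noteq>\<close>.
\<close>

type_synonym idx = "nat + nat"

definition gl_ix :: "nat \<Rightarrow> nat \<Rightarrow> idx set" where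
  "gl_ix p q = Inl ` {1..p} \<union> Inr ` {1..q}"

definition par :: "idx \<Rightarrow> bool" where
  "par a \<longleftrightarrow> \<not> isl a"

definition epar :: "idx \<Rightarrow> idx \<Rightarrow> bool" where
  "epar a b \<longleftrightarrow> (par a \<noteq> par b)"

definition ksign :: "bool \<Rightarrow> bool \<Rightarrow> complex" where
  "ksign \<epsilon> \<delta> = (if \<epsilon> \<and> \<delta> then -1 else 1)"

text \<open>
  A module over a general linear Lie superalgebra is given by its even and odd parts and the
  operators \<open>act V a b\<close> by which the matrix units \<open>E\<^sub>a\<^sub>b\<close> act; as these form a basis, the
  supercommutator relations among them are all that is required.
\<close>

record 'v supermodule =
  scal :: "complex \<Rightarrow> 'v \<Rightarrow> 'v"
  part :: "bool \<Rightarrow> 'v set"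
  act :: "idx \<Rightarrow> idx \<Rightarrow> 'v \<Rightarrow> 'v"

definition carr :: "'v::ab_group_add supermodule \<Rightarrow> 'v set" where
  "carr V = {u + w | u w. u \<in> part V False \<and> w \<in> part V True}"

definition gl_module :: "nat \<Rightarrow> nat \<Rightarrow> 'v::ab_group_add supermodule \<Rightarrow> bool" where
  "gl_module p q V \<longleftrightarrow>
     vector_space (scal V) \<and>
     (\<forall>\<epsilon>. module.subspace (scal V) (part V \<epsilon>)) \<and>
     part V False \<inter> part V True = {0} \<and>
     (\<forall>a\<in>gl_ix p q. \<forall>b\<in>gl_ix p q.
        (\<forall>v\<in>carr V. \<forall>w\<in>carr V. act V a b (v + w) = act V a b v + act V a b w) \<and>
        (\<forall>c. \<forall>v\<in>carr V. act V a b (scal V c v) = scal V c (act V a b v)) \<and>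
        (\<forall>\<epsilon>. \<forall>v\<in>part V \<epsilon>. act V a b v \<in> part V (\<epsilon> \<noteq> epar a b))) \<and>
     (\<forall>a\<in>gl_ix p q. \<forall>b\<in>gl_ix p q. \<forall>c\<in>gl_ix p q. \<forall>d\<in>gl_ix p q. \<forall>v\<in>carr V.
        act V a b (act V c d v)
          - scal V (ksign (epar a b) (epar c d)) (act V c d (act V a b v))
        = (if b = c then act V a d v else 0)
          - scal V (ksign (epar a b) (epar c d)) (if a = d then act V c b v else 0))"

definition gl_submodule :: "nat \<Rightarrow> nat \<Rightarrow> 'v::ab_group_add supermodule \<Rightarrow> 'v set \<Rightarrow> bool" where
  "gl_submodule p q V U \<longleftrightarrow>
     module.subspace (scal V) U \<and>
     U = {u + w | u w. u \<in> U \<inter> part V False \<and> w \<in> U \<inter> part V True} \<and>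
     (\<forall>a\<in>gl_ix p q. \<forall>b\<in>gl_ix p q. \<forall>u\<in>U. act V a b u \<in> U)"

definition irreducible_module :: "nat \<Rightarrow> nat \<Rightarrow> 'v::ab_group_add supermodule \<Rightarrow> bool" where
  "irreducible_module p q V \<longleftrightarrow>
     carr V \<noteq> {0} \<and> (\<forall>U. gl_submodule p q V U \<longrightarrow> U = {0} \<or> U = carr V)"

text \<open>The index pairs \<open>(a, b)\<close> for which \<open>E\<^sub>a\<^sub>b\<close> is a simple root vector.\<close>

definition simple_roots :: "nat \<Rightarrow> nat \<Rightarrow> (idx \<times> idx) set" where
  "simple_roots p q =
     {(Inl (i - 1), Inl i) | i. 1 < i \<and> i \<le> p} \<union>
     {(Inr (l - 1), Inr l) | l. 1 < l \<and> l \<le> q} \<union>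
     (if 1 \<le> p \<and> 1 \<le> q then {(Inl p, Inr 1)} else {})"

definition highest_weight_vector ::
  "nat \<Rightarrow> nat \<Rightarrow> 'v::ab_group_add supermodule \<Rightarrow> (idx \<Rightarrow> nat) \<Rightarrow> 'v \<Rightarrow> bool" where
  "highest_weight_vector p q V \<Lambda> v \<longleftrightarrow>
     v \<in> carr V \<and> v \<noteq> 0 \<and>
     (\<forall>a\<in>gl_ix p q. act V a a v = scal V (of_nat (\<Lambda> a)) v) \<and>
     (\<forall>(a, b)\<in>simple_roots p q. act V a b v = 0)"


section \<open>Young diagrams and highest weights\<close>

text \<open>A Young diagram is given by its row lengths \<open>\<lambda> 1, \<lambda> 2, \<dots>\<close>; the value \<open>\<lambda> 0\<close> is ignored.\<close>

definition young_diagram :: "(nat \<Rightarrow> nat) \<Rightarrow> bool" where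
  "young_diagram lam \<longleftrightarrow> (\<forall>i\<ge>1. lam (Suc i) \<le> lam i) \<and> finite {i. 1 \<le> i \<and> 0 < lam i}"

definition conj_diagram :: "(nat \<Rightarrow> nat) \<Rightarrow> nat \<Rightarrow> nat" where
  "conj_diagram lam j = card {i. 1 \<le> i \<and> j \<le> lam i}"

definition diagram_length :: "(nat \<Rightarrow> nat) \<Rightarrow> nat" where
  "diagram_length lam = card {i. 1 \<le> i \<and> 0 < lam i}"

definition diagram_size :: "(nat \<Rightarrow> nat) \<Rightarrow> nat" where
  "diagram_size lam = (\<Sum>i=1..diagram_length lam. lam i)"

text \<open>Truncated subtraction gives \<open>\<langle>\<lambda>'\<^sub>j - p\<rangle>\<close>.\<close>

definition hweight :: "nat \<Rightarrow> (nat \<Rightarrow> nat) \<Rightarrow> idx \<Rightarrow> nat" where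
  "hweight p lam = case_sum lam (\<lambda>j. conj_diagram lam j - p)"

text \<open>\<open>is_V p q \<lambda> V\<close>: \<open>V\<close> is (isomorphic to) \<open>V\<^sup>\<lambda>\<close> over \<open>gl(p|q)\<close>.\<close>

definition is_V :: "nat \<Rightarrow> nat \<Rightarrow> (nat \<Rightarrow> nat) \<Rightarrow> 'v::ab_group_add supermodule \<Rightarrow> bool" where
  "is_V p q lam V \<longleftrightarrow>
     gl_module p q V \<and> irreducible_module p q V \<and>
     (\<exists>v. highest_weight_vector p q V (hweight p lam) v)"


section \<open>The two actions on the polynomial superalgebra\<close>

text \<open>\<open>zvar s c\<close> is the variable \<open>e\<^sub>s \<otimes> e\<^sup>c\<close>, for \<open>s\<close> an index of \<open>\<complex>\<^sup>m\<^sup>|\<^sup>n\<close> and \<open>c\<close> one of \<open>\<complex>\<^sup>p\<^sup>|\<^sup>q\<close>.\<close>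

fun zvar :: "idx \<Rightarrow> idx \<Rightarrow> evar + ovar" where
  "zvar (Inl l) (Inl i) = Inl (X l i)"
| "zvar (Inl l) (Inr j) = Inr (Xi l j)"
| "zvar (Inr k) (Inl i) = Inr (Eta k i)"
| "zvar (Inr k) (Inr j) = Inl (Y k j)"

definition poly_vars :: "nat \<Rightarrow> nat \<Rightarrow> nat \<Rightarrow> nat \<Rightarrow> (evar + ovar) set" where
  "poly_vars p q m n = {zvar s c | s c. s \<in> gl_ix m n \<and> c \<in> gl_ix p q}"

definition mono_vars :: "smono \<Rightarrow> (evar + ovar) set" where
  "mono_vars k = Inl ` Poly_Mapping.keys (fst k) \<union> Inr ` fset (snd k)"

definition mono_degree :: "smono \<Rightarrow> nat" where
  "mono_degree k =
     (\<Sum>v\<in>Poly_Mapping.keys (fst k). Poly_Mapping.lookup (fst k) v) + fcard (snd k)"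

definition poly_part :: "nat \<Rightarrow> nat \<Rightarrow> nat \<Rightarrow> nat \<Rightarrow> bool \<Rightarrow> spoly set" where
  "poly_part p q m n \<epsilon> =
     {f. \<forall>k\<in>Poly_Mapping.keys (coeffs f).
           mono_vars k \<subseteq> poly_vars p q m n \<and> (odd (fcard (snd k)) \<longleftrightarrow> \<epsilon>)}"

definition homogeneous :: "nat \<Rightarrow> spoly set" where
  "homogeneous d = {f. \<forall>k\<in>Poly_Mapping.keys (coeffs f). mono_degree k = d}"

text \<open>
  In \<open>\<complex>\<^sup>p\<^sup>|\<^sup>q \<otimes> \<complex>\<^sup>m\<^sup>|\<^sup>n\<close> the algebra \<open>gl(p|q)\<close> acts on the left factor and \<open>gl(m|n)\<close> on
  the right one; passing an odd element of \<open>gl(m|n)\<close> over the odd basis vectors of \<open>\<complex>\<^sup>p\<^sup>|\<^sup>q\<close>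
  produces the sign in the second action.
\<close>

definition left_action :: "nat \<Rightarrow> nat \<Rightarrow> idx \<Rightarrow> idx \<Rightarrow> spoly \<Rightarrow> spoly" where
  "left_action m n a b f = (\<Sum>s\<in>gl_ix m n. gen (zvar s a) * pdiff (zvar s b) f)"

definition right_action :: "nat \<Rightarrow> nat \<Rightarrow> idx \<Rightarrow> idx \<Rightarrow> spoly \<Rightarrow> spoly" where
  "right_action p q s t f =
     (\<Sum>c\<in>gl_ix p q. smul (ksign (epar s t) (par c)) (gen (zvar s c) * pdiff (zvar t c) f))"

definition left_poly :: "nat \<Rightarrow> nat \<Rightarrow> nat \<Rightarrow> nat \<Rightarrow> spoly supermodule" where
  "left_poly p q m n = \<lparr>scal = smul, part = poly_part p q m n, act = left_action m n\<rparr>"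

definition right_poly :: "nat \<Rightarrow> nat \<Rightarrow> nat \<Rightarrow> nat \<Rightarrow> spoly supermodule" where
  "right_poly p q m n = \<lparr>scal = smul, part = poly_part p q m n, act = right_action p q\<rparr>"

text \<open>A (nonzero) joint highest weight vector with the weights attached to \<open>\<lambda>\<close>.\<close>

definition hwv_corresponds ::
  "nat \<Rightarrow> nat \<Rightarrow> nat \<Rightarrow> nat \<Rightarrow> (nat \<Rightarrow> nat) \<Rightarrow> spoly \<Rightarrow> bool" where
  "hwv_corresponds p q m n lam f \<longleftrightarrow>
     highest_weight_vector p q (left_poly p q m n) (hweight p lam) f \<and>
     highest_weight_vector m n (right_poly p q m n) (hweight m lam) f"

definition poly_submodule :: "nat \<Rightarrow> nat \<Rightarrow> nat \<Rightarrow> nat \<Rightarrow> spoly set \<Rightarrow> bool" where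
  "poly_submodule p q m n U \<longleftrightarrow>
     gl_submodule p q (left_poly p q m n) U \<and> gl_submodule m n (right_poly p q m n) U"

text \<open>
  \<open>\<tau>\<close> is a bilinear map inducing an even isomorphism from \<open>V \<otimes> W\<close> onto \<open>U\<close> that intertwines
  the actions of \<open>gl(p|q)\<close> on \<open>V\<close> and of \<open>gl(m|n)\<close> on \<open>W\<close> (with the sign rule for odd
  elements passing \<open>V\<close>).
\<close>

definition tensor_iso ::
  "nat \<Rightarrow> nat \<Rightarrow> nat \<Rightarrow> nat \<Rightarrow> 'v::ab_group_add supermodule \<Rightarrow> 'w::ab_group_add supermodule \<Rightarrow>
   spoly set \<Rightarrow> ('v \<Rightarrow> 'w \<Rightarrow> spoly) \<Rightarrow> bool" where
  "tensor_iso p q m n V W U \<tau> \<longleftrightarrow>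
     (\<forall>v\<in>carr V. \<forall>v'\<in>carr V. \<forall>w\<in>carr W. \<tau> (v + v') w = \<tau> v w + \<tau> v' w) \<and>
     (\<forall>v\<in>carr V. \<forall>w\<in>carr W. \<forall>w'\<in>carr W. \<tau> v (w + w') = \<tau> v w + \<tau> v w') \<and>
     (\<forall>c. \<forall>v\<in>carr V. \<forall>w\<in>carr W.
        \<tau> (scal V c v) w = smul c (\<tau> v w) \<and> \<tau> v (scal W c w) = smul c (\<tau> v w)) \<and>
     (\<exists>B C. \<not> module.dependent (scal V) B \<and> module.span (scal V) B = carr V \<and>
            \<not> module.dependent (scal W) C \<and> module.span (scal W) C = carr W \<and>
            inj_on (\<lambda>(b, c). \<tau> b c) (B \<times> C) \<and>
            spoly.independent ((\<lambda>(b, c). \<tau> b c) ` (B \<times> C)) \<and>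
            spoly.span ((\<lambda>(b, c). \<tau> b c) ` (B \<times> C)) = U) \<and>
     (\<forall>\<epsilon> \<delta>. \<forall>v\<in>part V \<epsilon>. \<forall>w\<in>part W \<delta>. \<tau> v w \<in> poly_part p q m n (\<epsilon> \<noteq> \<delta>)) \<and>
     (\<forall>a\<in>gl_ix p q. \<forall>b\<in>gl_ix p q. \<forall>v\<in>carr V. \<forall>w\<in>carr W.
        left_action m n a b (\<tau> v w) = \<tau> (act V a b v) w) \<and>
     (\<forall>s\<in>gl_ix m n. \<forall>t\<in>gl_ix m n. \<forall>\<epsilon>. \<forall>v\<in>part V \<epsilon>. \<forall>w\<in>carr W.
        right_action p q s t (\<tau> v w) = smul (ksign (epar s t) \<epsilon>) (\<tau> v (act W s t w)))"

text \<open>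
  \<open>appears p q m n \<lambda> H\<close>: some submodule of the polynomial superalgebra contained in \<open>H\<close> is
  isomorphic to \<open>V\<^sup>\<lambda> \<otimes> V\<^sup>\<lambda>\<close>.  The type \<^typ>\<open>spoly\<close> of \<open>V\<close> and \<open>W\<close> merely provides a vector
  space of infinite dimension in which to realise the two factors.
\<close>

definition appears ::
  "nat \<Rightarrow> nat \<Rightarrow> nat \<Rightarrow> nat \<Rightarrow> (nat \<Rightarrow> nat) \<Rightarrow> spoly set \<Rightarrow> bool" where
  "appears p q m n lam H \<longleftrightarrow>
     (\<exists>(V :: spoly supermodule) (W :: spoly supermodule) U \<tau>.
        is_V p q lam V \<and> is_V m n lam W \<and>
        poly_submodule p q m n U \<and> U \<subseteq> H \<and> tensor_iso p q m n V W U \<tau>)"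

text \<open>
  Two diagrams label the same irreducible modules if they have the same highest weights for
  both algebras.  This happens for distinct diagrams, since the weights do not see the boxes
  below row \<open>p\<close> and to the right of column \<open>q\<close>: for \<open>p = q = m = n = 1\<close>, for instance,
  \<open>(2, 1)\<close> and \<open>(2, 2)\<close> have the same weights.  The label of a constituent becomes unambiguous
  when its degree is required to be the number of boxes of the diagram.
\<close>

definition same_modules ::
  "nat \<Rightarrow> nat \<Rightarrow> nat \<Rightarrow> nat \<Rightarrow> (nat \<Rightarrow> nat) \<Rightarrow> (nat \<Rightarrow> nat) \<Rightarrow> bool" where
  "same_modules p q m n lam mu \<longleftrightarrow>
     (\<forall>a\<in>gl_ix p q. hweight p lam a = hweight p mu a) \<and>
     (\<forall>s\<in>gl_ix m n. hweight m lam s = hweight m mu s)"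


section \<open>Determinants and the polynomials \<open>\<Gamma>\<close>\<close>

abbreviation xv :: "nat \<Rightarrow> nat \<Rightarrow> spoly" where "xv l i \<equiv> gen (Inl (X l i))"
abbreviation yv :: "nat \<Rightarrow> nat \<Rightarrow> spoly" where "yv k j \<equiv> gen (Inl (Y k j))"
abbreviation xiv :: "nat \<Rightarrow> nat \<Rightarrow> spoly" where "xiv l j \<equiv> gen (Inr (Xi l j))"
abbreviation etav :: "nat \<Rightarrow> nat \<Rightarrow> spoly" where "etav k i \<equiv> gen (Inr (Eta k i))"

text \<open>Product of \<open>f a, f (a + 1), \<dots>, f b\<close> in this order (1 if \<open>b < a\<close>).\<close>

definition oprod :: "nat \<Rightarrow> nat \<Rightarrow> (nat \<Rightarrow> spoly) \<Rightarrow> spoly" where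
  "oprod a b f = prod_list (map f [a..<Suc b])"

definition sdet :: "nat \<Rightarrow> (nat \<Rightarrow> nat \<Rightarrow> spoly) \<Rightarrow> spoly" where
  "sdet r a = (\<Sum>\<sigma> | \<sigma> permutes {1..r}. of_int (sign \<sigma>) * oprod 1 r (\<lambda>i. a i (\<sigma> i)))"

definition Delta :: "nat \<Rightarrow> spoly" where
  "Delta r = sdet r xv"

definition Delta2 :: "nat \<Rightarrow> nat \<Rightarrow> nat \<Rightarrow> spoly" where
  "Delta2 m k r = sdet r (\<lambda>l i. if l \<le> m then xv l i else etav k i)"

text \<open>\<open>X\<^sub>j(I)\<close>; in particular \<open>detX p j {} = det X\<close> for every \<open>j\<close>.\<close>

definition detX :: "nat \<Rightarrow> nat \<Rightarrow> nat set \<Rightarrow> spoly" where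
  "detX p j I = sdet p (\<lambda>l i. if l \<in> I then etav j i else xv l i)"

text \<open>
  In this part \<open>\<mu> i\<close> stands for \<open>\<lambda>\<^sub>p\<^sub>+\<^sub>i\<close>, \<open>1 \<le> i \<le> s\<close>, and \<open>D = (D\<^sub>1, \<dots>, D\<^sub>s)\<close> is encoded as
  the set of the triples \<open>(i, c, k)\<close> such that the box in row \<open>k\<close> and column \<open>c\<close> of \<open>D\<^sub>i\<close> is
  marked.
\<close>

definition marked_diagrams :: "nat \<Rightarrow> nat \<Rightarrow> (nat \<Rightarrow> nat) \<Rightarrow> (nat \<times> nat \<times> nat) set set" where
  "marked_diagrams m s \<mu> =
     {D. D \<subseteq> {(i, c, k). i \<in> {1..s} \<and> c \<in> {1..\<mu> i} \<and> k \<in> {1..m}} \<and>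
         (\<forall>i c k k'. (i, c, k) \<in> D \<and> (i, c, k') \<in> D \<longrightarrow> k = k') \<and>
         (\<forall>i i' c k. (i, c, k) \<in> D \<and> (i', c, k) \<in> D \<longrightarrow> i = i')}"

definition detY_diagram :: "(nat \<Rightarrow> nat) \<Rightarrow> (nat \<times> nat \<times> nat) set \<Rightarrow> nat \<Rightarrow> spoly" where
  "detY_diagram \<mu> D i =
     sdet (\<mu> i) (\<lambda>c j. if \<exists>k. (i, c, k) \<in> D then xiv (THE k. (i, c, k) \<in> D) j else yv c j)"

definition detY_D :: "nat \<Rightarrow> (nat \<Rightarrow> nat) \<Rightarrow> (nat \<times> nat \<times> nat) set \<Rightarrow> spoly" where
  "detY_D s \<mu> D = oprod 1 s (detY_diagram \<mu> D)"

definition marked_rows :: "(nat \<times> nat \<times> nat) set \<Rightarrow> nat \<Rightarrow> nat set" where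
  "marked_rows D j = {k. \<exists>i. (i, j, k) \<in> D}"

definition detX_D :: "nat \<Rightarrow> (nat \<Rightarrow> nat) \<Rightarrow> (nat \<times> nat \<times> nat) set \<Rightarrow> spoly" where
  "detX_D p \<mu> D = oprod 1 (\<mu> 1) (\<lambda>j. detX p j (marked_rows D j))"

definition mark :: "(nat \<times> nat \<times> nat) set \<Rightarrow> nat \<Rightarrow> nat \<Rightarrow> nat \<Rightarrow> spoly" where
  "mark D i c k = (if (i, c, k) \<in> D then gen (Inr (Mark i k c)) else 1)"

definition eps_D :: "nat \<Rightarrow> nat \<Rightarrow> (nat \<Rightarrow> nat) \<Rightarrow> (nat \<times> nat \<times> nat) set \<Rightarrow> int" where
  "eps_D m s \<mu> D = (THE e.
     oprod 1 s (\<lambda>i. oprod 1 (\<mu> 1) (\<lambda>c. oprod 1 m (\<lambda>k. mark D i c k))) =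
     of_int e * oprod 1 (\<mu> 1) (\<lambda>c. oprod 1 m (\<lambda>k. oprod 1 s (\<lambda>i. mark D i c k))))"

definition marked_count :: "(nat \<times> nat \<times> nat) set \<Rightarrow> nat \<Rightarrow> nat" where
  "marked_count D i = card {(c, k). (i, c, k) \<in> D}"

definition coeff_D :: "nat \<Rightarrow> nat \<Rightarrow> (nat \<Rightarrow> nat) \<Rightarrow> (nat \<times> nat \<times> nat) set \<Rightarrow> complex" where
  "coeff_D m s \<mu> D =
     (-1) ^ (((\<Sum>i=1..s. \<Sum>j=1..s. marked_count D i * marked_count D j)
               - (\<Sum>i=1..s. marked_count D i)) div 2)
     * of_int (eps_D m s \<mu> D) / (\<Prod>j=1..\<mu> 1. fact (card (marked_rows D j)))"

definition Zprod :: "nat \<Rightarrow> nat \<Rightarrow> (nat \<Rightarrow> nat) \<Rightarrow> spoly" where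
  "Zprod p m \<mu> = oprod 1 (\<mu> 1) (\<lambda>j. detX p j {m+1..p})"

text \<open>
  Multiplication by a negative power of the even non-zero-divisor \<open>det X\<close> means exact
  division.
\<close>

definition Gamma :: "nat \<Rightarrow> nat \<Rightarrow> nat \<Rightarrow> (nat \<Rightarrow> nat) \<Rightarrow> spoly" where
  "Gamma p m s \<mu> = (THE G.
     (sdet p xv) ^ \<mu> 1 * G =
     (\<Sum>D\<in>marked_diagrams m s \<mu>.
        smul (coeff_D m s \<mu> D) (Zprod p m \<mu> * detX_D p \<mu> D * detY_D s \<mu> D)))"

end

theory Submission
  imports Defs
begin

text \<open>
  The proof rests on three ideas.

  \<open>Unitarity.\<close> In the monomial basis there is a positive definite Hermitian form for which
  multiplication by a variable is adjoint to the partial derivative (lemma \<open>ip_gen\<close>), so that for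
  both actions \<open>E\<^sub>a\<^sub>b\<close> is adjoint to \<open>E\<^sub>b\<^sub>a\<close> (\<open>left_adj\<close>, \<open>right_adj\<close>). Hence a highest weight
  vector \<open>f\<close> generates an irreducible module: a submodule contains the projections of its elements
  to the line of \<open>f\<close>, so it contains \<open>f\<close>, or else it is orthogonal to \<open>f\<close> and then, by
  adjointness, to the whole module (\<open>irreducible_Vmod\<close>). If \<open>f\<close> is a highest weight vector for
  both algebras, the assignment of \<open>A (B f)\<close> to \<open>A f\<close> and \<open>B f\<close>, for \<open>A\<close> in the algebra of the
  left and \<open>B\<close> in the algebra of the right action, is well defined because the actions
  supercommute, and it is multiplicative for the forms (\<open>ip_tau\<close>). So it embeds the tensor product
  of the two cyclic modules (\<open>appears_homogeneous\<close>): every joint highest weight vector gives a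
  constituent.

  \<open>Removing the denominators of \<Gamma>.\<close> Let \<open>det X\<close> be the generic determinant of size \<open>p\<close>, and let
  \<open>\<theta>\<^sub>c\<^sup>k = det X\<^sub>c({k})\<close>; by Cramer's rule these are \<open>det X\<close> times the coordinates of the row
  \<open>\<eta>\<^sub>c\<close> with respect to the rows of \<open>X\<close>. The collections of marked diagrams index those terms that
  do not contain a \<open>\<theta>\<^sub>c\<^sup>k\<close> twice in the expansion of the product of the determinants of size
  \<open>\<lambda>\<^sub>p\<^sub>+\<^sub>i\<close> in the even elements \<open>det X y\<^sub>c\<^sup>j + \<Sum>\<^sub>k \<theta>\<^sub>c\<^sup>k \<xi>\<^sub>k\<^sup>j\<close>, and their signs and factorials
  come from reordering odd factors and from the identity expressing \<open>det X\<^sub>j(I)\<close>, up to powers of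
  \<open>det X\<close>, as \<open>|I|!\<close> times a product of the \<open>\<theta>\<^sub>j\<^sup>k\<close> (\<open>detX_product\<close>). So the vector of the
  theorem, multiplied by a power of the non-zero-divisor \<open>det X\<close>, is a plain product of
  determinants (\<open>Gamma_factorisation\<close>, \<open>F_multiple\<close>). On this product a simple root vector kills
  every factor, or it creates a factor that is killed by another one: the odd left root vector
  creates multiples of those \<open>\<theta>\<^sub>c\<^sup>k\<close> that already occur (\<open>Om_th\<close>), and the right root vector that
  turns \<open>\<eta>\<^sub>k\<close> into the row \<open>\<eta>\<close> before it creates an element killed by the determinant in front
  (\<open>Delta2_sder\<close>). At the identity matrix the product becomes a nonzero multiple of a product of
  distinct variables \<open>\<eta>\<close>, so it is not zero, and its weight is a count of boxes (\<open>F_hwv\<close>).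

  \<open>Necessity.\<close> A constituent contains a nonzero vector \<open>f\<close> with the highest weights of both
  factors that is killed by the left simple root vectors (\<open>appears_vector\<close>). The Euler operator is
  the sum of the Cartan elements of either algebra, so the sum of the weights of \<open>f\<close> is its degree
  for both; that sum counts the boxes of \<open>\<lambda>\<close> except those below row \<open>p\<close> and to the right of column
  \<open>q\<close>, respectively below row \<open>m\<close> and to the right of column \<open>n\<close> (\<open>hweight_total\<close>). In degree
  \<open>|\<lambda>|\<close> no box may be missed, which gives the two inequalities. If the degree is not prescribed,
  for \<open>p = m\<close> the equality of the two sums shows that \<open>\<lambda>\<close> may be cut off at column \<open>min q n\<close> below
  row \<open>p\<close> without change of the weights. For \<open>p > m\<close> the bound on \<open>\<lambda>\<^sub>m\<^sub>+\<^sub>1\<close> is obtained from the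
  root vectors acting on the first \<open>m + 1\<close> coordinates: combined with cofactors, they eliminate
  the variables \<open>x\<close> and leave the number operator of \<open>n\<close> odd variables, with eigenvalue \<open>\<lambda>\<^sub>m\<^sub>+\<^sub>1\<close>
  on \<open>f\<close> (\<open>row_bound\<close>). The equality of the sums then gives the other bound.
\<close>

section \<open>Calculus in the superalgebra\<close>

definition coeff :: "spoly \<Rightarrow> smono \<Rightarrow> complex" where
  "coeff f = Poly_Mapping.lookup (coeffs f)"

definition smonom :: "(evar \<Rightarrow>\<^sub>0 nat) \<Rightarrow> ovar fset \<Rightarrow> spoly" where
  "smonom a A = Spoly (Poly_Mapping.single (a, A) 1)"

lemma coeffs_smonom: "coeffs (smonom a A) = Poly_Mapping.single (a, A) 1"
  by (simp add: smonom_def Spoly_inverse)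

lemmas coeffs_simps = coeffs_smonom zero_spoly.rep_eq one_spoly.rep_eq plus_spoly.rep_eq minus_spoly.rep_eq
  uminus_spoly.rep_eq times_spoly.rep_eq smul.rep_eq

lemma spoly_eqI: "(\<And>k. coeff f k = coeff g k) \<Longrightarrow> f = g"
  unfolding coeff_def by (metis coeffs_inject poly_mapping_eqI)

lemma coeff_simps [simp]:
  "coeff 0 k = 0" "coeff (f + g) k = coeff f k + coeff g k" "coeff (f - g) k = coeff f k - coeff g k"
  "coeff (- f) k = - coeff f k" "coeff (smul c f) k = c * coeff f k"
  by (simp_all add: coeff_def zero_spoly.rep_eq plus_spoly.rep_eq minus_spoly.rep_eq uminus_spoly.rep_eq
      smul.rep_eq lookup_add lookup_minus lookup_map_times)

lemma coeff_smonom: "coeff (smonom a A) k = (if k = (a, A) then 1 else 0)"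
  by (auto simp: coeff_def coeffs_smonom lookup_single when_def)

lemma coeff_sum: "coeff (\<Sum>x\<in>S. f x) k = (\<Sum>x\<in>S. coeff (f x) k)"
  by (induction S rule: infinite_finite_induct) auto

lemma keys_coeffs: "Poly_Mapping.keys (coeffs f) = {k. coeff f k \<noteq> 0}"
  by (auto simp: coeff_def in_keys_iff)

lemma finite_coeff: "finite {k. coeff f k \<noteq> 0}"
  using finite_keys[of "coeffs f"] unfolding keys_coeffs .

lemma spoly_expand: "f = (\<Sum>k\<in>Poly_Mapping.keys (coeffs f). smul (coeff f k) (smonom (fst k) (snd k)))"
proof (rule spoly_eqI)
  fix l
  have "coeff (\<Sum>k\<in>Poly_Mapping.keys (coeffs f). smul (coeff f k) (smonom (fst k) (snd k))) l
     = (\<Sum>k\<in>Poly_Mapping.keys (coeffs f). if l = k then coeff f k else 0)"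
    unfolding coeff_sum by (rule sum.cong) (auto simp: coeff_smonom)
  also have "\<dots> = coeff f l"
    by (subst sum.delta'[OF finite_keys]) (simp add: keys_coeffs)
  finally show "coeff f l = coeff (\<Sum>k\<in>Poly_Mapping.keys (coeffs f). smul (coeff f k) (smonom (fst k) (snd k))) l"
    by simp
qed

lemma spoly_lin_induct [case_names mono smul add]:
  assumes "\<And>a A. P (smonom a A)" "\<And>c f. P f \<Longrightarrow> P (smul c f)" "\<And>f g. P f \<Longrightarrow> P g \<Longrightarrow> P (f + g)"
  shows "P f"
proof -
  have "P (smul 0 (smonom 0 {||}))"
    using assms(1,2) by blast
  then have 0: "P 0"
    by simp
  have "P (\<Sum>k\<in>S. smul (coeff f k) (smonom (fst k) (snd k)))" if "finite S" for S
    using that by (induction S rule: finite_induct) (auto simp: 0 assms)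
  then show ?thesis
    by (subst spoly_expand) simp
qed

lemma map_scale_add:
  "Poly_Mapping.map ((*) c) (x + y) = Poly_Mapping.map ((*) c) x + Poly_Mapping.map ((*) (c :: complex)) y"
  by (rule poly_mapping_eqI) (simp add: lookup_map_times lookup_add distrib_left)

lemma pm_times_scale:
  "pm_times (Poly_Mapping.map ((*) c) f) g = Poly_Mapping.map ((*) c) (pm_times f g)"
  "pm_times f (Poly_Mapping.map ((*) c) g) = Poly_Mapping.map ((*) c) (pm_times f g)"
proof -
  have "pm_times (Poly_Mapping.map ((*) c) f) g = Poly_Mapping.map ((*) c) (pm_times f g) \<and>
     pm_times f (Poly_Mapping.map ((*) c) g) = Poly_Mapping.map ((*) c) (pm_times f g)"
  proof (induction f rule: pm_induct)
    case (single k a)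
    show ?case
    proof (induction g rule: pm_induct)
      case (single l b)
      show ?case
        by (simp add: pm_times_single mono_times_def mult_ac map_single)
    qed (simp add: pm_times_add_right map_scale_add)
  qed (simp add: pm_times_add_left map_scale_add)
  then show "pm_times (Poly_Mapping.map ((*) c) f) g = Poly_Mapping.map ((*) c) (pm_times f g)"
    "pm_times f (Poly_Mapping.map ((*) c) g) = Poly_Mapping.map ((*) c) (pm_times f g)"
    by auto
qed

lemma smul_mult_left: "smul c f * g = smul c (f * g)"
  by transfer (rule pm_times_scale)

lemma smul_mult_right: "f * smul c g = smul c (f * g)"
  by transfer (rule pm_times_scale)

lemma smonom_mult:
  "smonom a A * smonom b B = smul (shuffle_sign A B) (smonom (a + b) (A |\<union>| B))"
  by (subst coeffs_inject[symmetric]) (simp add: coeffs_simps pm_times_single mono_times_def map_single)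

lemma one_smonom: "1 = smonom 0 {||}"
  by (subst coeffs_inject[symmetric]) (simp add: coeffs_simps)

lemmas smul_mult [simp] = smul_mult_left smul_mult_right

lemma of_nat_spoly: "(of_nat n :: spoly) = smul (of_nat n) 1"
  by (induction n) (auto simp: spoly.scale_left_distrib)

lemma of_int_spoly: "(of_int z :: spoly) = smul (of_int z) 1"
  by (cases z rule: int_cases2) (auto simp: of_nat_spoly)

lemma gen_Inl: "gen (Inl v) = smonom (Poly_Mapping.single v 1) {||}"
  by (subst coeffs_inject[symmetric]) (simp add: coeffs_simps gen.rep_eq)

lemma gen_Inr: "gen (Inr v) = smonom 0 {|v|}"
  by (subst coeffs_inject[symmetric]) (simp add: coeffs_simps gen.rep_eq)

text \<open>The sign by which the odd variable \<open>v\<close> is moved to the front of the monomial \<open>A\<close>.\<close>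

definition osign :: "ovar \<Rightarrow> ovar fset \<Rightarrow> complex" where
  "osign v A = (-1) ^ card {u. u |\<in>| A \<and> u < v}"

lemma osign_sq [simp]: "osign v A * osign v A = 1" "osign v A * (osign v A * x) = x"
  by (simp_all add: osign_def flip: mult.assoc power_add)

lemma gen_Inl_smonom: "gen (Inl v) * smonom a A = smonom (Poly_Mapping.single v 1 + a) A"
  unfolding gen_Inl smonom_mult by (simp add: shuffle_sign_def)

lemma gen_Inr_smonom:
  "gen (Inr v) * smonom a A = (if v |\<in>| A then 0 else smul (osign v A) (smonom a (finsert v A)))"
proof -
  have "{(u, w). u |\<in>| {|v|} \<and> w |\<in>| A \<and> w < u} = (\<lambda>w. (v, w)) ` {w. w |\<in>| A \<and> w < v}"
    by auto
  then have "card {(u, w). u |\<in>| {|v|} \<and> w |\<in>| A \<and> w < u} = card {w. w |\<in>| A \<and> w < v}"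
    by (simp only:) (rule card_image, simp add: inj_on_def)
  then show ?thesis
    unfolding gen_Inr smonom_mult by (auto simp: shuffle_sign_def osign_def)
qed

lemma pm_sum_add:
  fixes h :: "'k \<Rightarrow> complex \<Rightarrow> 'b::ab_group_add"
  assumes "\<And>k c d. h k (c + d) = h k c + h k d"
  shows "(\<Sum>k\<in>Poly_Mapping.keys (f + g). h k (Poly_Mapping.lookup (f + g) k))
       = (\<Sum>k\<in>Poly_Mapping.keys f. h k (Poly_Mapping.lookup f k)) + (\<Sum>k\<in>Poly_Mapping.keys g. h k (Poly_Mapping.lookup g k))"
proof -
  have "h k 0 = 0" for k
    using assms[of k 0 0] by simp
  then show ?thesis
    by (rule setsum_keys_plus_distrib[of h]) (use assms in auto)
qed

lemma even_deriv_add: "even_deriv v (f + g) = even_deriv v f + even_deriv v g"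
  by transfer (rule pm_sum_add, simp add: distrib_left single_add)

lemma odd_deriv_add: "odd_deriv v (f + g) = odd_deriv v f + odd_deriv v g"
proof -
  define h where "h k c = (if v |\<in>| snd k then Poly_Mapping.single (fst k, snd k |-| {|v|})
       ((-1) ^ card {u. u |\<in>| snd k \<and> u < v} * c) else 0)" for k :: smono and c :: complex
  have *: "coeffs (odd_deriv v f) = (\<Sum>k\<in>Poly_Mapping.keys (coeffs f). h k (Poly_Mapping.lookup (coeffs f) k))" for f
    unfolding h_def odd_deriv.rep_eq by (rule sum.inter_filter) simp
  show ?thesis
    unfolding coeffs_inject[symmetric] * plus_spoly.rep_eq
    by (rule pm_sum_add) (simp add: h_def distrib_left single_add)
qed

lemma even_deriv_smul_smonom:
  "even_deriv v (smul c (smonom a A)) = smul (c * of_nat (Poly_Mapping.lookup a v)) (smonom (a - Poly_Mapping.single v 1) A)"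
  by (subst coeffs_inject[symmetric]) (simp add: coeffs_simps even_deriv.rep_eq map_single mult.commute)

lemma odd_deriv_smul_smonom:
  "odd_deriv v (smul c (smonom a A)) = (if v |\<in>| A then smul (c * osign v A) (smonom a (A |-| {|v|})) else 0)"
proof (cases "c = 0")
  case True
  have "odd_deriv v 0 = 0"
    using odd_deriv_add[of v 0 0] by simp
  with True show ?thesis by simp
next
  case False
  then have "{k \<in> Poly_Mapping.keys (Poly_Mapping.single (a, A) c). v |\<in>| snd k} = (if v |\<in>| A then {(a, A)} else {})"
    by auto
  then show ?thesis
    unfolding osign_def by (subst coeffs_inject[symmetric]) (auto simp: coeffs_simps odd_deriv.rep_eq map_single mult.commute)
qed

lemma even_deriv_smul: "even_deriv v (smul c f) = smul c (even_deriv v f)"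
proof (induction f arbitrary: c rule: spoly_lin_induct)
  case (mono a A)
  show ?case
    using even_deriv_smul_smonom[of v c a A] even_deriv_smul_smonom[of v 1 a A] by simp
qed (simp_all add: even_deriv_add spoly.scale_right_distrib)

lemma odd_deriv_smul: "odd_deriv v (smul c f) = smul c (odd_deriv v f)"
proof (induction f arbitrary: c rule: spoly_lin_induct)
  case (mono a A)
  show ?case
    using odd_deriv_smul_smonom[of v c a A] odd_deriv_smul_smonom[of v 1 a A] by simp
qed (simp_all add: odd_deriv_add spoly.scale_right_distrib)

lemma deriv_0 [simp]: "even_deriv v 0 = 0" "odd_deriv w 0 = 0"
  using even_deriv_smul[of v 0 0] odd_deriv_smul[of w 0 0] by simp_all

lemma even_deriv_smonom:
  "even_deriv v (smonom a A) = smul (of_nat (Poly_Mapping.lookup a v)) (smonom (a - Poly_Mapping.single v 1) A)"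
  using even_deriv_smul_smonom[of v 1] by simp

lemma odd_deriv_smonom:
  "odd_deriv v (smonom a A) = (if v |\<in>| A then smul (osign v A) (smonom a (A |-| {|v|})) else 0)"
  using odd_deriv_smul_smonom[of v 1] by simp

lemma pdiff_simps [simp]: "pdiff (Inl v) = even_deriv v" "pdiff (Inr w) = odd_deriv w"
  by (simp_all add: pdiff_def)

lemma pdiff_add: "pdiff v (f + g) = pdiff v f + pdiff v g"
  by (cases v) (auto simp: even_deriv_add odd_deriv_add)

lemma pdiff_smul: "pdiff v (smul c f) = smul c (pdiff v f)"
  by (cases v) (auto simp: even_deriv_smul odd_deriv_smul)

lemma pdiff_0 [simp]: "pdiff v 0 = 0"
  using pdiff_smul[of v 0 0] by simp

subsection \<open>Induction over products of generators\<close>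

definition polyin :: "(evar + ovar) set \<Rightarrow> spoly set" where
  "polyin S = {f. \<forall>k\<in>Poly_Mapping.keys (coeffs f). mono_vars k \<subseteq> S}"

lemma smonom_induct:
  assumes S: "mono_vars (a, A) \<subseteq> S" and one: "P 1" and smul: "\<And>c f. P f \<Longrightarrow> P (smul c f)"
    and gen: "\<And>v f. v \<in> S \<Longrightarrow> P f \<Longrightarrow> P (gen v * f)"
  shows "P (smonom a A)"
  using S
proof (induction "\<Sum>v\<in>Poly_Mapping.keys a. Poly_Mapping.lookup a v" arbitrary: a)
  case 0
  then have "a = 0"
    by (intro poly_mapping_eqI) (auto simp: in_keys_iff)
  with 0 have "Inr ` fset A \<subseteq> S"
    by (auto simp: mono_vars_def)
  then have "P (smonom 0 A)"
  proof (induction A rule: fset_induct)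
    case empty
    with one show ?case by (simp add: one_smonom)
  next
    case (insert v A)
    show ?case
    proof (cases "v |\<in>| A")
      case True
      then have "finsert v A = A" by auto
      with insert show ?thesis by simp
    next
      case False
      have "P (smul (osign v A) (gen (Inr v) * smonom 0 A))"
        using insert by (intro smul gen) auto
      moreover have "smul (osign v A) (gen (Inr v) * smonom 0 A) = smonom 0 (finsert v A)"
        using False by (simp add: gen_Inr_smonom)
      ultimately show ?thesis by simp
    qed
  qed
  then show ?case by (simp add: \<open>a = 0\<close>)
next
  case (Suc n)
  then obtain v where v: "v \<in> Poly_Mapping.keys a"
    by (metis all_not_in_conv nat.distinct(1) sum.empty)
  define b where "b = a - Poly_Mapping.single v 1"
  have lb: "Poly_Mapping.lookup b u = Poly_Mapping.lookup a u - (if u = v then 1 else 0)" for u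
    by (simp add: b_def lookup_minus lookup_single when_def)
  have a: "a = Poly_Mapping.single v 1 + b"
    using v by (intro poly_mapping_eqI) (auto simp: lb lookup_add lookup_single when_def in_keys_iff)
  have kb: "Poly_Mapping.keys b \<subseteq> Poly_Mapping.keys a"
    by (auto simp: in_keys_iff lb)
  have "(\<Sum>u\<in>Poly_Mapping.keys b. Poly_Mapping.lookup b u) = (\<Sum>u\<in>Poly_Mapping.keys a. Poly_Mapping.lookup b u)"
    by (rule sum.mono_neutral_left) (use kb in \<open>auto simp: in_keys_iff\<close>)
  moreover have "(\<Sum>u\<in>Poly_Mapping.keys a. Poly_Mapping.lookup a u) =
     (\<Sum>u\<in>Poly_Mapping.keys a. Poly_Mapping.lookup b u + (if u = v then 1 else 0))"
    by (rule sum.cong) (use v in \<open>auto simp: lb in_keys_iff\<close>)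
  ultimately have "n = (\<Sum>u\<in>Poly_Mapping.keys b. Poly_Mapping.lookup b u)"
    using Suc(2) v by (simp add: sum.distrib)
  moreover have "mono_vars (b, A) \<subseteq> S" "Inl v \<in> S"
    using Suc(3) kb v by (auto simp: mono_vars_def)
  ultimately have "P (gen (Inl v) * smonom b A)"
    using Suc(1) by (intro gen) auto
  then show ?case
    unfolding gen_Inl_smonom a[symmetric] .
qed

text \<open>Everything that is compatible with linear combinations may be checked by adding one variable at a
  time on the left; this is the form in which products, derivatives and actions are computed below.\<close>

lemma polyin_induct [consumes 1, case_names one smul add gen]:
  assumes f: "f \<in> polyin S" and one: "P 1" and smul: "\<And>c f. P f \<Longrightarrow> P (smul c f)"
    and add: "\<And>f g. P f \<Longrightarrow> P g \<Longrightarrow> P (f + g)"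
    and gen: "\<And>v f. v \<in> S \<Longrightarrow> P f \<Longrightarrow> P (gen v * f)"
  shows "P f"
proof -
  have "P (smul 0 1)"
    using one smul by blast
  then have 0: "P 0"
    by simp
  have "P (\<Sum>k\<in>T. smul (coeff f k) (smonom (fst k) (snd k)))" if "finite T" "T \<subseteq> Poly_Mapping.keys (coeffs f)" for T
    using that
  proof (induction T rule: finite_induct)
    case (insert k T)
    have "P (smonom (fst k) (snd k))"
      by (rule smonom_induct[of _ _ S]) (use insert f in \<open>auto simp: polyin_def one smul gen\<close>)
    with insert show ?case
      by (simp add: add smul)
  qed (simp add: 0)
  then show ?thesis
    by (subst spoly_expand) simp
qed

lemma polyin_UNIV [simp]: "f \<in> polyin UNIV"
  by (simp add: polyin_def)

lemmas spoly_induct [case_names one smul add gen] = polyin_induct[OF polyin_UNIV, simplified]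

lemma polyin_coeff: "f \<in> polyin S \<longleftrightarrow> (\<forall>k. coeff f k \<noteq> 0 \<longrightarrow> mono_vars k \<subseteq> S)"
  by (auto simp: polyin_def keys_coeffs)

lemma polyin_0 [simp]: "0 \<in> polyin S"
  by (simp add: polyin_coeff)

lemma polyin_1 [simp]: "1 \<in> polyin S"
  by (simp add: polyin_coeff one_smonom coeff_smonom mono_vars_def)

lemma polyin_add: "f \<in> polyin S \<Longrightarrow> g \<in> polyin S \<Longrightarrow> f + g \<in> polyin S"
  by (auto simp: polyin_coeff) (metis add_0 subsetD add.right_neutral)

lemma polyin_smul: "f \<in> polyin S \<Longrightarrow> smul c f \<in> polyin S"
  by (auto simp: polyin_coeff)

lemma polyin_sum: "(\<And>x. x \<in> T \<Longrightarrow> f x \<in> polyin S) \<Longrightarrow> sum f T \<in> polyin S"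
  by (induction T rule: infinite_finite_induct) (auto intro: polyin_add)

lemma polyin_smonom: "mono_vars (a, A) \<subseteq> S \<Longrightarrow> smonom a A \<in> polyin S"
  by (auto simp: polyin_coeff coeff_smonom split: if_splits)

lemma polyin_gen: assumes "v \<in> S" shows "gen v \<in> polyin S"
proof (cases v)
  case (Inl u)
  with assms show ?thesis
    by (auto simp: gen_Inl mono_vars_def intro!: polyin_smonom)
next
  case (Inr u)
  with assms show ?thesis
    by (auto simp: gen_Inr mono_vars_def intro!: polyin_smonom)
qed

lemma polyin_lin:
  assumes f: "f \<in> polyin S"
    and 0: "\<And>c f. D (smul c f) = smul c (D f)" "\<And>f g. D (f + g) = D f + D g"
    and s: "\<And>a A. mono_vars (a, A) \<subseteq> S \<Longrightarrow> D (smonom a A) \<in> polyin T"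
  shows "D f \<in> polyin T"
proof -
  have D0: "D 0 = 0"
    using 0(1)[of 0 0] by simp
  have "D (\<Sum>k\<in>K. smul (coeff f k) (smonom (fst k) (snd k))) = (\<Sum>k\<in>K. smul (coeff f k) (D (smonom (fst k) (snd k))))" if "finite K" for K
    using that by (induction K rule: finite_induct) (auto simp: D0 0)
  then have "D f = (\<Sum>k\<in>Poly_Mapping.keys (coeffs f). smul (coeff f k) (D (smonom (fst k) (snd k))))"
    by (rule trans[OF arg_cong[OF spoly_expand[of f], of D]]) simp
  also have "\<dots> \<in> polyin T"
    by (intro polyin_sum polyin_smul s) (use f in \<open>auto simp: polyin_def\<close>)
  finally show ?thesis .
qed

lemma keys_single_add: "Poly_Mapping.keys (Poly_Mapping.single v (1::nat) + a) = insert v (Poly_Mapping.keys a)"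
  by (auto simp: in_keys_iff lookup_add lookup_single when_def split: if_splits)

lemma polyin_gen_mult: "v \<in> S \<Longrightarrow> f \<in> polyin S \<Longrightarrow> gen v * f \<in> polyin S"
proof (erule polyin_lin)
  fix a A assume v: "v \<in> S" and m: "mono_vars (a, A) \<subseteq> S"
  show "gen v * smonom a A \<in> polyin S"
  proof (cases v)
    case (Inl u)
    with v m show ?thesis
      by (auto simp: gen_Inl_smonom mono_vars_def keys_single_add image_subset_iff simp del: One_nat_def intro!: polyin_smonom)
  next
    case (Inr u)
    with v m show ?thesis
      by (auto simp: gen_Inr_smonom mono_vars_def image_subset_iff intro!: polyin_smonom polyin_smul)
  qed
qed (auto simp: distrib_left)

lemma polyin_mult: "f \<in> polyin S \<Longrightarrow> g \<in> polyin S \<Longrightarrow> f * g \<in> polyin S"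
  by (induction f rule: polyin_induct)
    (auto simp: distrib_right mult.assoc intro: polyin_smul polyin_add polyin_gen_mult)

lemma polyin_pdiff: "f \<in> polyin S \<Longrightarrow> pdiff v f \<in> polyin S"
proof (erule polyin_lin)
  fix a A assume m: "mono_vars (a, A) \<subseteq> S"
  have "Poly_Mapping.keys (a - Poly_Mapping.single u 1) \<subseteq> Poly_Mapping.keys a" for u
    by (auto simp: in_keys_iff lookup_minus)
  then have "mono_vars (a - Poly_Mapping.single u 1, A) \<subseteq> S" for u
    using m unfolding mono_vars_def fst_conv snd_conv by (meson Un_mono image_mono order_refl order_trans)
  moreover have "mono_vars (a, A |-| {|w|}) \<subseteq> S" for w
    using m unfolding mono_vars_def by auto
  ultimately show "pdiff v (smonom a A) \<in> polyin S"
    by (cases v) (auto simp: even_deriv_smonom odd_deriv_smonom simp del: One_nat_def intro!: polyin_smul polyin_smonom)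
qed (auto simp: pdiff_add pdiff_smul)

subsection \<open>Parity\<close>

text \<open>The parity involution, the sign automorphism of the superalgebra.\<close>

lift_definition iota :: "spoly \<Rightarrow> spoly" is
  "\<lambda>f. \<Sum>k\<in>Poly_Mapping.keys f. Poly_Mapping.single k ((-1) ^ fcard (snd k) * Poly_Mapping.lookup f k)" .

lemma iota_add: "iota (f + g) = iota f + iota g"
  by transfer (rule pm_sum_add, simp add: distrib_left single_add)

lemma coeff_iota: "coeff (iota f) k = (-1) ^ fcard (snd k) * coeff f k"
  unfolding coeff_def iota.rep_eq
  by (simp add: lookup_sum lookup_single when_def in_keys_iff)

lemma iota_smul: "iota (smul c f) = smul c (iota f)"
  by (rule spoly_eqI) (simp add: coeff_iota)

lemma iota_diff: "iota (f - g) = iota f - iota g"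
  by (rule spoly_eqI) (simp add: coeff_iota algebra_simps)

lemma iota_uminus: "iota (- f) = - iota f"
  by (rule spoly_eqI) (simp add: coeff_iota)

lemma iota_0 [simp]: "iota 0 = 0"
  by (rule spoly_eqI) (simp add: coeff_iota)

lemma iota_iota [simp]: "iota (iota f) = f"
  by (rule spoly_eqI) (simp add: coeff_iota flip: mult.assoc power_add)

lemma iota_smonom: "iota (smonom a A) = smul ((-1) ^ fcard A) (smonom a A)"
  by (rule spoly_eqI) (auto simp: coeff_iota coeff_smonom)

lemma iota_mult: "iota (f * g) = iota f * iota g"
proof (induction f rule: spoly_lin_induct)
  case (mono a A)
  show ?case
  proof (induction g rule: spoly_lin_induct)
    case (mono b B)
    show ?case
    proof (cases "A |\<inter>| B = {||}")
      case True
      then have "fcard (A |\<union>| B) = fcard A + fcard B"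
        by (simp add: fcard_funion_disjoint)
      then show ?thesis
        by (simp add: smonom_mult iota_smul iota_smonom power_add mult_ac)
    qed (simp add: smonom_mult iota_smul iota_smonom shuffle_sign_def)
  qed (simp_all add: iota_add iota_smul distrib_left)
qed (simp_all add: iota_add iota_smul distrib_right)

definition iot :: "bool \<Rightarrow> spoly \<Rightarrow> spoly" where
  "iot \<epsilon> f = (if \<epsilon> then iota f else f)"

lemma iot_simps [simp]: "iot False f = f" "iot \<epsilon> 0 = 0" "iot \<epsilon> (iot \<delta> f) = iot (\<epsilon> \<noteq> \<delta>) f"
  by (auto simp: iot_def)

lemma iot_True: "iot True f = iota f"
  by (simp add: iot_def)

lemma iot_add: "iot \<epsilon> (f + g) = iot \<epsilon> f + iot \<epsilon> g" and iot_mult: "iot \<epsilon> (f * g) = iot \<epsilon> f * iot \<epsilon> g"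
  and iot_smul: "iot \<epsilon> (smul c f) = smul c (iot \<epsilon> f)"
  by (auto simp: iot_def iota_add iota_mult iota_smul)

lemma iota_1 [simp]: "iota 1 = 1"
  by (simp add: one_smonom iota_smonom fcard_fempty)

lemma iot_1 [simp]: "iot \<epsilon> 1 = 1"
  by (simp add: iot_def)

text \<open>The zero polynomial has both parities.\<close>

definition homog :: "bool \<Rightarrow> spoly \<Rightarrow> bool" where
  "homog \<epsilon> f \<longleftrightarrow> iota f = smul (ksign \<epsilon> True) f"

lemma ksign_simps [simp]: "ksign False \<delta> = 1" "ksign \<epsilon> False = 1" "ksign True True = -1"
  by (auto simp: ksign_def)

lemma ksign_sq [simp]: "ksign \<epsilon> \<delta> * ksign \<epsilon> \<delta> = 1" "ksign \<epsilon> \<delta> * (ksign \<epsilon> \<delta> * x) = x"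
  by (auto simp: ksign_def)

lemma homog_False: "homog False f \<longleftrightarrow> iota f = f" and homog_True: "homog True f \<longleftrightarrow> iota f = - f"
  by (simp_all add: homog_def)

lemma homog_0 [simp]: "homog \<epsilon> 0" and homog_1 [simp]: "homog False 1"
  by (simp_all add: homog_def)

lemma homog_add: "homog \<epsilon> f \<Longrightarrow> homog \<epsilon> g \<Longrightarrow> homog \<epsilon> (f + g)"
  and homog_smul: "homog \<epsilon> f \<Longrightarrow> homog \<epsilon> (smul c f)"
  and homog_uminus: "homog \<epsilon> f \<Longrightarrow> homog \<epsilon> (- f)"
  by (simp_all add: homog_def iota_add iota_smul iota_uminus spoly.scale_right_distrib mult.commute)

lemma homog_sum: "(\<And>x. x \<in> S \<Longrightarrow> homog \<epsilon> (f x)) \<Longrightarrow> homog \<epsilon> (sum f S)"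
  by (induction S rule: infinite_finite_induct) (auto intro: homog_add)

lemma homog_mult: "homog \<epsilon> f \<Longrightarrow> homog \<delta> g \<Longrightarrow> homog (\<epsilon> \<noteq> \<delta>) (f * g)"
  by (cases \<epsilon>; cases \<delta>) (auto simp: homog_def iota_mult)

lemma homog_mult_False: "homog False f \<Longrightarrow> homog False g \<Longrightarrow> homog False (f * g)"
  using homog_mult by fastforce

lemma homog_power: "homog False f \<Longrightarrow> homog False (f ^ n)"
  by (induction n) (auto intro: homog_mult_False)

lemma homog_of_int: "homog False (of_int z)" and homog_of_nat: "homog False (of_nat n)"
  by (simp_all add: of_int_spoly of_nat_spoly homog_smul)

definition gpar :: "evar + ovar \<Rightarrow> bool" where
  "gpar v \<longleftrightarrow> \<not> isl v"

lemma homog_gen: "homog (gpar v) (gen v)"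
  by (cases v) (auto simp: homog_def gpar_def gen_Inl gen_Inr iota_smonom fcard_fempty fcard_finsert_if)

lemma iota_gen: "iota (gen v) = smul (ksign (gpar v) True) (gen v)"
  using homog_gen[of v] by (simp add: homog_def)

lemma gen_commute: "gen u * gen v = smul (ksign (gpar u) (gpar v)) (gen v * gen u)"
proof (cases u; cases v)
  fix a b assume *: "u = Inr a" "v = Inr b"
  show ?thesis
  proof (cases "a = b")
    case False
    have "{u. u |\<in>| {|b|} \<and> u < a} = (if b < a then {b} else {})" "{u. u |\<in>| {|a|} \<and> u < b} = (if a < b then {a} else {})"
      by auto
    with False have "osign a {|b|} = - osign b {|a|}"
      by (cases a b rule: linorder_cases) (auto simp: osign_def)
    with * False show ?thesis
      by (simp add: gen_Inr_smonom gen_Inr[of b] gpar_def)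
         (simp add: gen_Inr gen_Inr_smonom[unfolded gen_Inr] finsert_commute)
  qed (use * in \<open>simp add: gen_Inr gen_Inr_smonom[unfolded gen_Inr]\<close>)
qed (auto simp: gpar_def gen_Inl gen_Inr smonom_mult shuffle_sign_def add.commute)

lemma gen_supercommute: "gen v * f = iot (gpar v) f * gen v"
proof (induction f rule: spoly_induct)
  case (gen u f)
  have "gen v * (gen u * f) = smul (ksign (gpar v) (gpar u)) (gen u * (gen v * f))"
    by (simp add: gen_commute[of v u] flip: mult.assoc)
  also have "\<dots> = smul (ksign (gpar v) (gpar u)) (gen u * iot (gpar v) f * gen v)"
    by (simp add: gen mult.assoc)
  also have "\<dots> = iot (gpar v) (gen u * f) * gen v"
    by (cases "gpar v") (auto simp: iot_mult iot_True iota_gen ksign_def)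
  finally show ?case .
qed (auto simp: distrib_left distrib_right iot_smul iot_add)

lemma iot_gen: "iot \<epsilon> (gen v) = smul (ksign \<epsilon> (gpar v)) (gen v)"
  by (auto simp: iot_def iota_gen ksign_def)

text \<open>Twice the even and twice the odd part of an arbitrary element: the two rules have to be proved
  together, because an odd variable exchanges the parts.\<close>

lemma supercommute_split:
  "(f + iota f) * g = g * (f + iota f)" "(f - iota f) * g = iota g * (f - iota f)"
proof -
  have "(f + iota f) * g = g * (f + iota f) \<and> (f - iota f) * g = iota g * (f - iota f)"
  proof (induction f arbitrary: g rule: spoly_induct)
    case one
    then show ?case by (simp add: mult_2 mult_2_right)
  next
    case (smul c f)
    then show ?case
      by (simp add: iota_smul flip: spoly.scale_right_distrib spoly.scale_right_diff_distrib)
  next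
    case (add f h)
    have *: "f + h + iota (f + h) = (f + iota f) + (h + iota h)" "f + h - iota (f + h) = (f - iota f) + (h - iota h)"
      by (simp_all add: iota_add)
    show ?case
      unfolding * by (metis add distrib_left distrib_right)
  next
    case (gen v f)
    have e: "(f + iota f) * h = h * (f + iota f)" and o: "(f - iota f) * h = iota h * (f - iota f)" for h
      using gen by blast+
    show ?case
    proof (cases "gpar v")
      case False
      then have *: "gen v * f + iota (gen v * f) = gen v * (f + iota f)" "gen v * f - iota (gen v * f) = gen v * (f - iota f)"
        by (simp_all add: iota_mult iota_gen distrib_left right_diff_distrib)
      have c: "gen v * h = h * gen v" for h
        using gen_supercommute[of v h] False by simp
      have "gen v * (f + iota f) * g = g * (gen v * (f + iota f))"
        by (metis c e mult.assoc)
      moreover have "gen v * (f - iota f) * g = iota g * (gen v * (f - iota f))"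
        by (metis c o mult.assoc)
      ultimately show ?thesis
        unfolding * by blast
    next
      case True
      then have *: "gen v * f + iota (gen v * f) = gen v * (f - iota f)" "gen v * f - iota (gen v * f) = gen v * (f + iota f)"
        by (simp_all add: iota_mult iota_gen distrib_left right_diff_distrib)
      have c: "gen v * h = iota h * gen v" for h
        using gen_supercommute[of v h] True by (simp add: iot_True)
      have "gen v * (f - iota f) * g = g * (gen v * (f - iota f))"
        by (metis c[of "iota g"] o[of g] mult.assoc iota_iota)
      moreover have "gen v * (f + iota f) * g = iota g * (gen v * (f + iota f))"
        by (metis c[of g] e[of g] mult.assoc)
      ultimately show ?thesis
        unfolding * by blast
    qed
  qed
  then show "(f + iota f) * g = g * (f + iota f)" "(f - iota f) * g = iota g * (f - iota f)"
    by auto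
qed

lemma half_twice: "f + f = g + g \<Longrightarrow> f = (g :: spoly)"
proof -
  assume "f + f = g + g"
  then have "smul (1/2) (f + f) = smul (1/2) (g + g)" by simp
  then show ?thesis
    by (simp add: spoly.scale_right_distrib flip: spoly.scale_left_distrib)
qed

text \<open>Twice an element of parity \<open>\<epsilon>\<close> is the sum or the difference in \<open>supercommute_split\<close>.\<close>

lemma homog_supercommute: assumes "homog \<epsilon> z" shows "z * f = iot \<epsilon> f * z"
proof (cases \<epsilon>)
  case False
  with assms have "(z + z) * f = f * (z + z)"
    using supercommute_split(1)[of z f] by (simp only: homog_False)
  with False show ?thesis
    by - (rule half_twice, simp only: distrib_left distrib_right iot_simps)
next
  case True
  with assms have "(z + z) * f = iota f * (z + z)"
    using supercommute_split(2)[of z f] by (simp only: homog_True diff_minus_eq_add)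
  with True show ?thesis
    by - (rule half_twice, simp only: distrib_left distrib_right iot_True)
qed

lemma homog_central: "homog False z \<Longrightarrow> z * f = f * z"
  using homog_supercommute[of False] by simp

lemma homog_anticommute: "homog True y \<Longrightarrow> homog True z \<Longrightarrow> y * z = - (z * y)"
  using homog_supercommute[of True y z] by (simp add: iot_True homog_True)

lemma homog_square: assumes "homog True z" shows "z * z = 0"
proof (rule half_twice)
  have "z * z + z * z = z * z + - (z * z)"
    by (rule arg_cong[OF homog_anticommute[OF assms assms]])
  then show "z * z + z * z = 0 + 0"
    by (simp only: right_minus add_0)
qed

subsection \<open>Superderivations\<close>

definition sder :: "bool \<Rightarrow> (spoly \<Rightarrow> spoly) \<Rightarrow> bool" where
  "sder \<epsilon> D \<longleftrightarrow> (\<forall>f g. D (f + g) = D f + D g) \<and> (\<forall>c f. D (smul c f) = smul c (D f)) \<and>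
     (\<forall>f g. D (f * g) = D f * g + iot \<epsilon> f * D g)"

lemma sder_add: "sder \<epsilon> D \<Longrightarrow> D (f + g) = D f + D g"
  and sder_smul: "sder \<epsilon> D \<Longrightarrow> D (smul c f) = smul c (D f)"
  and sder_mult: "sder \<epsilon> D \<Longrightarrow> D (f * g) = D f * g + iot \<epsilon> f * D g"
  by (auto simp: sder_def)

lemma sder_0: "sder \<epsilon> D \<Longrightarrow> D 0 = 0"
  using sder_smul[of \<epsilon> D 0 0] by simp

lemma sder_1: "sder \<epsilon> D \<Longrightarrow> D 1 = 0"
  using sder_mult[of \<epsilon> D 1 1] by simp

lemma sder_sum: "sder \<epsilon> D \<Longrightarrow> D (sum f S) = (\<Sum>x\<in>S. D (f x))"
  by (induction S rule: infinite_finite_induct) (auto simp: sder_0 sder_add)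

lemma sder_uminus: "sder \<epsilon> D \<Longrightarrow> D (- f) = - D f"
  using sder_smul[of \<epsilon> D "-1" f] by simp

lemma sder_eqI:
  assumes "sder \<epsilon> D" "sder \<epsilon> D'" "\<And>v. D (gen v) = D' (gen v)"
  shows "D f = D' f"
  by (induction f rule: spoly_induct) (use assms in \<open>auto simp: sder_1 sder_add sder_smul sder_mult\<close>)

lemma odd_deriv_gen_Inr:
  "odd_deriv v (gen (Inr u) * f) = (if u = v then f else 0) - gen (Inr u) * odd_deriv v f"
proof (induction f rule: spoly_lin_induct)
  case (mono a A)
  show ?case
  proof (cases "u = v")
    case True
    have "osign v (finsert v A) = osign v A" "osign v (A |-| {|v|}) = osign v A"
      unfolding osign_def by (auto intro!: arg_cong[of _ _ "\<lambda>x. (-1) ^ card x"])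
    moreover have "odd_deriv v 0 = 0"
      using odd_deriv_smul[of v 0 0] by simp
    moreover have "v |\<in>| A \<Longrightarrow> finsert v A = A" "v |\<notin>| A \<Longrightarrow> A |-| {|v|} = A"
      by auto
    ultimately show ?thesis
      using True by (auto simp: gen_Inr_smonom odd_deriv_smonom odd_deriv_smul)
  next
    case False
    show ?thesis
    proof (cases "v |\<in>| A \<and> u |\<notin>| A")
      case True
      have "{w. w |\<in>| finsert u A \<and> w < v} = (if u < v then insert u {w. w |\<in>| A \<and> w < v} else {w. w |\<in>| A \<and> w < v})"
        by auto
      moreover have fin: "finite {w. w |\<in>| A \<and> w < v}" for v
        by (rule finite_subset[of _ "fset A"]) auto
      ultimately have 1: "osign v (finsert u A) = (if u < v then - osign v A else osign v A)"
        using True by (auto simp: osign_def)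
      have "{w. w |\<in>| A \<and> w < u} = (if v < u then insert v {w. w |\<in>| (A |-| {|v|}) \<and> w < u} else {w. w |\<in>| (A |-| {|v|}) \<and> w < u})"
        using True by auto
      moreover have "finite {w. w |\<in>| (A |-| {|v|}) \<and> w < u}"
        by (rule finite_subset[of _ "fset A"]) auto
      ultimately have 2: "osign u A = (if v < u then - osign u (A |-| {|v|}) else osign u (A |-| {|v|}))"
        by (auto simp: osign_def)
      have "finsert u A |-| {|v|} = finsert u (A |-| {|v|})"
        using False by auto
      moreover have "osign u A * osign v (finsert u A) = - (osign v A * osign u (A |-| {|v|}))"
        unfolding 1 2 using False by (cases u v rule: linorder_cases) auto
      ultimately show ?thesis
        using True False by (simp add: gen_Inr_smonom odd_deriv_smonom odd_deriv_smul)
    qed (use False in \<open>auto simp: gen_Inr_smonom odd_deriv_smonom odd_deriv_smul\<close>)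
  qed
qed (simp_all add: odd_deriv_smul odd_deriv_add distrib_left spoly.scale_right_distrib spoly.scale_right_diff_distrib)

lemma pdiff_gen:
  "pdiff v (gen u * f) = (if u = v then f else 0) + smul (ksign (gpar v) (gpar u)) (gen u * pdiff v f)"
proof (induction f rule: spoly_lin_induct)
  case (mono a A)
  show ?case
  proof (cases v; cases u)
    fix x y assume *: "v = Inl x" "u = Inl y"
    define s where "s x = Poly_Mapping.single x (1::nat)" for x :: evar
    show ?thesis
    proof (cases "x = y")
      case True
      have "pdiff v (gen u * smonom a A) = smul (of_nat (Poly_Mapping.lookup a y) + 1) (smonom a A)"
        using * True by (simp add: gen_Inl_smonom even_deriv_smonom lookup_add add.commute)
      moreover have "gen u * pdiff v (smonom a A) = smul (of_nat (Poly_Mapping.lookup a y)) (smonom a A)"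
      proof (cases "Poly_Mapping.lookup a y = 0")
        case False
        then have "s y + (a - s y) = a"
          by (intro poly_mapping_eqI) (auto simp: s_def lookup_add lookup_minus lookup_single when_def)
        with * True show ?thesis
          by (simp add: gen_Inl_smonom even_deriv_smonom s_def)
      qed (use * True in \<open>simp add: even_deriv_smonom\<close>)
      ultimately show ?thesis
        using * True by (simp add: spoly.scale_left_distrib gpar_def add.commute)
    next
      case False
      have "s y + a - s x = s y + (a - s x)"
        using False by (intro poly_mapping_eqI) (auto simp: s_def lookup_add lookup_minus lookup_single when_def)
      then show ?thesis
        using * False by (auto simp: gpar_def gen_Inl_smonom even_deriv_smonom lookup_add lookup_single s_def[symmetric])
           (simp add: s_def lookup_single when_def)
    qed
  next
    fix x y assume *: "v = Inr x" "u = Inr y"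
    then show ?thesis
      by (simp add: odd_deriv_gen_Inr gpar_def)
  qed (auto simp: gpar_def gen_Inl_smonom gen_Inr_smonom even_deriv_smonom odd_deriv_smonom even_deriv_smul odd_deriv_smul mult.commute)
qed (auto simp: pdiff_smul pdiff_add distrib_left spoly.scale_right_distrib mult.commute)

lemma pdiff_gen_gen: "pdiff v (gen u) = (if u = v then 1 else 0)"
proof -
  have "pdiff v 1 = 0"
    by (cases v) (auto simp: one_smonom even_deriv_smonom odd_deriv_smonom)
  then show ?thesis
    using pdiff_gen[of v u 1] by simp
qed

lemma pdiff_1: "pdiff v 1 = 0"
  by (cases v) (auto simp: one_smonom even_deriv_smonom odd_deriv_smonom)

lemma sder_pdiff: "sder (gpar v) (pdiff v)"
  unfolding sder_def
proof (intro conjI allI)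
  fix f g
  show "pdiff v (f * g) = pdiff v f * g + iot (gpar v) f * pdiff v g"
  proof (induction f arbitrary: g rule: spoly_induct)
    case (gen u f)
    have "pdiff v (gen u * f * g) = pdiff v (gen u * (f * g))"
      by (simp add: mult.assoc)
    also have "\<dots> = pdiff v (gen u * f) * g + iot (gpar v) (gen u * f) * pdiff v g"
      unfolding pdiff_gen gen
      by (auto simp: distrib_left distrib_right spoly.scale_right_distrib iot_mult iot_gen mult.assoc)
    finally show ?case .
  qed (auto simp: pdiff_1 pdiff_add pdiff_smul distrib_right iot_add iot_smul spoly.scale_right_distrib)
qed (auto simp: pdiff_add pdiff_smul)

lemma sder_times: "homog \<delta> z \<Longrightarrow> sder \<epsilon> D \<Longrightarrow> sder (\<delta> \<noteq> \<epsilon>) (\<lambda>f. z * D f)"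
  unfolding sder_def
  by (auto simp: distrib_left mult.assoc[symmetric] homog_supercommute[of \<delta> z "iot _ _"])

lemma sder_plus: "sder \<epsilon> D \<Longrightarrow> sder \<epsilon> E \<Longrightarrow> sder \<epsilon> (\<lambda>f. D f + E f)"
  by (auto simp: sder_def algebra_simps spoly.scale_right_distrib)

lemma sder_scale: "sder \<epsilon> D \<Longrightarrow> sder \<epsilon> (\<lambda>f. smul c (D f))"
  by (auto simp: sder_def spoly.scale_right_distrib mult.commute)

lemma sder_zero: "sder \<epsilon> (\<lambda>f. 0)"
  by (simp add: sder_def)

lemma sder_diff: "sder \<epsilon> D \<Longrightarrow> sder \<epsilon> E \<Longrightarrow> sder \<epsilon> (\<lambda>f. D f - E f)"
  using sder_plus[OF _ sder_scale[of \<epsilon> E "-1"]] by simp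

lemma sder_Sum: "(\<And>x. x \<in> S \<Longrightarrow> sder \<epsilon> (D x)) \<Longrightarrow> sder \<epsilon> (\<lambda>f. \<Sum>x\<in>S. D x f)"
  by (induction S rule: infinite_finite_induct) (auto simp: sder_zero intro: sder_plus)

text \<open>Shifting parities by \<open>\<epsilon>\<close>, expressed without decomposition into homogeneous parts.\<close>

definition pshift :: "bool \<Rightarrow> (spoly \<Rightarrow> spoly) \<Rightarrow> bool" where
  "pshift \<epsilon> D \<longleftrightarrow> (\<forall>f. iota (D f) = smul (ksign \<epsilon> True) (D (iota f)))"

lemma pshift_sderI:
  assumes D: "sder \<epsilon> D" and gen: "\<And>v. homog (\<epsilon> \<noteq> gpar v) (D (gen v))"
  shows "pshift \<epsilon> D"
proof -
  define D' where "D' f = smul (ksign \<epsilon> True) (iota (D (iota f)))" for f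
  have "iota (iot \<epsilon> (iota f)) = iot \<epsilon> f" for f
    by (simp add: iot_def)
  then have D': "sder \<epsilon> D'"
    using D unfolding sder_def D'_def
    by (auto simp: iota_add iota_smul iota_mult spoly.scale_right_distrib mult.commute)
  have "D' f = D f" for f
  proof (rule sder_eqI[OF D' D])
    fix v
    show "D' (gen v) = D (gen v)"
      using gen[of v] unfolding D'_def iota_gen sder_smul[OF D] iota_smul homog_def
      by (cases \<epsilon>; cases "gpar v") auto
  qed
  from this[of "iota _"] show ?thesis
    unfolding pshift_def D'_def by (metis iota_iota iota_smul ksign_sq(1) spoly.scale_one spoly.scale_scale)
qed

lemma pshift_iot: "pshift \<epsilon> D \<Longrightarrow> D (iot \<delta> f) = smul (ksign \<epsilon> \<delta>) (iot \<delta> (D f))"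
  by (cases \<delta>; cases \<epsilon>) (auto simp: pshift_def iot_True)

lemma pshift_homog: "pshift \<epsilon> D \<Longrightarrow> (\<And>c f. D (smul c f) = smul c (D f)) \<Longrightarrow> homog \<delta> f \<Longrightarrow> homog (\<epsilon> \<noteq> \<delta>) (D f)"
  by (cases \<delta>; cases \<epsilon>) (auto simp: pshift_def homog_def simp del: spoly.scale_minus_left)

text \<open>Relations between supercommutators of superderivations need only be checked on the variables.\<close>

lemma sder_supercommutator:
  assumes D: "sder \<epsilon> D" "pshift \<epsilon> D" and E: "sder \<delta> E" "pshift \<delta> E"
  shows "sder (\<epsilon> \<noteq> \<delta>) (\<lambda>f. D (E f) - smul (ksign \<epsilon> \<delta>) (E (D f)))"
  unfolding sder_def
proof (intro conjI allI)
  fix f g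
  have 1: "D (E (f * g)) = D (E f) * g + iot \<epsilon> (E f) * D g + smul (ksign \<epsilon> \<delta>) (iot \<delta> (D f) * E g) + iot (\<epsilon> \<noteq> \<delta>) f * D (E g)"
    by (simp add: sder_mult[OF D(1)] sder_mult[OF E(1)] sder_add[OF D(1)] pshift_iot[OF D(2)] pshift_iot[OF E(2)])
  have 2: "E (D (f * g)) = E (D f) * g + iot \<delta> (D f) * E g + smul (ksign \<delta> \<epsilon>) (iot \<epsilon> (E f) * D g) + iot (\<delta> \<noteq> \<epsilon>) f * E (D g)"
    by (simp add: sder_mult[OF D(1)] sder_mult[OF E(1)] sder_add[OF E(1)] pshift_iot[OF D(2)] pshift_iot[OF E(2)])
  have 3: "ksign \<delta> \<epsilon> = ksign \<epsilon> \<delta>" "(\<delta> \<noteq> \<epsilon>) = (\<epsilon> \<noteq> \<delta>)"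
    by (auto simp: ksign_def)
  show "D (E (f * g)) - smul (ksign \<epsilon> \<delta>) (E (D (f * g))) =
    (D (E f) - smul (ksign \<epsilon> \<delta>) (E (D f))) * g + iot (\<epsilon> \<noteq> \<delta>) f * (D (E g) - smul (ksign \<epsilon> \<delta>) (E (D g)))"
    unfolding 1 2 3 by (simp add: spoly.scale_right_distrib left_diff_distrib right_diff_distrib)
qed (simp_all add: sder_add[OF D(1)] sder_add[OF E(1)] sder_smul[OF D(1)] sder_smul[OF E(1)]
   spoly.scale_right_distrib spoly.scale_right_diff_distrib mult.commute)

subsection \<open>An invariant inner product\<close>

definition mfact :: "smono \<Rightarrow> nat" where
  "mfact k = (\<Prod>v\<in>Poly_Mapping.keys (fst k). fact (Poly_Mapping.lookup (fst k) v))"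

text \<open>The Fock (Bargmann) form: monomials are orthogonal, and the factorials make multiplication adjoint
  to differentiation.\<close>

definition ip :: "spoly \<Rightarrow> spoly \<Rightarrow> complex" where
  "ip f g = (\<Sum>k | coeff f k \<noteq> 0. coeff f k * cnj (coeff g k) * of_nat (mfact k))"

lemma ip_superset: "finite S \<Longrightarrow> {k. coeff f k \<noteq> 0} \<subseteq> S \<Longrightarrow> ip f g = (\<Sum>k\<in>S. coeff f k * cnj (coeff g k) * of_nat (mfact k))"
  unfolding ip_def by (rule sum.mono_neutral_left) auto

lemma ip_add_left: "ip (f + h) g = ip f g + ip h g"
proof -
  let ?S = "{k. coeff f k \<noteq> 0} \<union> {k. coeff h k \<noteq> 0}"
  have "finite ?S" by (simp add: finite_coeff)
  moreover have "{k. coeff (f + h) k \<noteq> 0} \<subseteq> ?S" by auto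
  ultimately show ?thesis
    by (simp add: ip_superset[of ?S] distrib_right sum.distrib del: coeff_simps(2)) (simp add: sum.distrib distrib_right)
qed

lemma ip_smul_left: "ip (smul c f) g = c * ip f g"
proof -
  let ?S = "{k. coeff f k \<noteq> 0}"
  have "finite ?S" by (simp add: finite_coeff)
  moreover have "{k. coeff (smul c f) k \<noteq> 0} \<subseteq> ?S" by auto
  ultimately show ?thesis
    by (simp add: ip_superset[of ?S] sum_distrib_left mult.assoc)
qed

lemma ip_cnj: "ip g f = cnj (ip f g)"
proof -
  let ?S = "{k. coeff f k \<noteq> 0} \<union> {k. coeff g k \<noteq> 0}"
  have "finite ?S" by (simp add: finite_coeff)
  then have "ip g f = (\<Sum>k\<in>?S. coeff g k * cnj (coeff f k) * of_nat (mfact k))" "ip f g = (\<Sum>k\<in>?S. coeff f k * cnj (coeff g k) * of_nat (mfact k))"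
    by (auto intro!: ip_superset)
  then show ?thesis
    by (simp add: mult_ac)
qed

lemma ip_add_right: "ip g (f + h) = ip g f + ip g h"
  using ip_add_left[of f h g] by (simp add: ip_cnj[of g])

lemma ip_smul_right: "ip g (smul c f) = cnj c * ip g f"
  using ip_smul_left[of c f g] by (simp add: ip_cnj[of g])

lemma ip_0 [simp]: "ip 0 g = 0" "ip g 0 = 0"
  using ip_smul_left[of 0 0 g] ip_smul_right[of g 0 0] by simp_all

lemma ip_sum_left: "ip (sum f S) g = (\<Sum>x\<in>S. ip (f x) g)"
  by (induction S rule: infinite_finite_induct) (auto simp: ip_add_left)

lemma ip_sum_right: "ip g (sum f S) = (\<Sum>x\<in>S. ip g (f x))"
  by (induction S rule: infinite_finite_induct) (auto simp: ip_add_right)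

lemma ip_self_eq_0: "ip f f = 0 \<longleftrightarrow> f = 0"
proof
  assume *: "ip f f = 0"
  have "ip f f = of_real (\<Sum>k | coeff f k \<noteq> 0. (cmod (coeff f k))\<^sup>2 * real (mfact k))"
    unfolding ip_def of_real_sum
    by (rule sum.cong[OF refl]) (simp add: complex_norm_square[symmetric] del: of_real_power)
  with * have "of_real (\<Sum>k | coeff f k \<noteq> 0. (cmod (coeff f k))\<^sup>2 * real (mfact k)) = (0 :: complex)"
    by argo
  then have 0: "(\<Sum>k | coeff f k \<noteq> 0. (cmod (coeff f k))\<^sup>2 * real (mfact k)) = 0"
    by (simp only: of_real_eq_0_iff)
  have "\<forall>k\<in>{k. coeff f k \<noteq> 0}. (cmod (coeff f k))\<^sup>2 * real (mfact k) = 0"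
    by (rule iffD1[OF sum_nonneg_eq_0_iff 0]) (auto simp: finite_coeff)
  moreover have "real (mfact k) \<noteq> 0" for k
    unfolding mfact_def by simp
  ultimately have "coeff f k = 0" for k
    by (metis (mono_tags, lifting) mem_Collect_eq mult_eq_0_iff norm_eq_zero power_eq_0_iff)
  then show "f = 0"
    by (intro spoly_eqI) simp
qed simp

lemma ip_smonom: "ip (smonom a A) g = cnj (coeff g (a, A)) * of_nat (mfact (a, A))"
  by (subst ip_superset[of "{(a, A)}"]) (auto simp: coeff_smonom)

lemma mfact_single_add:
  "mfact (Poly_Mapping.single v 1 + a, A) = Suc (Poly_Mapping.lookup a v) * mfact (a, B)"
proof -
  let ?K = "insert v (Poly_Mapping.keys a)"
  have "mfact (a, B) = (\<Prod>u\<in>?K. fact (Poly_Mapping.lookup a u))"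
    unfolding mfact_def fst_conv by (rule prod.mono_neutral_left) (auto simp: in_keys_iff)
  moreover have "mfact (Poly_Mapping.single v 1 + a, A) = (\<Prod>u\<in>?K. fact (Poly_Mapping.lookup a u) * (if u = v then Suc (Poly_Mapping.lookup a v) else 1))"
    unfolding mfact_def fst_conv keys_single_add
    by (rule prod.cong) (auto simp: lookup_add lookup_single when_def)
  ultimately show ?thesis
    by (simp add: prod.distrib)
qed

text \<open>The exponent produced by the derivative is the quotient of the factorials of the two monomials; for
  odd variables the left derivative carries the same sign as left multiplication.\<close>

lemma ip_gen: "ip (gen v * f) g = ip f (pdiff v g)"
proof (induction f rule: spoly_lin_induct)
  case (mono a A)
  show ?case
  proof (induction g rule: spoly_lin_induct)
    case (mono b B)
    show ?case
    proof (cases v)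
      case (Inl x)
      have "(b = Poly_Mapping.single x 1 + a) \<longleftrightarrow> (a = b - Poly_Mapping.single x 1 \<and> Poly_Mapping.lookup b x > 0)"
        by (auto simp: lookup_add lookup_single intro!: poly_mapping_eqI)
           (auto simp: lookup_add lookup_minus lookup_single when_def)
      then show ?thesis
        using Inl mfact_single_add[of x a A A]
        by (auto simp: gen_Inl_smonom ip_smonom even_deriv_smonom coeff_smonom lookup_add lookup_single distrib_right)
    next
      case (Inr x)
      have o: "osign x (finsert x A) = osign x A"
        unfolding osign_def by (auto intro!: arg_cong[of _ _ "\<lambda>x. (-1) ^ card x"])
      have c: "cnj (osign x A) = osign x A"
        by (simp add: osign_def)
      have m: "mfact (a, finsert x A) = mfact (a, A)"
        by (simp add: mfact_def)
      show ?thesis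
      proof (cases "B = finsert x A \<and> x |\<notin>| A")
        case True
        then have "B |-| {|x|} = A" by auto
        with True show ?thesis
          by (simp add: Inr gen_Inr_smonom ip_smonom odd_deriv_smonom coeff_smonom ip_smul_left o c m)
      next
        case False
        then have "\<not> (x |\<in>| B \<and> A = B |-| {|x|})" by auto
        with False show ?thesis
          by (auto simp: Inr gen_Inr_smonom ip_smonom odd_deriv_smonom coeff_smonom ip_smul_left)
      qed
    qed
  qed (simp_all add: pdiff_add pdiff_smul ip_add_right ip_smul_right)
qed (simp_all add: distrib_left ip_add_left ip_smul_left)

lemma ip_gen_right: "ip f (gen v * g) = ip (pdiff v f) g"
  by (metis ip_cnj ip_gen)

section \<open>Determinants with entries in the superalgebra\<close>

text \<open>Indices start at 1; the bound 1 of an ordered product must survive simplification.\<close>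

declare One_nat_def [simp del]

subsection \<open>Ordered products\<close>

lemma oprod_empty [simp]: "b < a \<Longrightarrow> oprod a b f = 1"
  by (simp add: oprod_def)

lemma oprod_Suc: "a \<le> Suc b \<Longrightarrow> oprod a (Suc b) f = oprod a b f * f (Suc b)"
  by (simp add: oprod_def)

lemma oprod_cong: "(\<And>i. a \<le> i \<Longrightarrow> i \<le> b \<Longrightarrow> f i = g i) \<Longrightarrow> oprod a b f = oprod a b g"
  unfolding oprod_def by (rule arg_cong[of _ _ prod_list], rule map_cong) auto

lemma oprod_append: "a \<le> Suc c \<Longrightarrow> c \<le> b \<Longrightarrow> oprod a b f = oprod a c f * oprod (Suc c) b f"
proof -
  assume "a \<le> Suc c" "c \<le> b"
  then have "[a..<Suc b] = [a..<Suc c] @ [Suc c..<Suc b]"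
    by (metis Suc_le_mono le_add_diff_inverse upt_add_eq_append)
  then show ?thesis
    by (simp add: oprod_def del: upt_Suc)
qed

lemma oprod_split:
  assumes "1 \<le> a" "a \<le> k" "k \<le> b"
  shows "oprod a b f = oprod a (k - 1) f * f k * oprod (Suc k) b f"
proof -
  obtain j where k: "k = Suc j"
    using assms by (cases k) auto
  show ?thesis
    using oprod_append[of a k b f] assms by (simp add: k oprod_Suc)
qed

lemma oprod_upd:
  assumes "1 \<le> a" "a \<le> k" "k \<le> b"
  shows "oprod a b (f(k := x)) = oprod a (k - 1) f * x * oprod (Suc k) b f"
proof -
  have "oprod a (k - 1) (f(k := x)) = oprod a (k - 1) f" "oprod (Suc k) b (f(k := x)) = oprod (Suc k) b f"
    by (rule oprod_cong; use assms in auto)+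
  then show ?thesis
    using oprod_split[OF assms, of "f(k := x)"] by simp
qed

lemma oprod_induct:
  assumes "P 1" "\<And>x y. P x \<Longrightarrow> P y \<Longrightarrow> P (x * y)" "\<And>i. a \<le> i \<Longrightarrow> i \<le> b \<Longrightarrow> P (f i)"
  shows "P (oprod a b f)"
proof -
  have "P (prod_list (map f xs))" if "set xs \<subseteq> {a..b}" for xs
    using that by (induction xs) (auto intro: assms)
  then have "P (prod_list (map f [a..<Suc b]))"
    by (metis atLeastLessThanSuc_atLeastAtMost order_refl set_upt)
  then show ?thesis
    unfolding oprod_def .
qed

lemma homog_oprod_False: "(\<And>i. a \<le> i \<Longrightarrow> i \<le> b \<Longrightarrow> homog False (f i)) \<Longrightarrow> homog False (oprod a b f)"
  by (rule oprod_induct) (auto intro: homog_mult_False)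

lemma polyin_oprod: "(\<And>i. a \<le> i \<Longrightarrow> i \<le> b \<Longrightarrow> f i \<in> polyin S) \<Longrightarrow> oprod a b f \<in> polyin S"
  by (rule oprod_induct) (auto intro: polyin_mult)

lemma oprod_1: "(\<And>i. a \<le> i \<Longrightarrow> i \<le> b \<Longrightarrow> f i = 1) \<Longrightarrow> oprod a b f = 1"
  by (rule oprod_induct[of "\<lambda>x. x = 1"]) auto

lemma oprod_zero:
  assumes "1 \<le> a" "a \<le> k" "k \<le> b" "f k = 0"
  shows "oprod a b f = 0"
  using oprod_split[OF assms(1-3), of f] assms(4) by simp

lemma homog_oprod:
  assumes "1 \<le> a" "\<And>i. a \<le> i \<Longrightarrow> i \<le> b \<Longrightarrow> homog (odd (e i)) (f i)"
  shows "homog (odd (\<Sum>i=a..b. e i)) (oprod a b f)"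
  using assms(2)
proof (induction b)
  case 0
  with \<open>1 \<le> a\<close> show ?case by simp
next
  case (Suc b)
  show ?case
  proof (cases "a \<le> Suc b")
    case True
    have "homog (odd (\<Sum>i=a..b. e i) \<noteq> odd (e (Suc b))) (oprod a b f * f (Suc b))"
      using True by (intro homog_mult Suc) auto
    moreover have "(odd (\<Sum>i=a..b. e i) \<noteq> odd (e (Suc b))) = odd (\<Sum>i=a..Suc b. e i)"
      using True by auto
    ultimately show ?thesis
      using True by (simp add: oprod_Suc)
  qed simp
qed

lemma oprod_central_mult:
  assumes "1 \<le> a" "\<And>i. a \<le> i \<Longrightarrow> i \<le> b \<Longrightarrow> homog False (g i)"
  shows "oprod a b (\<lambda>i. f i * g i) = oprod a b f * oprod a b g"
  using assms(2)
proof (induction b)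
  case (Suc b)
  show ?case
  proof (cases "a \<le> Suc b")
    case True
    have IH: "oprod a b (\<lambda>i. f i * g i) = oprod a b f * oprod a b g"
      using Suc by auto
    have c: "f (Suc b) * oprod a b g = oprod a b g * f (Suc b)"
      by (rule homog_central[symmetric], rule homog_oprod_False) (use Suc in auto)
    have "oprod a b f * oprod a b g * (f (Suc b) * g (Suc b)) = oprod a b f * (oprod a b g * f (Suc b)) * g (Suc b)"
      by (simp only: mult.assoc)
    also have "\<dots> = (oprod a b f * f (Suc b)) * (oprod a b g * g (Suc b))"
      unfolding c[symmetric] by (simp only: mult.assoc)
    finally show ?thesis
      using True by (simp add: oprod_Suc IH)
  qed simp
qed (use \<open>1 \<le> a\<close> in simp)

lemma oprod_const: "1 \<le> a \<Longrightarrow> oprod a b (\<lambda>_. d) = d ^ (Suc b - a)"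
proof (induction b)
  case (Suc b)
  then show ?case
    by (cases "a \<le> Suc b") (auto simp: oprod_Suc Suc_diff_le power_Suc2 simp del: power_Suc)
qed simp

lemma oprod_exchange:
  assumes ab: "1 \<le> a" "a < b" "b \<le> r"
    and g: "g a = f b" "g b = f a" "\<And>i. i \<noteq> a \<Longrightarrow> i \<noteq> b \<Longrightarrow> g i = f i"
    and s: "f a * oprod (Suc a) (b - 1) f * f b = smul s (f b * oprod (Suc a) (b - 1) f * f a)"
  shows "oprod 1 r f = smul s (oprod 1 r g)"
proof -
  have split: "oprod 1 r h = oprod 1 (a - 1) h * (h a * oprod (Suc a) (b - 1) h * h b) * oprod (Suc b) r h" for h
  proof -
    have "oprod 1 r h = oprod 1 (a - 1) h * h a * oprod (Suc a) r h"
      by (rule oprod_split) (use ab in auto)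
    also have "oprod (Suc a) r h = oprod (Suc a) (b - 1) h * h b * oprod (Suc b) r h"
      by (rule oprod_split) (use ab in auto)
    finally show ?thesis
      by (simp only: mult.assoc)
  qed
  have "oprod 1 (a - 1) g = oprod 1 (a - 1) f" "oprod (Suc a) (b - 1) g = oprod (Suc a) (b - 1) f"
    "oprod (Suc b) r g = oprod (Suc b) r f"
    by (rule oprod_cong; use ab g in auto)+
  then show ?thesis
    using split[of f] split[of g] by (simp only: g s smul_mult)
qed

lemma homog_exchange:
  assumes "homog \<epsilon> x" "homog \<epsilon> y"
  shows "x * W * y = smul (ksign \<epsilon> True) (y * W * x)"
proof (cases \<epsilon>)
  case False
  then have "x * (W * y) = (W * y) * x" "W * y = y * W"
    using assms homog_central[of x "W * y"] homog_central[of y W] by simp_all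
  with False show ?thesis
    by (simp add: mult.assoc)
next
  case True
  then have "x * W = iota W * x" "y * W = iota W * y" "x * y = - (y * x)"
    using assms homog_supercommute[of True x W] homog_supercommute[of True y W] homog_anticommute[of x y]
    by (simp_all add: iot_True)
  then have "x * W * y = iota W * - (y * x)" "y * W * x = iota W * (y * x)"
    by (simp_all only: mult.assoc)
  with True show ?thesis
    by simp
qed

text \<open>Permuting factors of one parity among themselves produces no sign or the sign of the permutation,
  whatever the other factors are: an exchange of two of them passes the factors in between twice.\<close>

lemma oprod_permute:
  assumes \<sigma>: "\<sigma> permutes I" and I: "I \<subseteq> {1..r}" and f: "\<And>i. i \<in> I \<Longrightarrow> homog \<epsilon> (f i)"
  shows "oprod 1 r (\<lambda>i. f (\<sigma> i)) = smul (if \<epsilon> then of_int (sign \<sigma>) else 1) (oprod 1 r f)"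
proof -
  have fin: "finite I"
    using I finite_subset by blast
  have "\<forall>f. (\<forall>i\<in>I. homog \<epsilon> (f i)) \<longrightarrow> oprod 1 r (\<lambda>i. f (\<sigma> i)) = smul (if \<epsilon> then of_int (sign \<sigma>) else 1) (oprod 1 r f)"
    using \<sigma> fin
  proof (induction rule: permutes_induct)
    case id
    then show ?case by simp
  next
    case (swap a b p)
    show ?case
    proof (intro allI impI)
      fix f assume f: "\<forall>i\<in>I. homog \<epsilon> (f i)"
      define g where "g = (\<lambda>i. f (transpose a b i))"
      have "\<forall>i\<in>I. homog \<epsilon> (g i)"
        using f swap(1,2) by (auto simp: g_def transpose_def)
      then have "oprod 1 r (\<lambda>i. g (p i)) = smul (if \<epsilon> then of_int (sign p) else 1) (oprod 1 r g)"
        using swap by blast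
      moreover have "oprod 1 r f = smul (ksign \<epsilon> True) (oprod 1 r g)"
      proof (cases "a < b")
        case True
        then show ?thesis
          by (intro oprod_exchange[of a b] homog_exchange) (use swap f I in \<open>auto simp: g_def\<close>)
      next
        case False
        with swap show ?thesis
          by (intro oprod_exchange[of b a] homog_exchange) (use swap f I in \<open>auto simp: g_def\<close>)
      qed
      then have "oprod 1 r g = smul (ksign \<epsilon> True) (oprod 1 r f)"
        by simp
      moreover have "sign (transpose a b \<circ> p) = - sign p"
        using swap fin by (subst sign_compose) (auto simp: sign_swap_id permutation_swap_id dest: permutes_imp_permutation)
      ultimately show "oprod 1 r (\<lambda>i. f ((transpose a b \<circ> p) i)) = smul (if \<epsilon> then of_int (sign (transpose a b \<circ> p)) else 1) (oprod 1 r f)"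
        by (auto simp: g_def)
    qed
  qed
  with f show ?thesis by blast
qed

lemma sum_PiE_insert:
  assumes "x \<notin> T"
  shows "(\<Sum>h\<in>Pi\<^sub>E (insert x T) K. F h) = (\<Sum>h\<in>Pi\<^sub>E T K. \<Sum>y\<in>K x. F (h(x := y)))"
proof -
  have "inj_on (\<lambda>(y, g). g(x := y)) (K x \<times> Pi\<^sub>E T K)"
    using inj_combinator[OF assms] .
  then have "(\<Sum>h\<in>Pi\<^sub>E (insert x T) K. F h) = (\<Sum>(y, g)\<in>K x \<times> Pi\<^sub>E T K. F (g(x := y)))"
    unfolding PiE_insert_eq by (subst sum.reindex) (auto simp: case_prod_unfold)
  also have "\<dots> = (\<Sum>y\<in>K x. \<Sum>g\<in>Pi\<^sub>E T K. F (g(x := y)))"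
    by (rule sum.cartesian_product[symmetric])
  finally show ?thesis
    by (simp only: sum.swap[of _ "K x"])
qed

lemma oprod_sum_PiE:
  "oprod 1 r (\<lambda>l. \<Sum>k\<in>K l. g l k) = (\<Sum>\<kappa>\<in>Pi\<^sub>E {1..r} K. oprod 1 r (\<lambda>l. g l (\<kappa> l)))"
proof (induction r)
  case (Suc r)
  have "oprod 1 (Suc r) (\<lambda>l. \<Sum>k\<in>K l. g l k) = (\<Sum>\<kappa>\<in>Pi\<^sub>E {1..r} K. \<Sum>k\<in>K (Suc r). oprod 1 r (\<lambda>l. g l (\<kappa> l)) * g (Suc r) k)"
    by (simp add: oprod_Suc Suc[simplified] sum_distrib_left sum_distrib_right)
       (rule sum.swap)
  also have "\<dots> = (\<Sum>\<kappa>\<in>Pi\<^sub>E {1..r} K. \<Sum>k\<in>K (Suc r). oprod 1 (Suc r) (\<lambda>l. g l ((\<kappa>(Suc r := k)) l)))"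
  proof (intro sum.cong refl)
    fix \<kappa> k
    have "oprod 1 r (\<lambda>l. g l ((\<kappa>(Suc r := k)) l)) = oprod 1 r (\<lambda>l. g l (\<kappa> l))"
      by (rule oprod_cong) auto
    then show "oprod 1 r (\<lambda>l. g l (\<kappa> l)) * g (Suc r) k = oprod 1 (Suc r) (\<lambda>l. g l ((\<kappa>(Suc r := k)) l))"
      by (simp add: oprod_Suc)
  qed
  also have "\<dots> = (\<Sum>\<kappa>\<in>Pi\<^sub>E (insert (Suc r) {1..r}) K. oprod 1 (Suc r) (\<lambda>l. g l (\<kappa> l)))"
    by (rule sum_PiE_insert[symmetric]) simp
  finally show ?case
    by (simp add: atLeastAtMostSuc_conv)
qed simp

subsection \<open>Row and column operations\<close>

lemma permutes_range: "\<sigma> permutes {1..r} \<Longrightarrow> 1 \<le> i \<Longrightarrow> i \<le> r \<Longrightarrow> 1 \<le> \<sigma> i \<and> \<sigma> i \<le> r"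
  using permutes_in_image[of \<sigma> "{1..r}" i] by auto

lemma sdet_cong: "(\<And>l i. l \<in> {1..r} \<Longrightarrow> i \<in> {1..r} \<Longrightarrow> a l i = b l i) \<Longrightarrow> sdet r a = sdet r b"
  unfolding sdet_def by (intro sum.cong refl arg_cong[of _ _ "(*) _"] oprod_cong) (auto simp: permutes_range)

lemma homog_sdet_False: "(\<And>l i. l \<in> {1..r} \<Longrightarrow> i \<in> {1..r} \<Longrightarrow> homog False (a l i)) \<Longrightarrow> homog False (sdet r a)"
  unfolding sdet_def
  by (intro homog_sum homog_mult_False homog_of_int homog_oprod_False) (auto simp: permutes_range)

lemma homog_sdet:
  assumes "\<And>l i. l \<in> {1..r} \<Longrightarrow> i \<in> {1..r} \<Longrightarrow> homog (l \<in> I) (a l i)" and I: "I \<subseteq> {1..r}"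
  shows "homog (odd (card I)) (sdet r a)"
  unfolding sdet_def
proof (rule homog_sum)
  fix \<sigma> assume "\<sigma> \<in> {\<sigma>. \<sigma> permutes {1..r}}"
  then have h: "homog (odd (if l \<in> I then 1 else 0 :: nat)) (a l (\<sigma> l))" if "1 \<le> l" "l \<le> r" for l
    using assms(1)[of l "\<sigma> l"] that by (auto simp: permutes_range split: if_splits)
  have "homog (odd (\<Sum>l=1..r. if l \<in> I then 1 else 0 :: nat)) (oprod 1 r (\<lambda>l. a l (\<sigma> l)))"
    by (rule homog_oprod[OF order_refl h])
  moreover have "(\<Sum>l=1..r. if l \<in> I then 1 else 0 :: nat) = card I"
    using I by (simp add: Int_absorb1 flip: sum.inter_restrict)
  ultimately show "homog (odd (card I)) (of_int (sign \<sigma>) * oprod 1 r (\<lambda>l. a l (\<sigma> l)))"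
    using homog_mult[OF homog_of_int] by fastforce
qed

lemma polyin_of_int: "of_int z \<in> polyin S"
  by (simp add: of_int_spoly polyin_smul)

lemma polyin_sdet: "(\<And>l i. l \<in> {1..r} \<Longrightarrow> i \<in> {1..r} \<Longrightarrow> a l i \<in> polyin S) \<Longrightarrow> sdet r a \<in> polyin S"
  unfolding sdet_def
  by (intro polyin_sum polyin_mult polyin_of_int polyin_oprod) (auto simp: permutes_range)

lemma sign_transpose_left: "finite S \<Longrightarrow> p permutes S \<Longrightarrow> i \<noteq> j \<Longrightarrow> sign (transpose i j \<circ> p) = - sign p"
  by (subst sign_compose) (auto simp: sign_swap_id permutation_swap_id dest: permutes_imp_permutation)

lemma sign_transpose_right: "finite S \<Longrightarrow> p permutes S \<Longrightarrow> i \<noteq> j \<Longrightarrow> sign (p \<circ> transpose i j) = - sign p"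
  by (subst sign_compose) (auto simp: sign_swap_id permutation_swap_id dest: permutes_imp_permutation)

text \<open>In row order this holds for entries of any parity: exchanging the two columns pairs off the terms
  with opposite signs and does not move factors.\<close>

lemma sdet_equal_columns:
  assumes ij: "i \<in> {1..r}" "j \<in> {1..r}" "i \<noteq> j" and eq: "\<And>l. l \<in> {1..r} \<Longrightarrow> a l i = a l j"
  shows "sdet r a = 0"
proof (rule half_twice)
  let ?P = "{\<sigma>. \<sigma> permutes {1..r}}"
  have "sdet r a = (\<Sum>\<sigma>\<in>?P. of_int (sign (transpose i j \<circ> \<sigma>)) * oprod 1 r (\<lambda>l. a l ((transpose i j \<circ> \<sigma>) l)))"
    unfolding sdet_def by (rule setum_permutations_compose_left) (use ij in \<open>simp add: permutes_swap_id\<close>)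
  also have "\<dots> = (\<Sum>\<sigma>\<in>?P. - (of_int (sign \<sigma>) * oprod 1 r (\<lambda>l. a l (\<sigma> l))))"
  proof (rule sum.cong[OF refl])
    fix \<sigma> assume "\<sigma> \<in> ?P"
    moreover have "oprod 1 r (\<lambda>l. a l ((transpose i j \<circ> \<sigma>) l)) = oprod 1 r (\<lambda>l. a l (\<sigma> l))"
      by (rule oprod_cong) (use eq in \<open>auto simp: transpose_def\<close>)
    ultimately show "of_int (sign (transpose i j \<circ> \<sigma>)) * oprod 1 r (\<lambda>l. a l ((transpose i j \<circ> \<sigma>) l)) = - (of_int (sign \<sigma>) * oprod 1 r (\<lambda>l. a l (\<sigma> l)))"
      using ij by (simp add: sign_transpose_left[of "{1..r}"])
  qed
  also have "\<dots> = - sdet r a"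
    by (simp add: sum_negf sdet_def)
  finally have "sdet r a + sdet r a = sdet r a + - sdet r a"
    by simp
  then show "sdet r a + sdet r a = 0 + 0"
    by (simp only: right_minus add_0)
qed

text \<open>In contrast to columns, exchanging rows moves factors past each other; it changes the sign if this
  is harmless for every term.\<close>

lemma sdet_swap_rows:
  assumes kl: "1 \<le> k" "k < l" "l \<le> r"
    and b: "\<And>i. b k i = a l i" "\<And>i. b l i = a k i" "\<And>h i. h \<noteq> k \<Longrightarrow> h \<noteq> l \<Longrightarrow> b h i = a h i"
    and comm: "\<And>\<sigma>. \<sigma> permutes {1..r} \<Longrightarrow> a k (\<sigma> k) * oprod (Suc k) (l - 1) (\<lambda>h. a h (\<sigma> h)) * a l (\<sigma> l) = a l (\<sigma> l) * oprod (Suc k) (l - 1) (\<lambda>h. a h (\<sigma> h)) * a k (\<sigma> k)"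
  shows "sdet r b = - sdet r a"
proof -
  let ?P = "{\<sigma>. \<sigma> permutes {1..r}}"
  have "sdet r b = (\<Sum>\<sigma>\<in>?P. of_int (sign (\<sigma> \<circ> transpose k l)) * oprod 1 r (\<lambda>h. b h ((\<sigma> \<circ> transpose k l) h)))"
    unfolding sdet_def by (rule sum_permutations_compose_right) (use kl in \<open>simp add: permutes_swap_id\<close>)
  also have "\<dots> = (\<Sum>\<sigma>\<in>?P. - (of_int (sign \<sigma>) * oprod 1 r (\<lambda>h. a h (\<sigma> h))))"
  proof (rule sum.cong[OF refl])
    fix \<sigma> assume \<sigma>: "\<sigma> \<in> ?P"
    have "oprod 1 r (\<lambda>h. a h (\<sigma> h)) = smul 1 (oprod 1 r (\<lambda>h. b h ((\<sigma> \<circ> transpose k l) h)))"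
      by (rule oprod_exchange[OF kl]) (use b comm \<sigma> in auto)
    with \<sigma> kl show "of_int (sign (\<sigma> \<circ> transpose k l)) * oprod 1 r (\<lambda>h. b h ((\<sigma> \<circ> transpose k l) h)) = - (of_int (sign \<sigma>) * oprod 1 r (\<lambda>h. a h (\<sigma> h)))"
      by (simp add: sign_transpose_right[of "{1..r}"])
  qed
  finally show ?thesis
    by (simp add: sum_negf sdet_def)
qed

lemma sdet_equal_rows:
  assumes kl: "k \<in> {1..r}" "l \<in> {1..r}" "k \<noteq> l"
    and eq: "\<And>i. a k i = a l i" and c: "\<And>i. homog False (a k i)"
  shows "sdet r a = 0"
proof -
  have *: "sdet r a = 0" if "1 \<le> k" "k < l" "l \<le> r" "\<And>i. a k i = a l i" "\<And>i. homog False (a k i)" for k l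
  proof (rule half_twice)
    have "sdet r a = - sdet r a"
      by (rule sdet_swap_rows[OF that(1-3)])
         (use that homog_exchange[of False] in \<open>auto simp: that(4)[symmetric]\<close>)
    then have "sdet r a + sdet r a = sdet r a + - sdet r a"
      by simp
    then show "sdet r a + sdet r a = 0 + 0"
      by (simp only: right_minus add_0)
  qed
  show ?thesis
    using *[of k l] *[of l k] kl eq c by (cases "k < l") auto
qed

lemma sdet_row_sum:
  assumes k: "k \<in> {1..r}" and even: "\<And>l i. l \<in> {1..<k} \<Longrightarrow> i \<in> {1..r} \<Longrightarrow> homog False (a l i)"
  shows "sdet r (a(k := \<lambda>i. \<Sum>t\<in>T. c t * b t i)) = (\<Sum>t\<in>T. c t * sdet r (a(k := b t)))"
proof -
  have upd: "oprod 1 r (\<lambda>l. (a(k := v)) l (\<sigma> l)) = oprod 1 (k - 1) (\<lambda>l. a l (\<sigma> l)) * v (\<sigma> k) * oprod (Suc k) r (\<lambda>l. a l (\<sigma> l))" for v \<sigma>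
  proof -
    have "(\<lambda>l. (a(k := v)) l (\<sigma> l)) = (\<lambda>l. a l (\<sigma> l))(k := v (\<sigma> k))"
      by auto
    then show ?thesis
      using k by (simp add: oprod_upd)
  qed
  have "oprod 1 r (\<lambda>l. (a(k := \<lambda>i. \<Sum>t\<in>T. c t * b t i)) l (\<sigma> l)) = (\<Sum>t\<in>T. c t * oprod 1 r (\<lambda>l. (a(k := b t)) l (\<sigma> l)))"
    if \<sigma>: "\<sigma> permutes {1..r}" for \<sigma>
  proof -
    have "homog False (oprod 1 (k - 1) (\<lambda>l. a l (\<sigma> l)))"
      by (rule homog_oprod_False) (use even permutes_range[OF \<sigma>] k in auto)
    then have "oprod 1 (k - 1) (\<lambda>l. a l (\<sigma> l)) * (c t * x) = c t * (oprod 1 (k - 1) (\<lambda>l. a l (\<sigma> l)) * x)" for t x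
      by (metis homog_central mult.assoc)
    then show ?thesis
      unfolding upd by (simp add: sum_distrib_left sum_distrib_right mult.assoc)
  qed
  then have "sdet r (a(k := \<lambda>i. \<Sum>t\<in>T. c t * b t i)) = (\<Sum>\<sigma> | \<sigma> permutes {1..r}. \<Sum>t\<in>T. c t * (of_int (sign \<sigma>) * oprod 1 r (\<lambda>l. (a(k := b t)) l (\<sigma> l))))"
    unfolding sdet_def by (intro sum.cong refl) (simp add: sum_distrib_left of_int_spoly)
  then show ?thesis
    unfolding sdet_def by (simp only: sum.swap[of _ "{\<sigma>. \<sigma> permutes {1..r}}" T] sum_distrib_left)
qed

lemma sdet_scale:
  assumes d: "homog False d"
  shows "sdet r (\<lambda>l i. d * a l i) = d ^ r * sdet r a"
proof -
  have "oprod 1 r (\<lambda>l. d * a l (\<sigma> l)) = d ^ r * oprod 1 r (\<lambda>l. a l (\<sigma> l))" for \<sigma>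
    using oprod_central_mult[of 1 r "\<lambda>_. d" "\<lambda>l. a l (\<sigma> l)"] oprod_central_mult[of 1 r "\<lambda>_. d" "\<lambda>l. a l (\<sigma> l)"] d
      oprod_central_mult[of 1 r "\<lambda>_. d" "\<lambda>l. a l (\<sigma> l)"]
    by (simp add: homog_central[OF d] homog_central[OF homog_power[OF d]] oprod_central_mult oprod_const)
  then show ?thesis
    unfolding sdet_def by (simp add: sum_distrib_left of_int_spoly)
qed

lemma sdet_unit: "sdet r (\<lambda>l i. if i = l then 1 else 0) = 1"
proof -
  have "sdet r (\<lambda>l i. if i = l then 1 else 0) = (\<Sum>\<sigma> | \<sigma> permutes {1..r}. if \<sigma> = id then 1 else 0)"
    unfolding sdet_def
  proof (rule sum.cong[OF refl], clarify)
    fix \<sigma> assume \<sigma>: "\<sigma> permutes {1..r}"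
    show "of_int (sign \<sigma>) * oprod 1 r (\<lambda>l. if \<sigma> l = l then 1 else 0) = (if \<sigma> = id then 1 else (0::spoly))"
    proof (cases "\<sigma> = id")
      case False
      then obtain l where l: "\<sigma> l \<noteq> l" by (auto simp: fun_eq_iff)
      then have "l \<in> {1..r}"
        using \<sigma> permutes_not_in by metis
      then have "oprod 1 r (\<lambda>l. if \<sigma> l = l then 1 else 0) = 0"
        by (intro oprod_zero[of 1 l]) (use l in auto)
      with False show ?thesis by simp
    qed (simp add: oprod_1)
  qed
  also have "\<dots> = 1"
    by (subst sum.delta) (auto simp: finite_permutations)
  finally show ?thesis .
qed

lemma sdet_permuted_rows:
  assumes x: "\<And>l i. homog False (x l i)" and \<sigma>: "\<sigma> permutes {1..r}"
  shows "sdet r (\<lambda>l. x (\<sigma> l)) = of_int (sign \<sigma>) * sdet r x"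
proof -
  let ?P = "{\<sigma>. \<sigma> permutes {1..r}}"
  have "sdet r (\<lambda>l. x (\<sigma> l)) = (\<Sum>\<tau>\<in>?P. of_int (sign (\<tau> \<circ> \<sigma>)) * oprod 1 r (\<lambda>l. x (\<sigma> l) ((\<tau> \<circ> \<sigma>) l)))"
    unfolding sdet_def by (rule sum_permutations_compose_right[OF \<sigma>])
  also have "\<dots> = (\<Sum>\<tau>\<in>?P. of_int (sign \<sigma>) * (of_int (sign \<tau>) * oprod 1 r (\<lambda>l. x l (\<tau> l))))"
  proof (rule sum.cong[OF refl])
    fix \<tau> assume "\<tau> \<in> ?P"
    then have "sign (\<tau> \<circ> \<sigma>) = sign \<tau> * sign \<sigma>"
      using \<sigma> by (intro sign_compose) (auto intro: permutes_imp_permutation[of "{1..r}"])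
    moreover have "oprod 1 r (\<lambda>l. x (\<sigma> l) ((\<tau> \<circ> \<sigma>) l)) = oprod 1 r (\<lambda>l. x l (\<tau> l))"
      using oprod_permute[OF \<sigma>, of r False "\<lambda>l. x l (\<tau> l)"] x by simp
    ultimately show "of_int (sign (\<tau> \<circ> \<sigma>)) * oprod 1 r (\<lambda>l. x (\<sigma> l) ((\<tau> \<circ> \<sigma>) l)) = of_int (sign \<sigma>) * (of_int (sign \<tau>) * oprod 1 r (\<lambda>l. x l (\<tau> l)))"
      by (simp add: mult.commute flip: mult.assoc of_int_mult)
  qed
  finally show ?thesis
    by (simp add: sdet_def sum_distrib_left)
qed

text \<open>The usual proof works if the right matrix is even: after multilinear expansion, repeated choices of
  rows give determinants with equal even rows, and permutations can be undone.\<close>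

lemma sdet_mult:
  assumes x: "\<And>l i. homog False (x l i)"
  shows "sdet r (\<lambda>l i. \<Sum>k=1..r. c l k * x k i) = sdet r c * sdet r x"
proof -
  let ?P = "{\<sigma>. \<sigma> permutes {1..r}}" and ?F = "{1..r} \<rightarrow>\<^sub>E {1..r}"
  define ext where "ext \<kappa> = (\<lambda>i. if i \<in> {1..r} then \<kappa> i else i)" for \<kappa> :: "nat \<Rightarrow> nat"
  have "sdet r (\<lambda>l i. \<Sum>k=1..r. c l k * x k i)
      = (\<Sum>\<sigma>\<in>?P. \<Sum>\<kappa>\<in>?F. of_int (sign \<sigma>) * (oprod 1 r (\<lambda>l. c l (\<kappa> l)) * oprod 1 r (\<lambda>l. x (\<kappa> l) (\<sigma> l))))"
    unfolding sdet_def oprod_sum_PiE sum_distrib_left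
    by (simp add: oprod_central_mult x)
  also have "\<dots> = (\<Sum>\<kappa>\<in>?F. oprod 1 r (\<lambda>l. c l (\<kappa> l)) * sdet r (\<lambda>l. x (\<kappa> l)))"
    unfolding sum.swap[of _ ?P ?F] sdet_def sum_distrib_left
    by (simp add: of_int_spoly)
  also have "\<dots> = (\<Sum>\<kappa>\<in>{\<kappa>\<in>?F. inj_on \<kappa> {1..r}}. oprod 1 r (\<lambda>l. c l (\<kappa> l)) * sdet r (\<lambda>l. x (\<kappa> l)))"
  proof (rule sum.mono_neutral_right)
    show "\<forall>\<kappa>\<in>?F - {\<kappa>\<in>?F. inj_on \<kappa> {1..r}}. oprod 1 r (\<lambda>l. c l (\<kappa> l)) * sdet r (\<lambda>l. x (\<kappa> l)) = 0"
    proof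
      fix \<kappa> assume "\<kappa> \<in> ?F - {\<kappa>\<in>?F. inj_on \<kappa> {1..r}}"
      then obtain k l where "k \<in> {1..r}" "l \<in> {1..r}" "k \<noteq> l" "\<kappa> k = \<kappa> l"
        by (auto simp: inj_on_def)
      then have "sdet r (\<lambda>l. x (\<kappa> l)) = 0"
        by (intro sdet_equal_rows[of k _ l]) (use x in auto)
      then show "oprod 1 r (\<lambda>l. c l (\<kappa> l)) * sdet r (\<lambda>l. x (\<kappa> l)) = 0"
        by simp
    qed
  qed (auto intro: finite_PiE)
  also have "\<dots> = (\<Sum>\<sigma>\<in>?P. of_int (sign \<sigma>) * oprod 1 r (\<lambda>l. c l (\<sigma> l)) * sdet r x)"
  proof (rule sum.reindex_bij_witness[of _ "\<lambda>\<sigma>. restrict \<sigma> {1..r}" ext])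
    fix \<kappa> assume \<kappa>: "\<kappa> \<in> {\<kappa>\<in>?F. inj_on \<kappa> {1..r}}"
    then have "\<kappa> ` {1..r} \<subseteq> {1..r}" by auto
    then have "\<kappa> ` {1..r} = {1..r}"
      using \<kappa> by (intro endo_inj_surj) auto
    then have "bij_betw \<kappa> {1..r} {1..r}"
      using \<kappa> by (auto simp: bij_betw_def)
    then have "bij_betw (ext \<kappa>) {1..r} {1..r}"
      by (rule bij_betw_cong[THEN iffD1, rotated]) (simp add: ext_def)
    then show e: "ext \<kappa> \<in> ?P"
      by (auto intro!: bij_imp_permutes simp: ext_def)
    show "restrict (ext \<kappa>) {1..r} = \<kappa>"
      using \<kappa> by (auto simp: ext_def restrict_def PiE_def extensional_def fun_eq_iff)
    have "oprod 1 r (\<lambda>l. c l (\<kappa> l)) = oprod 1 r (\<lambda>l. c l (ext \<kappa> l))"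
      by (rule oprod_cong) (simp add: ext_def)
    moreover have "sdet r (\<lambda>l. x (\<kappa> l)) = sdet r (\<lambda>l. x (ext \<kappa> l))"
      by (rule sdet_cong) (simp add: ext_def)
    ultimately show "of_int (sign (ext \<kappa>)) * oprod 1 r (\<lambda>l. c l (ext \<kappa> l)) * sdet r x = oprod 1 r (\<lambda>l. c l (\<kappa> l)) * sdet r (\<lambda>l. x (\<kappa> l))"
      using e sdet_permuted_rows[of x "ext \<kappa>" r] x by (simp add: of_int_spoly)
  next
    fix \<sigma> assume \<sigma>: "\<sigma> \<in> ?P"
    then show "restrict \<sigma> {1..r} \<in> {\<kappa>\<in>?F. inj_on \<kappa> {1..r}}"
      using permutes_range[of \<sigma> r] by (auto simp: inj_on_def dest: permutes_inj[THEN injD])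
    show "ext (restrict \<sigma> {1..r}) = \<sigma>"
      using \<sigma> by (auto simp: ext_def fun_eq_iff permutes_def)
  qed
  finally show ?thesis
    by (simp add: sdet_def sum_distrib_right)
qed

subsection \<open>Superderivations of determinants\<close>

lemma sder_oprod:
  assumes D: "sder \<epsilon> D"
    and even: "\<And>l l'. 1 \<le> l' \<Longrightarrow> l' < l \<Longrightarrow> l \<le> r \<Longrightarrow> D (f l) \<noteq> 0 \<Longrightarrow> iot \<epsilon> (f l') = f l'"
  shows "D (oprod 1 r f) = (\<Sum>k=1..r. oprod 1 r (f(k := D (f k))))"
  using even
proof (induction r)
  case 0
  then show ?case by (simp add: sder_1[OF D])
next
  case (Suc r)
  have "iot \<epsilon> (oprod 1 r f) * D (f (Suc r)) = oprod 1 r f * D (f (Suc r))"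
  proof (cases "D (f (Suc r)) = 0")
    case False
    then have "iot \<epsilon> (f i) = f i" if "1 \<le> i" "i \<le> r" for i
      using Suc.prems[of i "Suc r"] that by simp
    then have "iot \<epsilon> (oprod 1 r f) = oprod 1 r f"
      by (intro oprod_induct[of "\<lambda>x. iot \<epsilon> x = x"]) (auto simp: iot_mult)
    then show ?thesis by simp
  qed simp
  moreover have "oprod 1 (Suc r) (f(k := D (f k))) = oprod 1 r (f(k := D (f k))) * f (Suc r)" if "k \<in> {1..r}" for k
    using that by (auto simp: oprod_Suc)
  moreover have "oprod 1 r (f(Suc r := D (f (Suc r)))) = oprod 1 r f"
    by (rule oprod_cong) auto
  moreover have "D (oprod 1 r f) = (\<Sum>k=1..r. oprod 1 r (f(k := D (f k))))"
    by (rule Suc.IH) (use Suc.prems in auto)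
  ultimately show ?case
    by (simp add: oprod_Suc sder_mult[OF D] sum_distrib_right fun_upd_same del: fun_upd_apply)
qed

lemma sder_even_oprod: "sder False D \<Longrightarrow> D (oprod 1 r f) = (\<Sum>k=1..r. oprod 1 r (f(k := D (f k))))"
  by (rule sder_oprod) auto

lemma sder_of_int_mult: "sder \<epsilon> D \<Longrightarrow> D (of_int z * f) = of_int z * D f"
  by (simp add: of_int_spoly sder_smul)

lemma sder_sdet:
  assumes D: "sder \<epsilon> D"
    and even: "\<And>l l' i i'. 1 \<le> l' \<Longrightarrow> l' < l \<Longrightarrow> l \<le> r \<Longrightarrow> i \<in> {1..r} \<Longrightarrow> i' \<in> {1..r} \<Longrightarrow> D (a l i) \<noteq> 0 \<Longrightarrow> iot \<epsilon> (a l' i') = a l' i'"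
  shows "D (sdet r a) = (\<Sum>k=1..r. sdet r (a(k := \<lambda>i. D (a k i))))"
proof -
  let ?P = "{\<sigma>. \<sigma> permutes {1..r}}"
  have "D (sdet r a) = (\<Sum>\<sigma>\<in>?P. of_int (sign \<sigma>) * D (oprod 1 r (\<lambda>l. a l (\<sigma> l))))"
    unfolding sdet_def by (simp add: sder_sum[OF D] sder_of_int_mult[OF D])
  also have "\<dots> = (\<Sum>\<sigma>\<in>?P. of_int (sign \<sigma>) * (\<Sum>k=1..r. oprod 1 r (\<lambda>l. (a(k := \<lambda>i. D (a k i))) l (\<sigma> l))))"
  proof (rule sum.cong[OF refl])
    fix \<sigma> assume \<sigma>: "\<sigma> \<in> ?P"
    have "D (oprod 1 r (\<lambda>l. a l (\<sigma> l))) = (\<Sum>k=1..r. oprod 1 r ((\<lambda>l. a l (\<sigma> l))(k := D (a k (\<sigma> k)))))"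
    proof (rule sder_oprod[OF D])
      fix l l' assume "1 \<le> l'" "l' < l" "l \<le> r" "D (a l (\<sigma> l)) \<noteq> 0"
      then show "iot \<epsilon> (a l' (\<sigma> l')) = a l' (\<sigma> l')"
        using \<sigma> permutes_range[of \<sigma> r l] permutes_range[of \<sigma> r l'] by (intro even[of l' l "\<sigma> l"]) auto
    qed
    also have "\<dots> = (\<Sum>k=1..r. oprod 1 r (\<lambda>l. (a(k := \<lambda>i. D (a k i))) l (\<sigma> l)))"
      by (intro sum.cong refl arg_cong[of _ _ "oprod 1 r"]) auto
    finally show "of_int (sign \<sigma>) * D (oprod 1 r (\<lambda>l. a l (\<sigma> l))) = of_int (sign \<sigma>) * (\<Sum>k=1..r. oprod 1 r (\<lambda>l. (a(k := \<lambda>i. D (a k i))) l (\<sigma> l)))"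
      by simp
  qed
  also have "\<dots> = (\<Sum>k=1..r. sdet r (a(k := \<lambda>i. D (a k i))))"
    unfolding sum_distrib_left sdet_def by (rule sum.swap)
  finally show ?thesis .
qed

lemma sdet_zero_row: "k \<in> {1..r} \<Longrightarrow> (\<And>i. i \<in> {1..r} \<Longrightarrow> a k i = 0) \<Longrightarrow> sdet r a = 0"
  unfolding sdet_def
proof (rule sum.neutral, rule ballI)
  fix \<sigma> assume k: "k \<in> {1..r}" and a: "\<And>i. i \<in> {1..r} \<Longrightarrow> a k i = 0" and \<sigma>: "\<sigma> \<in> {\<sigma>. \<sigma> permutes {1..r}}"
  then have "oprod 1 r (\<lambda>l. a l (\<sigma> l)) = 0"
    by (intro oprod_zero[of 1 k]) (use permutes_range[of \<sigma> r k] in auto)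
  then show "of_int (sign \<sigma>) * oprod 1 r (\<lambda>l. a l (\<sigma> l)) = 0"
    by simp
qed

lemma sder_sdet_0:
  assumes D: "sder \<epsilon> D" and 0: "\<And>l i. l \<in> {1..r} \<Longrightarrow> i \<in> {1..r} \<Longrightarrow> D (a l i) = 0"
  shows "D (sdet r a) = 0"
proof -
  have "D (sdet r a) = (\<Sum>k=1..r. sdet r (a(k := \<lambda>i. D (a k i))))"
    by (rule sder_sdet[OF D]) (use 0 in auto)
  also have "\<dots> = 0"
    by (intro sum.neutral ballI sdet_zero_row) (use 0 in auto)
  finally show ?thesis .
qed

text \<open>A root vector that replaces one coordinate by another acts on a determinant by replacing one column
  by another, which then occurs twice.\<close>

lemma sder_column:
  assumes D: "sder False D" and i: "i0 \<in> {1..r}" "i0 \<noteq> i1"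
    and 0: "\<And>l i. l \<in> {1..r} \<Longrightarrow> i \<in> {1..r} \<Longrightarrow> D (a l i) = (if i = i1 then a l i0 else 0)"
  shows "D (sdet r a) = 0"
proof (cases "i1 \<in> {1..r}")
  case True
  let ?P = "{\<sigma>. \<sigma> permutes {1..r}}"
  \<comment> \<open>the matrix with column \<open>i1\<close> replaced by column \<open>i0\<close>\<close>
  define b where "b l i = (if i = i1 then a l i0 else a l i)" for l i
  have "D (sdet r a) = (\<Sum>\<sigma>\<in>?P. of_int (sign \<sigma>) * D (oprod 1 r (\<lambda>l. a l (\<sigma> l))))"
    unfolding sdet_def by (simp add: sder_sum[OF D] sder_of_int_mult[OF D])
  also have "\<dots> = sdet r b"
    unfolding sdet_def
  proof (rule sum.cong[OF refl])
    fix \<sigma> assume \<sigma>: "\<sigma> \<in> ?P"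
    define k where "k = inv \<sigma> i1"
    have \<sigma>k: "\<sigma> l = i1 \<longleftrightarrow> l = k" for l
      using \<sigma> by (auto simp: k_def permutes_inverses)
    have k: "k \<in> {1..r}"
      using \<sigma> True unfolding k_def by (metis mem_Collect_eq permutes_in_image permutes_inv)
    have "D (oprod 1 r (\<lambda>l. a l (\<sigma> l))) = (\<Sum>l=1..r. oprod 1 r ((\<lambda>l. a l (\<sigma> l))(l := D (a l (\<sigma> l)))))"
      by (rule sder_even_oprod[OF D])
    also have "\<dots> = (\<Sum>l=1..r. if l = k then oprod 1 r (\<lambda>l. b l (\<sigma> l)) else 0)"
    proof (rule sum.cong[OF refl])
      fix l assume l: "l \<in> {1..r}"
      have Dl: "D (a l (\<sigma> l)) = (if l = k then a l i0 else 0)"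
        using 0[of l "\<sigma> l"] permutes_range[of \<sigma> r l] \<sigma> l \<sigma>k by auto
      show "oprod 1 r ((\<lambda>l. a l (\<sigma> l))(l := D (a l (\<sigma> l)))) = (if l = k then oprod 1 r (\<lambda>l. b l (\<sigma> l)) else 0)"
      proof (cases "l = k")
        case True
        then show ?thesis
          unfolding Dl by (auto intro!: oprod_cong simp: b_def \<sigma>k)
      next
        case False
        with l show ?thesis
          unfolding Dl by (simp add: oprod_upd)
      qed
    qed
    also have "\<dots> = oprod 1 r (\<lambda>l. b l (\<sigma> l))"
      using k by (subst sum.delta) auto
    finally show "of_int (sign \<sigma>) * D (oprod 1 r (\<lambda>l. a l (\<sigma> l))) = of_int (sign \<sigma>) * oprod 1 r (\<lambda>l. b l (\<sigma> l))"
      by simp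
  qed
  also have "\<dots> = 0"
    by (rule sdet_equal_columns[of i0 r i1]) (use i True in \<open>auto simp: b_def\<close>)
  finally show ?thesis .
next
  case False
  with 0 show ?thesis
    by (intro sder_sdet_0[OF D]) auto
qed

lemma sder_oprod_weight:
  assumes D: "sder False D" and w: "\<And>l. l \<in> {a..b} \<Longrightarrow> D (f l) = smul (w l) (f l)" and a: "1 \<le> a"
  shows "D (oprod a b f) = smul (\<Sum>l=a..b. w l) (oprod a b f)"
  using w a
proof (induction b)
  case 0
  then show ?case by (simp add: sder_1[OF D])
next
  case (Suc b)
  show ?case
  proof (cases "a \<le> Suc b")
    case True
    then have "D (oprod a b f) = smul (\<Sum>l=a..b. w l) (oprod a b f)" "D (f (Suc b)) = smul (w (Suc b)) (f (Suc b))"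
      using Suc by auto
    with True show ?thesis
      by (simp add: oprod_Suc sder_mult[OF D] spoly.scale_left_distrib)
  next
    case False
    then show ?thesis by (simp add: sder_1[OF D])
  qed
qed

lemma sder_sdet_weight:
  assumes D: "sder False D" and w: "\<And>l i. l \<in> {1..r} \<Longrightarrow> i \<in> {1..r} \<Longrightarrow> D (a l i) = smul (u l + w i) (a l i)"
  shows "D (sdet r a) = smul ((\<Sum>l=1..r. u l) + (\<Sum>i=1..r. w i)) (sdet r a)"
proof -
  have "D (oprod 1 r (\<lambda>l. a l (\<sigma> l))) = smul ((\<Sum>l=1..r. u l) + (\<Sum>i=1..r. w i)) (oprod 1 r (\<lambda>l. a l (\<sigma> l)))"
    if \<sigma>: "\<sigma> permutes {1..r}" for \<sigma>
  proof -
    have "D (oprod 1 r (\<lambda>l. a l (\<sigma> l))) = smul (\<Sum>l=1..r. u l + w (\<sigma> l)) (oprod 1 r (\<lambda>l. a l (\<sigma> l)))"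
      by (rule sder_oprod_weight[OF D]) (use w permutes_range[OF \<sigma>] in auto)
    moreover have "(\<Sum>l=1..r. w (\<sigma> l)) = (\<Sum>i=1..r. w i)"
      using sum.permute[OF \<sigma>, of w] by (simp add: o_def)
    ultimately show ?thesis
      by (simp add: sum.distrib)
  qed
  then show ?thesis
    unfolding sdet_def by (simp add: sder_sum[OF D] sder_of_int_mult[OF D] spoly.scale_sum_right)
qed

subsection \<open>Non-zero-divisors\<close>

text \<open>A linear order on the even variables, so that the polynomials in them form an integral domain.\<close>

instance evar :: countable
  by countable_datatype

instantiation evar :: linorder
begin
definition less_eq_evar :: "evar \<Rightarrow> evar \<Rightarrow> bool" where
  "less_eq_evar u v \<longleftrightarrow> to_nat u \<le> to_nat v"
definition less_evar :: "evar \<Rightarrow> evar \<Rightarrow> bool" where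
  "less_evar u v \<longleftrightarrow> to_nat u < to_nat v"
instance
  by standard (auto simp: less_eq_evar_def less_evar_def)
end

definition nzd :: "spoly \<Rightarrow> bool" where
  "nzd z \<longleftrightarrow> (\<forall>f. z * f = 0 \<longrightarrow> f = 0)"

lemma nzd_cancel: "nzd z \<Longrightarrow> z * f = z * g \<Longrightarrow> f = g"
  unfolding nzd_def by (metis right_diff_distrib eq_iff_diff_eq_0)

lemma nzd_mult: "nzd y \<Longrightarrow> nzd z \<Longrightarrow> nzd (y * z)"
  unfolding nzd_def by (metis mult.assoc)

lemma nzd_power: "nzd z \<Longrightarrow> nzd (z ^ n)"
proof (induction n)
  case 0
  show ?case by (simp add: nzd_def)
qed (simp add: nzd_mult)

text \<open>The coefficient of the odd monomial \<open>A\<close>, a polynomial in the even variables.\<close>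

definition oc :: "ovar fset \<Rightarrow> spoly \<Rightarrow> (evar \<Rightarrow>\<^sub>0 nat) \<Rightarrow>\<^sub>0 complex" where
  "oc A f = Poly_Mapping.map_key (\<lambda>a. (a, A)) (coeffs f)"

lemma inj_pair: "inj (\<lambda>a. (a, A))"
  by (simp add: inj_def)

lemma lookup_oc: "Poly_Mapping.lookup (oc A f) a = coeff f (a, A)"
  unfolding oc_def coeff_def by (subst map_key.rep_eq) (simp_all add: inj_pair)

lemma oc_add: "oc A (f + g) = oc A f + oc A g"
  by (rule poly_mapping_eqI) (simp add: lookup_oc lookup_add)

lemma oc_smul: "oc A (smul c f) = Poly_Mapping.single 0 c * oc A f"
  by (rule poly_mapping_eqI) (simp add: lookup_oc lookup_map_times flip: mult_map_scale_conv_mult)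

lemma oc_smonom: "oc A (smonom b B) = (if A = B then Poly_Mapping.single b 1 else 0)"
  by (rule poly_mapping_eqI) (auto simp: lookup_oc coeff_smonom lookup_single when_def)

lemma oc_gen: "oc A (gen (Inl v) * f) = Poly_Mapping.single (Poly_Mapping.single v 1) 1 * oc A f"
  by (induction f rule: spoly_lin_induct)
    (simp_all add: gen_Inl_smonom oc_smonom oc_add oc_smul distrib_left mult_single mult.left_commute)

lemma oc_mult: "z \<in> polyin (range Inl) \<Longrightarrow> oc A (z * f) = oc {||} z * oc A f"
proof (induction z rule: polyin_induct)
  case one
  have "oc {||} 1 = (1 :: (evar \<Rightarrow>\<^sub>0 nat) \<Rightarrow>\<^sub>0 complex)"
    by (simp add: one_smonom oc_smonom)
  then show ?case
    by (simp only: mult_1)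
next
  case (gen v z)
  then obtain u where "v = Inl u" by auto
  with gen show ?case
    by (simp only: mult.assoc oc_gen)
qed (simp_all add: distrib_right oc_add oc_smul mult.assoc)

text \<open>On the coefficient of each odd monomial, an even polynomial acts by multiplication in an integral
  domain.\<close>

lemma nzd_polyin: assumes z: "z \<in> polyin (range Inl)" "z \<noteq> 0" shows "nzd z"
  unfolding nzd_def
proof (intro allI impI)
  fix f assume "z * f = 0"
  obtain k where k: "coeff z k \<noteq> 0"
    using z(2) by (metis coeff_simps(1) spoly_eqI)
  with z(1) have "mono_vars k \<subseteq> range Inl"
    unfolding polyin_coeff by blast
  then have "fset (snd k) = fset {||}"
    by (auto simp: mono_vars_def)
  then have "snd k = {||}"
    by (simp only: fset_inject)
  with k have nz: "oc {||} z \<noteq> 0"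
    by (metis lookup_oc lookup_zero prod.collapse)
  have "oc A f = 0" for A
  proof -
    have "oc {||} z * oc A f = oc A 0"
      using oc_mult[OF z(1), of A f] \<open>z * f = 0\<close> by simp
    also have "oc A 0 = 0"
      by (rule poly_mapping_eqI) (simp add: lookup_oc)
    finally show ?thesis
      using nz by (simp only: mult_eq_0_iff) simp
  qed
  then have "coeff f k = 0" for k
    by (metis lookup_oc lookup_zero prod.collapse)
  then show "f = 0"
    by (intro spoly_eqI) simp
qed

subsection \<open>Evaluation at the identity matrices\<close>

text \<open>The homomorphism with \<open>x\<^sub>l\<^sup>i, y\<^sub>l\<^sup>i \<mapsto> \<delta>\<^sub>l\<^sub>i\<close> and \<open>\<xi> \<mapsto> 0\<close> that fixes the variables \<open>\<eta>\<close> detects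
  non-vanishing.\<close>

fun diag_var :: "evar \<Rightarrow> bool" where
  "diag_var (X l i) \<longleftrightarrow> l = i"
| "diag_var (Y l i) \<longleftrightarrow> l = i"

fun is_Xi :: "ovar \<Rightarrow> bool" where
  "is_Xi (Xi l j) \<longleftrightarrow> True"
| "is_Xi (Eta k i) \<longleftrightarrow> False"
| "is_Xi (Mark i k c) \<longleftrightarrow> False"

definition ev_mono :: "smono \<Rightarrow> spoly" where
  "ev_mono k = (if (\<forall>v\<in>Poly_Mapping.keys (fst k). diag_var v) \<and> (\<forall>u\<in>fset (snd k). \<not> is_Xi u) then smonom 0 (snd k) else 0)"

definition ev :: "spoly \<Rightarrow> spoly" where
  "ev f = (\<Sum>k\<in>Poly_Mapping.keys (coeffs f). smul (Poly_Mapping.lookup (coeffs f) k) (ev_mono k))"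

lemma ev_add: "ev (f + g) = ev f + ev g"
  unfolding ev_def plus_spoly.rep_eq by (rule pm_sum_add) (simp add: spoly.scale_left_distrib)

lemma ev_smul_smonom: "ev (smul c (smonom a A)) = smul c (ev_mono (a, A))"
  by (simp add: ev_def coeffs_simps map_single)

lemma ev_smul: "ev (smul c f) = smul c (ev f)"
proof (induction f arbitrary: c rule: spoly_lin_induct)
  case (mono a A)
  then show ?case
    using ev_smul_smonom[of c a A] ev_smul_smonom[of 1 a A] by simp
qed (simp_all add: ev_add spoly.scale_right_distrib)

lemma ev_smonom: "ev (smonom a A) = ev_mono (a, A)"
  using ev_smul_smonom[of 1] by simp

lemma ev_0 [simp]: "ev 0 = 0"
  using ev_smul[of 0 0] by simp

lemma ev_1 [simp]: "ev 1 = 1"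
  by (simp add: one_smonom ev_smonom ev_mono_def)

lemma ev_gens: "ev (gen (Inl v)) = (if diag_var v then 1 else 0)" "ev (gen (Inr u)) = (if is_Xi u then 0 else gen (Inr u))"
  by (simp_all add: gen_Inl gen_Inr ev_smonom ev_mono_def one_smonom)

lemma ev_gen_mult: "ev (gen v * f) = ev (gen v) * ev f"
proof (induction f rule: spoly_lin_induct)
  case (mono a A)
  show ?case
  proof (cases v)
    case (Inl u)
    then show ?thesis
      by (simp add: gen_Inl_smonom ev_smonom ev_gens ev_mono_def keys_single_add del: One_nat_def)
  next
    case (Inr u)
    then show ?thesis
      by (auto simp: gen_Inr_smonom ev_smonom ev_gens ev_mono_def ev_smul)
  qed
qed (simp_all add: ev_add ev_smul distrib_left)

lemma ev_mult: "ev (f * g) = ev f * ev g"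
  by (induction f rule: spoly_induct) (simp_all add: ev_add ev_smul distrib_right mult.assoc ev_gen_mult)

lemma ev_sum: "ev (sum f S) = (\<Sum>x\<in>S. ev (f x))"
  by (induction S rule: infinite_finite_induct) (auto simp: ev_add)

lemma ev_oprod: "ev (oprod a b f) = oprod a b (\<lambda>i. ev (f i))"
proof -
  have "ev (prod_list (map f xs)) = prod_list (map (\<lambda>i. ev (f i)) xs)" for xs
    by (induction xs) (auto simp: ev_mult)
  then show ?thesis
    by (simp add: oprod_def)
qed

lemma ev_sdet: "ev (sdet r a) = sdet r (\<lambda>l i. ev (a l i))"
  unfolding sdet_def by (simp add: ev_sum of_int_spoly ev_smul ev_oprod)

lemma ev_power: "ev (f ^ n) = ev f ^ n"
  by (induction n) (auto simp: ev_mult)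

section \<open>Determinants with equal odd rows\<close>

lemma homog_vars: "homog False (xv l i)" "homog False (yv l i)" "homog True (xiv l i)" "homog True (etav l i)"
  using homog_gen[of "Inl (X l i)"] homog_gen[of "Inl (Y l i)"] homog_gen[of "Inr (Xi l i)"] homog_gen[of "Inr (Eta l i)"]
  by (simp_all add: gpar_def)

lemma detX_empty: "detX r j {} = Delta r"
  by (simp add: detX_def Delta_def)

lemma Delta2_detX: "Delta2 m j r = detX r j {m+1..r}"
  unfolding Delta2_def detX_def by (rule sdet_cong) auto

lemma homog_Delta: "homog False (Delta r)"
  unfolding Delta_def by (rule homog_sdet_False) (rule homog_vars)

lemma homog_detX: "I \<subseteq> {1..r} \<Longrightarrow> homog (odd (card I)) (detX r j I)"
  unfolding detX_def by (rule homog_sdet) (auto simp: homog_vars)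

lemma homog_th: "k \<in> {1..r} \<Longrightarrow> homog True (detX r j {k})"
  using homog_detX[of "{k}" r j] by simp

lemma ev_Delta: "ev (Delta r) = 1"
proof -
  have "ev (Delta r) = sdet r (\<lambda>l i. if i = l then 1 else 0)"
    unfolding Delta_def ev_sdet by (rule sdet_cong) (auto simp: ev_gens)
  then show ?thesis by (simp add: sdet_unit)
qed

lemma nzd_Delta: "nzd (Delta r)"
proof (rule nzd_polyin)
  show "Delta r \<in> polyin (range Inl)"
    unfolding Delta_def by (intro polyin_sdet polyin_gen) auto
  show "Delta r \<noteq> 0"
    using ev_Delta[of r] by auto
qed

definition cof :: "nat \<Rightarrow> nat \<Rightarrow> nat \<Rightarrow> spoly" where
  "cof r k i' = sdet r (xv(k := \<lambda>i. if i = i' then 1 else 0))"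

lemma homog_cof: "homog False (cof r k i)"
  unfolding cof_def by (rule homog_sdet_False) (auto simp: homog_vars)

lemma cof_row:
  assumes "k \<in> {1..r}"
  shows "sdet r (xv(k := v)) = (\<Sum>i=1..r. v i * cof r k i)"
proof -
  have "sdet r (xv(k := v)) = sdet r (xv(k := \<lambda>i. \<Sum>t\<in>{1..r}. v t * (if i = t then 1 else 0)))"
    by (rule sdet_cong) (auto simp: if_distrib cong: if_cong)
  also have "\<dots> = (\<Sum>t\<in>{1..r}. v t * sdet r (xv(k := \<lambda>i. if i = t then 1 else 0)))"
    by (rule sdet_row_sum) (use assms homog_vars in auto)
  finally show ?thesis
    by (simp add: cof_def)
qed

lemma th_upd: "detX r j {k} = sdet r (xv(k := etav j))"
  unfolding detX_def by (rule sdet_cong) auto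

lemma th_cof: "k \<in> {1..r} \<Longrightarrow> detX r j {k} = (\<Sum>i=1..r. etav j i * cof r k i)"
  unfolding th_upd by (rule cof_row)

text \<open>The expansion along a column, by which cofactors form the adjugate matrix also from the other side.\<close>

lemma cof_col:
  assumes i': "i' \<in> {1..r}" and b: "\<And>l. homog False (b l)"
  shows "(\<Sum>k=1..r. b k * cof r k i') = sdet r (\<lambda>l i. if i = i' then b l else xv l i)"
proof -
  let ?P = "{\<sigma>. \<sigma> permutes {1..r}}"
  have "(\<Sum>k=1..r. b k * cof r k i') = (\<Sum>\<sigma>\<in>?P. \<Sum>k=1..r. of_int (sign \<sigma>) * (b k * oprod 1 r (\<lambda>l. (xv(k := \<lambda>i. if i = i' then 1 else 0)) l (\<sigma> l))))"
    unfolding cof_def sdet_def sum_distrib_left sum.swap[of _ "{1..r}" ?P]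
    by (simp add: of_int_spoly)
  also have "\<dots> = sdet r (\<lambda>l i. if i = i' then b l else xv l i)"
    unfolding sdet_def
  proof (rule sum.cong[OF refl])
    fix \<sigma> assume \<sigma>: "\<sigma> \<in> ?P"
    define k0 where "k0 = inv \<sigma> i'"
    have \<sigma>k: "\<sigma> l = i' \<longleftrightarrow> l = k0" for l
      using \<sigma> by (auto simp: k0_def permutes_inverses)
    have k0: "k0 \<in> {1..r}"
      using \<sigma> i' unfolding k0_def by (metis mem_Collect_eq permutes_in_image permutes_inv)
    have 1: "oprod 1 r (\<lambda>l. (xv(k := \<lambda>i. if i = i' then 1 else 0)) l (\<sigma> l)) = (if k = k0 then oprod 1 r ((\<lambda>l. xv l (\<sigma> l))(k0 := 1)) else 0)"
      if "k \<in> {1..r}" for k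
    proof (cases "k = k0")
      case True
      then show ?thesis by (auto intro!: oprod_cong simp: \<sigma>k)
    next
      case False
      with that show ?thesis by (auto intro!: oprod_zero[of 1 k] simp: \<sigma>k)
    qed
    have "homog False (oprod 1 (k0 - 1) (\<lambda>l. xv l (\<sigma> l)))"
      by (rule homog_oprod_False) (rule homog_vars)
    then have c: "oprod 1 (k0 - 1) (\<lambda>l. xv l (\<sigma> l)) * b k0 = b k0 * oprod 1 (k0 - 1) (\<lambda>l. xv l (\<sigma> l))"
      by (rule homog_central)
    have "oprod 1 r (\<lambda>l. if \<sigma> l = i' then b l else xv l (\<sigma> l)) = oprod 1 r ((\<lambda>l. xv l (\<sigma> l))(k0 := b k0))"
      by (rule oprod_cong) (auto simp: \<sigma>k)
    also have "\<dots> = b k0 * oprod 1 r ((\<lambda>l. xv l (\<sigma> l))(k0 := 1))"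
      using k0 by (simp add: oprod_upd c mult.assoc)
    finally have 2: "oprod 1 r (\<lambda>l. if \<sigma> l = i' then b l else xv l (\<sigma> l)) = b k0 * oprod 1 r ((\<lambda>l. xv l (\<sigma> l))(k0 := 1))" .
    have "(\<Sum>k=1..r. of_int (sign \<sigma>) * (b k * oprod 1 r (\<lambda>l. (xv(k := \<lambda>i. if i = i' then 1 else 0)) l (\<sigma> l))))
       = (\<Sum>k=1..r. if k = k0 then of_int (sign \<sigma>) * (b k0 * oprod 1 r ((\<lambda>l. xv l (\<sigma> l))(k0 := 1))) else 0)"
      by (intro sum.cong refl) (simp only: 1 split: if_splits, simp)
    also have "\<dots> = of_int (sign \<sigma>) * oprod 1 r (\<lambda>l. if \<sigma> l = i' then b l else xv l (\<sigma> l))"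
      using k0 unfolding 2 by (subst sum.delta) auto
    finally show "(\<Sum>k=1..r. of_int (sign \<sigma>) * (b k * oprod 1 r (\<lambda>l. (xv(k := \<lambda>i. if i = i' then 1 else 0)) l (\<sigma> l))))
      = of_int (sign \<sigma>) * oprod 1 r (\<lambda>l. if \<sigma> l = i' then b l else xv l (\<sigma> l))" .
  qed
  finally show ?thesis .
qed

lemma cof_col_x:
  assumes "i \<in> {1..r}" "i' \<in> {1..r}"
  shows "(\<Sum>k=1..r. xv k i * cof r k i') = (if i = i' then Delta r else 0)"
proof -
  have "(\<Sum>k=1..r. xv k i * cof r k i') = sdet r (\<lambda>l i''. if i'' = i' then xv l i else xv l i'')"
    by (rule cof_col) (use assms homog_vars in auto)
  also have "\<dots> = (if i = i' then Delta r else 0)"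
  proof (cases "i = i'")
    case True
    then show ?thesis by (auto simp: Delta_def intro!: sdet_cong)
  next
    case False
    then show ?thesis by (auto intro!: sdet_equal_columns[of i r i'] simp: assms[simplified])
  qed
  finally show ?thesis .
qed

text \<open>Cramer's rule for the coordinates of the row \<open>\<eta>\<^sub>j\<close> with respect to the rows of \<open>x\<close>; the odd
  coordinates \<open>det X\<^sub>j({k})\<close> replace the rows \<open>\<eta>\<^sub>j\<close> in all computations.\<close>

lemma cramer:
  assumes i: "i \<in> {1..r}"
  shows "Delta r * etav j i = (\<Sum>k=1..r. detX r j {k} * xv k i)"
proof -
  have "(\<Sum>k=1..r. detX r j {k} * xv k i) = (\<Sum>k=1..r. \<Sum>i'=1..r. etav j i' * (xv k i * cof r k i'))"
  proof (rule sum.cong[OF refl])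
    fix k assume "k \<in> {1..r}"
    then show "detX r j {k} * xv k i = (\<Sum>i'=1..r. etav j i' * (xv k i * cof r k i'))"
      by (simp add: th_cof sum_distrib_right mult.assoc homog_central[OF homog_cof])
  qed
  also have "\<dots> = (\<Sum>i'=1..r. etav j i' * (\<Sum>k=1..r. xv k i * cof r k i'))"
    unfolding sum_distrib_left by (rule sum.swap)
  also have "\<dots> = (\<Sum>i'=1..r. if i' = i then etav j i * Delta r else 0)"
    by (rule sum.cong[OF refl]) (use i cof_col_x in auto)
  also have "\<dots> = Delta r * etav j i"
    using i by (simp add: homog_central[OF homog_Delta])
  finally show ?thesis ..
qed

lemma oprod_if_power: "oprod 1 r (\<lambda>k. if k \<in> I then 1 else d) = d ^ card ({1..r} - I)"
proof (induction r)
  case (Suc r)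
  have *: "{1..Suc r} - I = (if Suc r \<in> I then {1..r} - I else insert (Suc r) ({1..r} - I))"
    by (auto simp: le_Suc_eq)
  show ?case
    by (simp add: oprod_Suc Suc * power_Suc2 del: power_Suc)
qed simp

text \<open>Several equal odd rows do not make a determinant vanish. Expand all of them by Cramer's rule and use
  that the determinant is multiplicative: the permutations of \<open>I\<close> contribute equal terms, as the sign
  of reordering the odd factors cancels the sign of the permutation.\<close>

lemma detX_product:
  assumes I: "I \<subseteq> {1..r}"
  shows "Delta r ^ card I * detX r j I = smul (fact (card I)) (Delta r * oprod 1 r (\<lambda>k. if k \<in> I then detX r j {k} else 1))"
proof -
  let ?d = "Delta r" and ?t = "\<lambda>k. detX r j {k}"
  \<comment> \<open>the matrix that expresses \<open>det X\<close> times the rows of \<open>X\<^sub>j(I)\<close> by the rows of \<open>X\<close>\<close>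
  define C where "C l k = (if l \<in> I then ?t k else if k = l then ?d else 0)" for l k
  define h where "h k = (if k \<in> I then ?t k else ?d)" for k
  have fin: "finite I"
    using I finite_subset by blast
  have "?d ^ r * detX r j I = sdet r (\<lambda>l i. ?d * (if l \<in> I then etav j i else xv l i))"
    unfolding detX_def by (rule sdet_scale[symmetric]) (rule homog_Delta)
  also have "\<dots> = sdet r (\<lambda>l i. \<Sum>k=1..r. C l k * xv k i)"
  proof (rule sdet_cong)
    fix l i assume l: "l \<in> {1..r}" and i: "i \<in> {1..r}"
    show "?d * (if l \<in> I then etav j i else xv l i) = (\<Sum>k=1..r. C l k * xv k i)"
    proof (cases "l \<in> I")
      case True
      with i show ?thesis by (simp add: C_def cramer)
    next
      case False
      then have "(\<Sum>k=1..r. C l k * xv k i) = (\<Sum>k=1..r. if k = l then ?d * xv l i else 0)"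
        by (intro sum.cong refl) (auto simp: C_def)
      with False l show ?thesis by simp
    qed
  qed
  also have "\<dots> = sdet r C * ?d"
    unfolding Delta_def by (rule sdet_mult) (rule homog_vars)
  also have "sdet r C = (\<Sum>\<sigma> | \<sigma> permutes I. oprod 1 r h)"
  proof -
    have "sdet r C = (\<Sum>\<sigma> | \<sigma> permutes I. of_int (sign \<sigma>) * oprod 1 r (\<lambda>l. C l (\<sigma> l)))"
      unfolding sdet_def
    proof (rule sum.mono_neutral_right)
      show "{\<sigma>. \<sigma> permutes I} \<subseteq> {\<sigma>. \<sigma> permutes {1..r}}"
        using I permutes_subset by blast
      show "\<forall>\<sigma>\<in>{\<sigma>. \<sigma> permutes {1..r}} - {\<sigma>. \<sigma> permutes I}. of_int (sign \<sigma>) * oprod 1 r (\<lambda>l. C l (\<sigma> l)) = 0"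
      proof
        fix \<sigma> assume \<sigma>: "\<sigma> \<in> {\<sigma>. \<sigma> permutes {1..r}} - {\<sigma>. \<sigma> permutes I}"
        then obtain l where l: "l \<notin> I" "\<sigma> l \<noteq> l"
          using permutes_superset[of \<sigma> "{1..r}" I] by auto
        then have "l \<in> {1..r}"
          using \<sigma> permutes_not_in[of \<sigma> "{1..r}" l] by auto
        then have "oprod 1 r (\<lambda>l. C l (\<sigma> l)) = 0"
          by (intro oprod_zero[of 1 l]) (use l in \<open>auto simp: C_def\<close>)
        then show "of_int (sign \<sigma>) * oprod 1 r (\<lambda>l. C l (\<sigma> l)) = 0" by simp
      qed
    qed (simp add: finite_permutations)
    also have "\<dots> = (\<Sum>\<sigma> | \<sigma> permutes I. oprod 1 r h)"
    proof (rule sum.cong[OF refl], clarify)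
      fix \<sigma> assume \<sigma>: "\<sigma> permutes I"
      have "oprod 1 r (\<lambda>l. C l (\<sigma> l)) = oprod 1 r (\<lambda>l. h (\<sigma> l))"
      proof (rule oprod_cong)
        fix l show "C l (\<sigma> l) = h (\<sigma> l)"
          using permutes_in_image[OF \<sigma>, of l] permutes_not_in[OF \<sigma>, of l] by (auto simp: C_def h_def)
      qed
      also have "\<dots> = smul (of_int (sign \<sigma>)) (oprod 1 r h)"
      proof -
        have "homog True (h i)" if "i \<in> I" for i
          using that I homog_th[of i r j] by (auto simp: h_def)
        then show ?thesis
          using oprod_permute[OF \<sigma> I, of True h] by simp
      qed
      finally show "of_int (sign \<sigma>) * oprod 1 r (\<lambda>l. C l (\<sigma> l)) = oprod 1 r h"
        by (simp add: of_int_spoly flip: of_int_mult)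
    qed
    finally show ?thesis .
  qed
  also have "(\<Sum>\<sigma> | \<sigma> permutes I. oprod 1 r h) = smul (fact (card I)) (oprod 1 r h)"
    by (simp add: card_permutations[OF refl fin] of_nat_spoly)
  also have "oprod 1 r h = ?d ^ (r - card I) * oprod 1 r (\<lambda>k. if k \<in> I then ?t k else 1)"
  proof -
    have "oprod 1 r h = oprod 1 r (\<lambda>k. (if k \<in> I then ?t k else 1) * (if k \<in> I then 1 else ?d))"
      by (rule oprod_cong) (auto simp: h_def)
    also have "\<dots> = oprod 1 r (\<lambda>k. if k \<in> I then ?t k else 1) * oprod 1 r (\<lambda>k. if k \<in> I then 1 else ?d)"
      by (rule oprod_central_mult) (auto simp: homog_Delta)
    also have "oprod 1 r (\<lambda>k. if k \<in> I then 1 else ?d) = ?d ^ (r - card I)"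
      unfolding oprod_if_power using I fin by (simp add: card_Diff_subset)
    finally show ?thesis
      by (simp add: homog_central[OF homog_power[OF homog_Delta]])
  qed
  finally have *: "?d ^ r * detX r j I = smul (fact (card I)) (?d ^ (r - card I) * oprod 1 r (\<lambda>k. if k \<in> I then ?t k else 1)) * ?d" .
  have "card I \<le> r"
    using card_mono[OF _ I] by simp
  then have "?d ^ r = ?d ^ (r - card I) * ?d ^ card I"
    by (simp flip: power_add)
  with * have "?d ^ (r - card I) * (?d ^ card I * detX r j I) = ?d ^ (r - card I) * smul (fact (card I)) (oprod 1 r (\<lambda>k. if k \<in> I then ?t k else 1) * ?d)"
    by (simp add: mult.assoc)
  then have "?d ^ card I * detX r j I = smul (fact (card I)) (oprod 1 r (\<lambda>k. if k \<in> I then ?t k else 1) * ?d)"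
    by (rule nzd_cancel[OF nzd_power[OF nzd_Delta]])
  then show ?thesis
    by (simp add: homog_central[OF homog_Delta])
qed

lemma Delta2_product:
  "Delta r ^ (r - m) * Delta2 m j r = smul (fact (r - m)) (Delta r * oprod 1 r (\<lambda>k. if m < k then detX r j {k} else 1))"
proof -
  have "oprod 1 r (\<lambda>k. if k \<in> {m+1..r} then detX r j {k} else 1) = oprod 1 r (\<lambda>k. if m < k then detX r j {k} else 1)"
    by (rule oprod_cong) auto
  moreover have "{m+1..r} \<subseteq> {1..r}"
    by auto
  ultimately show ?thesis
    using detX_product[of "{m+1..r}" r j] by (simp add: Delta2_detX)
qed

subsection \<open>Annihilation between the determinants\<close>

text \<open>The even and the odd part of \<open>B\<close> pass \<open>z\<close> with opposite signs.\<close>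

lemma odd_right: "homog True z \<Longrightarrow> B * z = z * iota B"
  using homog_supercommute[of True z "iota B"] by (simp add: iot_True)

lemma oprod_times_factor:
  assumes "1 \<le> l" "l \<le> r" "homog True (f l)"
  shows "oprod 1 r f * f l = 0"
proof -
  have "oprod 1 r f * f l = oprod 1 (l - 1) f * f l * (oprod (Suc l) r f * f l)"
    using oprod_split[of 1 l r f] assms by (simp add: mult.assoc)
  also have "\<dots> = oprod 1 (l - 1) f * (f l * f l) * iota (oprod (Suc l) r f)"
    using odd_right[OF assms(3), of "oprod (Suc l) r f"] by (simp add: mult.assoc)
  finally show ?thesis
    using homog_square[OF assms(3)] by simp
qed

text \<open>The factor already occurs in the product for \<^const>\<open>Delta2\<close>, and its square is 0.\<close>

lemma Delta2_th_same:
  assumes "m < l" "l \<le> r"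
  shows "Delta2 m j r * detX r j {l} = 0"
proof -
  have "Delta r ^ (r - m) * (Delta2 m j r * detX r j {l}) = 0"
    using oprod_times_factor[of l r "\<lambda>k. if m < k then detX r j {k} else 1"] assms homog_th[of l r j]
    by (simp add: Delta2_product mult.assoc flip: mult.assoc[of "Delta r ^ (r - m)"])
  then show ?thesis
    using nzd_power[OF nzd_Delta] by (auto simp: nzd_def)
qed

text \<open>The same for a smaller determinant: up to the factor \<open>\<Delta>\<close>, its row \<open>\<eta>\<^sub>j\<close> is a combination of
  the rows \<open>x\<^sub>k\<close>, \<open>k \<le> r1\<close>, with odd coefficients; those with \<open>k > m\<close> are killed by the large determinant, and the
  others give two equal rows.\<close>

lemma Delta2_th:
  assumes "m < l" "l \<le> r2" "r2 \<le> r1"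
  shows "Delta2 m j r1 * detX r2 j {l} = 0"
proof -
  have l: "l \<in> {1..r2}"
    using assms by auto
  have "Delta r1 * detX r2 j {l} = sdet r2 (xv(l := \<lambda>i. \<Sum>k\<in>{1..r1}. detX r1 j {k} * xv k i))"
  proof -
    have "Delta r1 * detX r2 j {l} = Delta r1 * sdet r2 (xv(l := \<lambda>i. \<Sum>t\<in>{()}. 1 * etav j i))"
      by (auto simp: detX_def intro!: arg_cong[of _ _ "(*) _"] sdet_cong)
    also have "\<dots> = (\<Sum>t\<in>{()}. Delta r1 * sdet r2 (xv(l := \<lambda>i. etav j i)))"
      by simp
    also have "\<dots> = sdet r2 (xv(l := \<lambda>i. \<Sum>t\<in>{()}. Delta r1 * etav j i))"
      by (rule sdet_row_sum[symmetric]) (use l homog_vars in auto)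
    also have "\<dots> = sdet r2 (xv(l := \<lambda>i. \<Sum>k\<in>{1..r1}. detX r1 j {k} * xv k i))"
      by (rule sdet_cong) (use assms in \<open>auto simp: cramer\<close>)
    finally show ?thesis .
  qed
  also have "\<dots> = (\<Sum>k\<in>{1..r1}. detX r1 j {k} * sdet r2 (xv(l := xv k)))"
    by (rule sdet_row_sum) (use l homog_vars in auto)
  finally have "Delta r1 * (Delta2 m j r1 * detX r2 j {l}) = (\<Sum>k\<in>{1..r1}. Delta2 m j r1 * detX r1 j {k} * sdet r2 (xv(l := xv k)))"
    by (simp add: sum_distrib_left mult.assoc homog_central[OF homog_Delta, of r1 "Delta2 m j r1"] flip: mult.assoc[of "Delta r1"])
  also have "\<dots> = 0"
  proof (rule sum.neutral, rule ballI)
    fix k assume k: "k \<in> {1..r1}"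
    show "Delta2 m j r1 * detX r1 j {k} * sdet r2 (xv(l := xv k)) = 0"
    proof (cases "m < k")
      case True
      with k show ?thesis by (simp add: Delta2_th_same)
    next
      case False
      then have "sdet r2 (xv(l := xv k)) = 0"
        by (intro sdet_equal_rows[of k r2 l]) (use k assms homog_vars in auto)
      then show ?thesis by simp
    qed
  qed
  finally show ?thesis
    using nzd_Delta by (auto simp: nzd_def)
qed

lemma sder_central_mult:
  "sder \<epsilon> D \<Longrightarrow> homog False z \<Longrightarrow> D z = 0 \<Longrightarrow> D (z * f) = z * D f"
  by (cases \<epsilon>) (auto simp: sder_mult homog_False iot_True)

lemma sder_power_0: "sder \<epsilon> D \<Longrightarrow> D z = 0 \<Longrightarrow> D (z ^ n) = 0"
  by (induction n) (auto simp: sder_1 sder_mult)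

lemma sder_th:
  assumes D: "sder \<epsilon> D" "\<And>l i. D (xv l i) = 0" and k: "k \<in> {1..r}"
  shows "D (detX r j {k}) = sdet r (xv(k := \<lambda>i. D (etav j i)))"
proof -
  let ?a = "\<lambda>l i. if l \<in> {k} then etav j i else xv l i"
  have "D (detX r j {k}) = (\<Sum>h=1..r. sdet r (?a(h := \<lambda>i. D (?a h i))))"
    unfolding detX_def
  proof (rule sder_sdet[OF D(1)])
    fix l l' i i' assume "l' < l" "D (?a l i) \<noteq> 0"
    then have "l = k" using D(2) by (auto split: if_splits)
    with \<open>l' < l\<close> have "?a l' i' = xv l' i'" by auto
    then show "iot \<epsilon> (?a l' i') = ?a l' i'"
      using homog_vars(1)[of l' i'] by (simp add: iot_def homog_False)
  qed
  also have "\<dots> = (\<Sum>h=1..r. if h = k then sdet r (xv(k := \<lambda>i. D (etav j i))) else 0)"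
  proof (rule sum.cong[OF refl])
    fix h assume h: "h \<in> {1..r}"
    show "sdet r (?a(h := \<lambda>i. D (?a h i))) = (if h = k then sdet r (xv(k := \<lambda>i. D (etav j i))) else 0)"
    proof (cases "h = k")
      case True
      then show ?thesis by (auto intro!: sdet_cong)
    next
      case False
      with h show ?thesis by (auto intro!: sdet_zero_row[of h] simp: D(2))
    qed
  qed
  finally show ?thesis
    using k by simp
qed

lemma sder_Delta_0: "sder \<epsilon> D \<Longrightarrow> (\<And>l i. l \<in> {1..r} \<Longrightarrow> i \<in> {1..r} \<Longrightarrow> D (xv l i) = 0) \<Longrightarrow> D (Delta r) = 0"
  unfolding Delta_def by (rule sder_sdet_0)

lemma sder_Delta2_0:
  assumes D: "sder \<epsilon> D" and d: "D (Delta r) = 0" and t: "\<And>k. m < k \<Longrightarrow> k \<le> r \<Longrightarrow> D (detX r j {k}) = 0"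
  shows "D (Delta2 m j r) = 0"
proof -
  let ?h = "\<lambda>k. if m < k then detX r j {k} else 1"
  have "D (oprod 1 r ?h) = (\<Sum>k=1..r. oprod 1 r (?h(k := D (?h k))))"
    by (rule sder_oprod[OF D]) (use t sder_1[OF D] in auto)
  also have "\<dots> = 0"
    by (rule sum.neutral) (use t sder_1[OF D] in \<open>auto simp: oprod_upd\<close>)
  finally have "D (Delta r * oprod 1 r ?h) = 0"
    by (simp add: sder_mult[OF D] d)
  then have "D (Delta r ^ (r - m) * Delta2 m j r) = 0"
    by (simp add: Delta2_product sder_smul[OF D])
  then have "Delta r ^ (r - m) * D (Delta2 m j r) = 0"
    by (simp add: sder_central_mult[OF D homog_power[OF homog_Delta] sder_power_0[OF D d]])
  then show ?thesis
    using nzd_power[OF nzd_Delta] by (auto simp: nzd_def)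
qed

text \<open>For a derivation that turns \<open>\<eta>\<^sub>j\<close> into another row of odd variables, every term of the derivative
  contains an odd determinant with that row, which the larger determinant kills.\<close>

lemma Delta2_sder:
  assumes D: "sder False D" and d: "D (Delta r2) = 0" and r: "r2 \<le> r1"
    and t: "\<And>k. m < k \<Longrightarrow> k \<le> r2 \<Longrightarrow> D (detX r2 j {k}) = detX r2 j' {k}"
  shows "Delta2 m j' r1 * D (Delta2 m j r2) = 0"
proof -
  let ?h = "\<lambda>k. if m < k then detX r2 j {k} else 1"
  let ?O = "Delta2 m j' r1"
  have "?O * D (oprod 1 r2 ?h) = (\<Sum>k=1..r2. ?O * oprod 1 r2 (?h(k := D (?h k))))"
    by (simp only: sder_even_oprod[OF D] sum_distrib_left)
  also have "\<dots> = 0"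
  proof (rule sum.neutral, rule ballI)
    fix k assume k: "k \<in> {1..r2}"
    show "?O * oprod 1 r2 (?h(k := D (?h k))) = 0"
    proof (cases "m < k")
      case True
      let ?A = "oprod 1 (k - 1) ?h"
      have "?O * (?A * detX r2 j' {k}) = 0"
      proof -
        have "?A * detX r2 j' {k} = detX r2 j' {k} * iota ?A"
          by (rule odd_right, rule homog_th) (use k in simp)
        then have "?O * (?A * detX r2 j' {k}) = ?O * detX r2 j' {k} * iota ?A"
          by (simp only: mult.assoc)
        also have "?O * detX r2 j' {k} = 0"
          by (rule Delta2_th) (use k True r in auto)
        finally show ?thesis by simp
      qed
      then have "?O * (?A * detX r2 j' {k} * B) = 0" for B
        by (simp flip: mult.assoc)
      with k True t show ?thesis
        by (simp add: oprod_upd)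
    next
      case False
      with k show ?thesis by (simp add: oprod_upd sder_1[OF D])
    qed
  qed
  finally have *: "?O * D (Delta r2 * oprod 1 r2 ?h) = 0"
    unfolding sder_central_mult[OF D homog_Delta d]
    by (metis homog_central[OF homog_Delta] mult.assoc mult_zero_right)
  have "D (Delta r2 ^ (r2 - m) * Delta2 m j r2) = smul (fact (r2 - m)) (D (Delta r2 * oprod 1 r2 ?h))"
    by (simp add: Delta2_product sder_smul[OF D])
  then have "Delta r2 ^ (r2 - m) * D (Delta2 m j r2) = smul (fact (r2 - m)) (D (Delta r2 * oprod 1 r2 ?h))"
    by (simp add: sder_central_mult[OF D homog_power[OF homog_Delta] sder_power_0[OF D d]])
  then have "?O * (Delta r2 ^ (r2 - m) * D (Delta2 m j r2)) = 0"
    using * by simp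
  then have "Delta r2 ^ (r2 - m) * (?O * D (Delta2 m j r2)) = 0"
    using homog_central[OF homog_power[OF homog_Delta], of r2 "r2 - m" ?O] by (simp flip: mult.assoc)
  then show ?thesis
    using nzd_power[OF nzd_Delta] by (auto simp: nzd_def)
qed

section \<open>The polynomials \<open>\<Gamma>\<close>\<close>

subsection \<open>Signs of reordered products\<close>

lemma odd_prod_list_insert:
  assumes "\<And>x. x \<in> set xs \<Longrightarrow> homog True (t x)" "homog True z"
  shows "prod_list (map t xs) * z = of_int ((-1) ^ length xs) * (z * prod_list (map t xs))"
  using assms(1)
proof (induction xs)
  case (Cons x xs)
  have "t x * prod_list (map t xs) * z = of_int ((-1) ^ length xs) * (t x * z) * prod_list (map t xs)"
    using Cons by (simp add: mult.assoc of_int_spoly)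
  also have "t x * z = - (z * t x)"
    using Cons assms(2) by (intro homog_anticommute) auto
  finally show ?case
    by (simp add: mult.assoc of_int_spoly)
qed simp

text \<open>The sign depends only on the two orders, not on the odd elements that are reordered; so it can be
  determined on the indeterminates \<open>a\<^sub>i\<^sup>k\<^sup>c\<close> and used for determinants.\<close>

lemma prod_list_reorder:
  assumes "distinct xs" "distinct ys" "set xs = set ys"
  obtains e :: int where "e = 1 \<or> e = -1"
    "\<And>t. (\<And>x. x \<in> set xs \<Longrightarrow> homog True (t x)) \<Longrightarrow> prod_list (map t xs) = of_int e * prod_list (map t ys)"
proof -
  have "\<exists>e::int. (e = 1 \<or> e = -1) \<and> (\<forall>t. (\<forall>x\<in>set xs. homog True (t x)) \<longrightarrow> prod_list (map t xs) = of_int e * prod_list (map t ys))"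
    using assms
  proof (induction xs arbitrary: ys)
    case (Cons x xs)
    then obtain as bs where ys: "ys = as @ x # bs"
      by (metis list.set_intros(1) split_list)
    with Cons have "distinct (as @ bs)" "x \<notin> set xs" "x \<notin> set (as @ bs)" "insert x (set xs) = insert x (set (as @ bs))"
      by auto
    then have sx: "set xs = set (as @ bs)"
      by (simp add: insert_ident)
    with Cons \<open>distinct (as @ bs)\<close> obtain e :: int where e: "e = 1 \<or> e = -1" and
      h: "\<And>t. \<forall>x\<in>set xs. homog True (t x) \<Longrightarrow> prod_list (map t xs) = of_int e * prod_list (map t (as @ bs))"
      by (metis distinct.simps(2))
    have "prod_list (map t (x # xs)) = of_int (e * (-1) ^ length as) * prod_list (map t ys)"
      if t: "\<forall>x\<in>set (x # xs). homog True (t x)" for t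
    proof -
      have "prod_list (map t as) * t x = of_int ((-1) ^ length as) * (t x * prod_list (map t as))"
        by (rule odd_prod_list_insert) (use t sx in auto)
      then have 1: "of_int ((-1) ^ length as) * (prod_list (map t as) * t x) = t x * prod_list (map t as)"
        by (simp add: of_int_spoly flip: power_mult_distrib)
      have "prod_list (map t (x # xs)) = of_int e * (t x * prod_list (map t as) * prod_list (map t bs))"
        using h[of t] t by (simp add: of_int_spoly mult.assoc)
      also have "\<dots> = of_int (e * (-1) ^ length as) * prod_list (map t ys)"
        unfolding 1[symmetric] ys by (simp add: of_int_spoly mult.assoc)
      finally show ?thesis .
    qed
    moreover have "e * (-1) ^ length as = 1 \<or> e * (-1) ^ length as = -1"
      using e by (cases "even (length as)") auto
    ultimately show ?case
      by blast
  next
    case Nil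
    then show ?case
      by (intro exI[of _ 1]) simp
  qed
  then obtain e :: int where "e = 1 \<or> e = -1" and e: "\<forall>t. (\<forall>x\<in>set xs. homog True (t x)) \<longrightarrow> prod_list (map t xs) = of_int e * prod_list (map t ys)"
    by blast
  then show ?thesis
    by (intro that[of e]) simp_all
qed

lemma prod_list_repeated:
  assumes "distinct xs" "x \<in> set xs" "y \<in> set xs" "x \<noteq> y" "t x = t y" "homog True (t x)"
  shows "prod_list (map t xs) = 0"
proof -
  have *: "prod_list (map t xs) = 0" if xs: "xs = as @ u # bs" and v: "v \<in> set bs" and uv: "t u = t v" and u: "homog True (t u)" for u v as bs
  proof -
    obtain cs ds where bs: "bs = cs @ v # ds"
      using v by (meson split_list)
    have "t u * (prod_list (map t cs) * t u) = t u * t u * iota (prod_list (map t cs))"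
      using odd_right[OF u, of "prod_list (map t cs)"] by (simp add: mult.assoc)
    then have "t u * (prod_list (map t cs) * t u) * z = 0" for z
      using homog_square[OF u] by simp
    then show ?thesis
      by (simp add: xs bs mult.assoc flip: uv)
  qed
  obtain as bs where xs: "xs = as @ x # bs"
    using assms(2) by (meson split_list)
  show ?thesis
  proof (cases "y \<in> set bs")
    case True
    with xs assms show ?thesis by (intro *[of as x bs y]) auto
  next
    case False
    then have "y \<in> set as"
      using assms xs by auto
    then obtain cs ds where "as = cs @ y # ds"
      by (meson split_list)
    with xs assms show ?thesis by (intro *[of cs y "ds @ x # bs" x]) auto
  qed
qed

text \<open>Products of distinct odd variables are nonzero multiples of monomials; this makes the sign of a
  reordering unique.\<close>

lemma prod_list_gens:
  assumes "distinct us"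
  shows "\<exists>e. e \<noteq> 0 \<and> prod_list (map (\<lambda>u. gen (Inr u)) us) = smul e (smonom 0 (fset_of_list us))"
  using assms
proof (induction us)
  case Nil
  then show ?case by (auto simp: one_smonom intro: exI[of _ 1])
next
  case (Cons u us)
  then obtain e where e: "e \<noteq> 0" "prod_list (map (\<lambda>u. gen (Inr u)) us) = smul e (smonom 0 (fset_of_list us))"
    by auto
  have "u |\<notin>| fset_of_list us"
    using Cons by (simp add: fset_of_list_elem)
  then have "prod_list (map (\<lambda>u. gen (Inr u)) (u # us)) = smul (e * osign u (fset_of_list us)) (smonom 0 (fset_of_list (u # us)))"
    by (simp add: e gen_Inr_smonom)
  moreover have "osign u (fset_of_list us) \<noteq> 0"
    by (simp add: osign_def)
  ultimately show ?case
    using e(1) by (intro exI[of _ "e * osign u (fset_of_list us)"]) auto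
qed

lemma smonom_neq_0: "smonom a A \<noteq> 0"
  by (metis coeff_simps(1) coeff_smonom zero_neq_one)

lemma prod_list_gens_neq_0: "distinct us \<Longrightarrow> prod_list (map (\<lambda>u. gen (Inr u)) us) \<noteq> 0"
  using prod_list_gens[of us] by (auto simp: smonom_neq_0)

lemma prod_list_product:
  "prod_list (map g (List.product xs ys)) = prod_list (map (\<lambda>x. prod_list (map (\<lambda>y. g (x, y)) ys)) xs)"
  by (induction xs) (auto simp: comp_def)

lemma prod_list_filter: "prod_list (map t (filter P xs)) = prod_list (map (\<lambda>x. if P x then t x else 1) xs)"
  by (induction xs) auto

text \<open>The two orders in which the marks are multiplied in the definition of \<open>\<epsilon>\<^sub>D\<close>: lexicographic for
  \<open>(i, c, k)\<close>, and for \<open>(c, k, i)\<close> below.\<close>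

definition lex1 :: "nat \<Rightarrow> nat \<Rightarrow> nat \<Rightarrow> (nat \<times> nat \<times> nat) set \<Rightarrow> (nat \<times> nat \<times> nat) list" where
  "lex1 s u m D = filter (\<lambda>x. x \<in> D) (List.product [1..<Suc s] (List.product [1..<Suc u] [1..<Suc m]))"

definition lex2 :: "nat \<Rightarrow> nat \<Rightarrow> nat \<Rightarrow> (nat \<times> nat \<times> nat) set \<Rightarrow> (nat \<times> nat \<times> nat) list" where
  "lex2 s u m D = filter (\<lambda>x. x \<in> D) (map (\<lambda>(c, k, i). (i, c, k)) (List.product [1..<Suc u] (List.product [1..<Suc m] [1..<Suc s])))"

lemma prod_lex1:
  "oprod 1 s (\<lambda>i. oprod 1 u (\<lambda>c. oprod 1 m (\<lambda>k. if (i, c, k) \<in> D then t (i, c, k) else 1))) = prod_list (map t (lex1 s u m D))"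
  unfolding lex1_def prod_list_filter prod_list_product oprod_def by (simp add: comp_def del: upt_Suc)

lemma prod_lex2:
  "oprod 1 u (\<lambda>c. oprod 1 m (\<lambda>k. oprod 1 s (\<lambda>i. if (i, c, k) \<in> D then t (i, c, k) else 1))) = prod_list (map t (lex2 s u m D))"
  unfolding lex2_def prod_list_filter map_map prod_list_product oprod_def by (simp add: comp_def del: upt_Suc cong: if_cong)

lemma lex_distinct: "distinct (lex1 s u m D)" "distinct (lex2 s u m D)"
  unfolding lex1_def lex2_def by (auto simp: distinct_product distinct_map inj_on_def intro!: distinct_filter simp del: upt_Suc)

lemma lex_set:
  assumes "D \<subseteq> {(i, c, k). i \<in> {1..s} \<and> c \<in> {1..u} \<and> k \<in> {1..m}}"
  shows "set (lex1 s u m D) = D" "set (lex2 s u m D) = D"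
proof -
  show "set (lex1 s u m D) = D"
    unfolding lex1_def using assms by (auto simp: atLeastLessThanSuc_atLeastAtMost simp del: upt_Suc)
  show "set (lex2 s u m D) = D"
  proof (intro subset_antisym subsetI)
    fix x assume "x \<in> D"
    moreover obtain i c k where "x = (i, c, k)"
      by (cases x)
    ultimately show "x \<in> set (lex2 s u m D)"
      unfolding lex2_def using assms
      by (auto simp: atLeastLessThanSuc_atLeastAtMost simp del: upt_Suc intro!: image_eqI[of _ _ "(c, k, i)"])
  qed (simp add: lex2_def)
qed

text \<open>The sign \<open>\<epsilon>\<^sub>D\<close>, defined on the marks, applies to any family of odd elements indexed by the marked
  boxes.\<close>

lemma eps_D_reorder:
  assumes D: "D \<subseteq> {(i, c, k). i \<in> {1..s} \<and> c \<in> {1..\<mu> 1} \<and> k \<in> {1..m}}"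
    and t: "\<And>x. x \<in> D \<Longrightarrow> homog True (t x)"
  shows "oprod 1 s (\<lambda>i. oprod 1 (\<mu> 1) (\<lambda>c. oprod 1 m (\<lambda>k. if (i, c, k) \<in> D then t (i, c, k) else 1))) =
    of_int (eps_D m s \<mu> D) * oprod 1 (\<mu> 1) (\<lambda>c. oprod 1 m (\<lambda>k. oprod 1 s (\<lambda>i. if (i, c, k) \<in> D then t (i, c, k) else 1)))"
proof -
  let ?xs = "lex1 s (\<mu> 1) m D" and ?ys = "lex2 s (\<mu> 1) m D"
  note set = lex_set[OF D]
  obtain e :: int where e: "\<And>t. (\<And>x. x \<in> set ?xs \<Longrightarrow> homog True (t x)) \<Longrightarrow> prod_list (map t ?xs) = of_int e * prod_list (map t ?ys)"
    using prod_list_reorder[OF lex_distinct] set by metis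
  define g where "g = (\<lambda>(i, c, k). gen (Inr (Mark i k c)))"
  have g: "homog True (g x)" for x
    using homog_gen[of "Inr (Mark (fst x) (snd (snd x)) (fst (snd x)))"] by (simp add: g_def gpar_def case_prod_beta)
  have mark: "mark D i c k = (if (i, c, k) \<in> D then g (i, c, k) else 1)" for i c k
    by (simp add: mark_def g_def)
  have "prod_list (map g ?ys) = prod_list (map (\<lambda>u. gen (Inr u)) (map (\<lambda>(i, c, k). Mark i k c) ?ys))"
    by (simp add: g_def comp_def case_prod_unfold)
  moreover have "distinct (map (\<lambda>(i, c, k). Mark i k c) ?ys)"
    using lex_distinct by (auto simp: distinct_map inj_on_def)
  ultimately have nz: "prod_list (map g ?ys) \<noteq> 0"
    using prod_list_gens_neq_0 by metis
  have "eps_D m s \<mu> D = e"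
    unfolding eps_D_def mark prod_lex1 prod_lex2
  proof (rule the_equality)
    show "prod_list (map g ?xs) = of_int e * prod_list (map g ?ys)"
      by (rule e) (rule g)
    fix e' assume "prod_list (map g ?xs) = of_int e' * prod_list (map g ?ys)"
    then have "of_int e' * prod_list (map g ?ys) = of_int e * prod_list (map g ?ys)"
      using e[of g] g by metis
    with nz show "e' = e"
      by (simp add: of_int_spoly)
  qed
  then show ?thesis
    unfolding prod_lex1 prod_lex2 using e[of t] t set by simp
qed

lemma oprod_single: "oprod 1 m (\<lambda>k. if k = k0 then x else 1) = (if k0 \<in> {1..m} then x else 1)"
  by (induction m) (auto simp: oprod_Suc)

subsection \<open>Expansion of the determinants of the changed variables\<close>

text \<open>This is \<open>det X\<close> times the result of the even change of variables that adds to \<open>y\<^sub>c\<^sup>j\<close> the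
  combination of \<open>\<xi>\<^sub>1\<^sup>j, \<dots>, \<xi>\<^sub>m\<^sup>j\<close> given by the coordinates of \<open>\<eta>\<^sub>c\<close> with respect to the rows of
  \<open>X\<close>.\<close>

definition yhat :: "nat \<Rightarrow> nat \<Rightarrow> nat \<Rightarrow> nat \<Rightarrow> spoly" where
  "yhat p m c j = Delta p * yv c j + (\<Sum>k=1..m. detX p c {k} * xiv k j)"

text \<open>The index 0 stands for the variable \<open>y\<close>, the index \<open>k\<close> for \<open>\<xi>\<^sub>k\<close>.\<close>

definition coef :: "nat \<Rightarrow> nat \<Rightarrow> nat \<Rightarrow> spoly" where
  "coef p c k = (if k = 0 then Delta p else detX p c {k})"

definition vrow :: "nat \<Rightarrow> nat \<Rightarrow> nat \<Rightarrow> spoly" where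
  "vrow c k j = (if k = 0 then yv c j else xiv k j)"

lemma yhat_sum: "yhat p m c j = (\<Sum>k\<in>{0..m}. coef p c k * vrow c k j)"
  unfolding yhat_def by (subst sum.atLeast_Suc_atMost) (auto simp: coef_def vrow_def intro!: sum.cong)

lemma homog_coef: "k \<le> p \<Longrightarrow> homog (k \<noteq> 0) (coef p c k)"
  by (auto simp: coef_def homog_Delta homog_th)

lemma homog_vrow: "homog (k \<noteq> 0) (vrow c k j)"
  by (simp add: vrow_def homog_vars)

lemma homog_yhat: "m \<le> p \<Longrightarrow> homog False (yhat p m c j)"
  unfolding yhat_sum
proof (rule homog_sum)
  fix k assume "m \<le> p" "k \<in> {0..m}"
  then show "homog False (coef p c k * vrow c k j)"
    using homog_mult[OF homog_coef[of k p c] homog_vrow[of k c j]] by simp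
qed

lemma choose_two_add: "(a + b) choose 2 = (a choose 2) + (b choose 2) + a * b"
  by (induction b) (auto simp: numeral_2_eq_2)

lemma homog_swap: "homog \<epsilon> x \<Longrightarrow> homog \<delta> y \<Longrightarrow> x * y = smul (ksign \<epsilon> \<delta>) (y * x)"
  using homog_supercommute[of \<epsilon> x y] by (cases \<epsilon>; cases \<delta>) (auto simp: iot_True homog_def)

text \<open>Collecting the first factors: moving \<open>A j\<close> past \<open>B i\<close> for all \<open>i < j\<close> costs a sign for each pair of
  odd factors, and binomial coefficients count pairs both inside and between the groups.\<close>

lemma oprod_pairs:
  assumes A: "\<And>i. 1 \<le> i \<Longrightarrow> i \<le> s \<Longrightarrow> homog (odd (n i)) (A i)" and B: "\<And>i. 1 \<le> i \<Longrightarrow> i \<le> s \<Longrightarrow> homog (odd (n i)) (B i)"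
    and f: "\<And>i. 1 \<le> i \<Longrightarrow> i \<le> s \<Longrightarrow> f i = smul ((-1) ^ (n i choose 2)) (A i * B i)"
  shows "oprod 1 s f = smul ((-1) ^ ((\<Sum>i=1..s. n i) choose 2)) (oprod 1 s A * oprod 1 s B)"
  using assms
proof (induction s)
  case 0
  then show ?case by (simp add: binomial_eq_0)
next
  case (Suc s)
  let ?N = "\<Sum>i=1..s. n i" and ?n = "n (Suc s)"
  have IH: "oprod 1 s f = smul ((-1) ^ (?N choose 2)) (oprod 1 s A * oprod 1 s B)"
    by (rule Suc.IH) (use Suc.prems in auto)
  have "homog (odd ?N) (oprod 1 s B)"
    by (rule homog_oprod) (use Suc.prems in auto)
  then have c: "oprod 1 s B * A (Suc s) = smul ((-1) ^ (?N * ?n)) (A (Suc s) * oprod 1 s B)"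
    using homog_swap[of "odd ?N" "oprod 1 s B" "odd ?n" "A (Suc s)"] Suc.prems(1)[of "Suc s"] by (auto simp: ksign_def)
  have "oprod 1 (Suc s) f = smul ((-1) ^ (?N choose 2) * (-1) ^ (?n choose 2)) (oprod 1 s A * (oprod 1 s B * A (Suc s)) * B (Suc s))"
    using Suc.prems(3)[of "Suc s"] by (simp add: oprod_Suc IH mult.assoc)
  also have "\<dots> = smul ((-1) ^ ((?N + ?n) choose 2)) (oprod 1 (Suc s) A * oprod 1 (Suc s) B)"
    unfolding c by (simp add: oprod_Suc mult.assoc choose_two_add power_add)
  finally show ?case by simp
qed

definition ncol :: "nat \<Rightarrow> (nat \<Rightarrow> nat) \<Rightarrow> nat" where
  "ncol u \<kappa> = (\<Sum>c=1..u. if \<kappa> c = 0 then 0 else 1)"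

lemma sdet_yhat:
  assumes "m \<le> p"
  shows "sdet u (yhat p m) = (\<Sum>\<kappa>\<in>{1..u} \<rightarrow>\<^sub>E {0..m}. smul ((-1) ^ (ncol u \<kappa> choose 2)) (oprod 1 u (\<lambda>c. coef p c (\<kappa> c)) * sdet u (\<lambda>c. vrow c (\<kappa> c))))"
proof -
  let ?P = "{\<sigma>. \<sigma> permutes {1..u}}" and ?K = "{1..u} \<rightarrow>\<^sub>E {0..m}"
  have "sdet u (yhat p m) = (\<Sum>\<sigma>\<in>?P. \<Sum>\<kappa>\<in>?K. of_int (sign \<sigma>) * oprod 1 u (\<lambda>c. coef p c (\<kappa> c) * vrow c (\<kappa> c) (\<sigma> c)))"
    unfolding sdet_def yhat_sum oprod_sum_PiE sum_distrib_left ..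
  also have "\<dots> = (\<Sum>\<sigma>\<in>?P. \<Sum>\<kappa>\<in>?K. smul ((-1) ^ (ncol u \<kappa> choose 2)) (oprod 1 u (\<lambda>c. coef p c (\<kappa> c)) * (of_int (sign \<sigma>) * oprod 1 u (\<lambda>c. vrow c (\<kappa> c) (\<sigma> c)))))"
  proof (intro sum.cong refl)
    fix \<sigma> \<kappa> assume \<kappa>: "\<kappa> \<in> ?K"
    have h: "homog (\<kappa> c \<noteq> 0) (coef p c (\<kappa> c))" if "1 \<le> c" "c \<le> u" for c
      using \<kappa> that assms by (intro homog_coef) (fastforce dest: PiE_mem)
    have "oprod 1 u (\<lambda>c. coef p c (\<kappa> c) * vrow c (\<kappa> c) (\<sigma> c)) = smul ((-1) ^ (ncol u \<kappa> choose 2)) (oprod 1 u (\<lambda>c. coef p c (\<kappa> c)) * oprod 1 u (\<lambda>c. vrow c (\<kappa> c) (\<sigma> c)))"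
      unfolding ncol_def
    proof (rule oprod_pairs)
      fix c assume c: "1 \<le> c" "c \<le> u"
      have odd_if: "odd (if \<kappa> c = 0 then 0 else 1 :: nat) \<longleftrightarrow> \<kappa> c \<noteq> 0"
        by simp
      show "homog (odd (if \<kappa> c = 0 then 0 else 1 :: nat)) (coef p c (\<kappa> c))"
        unfolding odd_if by (rule h[OF c])
      show "homog (odd (if \<kappa> c = 0 then 0 else 1 :: nat)) (vrow c (\<kappa> c) (\<sigma> c))"
        unfolding odd_if by (rule homog_vrow)
    qed (auto simp: binomial_eq_0)
    then show "of_int (sign \<sigma>) * oprod 1 u (\<lambda>c. coef p c (\<kappa> c) * vrow c (\<kappa> c) (\<sigma> c)) =
      smul ((-1) ^ (ncol u \<kappa> choose 2)) (oprod 1 u (\<lambda>c. coef p c (\<kappa> c)) * (of_int (sign \<sigma>) * oprod 1 u (\<lambda>c. vrow c (\<kappa> c) (\<sigma> c))))"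
      by (simp add: of_int_spoly mult.commute)
  qed
  also have "\<dots> = (\<Sum>\<kappa>\<in>?K. smul ((-1) ^ (ncol u \<kappa> choose 2)) (oprod 1 u (\<lambda>c. coef p c (\<kappa> c)) * sdet u (\<lambda>c. vrow c (\<kappa> c))))"
    unfolding sdet_def sum.swap[of _ ?P ?K] sum_distrib_left spoly.scale_sum_right ..
  finally show ?thesis .
qed

text \<open>A choice of a term (0 for \<open>y\<close>, \<open>k\<close> for \<open>\<xi>\<^sub>k\<close>) in each row \<open>c\<close> of each determinant \<open>i\<close>. It marks box
  \<open>k\<close> of column \<open>c\<close> of the \<open>i\<close>-th diagram, so that choices are the collections of marked diagrams in
  which different diagrams may have marks at the same position.\<close>

definition choices :: "nat \<Rightarrow> nat \<Rightarrow> (nat \<Rightarrow> nat) \<Rightarrow> (nat \<Rightarrow> nat \<Rightarrow> nat) set" where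
  "choices m s \<mu> = Pi\<^sub>E {1..s} (\<lambda>i. {1..\<mu> i} \<rightarrow>\<^sub>E {0..m})"

definition diagram_of :: "nat \<Rightarrow> (nat \<Rightarrow> nat) \<Rightarrow> (nat \<Rightarrow> nat \<Rightarrow> nat) \<Rightarrow> (nat \<times> nat \<times> nat) set" where
  "diagram_of s \<mu> \<kappa> = {(i, c, k). i \<in> {1..s} \<and> c \<in> {1..\<mu> i} \<and> k \<noteq> 0 \<and> \<kappa> i c = k}"

lemma ncol_card: "ncol u \<kappa> = card {c \<in> {1..u}. \<kappa> c \<noteq> 0}"
  unfolding ncol_def by (simp add: sum.If_cases Int_def)

lemma oprod_sdet_yhat:
  assumes mp: "m \<le> p"
  shows "oprod 1 s (\<lambda>i. sdet (\<mu> i) (yhat p m)) = (\<Sum>\<kappa>\<in>choices m s \<mu>. smul ((-1) ^ ((\<Sum>i=1..s. ncol (\<mu> i) (\<kappa> i)) choose 2))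
     (oprod 1 s (\<lambda>i. oprod 1 (\<mu> i) (\<lambda>c. coef p c (\<kappa> i c))) * oprod 1 s (\<lambda>i. sdet (\<mu> i) (\<lambda>c. vrow c (\<kappa> i c)))))"
  unfolding sdet_yhat[OF mp] oprod_sum_PiE choices_def
proof (rule sum.cong[OF refl], rule oprod_pairs)
  fix \<kappa> i assume \<kappa>: "\<kappa> \<in> Pi\<^sub>E {1..s} (\<lambda>i. {1..\<mu> i} \<rightarrow>\<^sub>E {0..m})" and i: "1 \<le> i" "i \<le> s"
  then have \<kappa>i: "\<kappa> i \<in> {1..\<mu> i} \<rightarrow>\<^sub>E {0..m}"
    by auto
  show "homog (odd (ncol (\<mu> i) (\<kappa> i))) (oprod 1 (\<mu> i) (\<lambda>c. coef p c (\<kappa> i c)))"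
    unfolding ncol_def
  proof (rule homog_oprod)
    fix c assume "1 \<le> c" "c \<le> \<mu> i"
    then have "\<kappa> i c \<le> m"
      using \<kappa>i by (fastforce dest: PiE_mem)
    then show "homog (odd (if \<kappa> i c = 0 then 0 else 1 :: nat)) (coef p c (\<kappa> i c))"
      using homog_coef[of "\<kappa> i c" p c] mp by auto
  qed simp
  show "homog (odd (ncol (\<mu> i) (\<kappa> i))) (sdet (\<mu> i) (\<lambda>c. vrow c (\<kappa> i c)))"
    unfolding ncol_card by (rule homog_sdet) (use homog_vrow in auto)
qed simp

lemma marked_count_diagram_of: "i \<in> {1..s} \<Longrightarrow> marked_count (diagram_of s \<mu> \<kappa>) i = ncol (\<mu> i) (\<kappa> i)"
  unfolding marked_count_def ncol_card
  by (rule bij_betw_same_card[of fst], rule bij_betw_byWitness[of _ "\<lambda>c. (c, \<kappa> i c)"]) (auto simp: diagram_of_def)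

lemma homog_central_left: "homog False z \<Longrightarrow> y * (z * x) = z * (y * x)"
  using homog_central[of z y] by (simp flip: mult.assoc)

lemma oprod_power_mult:
  assumes "homog False d"
  shows "oprod 1 s (\<lambda>i. d ^ n i * f i) = d ^ (\<Sum>i=1..s. n i) * oprod 1 s f"
proof (induction s)
  case (Suc s)
  have "oprod 1 s f * (d ^ n (Suc s) * f (Suc s)) = d ^ n (Suc s) * (oprod 1 s f * f (Suc s))"
    using homog_central[OF homog_power[OF assms], of "n (Suc s)" "oprod 1 s f"] by (simp flip: mult.assoc)
  then show ?case
    by (simp add: oprod_Suc Suc power_add mult.assoc)
qed simp

text \<open>Each row without a mark contributes \<open>det X\<close>, which turns the power for the marked rows into one for all
  rows.\<close>

lemma coef_product:
  assumes \<kappa>: "\<kappa> \<in> choices m s \<mu>" and mp: "m \<le> p" and mu: "\<forall>i\<in>{1..s}. \<mu> i \<le> \<mu> 1"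
  shows "Delta p ^ (\<Sum>i=1..s. ncol (\<mu> i) (\<kappa> i)) * oprod 1 s (\<lambda>i. oprod 1 (\<mu> i) (\<lambda>c. coef p c (\<kappa> i c)))
    = Delta p ^ (\<Sum>i=1..s. \<mu> i) * oprod 1 s (\<lambda>i. oprod 1 (\<mu> 1) (\<lambda>c. oprod 1 m (\<lambda>k. if (i, c, k) \<in> diagram_of s \<mu> \<kappa> then detX p c {k} else 1)))"
    (is "?d ^ _ * _ = _ * oprod 1 s ?R")
proof -
  have row: "?d ^ ncol (\<mu> i) (\<kappa> i) * oprod 1 (\<mu> i) (\<lambda>c. coef p c (\<kappa> i c)) = ?d ^ \<mu> i * ?R i" if i: "i \<in> {1..s}" for i
  proof -
    let ?g = "\<lambda>c. if \<kappa> i c = 0 then 1 else detX p c {\<kappa> i c}"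
    have km: "\<kappa> i c \<le> m" if "1 \<le> c" "c \<le> \<mu> i" for c
      using \<kappa> that i unfolding choices_def by (fastforce dest: PiE_mem)
    have "oprod 1 (\<mu> i) (\<lambda>c. coef p c (\<kappa> i c)) = oprod 1 (\<mu> i) (\<lambda>c. ?g c * (if c \<in> {c \<in> {1..\<mu> i}. \<kappa> i c \<noteq> 0} then 1 else ?d))"
      by (rule oprod_cong) (auto simp: coef_def)
    also have "\<dots> = oprod 1 (\<mu> i) ?g * ?d ^ card ({1..\<mu> i} - {c \<in> {1..\<mu> i}. \<kappa> i c \<noteq> 0})"
      unfolding oprod_if_power[symmetric] by (rule oprod_central_mult) (auto simp: homog_Delta)
    also have "card ({1..\<mu> i} - {c \<in> {1..\<mu> i}. \<kappa> i c \<noteq> 0}) = \<mu> i - ncol (\<mu> i) (\<kappa> i)"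
      unfolding ncol_card by (subst card_Diff_subset) auto
    also have "oprod 1 (\<mu> i) ?g = ?R i"
    proof -
      have "?R i = oprod 1 (\<mu> 1) (\<lambda>c. if c \<le> \<mu> i then ?g c else 1)"
      proof (rule oprod_cong)
        fix c assume c: "1 \<le> c" "c \<le> \<mu> 1"
        show "oprod 1 m (\<lambda>k. if (i, c, k) \<in> diagram_of s \<mu> \<kappa> then detX p c {k} else 1) = (if c \<le> \<mu> i then ?g c else 1)"
        proof (cases "c \<le> \<mu> i \<and> \<kappa> i c \<noteq> 0")
          case True
          then have "(\<lambda>k. if (i, c, k) \<in> diagram_of s \<mu> \<kappa> then detX p c {k} else 1) = (\<lambda>k. if k = \<kappa> i c then detX p c {\<kappa> i c} else 1)"
            using c i by (auto simp: diagram_of_def)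
          moreover have "\<kappa> i c \<in> {1..m}"
            using km[of c] c True by auto
          ultimately show ?thesis
            using True by (simp only: oprod_single if_True simp_thms if_False)
        next
          case False
          then have "(\<lambda>k. if (i, c, k) \<in> diagram_of s \<mu> \<kappa> then detX p c {k} else 1) = (\<lambda>k. 1)"
            by (auto simp: diagram_of_def)
          with False show ?thesis by (simp add: oprod_1)
        qed
      qed
      also have "\<dots> = oprod 1 (\<mu> i) (\<lambda>c. if c \<le> \<mu> i then ?g c else 1) * oprod (Suc (\<mu> i)) (\<mu> 1) (\<lambda>c. if c \<le> \<mu> i then ?g c else 1)"
        by (rule oprod_append) (use mu i in auto)
      also have "oprod (Suc (\<mu> i)) (\<mu> 1) (\<lambda>c. if c \<le> \<mu> i then ?g c else 1) = 1"
        by (rule oprod_1) auto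
      also have "oprod 1 (\<mu> i) (\<lambda>c. if c \<le> \<mu> i then ?g c else 1) = oprod 1 (\<mu> i) ?g"
        by (rule oprod_cong) auto
      finally show ?thesis by simp
    qed
    finally have "oprod 1 (\<mu> i) (\<lambda>c. coef p c (\<kappa> i c)) = ?d ^ (\<mu> i - ncol (\<mu> i) (\<kappa> i)) * ?R i"
      by (simp only: homog_central[OF homog_power[OF homog_Delta]])
    moreover have "ncol (\<mu> i) (\<kappa> i) \<le> \<mu> i"
      unfolding ncol_def by (rule order_trans[OF sum_bounded_above[of _ _ 1]]) auto
    ultimately show ?thesis
      by (simp flip: mult.assoc power_add)
  qed
  note pow = oprod_power_mult[OF homog_Delta]
  have "?d ^ (\<Sum>i=1..s. ncol (\<mu> i) (\<kappa> i)) * oprod 1 s (\<lambda>i. oprod 1 (\<mu> i) (\<lambda>c. coef p c (\<kappa> i c)))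
      = oprod 1 s (\<lambda>i. ?d ^ ncol (\<mu> i) (\<kappa> i) * oprod 1 (\<mu> i) (\<lambda>c. coef p c (\<kappa> i c)))"
    by (rule pow[symmetric])
  also have "\<dots> = oprod 1 s (\<lambda>i. ?d ^ \<mu> i * ?R i)"
    by (rule oprod_cong) (use row in auto)
  also have "\<dots> = ?d ^ (\<Sum>i=1..s. \<mu> i) * oprod 1 s ?R"
    by (rule pow)
  finally show ?thesis .
qed

subsection \<open>Existence of \<open>\<Gamma>\<close> and its factorisation\<close>

lemma oprod_smul: "oprod 1 s (\<lambda>i. smul (c i) (f i)) = smul (\<Prod>i=1..s. c i) (oprod 1 s f)"
  by (induction s) (auto simp: oprod_Suc mult.commute)

lemma marked_diagrams_box:
  assumes "D \<in> marked_diagrams m s \<mu>" "\<forall>i\<in>{1..s}. \<mu> i \<le> \<mu> 1"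
  shows "D \<subseteq> {(i, c, k). i \<in> {1..s} \<and> c \<in> {1..\<mu> 1} \<and> k \<in> {1..m}}"
proof clarify
  fix i c k assume "(i, c, k) \<in> D"
  with assms(1) have "i \<in> {1..s}" "c \<in> {1..\<mu> i}" "k \<in> {1..m}"
    by (auto simp: marked_diagrams_def)
  moreover have "\<mu> i \<le> \<mu> 1"
    using assms(2) \<open>i \<in> {1..s}\<close> by blast
  ultimately show "i \<in> {1..s} \<and> c \<in> {1..\<mu> 1} \<and> k \<in> {1..m}"
    by auto
qed

lemma diagram_of_box:
  assumes "\<kappa> \<in> choices m s \<mu>" "\<forall>i\<in>{1..s}. \<mu> i \<le> \<mu> 1"
  shows "diagram_of s \<mu> \<kappa> \<subseteq> {(i, c, k). i \<in> {1..s} \<and> c \<in> {1..\<mu> 1} \<and> k \<in> {1..m}}"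
proof -
  have "\<kappa> i c \<le> m" if "i \<in> {1..s}" "c \<in> {1..\<mu> i}" for i c
    using assms(1) that unfolding choices_def by (fastforce dest: PiE_mem)
  moreover have "c \<le> \<mu> 1" if "i \<in> {1..s}" "c \<in> {1..\<mu> i}" for i c
    using assms(2) that by fastforce
  ultimately show ?thesis
    by (auto simp: diagram_of_def Suc_le_eq)
qed

lemma finite_box: "finite {(i, c, k :: nat). i \<in> {1..s :: nat} \<and> c \<in> {1..u :: nat} \<and> k \<in> {1..m}}"
  by (rule finite_subset[of _ "{1..s} \<times> {1..u} \<times> {1..m}"]) auto

lemma marked_counts:
  assumes D: "D \<in> marked_diagrams m s \<mu>" and mu: "\<forall>i\<in>{1..s}. \<mu> i \<le> \<mu> 1"
  shows "(\<Sum>j=1..\<mu> 1. card (marked_rows D j)) = (\<Sum>i=1..s. marked_count D i)"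
proof -
  note box = marked_diagrams_box[OF D mu]
  have finD: "finite D"
    using box finite_box finite_subset by blast
  have "D = Sigma {1..s} (\<lambda>i. {(c, k). (i, c, k) \<in> D})"
    using box by auto
  moreover have fin: "finite {(c, k). (i, c, k) \<in> D}" for i
    by (rule finite_subset[OF _ finite_imageI[OF finD, of snd]]) force
  ultimately have 1: "card D = (\<Sum>i=1..s. marked_count D i)"
    unfolding marked_count_def by (metis (no_types, lifting) card_SigmaI finite_atLeastAtMost sum.cong)
  have "bij_betw (\<lambda>(i, c, k). (c, k)) D (Sigma {1..\<mu> 1} (marked_rows D))"
  proof (rule bij_betw_imageI)
    have "\<forall>i i' c k. (i, c, k) \<in> D \<and> (i', c, k) \<in> D \<longrightarrow> i = i'"
      using D unfolding marked_diagrams_def by blast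
    then show "inj_on (\<lambda>(i, c, k). (c, k)) D"
      by (intro inj_onI) (clarsimp, blast)
    show "(\<lambda>(i, c, k). (c, k)) ` D = Sigma {1..\<mu> 1} (marked_rows D)"
      using box by (force simp: marked_rows_def)
  qed
  then have "card D = card (Sigma {1..\<mu> 1} (marked_rows D))"
    by (rule bij_betw_same_card)
  also have "\<dots> = (\<Sum>j=1..\<mu> 1. card (marked_rows D j))"
  proof (rule card_SigmaI)
    have "marked_rows D j \<subseteq> {1..m}" for j
      using box by (auto simp: marked_rows_def)
    then show "\<forall>j\<in>{1..\<mu> 1}. finite (marked_rows D j)"
      using finite_subset by blast
  qed simp
  finally show ?thesis
    using 1 by simp
qed

lemma detY_diagram_of:
  assumes "i \<in> {1..s}"
  shows "detY_diagram \<mu> (diagram_of s \<mu> \<kappa>) i = sdet (\<mu> i) (\<lambda>c. vrow c (\<kappa> i c))"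
  unfolding detY_diagram_def
proof (rule sdet_cong)
  fix c j assume c: "c \<in> {1..\<mu> i}"
  have D: "(i, c, k) \<in> diagram_of s \<mu> \<kappa> \<longleftrightarrow> \<kappa> i c \<noteq> 0 \<and> k = \<kappa> i c" for k
    using assms c by (auto simp: diagram_of_def)
  show "(if \<exists>k. (i, c, k) \<in> diagram_of s \<mu> \<kappa> then xiv (THE k. (i, c, k) \<in> diagram_of s \<mu> \<kappa>) j else yv c j) = vrow c (\<kappa> i c) j"
    unfolding D by (auto simp: vrow_def)
qed

text \<open>The exponent of \<open>-1\<close> is the number of pairs of marks, from separating the \<open>\<theta>\<close> from the \<open>\<xi>\<close>; \<open>\<epsilon>\<^sub>D\<close>
  comes from sorting the \<open>\<theta>\<close> by columns; and the factorials relate the products of the \<open>\<theta>\<close> of one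
  column to determinants with repeated rows.\<close>

lemma Gamma_term:
  assumes mp: "m \<le> p" and mu: "\<forall>i\<in>{1..s}. \<mu> i \<le> \<mu> 1"
    and \<kappa>: "\<kappa> \<in> choices m s \<mu>" and D: "diagram_of s \<mu> \<kappa> = D" "D \<in> marked_diagrams m s \<mu>"
  shows "Delta p ^ (\<Sum>i=1..s. \<mu> i) * smul (coeff_D m s \<mu> D) (detX_D p \<mu> D * detY_D s \<mu> D)
    = Delta p ^ \<mu> 1 * smul ((-1) ^ ((\<Sum>i=1..s. ncol (\<mu> i) (\<kappa> i)) choose 2))
     (oprod 1 s (\<lambda>i. oprod 1 (\<mu> i) (\<lambda>c. coef p c (\<kappa> i c))) * oprod 1 s (\<lambda>i. sdet (\<mu> i) (\<lambda>c. vrow c (\<kappa> i c))))"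
    (is "?d ^ ?nb * _ = _ * smul _ (?T * ?R)")
proof -
  let ?N = "\<Sum>i=1..s. ncol (\<mu> i) (\<kappa> i)"
  let ?e = "\<lambda>j. card (marked_rows D j)"
  let ?th = "\<lambda>(i, c, k). detX p c {k}"
  note box = marked_diagrams_box[OF D(2) mu]
  have N: "?N = (\<Sum>i=1..s. marked_count D i)"
    by (rule sum.cong) (auto simp: marked_count_diagram_of simp flip: D(1))
  have "(\<Sum>i=1..s. \<Sum>j=1..s. marked_count D i * marked_count D j) = ?N * ?N"
    unfolding N by (simp add: sum_product)
  \<comment> \<open>the exponent \<open>(N\<^sup>2 - N) / 2\<close> in terms of the total number \<open>N\<close> of marks\<close>
  then have ex: "((\<Sum>i=1..s. \<Sum>j=1..s. marked_count D i * marked_count D j) - (\<Sum>i=1..s. marked_count D i)) div 2 = ?N choose 2"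
    unfolding N[symmetric] by (simp add: choose_two diff_mult_distrib2)
  \<comment> \<open>the product of the \<open>\<theta>\<close> in the order of the diagrams and in the order of the columns\<close>
  define O1 where "O1 = oprod 1 s (\<lambda>i. oprod 1 (\<mu> 1) (\<lambda>c. oprod 1 m (\<lambda>k. if (i, c, k) \<in> D then ?th (i, c, k) else 1)))"
  define O2 where "O2 = oprod 1 (\<mu> 1) (\<lambda>c. oprod 1 p (\<lambda>k. if k \<in> marked_rows D c then detX p c {k} else 1))"
  have T: "?d ^ ?N * ?T = ?d ^ ?nb * O1"
    using coef_product[OF \<kappa> mp mu] unfolding O1_def D(1) prod.case by simp
  have "O1 = of_int (eps_D m s \<mu> D) * oprod 1 (\<mu> 1) (\<lambda>c. oprod 1 m (\<lambda>k. oprod 1 s (\<lambda>i. if (i, c, k) \<in> D then ?th (i, c, k) else 1)))"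
    unfolding O1_def
  proof (rule eps_D_reorder[where \<mu> = \<mu>])
    show "D \<subseteq> {(i, c, k). i \<in> {1..s} \<and> c \<in> {1..\<mu> 1} \<and> k \<in> {1..m}}"
      by (rule box)
    fix x assume "x \<in> D"
    with box mp show "homog True (?th x)"
      by (auto intro!: homog_th)
  qed
  also have "oprod 1 (\<mu> 1) (\<lambda>c. oprod 1 m (\<lambda>k. oprod 1 s (\<lambda>i. if (i, c, k) \<in> D then ?th (i, c, k) else 1))) = O2"
    unfolding O2_def
  proof (rule oprod_cong)
    fix c
    have "oprod 1 p (\<lambda>k. if k \<in> marked_rows D c then detX p c {k} else 1) = oprod 1 m (\<lambda>k. if k \<in> marked_rows D c then detX p c {k} else 1)
       * oprod (Suc m) p (\<lambda>k. if k \<in> marked_rows D c then detX p c {k} else 1)"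
      by (rule oprod_append) (use mp in auto)
    also have "oprod (Suc m) p (\<lambda>k. if k \<in> marked_rows D c then detX p c {k} else 1) = 1"
      by (rule oprod_1) (use box in \<open>auto simp: marked_rows_def\<close>)
    also have "oprod 1 m (\<lambda>k. if k \<in> marked_rows D c then detX p c {k} else 1) = oprod 1 m (\<lambda>k. oprod 1 s (\<lambda>i. if (i, c, k) \<in> D then ?th (i, c, k) else 1))"
    proof (rule oprod_cong)
      fix k
      show "(if k \<in> marked_rows D c then detX p c {k} else 1) = oprod 1 s (\<lambda>i. if (i, c, k) \<in> D then ?th (i, c, k) else 1)"
      proof (cases "k \<in> marked_rows D c")
        case True
        then obtain i0 where i0: "(i0, c, k) \<in> D"
          by (auto simp: marked_rows_def)
        then have "(i, c, k) \<in> D \<longleftrightarrow> i = i0" for i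
          using D(2) unfolding marked_diagrams_def by blast
        then have "(\<lambda>i. if (i, c, k) \<in> D then ?th (i, c, k) else 1) = (\<lambda>i. if i = i0 then detX p c {k} else 1)"
          by (simp only: prod.case)
        moreover have "i0 \<in> {1..s}"
          using i0 box by auto
        ultimately show ?thesis
          using True by (simp only: oprod_single if_True)
      next
        case False
        then have "(\<lambda>i. if (i, c, k) \<in> D then ?th (i, c, k) else 1) = (\<lambda>i. 1)"
          by (auto simp: marked_rows_def)
        with False show ?thesis by (simp add: oprod_1)
      qed
    qed
    finally show "oprod 1 m (\<lambda>k. oprod 1 s (\<lambda>i. if (i, c, k) \<in> D then ?th (i, c, k) else 1)) = oprod 1 p (\<lambda>k. if k \<in> marked_rows D c then detX p c {k} else 1)"
      by simp
  qed
  finally have O: "O1 = smul (of_int (eps_D m s \<mu> D)) O2"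
    by (simp add: of_int_spoly)
  have X: "?d ^ ?N * detX_D p \<mu> D = smul (\<Prod>j=1..\<mu> 1. fact (?e j)) (?d ^ \<mu> 1 * O2)"
  proof -
    have "?d ^ ?N * detX_D p \<mu> D = oprod 1 (\<mu> 1) (\<lambda>j. ?d ^ ?e j * detX p j (marked_rows D j))"
      unfolding oprod_power_mult[OF homog_Delta] marked_counts[OF D(2) mu] N detX_D_def ..
    also have "\<dots> = oprod 1 (\<mu> 1) (\<lambda>j. smul (fact (?e j)) (?d ^ 1 * oprod 1 p (\<lambda>k. if k \<in> marked_rows D j then detX p j {k} else 1)))"
    proof (rule oprod_cong)
      fix j
      have "marked_rows D j \<subseteq> {1..p}"
        using box mp by (fastforce simp: marked_rows_def)
      then show "?d ^ ?e j * detX p j (marked_rows D j) = smul (fact (?e j)) (?d ^ 1 * oprod 1 p (\<lambda>k. if k \<in> marked_rows D j then detX p j {k} else 1))"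
        by (simp add: detX_product)
    qed
    also have "\<dots> = smul (\<Prod>j=1..\<mu> 1. fact (?e j)) (?d ^ \<mu> 1 * O2)"
      unfolding oprod_smul oprod_power_mult[OF homog_Delta] O2_def by simp
    finally show ?thesis .
  qed
  have Y: "detY_D s \<mu> D = ?R"
    unfolding detY_D_def by (rule oprod_cong) (use detY_diagram_of D(1) in auto)
  have fact: "(\<Prod>j=1..\<mu> 1. fact (?e j)) \<noteq> (0::complex)"
    by simp
  have dd: "?d ^ i * (?d ^ j * x) = ?d ^ j * (?d ^ i * x)" for i j x
    by (simp add: add.commute flip: mult.assoc power_add)
  have "?d ^ ?N * (?d ^ ?nb * smul (coeff_D m s \<mu> D) (detX_D p \<mu> D * detY_D s \<mu> D))
      = smul (coeff_D m s \<mu> D) (?d ^ ?nb * (?d ^ ?N * detX_D p \<mu> D) * ?R)"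
    unfolding Y by (simp only: smul_mult mult.assoc dd[of ?N ?nb])
  also have "\<dots> = smul ((-1) ^ (?N choose 2) * of_int (eps_D m s \<mu> D)) (?d ^ ?nb * (?d ^ \<mu> 1 * (O2 * ?R)))"
    unfolding X coeff_D_def ex using fact by (simp add: mult.assoc)
  also have "\<dots> = smul ((-1) ^ (?N choose 2)) (?d ^ \<mu> 1 * (?d ^ ?nb * O1) * ?R)"
    unfolding O by (simp only: smul_mult mult.assoc dd[of ?nb "\<mu> 1"] spoly.scale_scale)
  also have "\<dots> = ?d ^ ?N * (?d ^ \<mu> 1 * smul ((-1) ^ (?N choose 2)) (?T * ?R))"
    unfolding T[symmetric] by (simp only: smul_mult mult.assoc dd[of "\<mu> 1" ?N])
  finally show ?thesis
    by (rule nzd_cancel[OF nzd_power[OF nzd_Delta]])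
qed

text \<open>The choices excluded from the collections of marked diagrams contain an odd factor twice.\<close>

lemma Gamma_term_0:
  assumes mp: "m \<le> p" and mu: "\<forall>i\<in>{1..s}. \<mu> i \<le> \<mu> 1"
    and \<kappa>: "\<kappa> \<in> choices m s \<mu>" and D: "diagram_of s \<mu> \<kappa> \<notin> marked_diagrams m s \<mu>"
  shows "oprod 1 s (\<lambda>i. oprod 1 (\<mu> i) (\<lambda>c. coef p c (\<kappa> i c))) = 0"
proof -
  let ?D = "diagram_of s \<mu> \<kappa>"
  let ?th = "\<lambda>(i, c, k). detX p c {k}"
  note box = diagram_of_box[OF \<kappa> mu]
  have "?D \<subseteq> {(i, c, k). i \<in> {1..s} \<and> c \<in> {1..\<mu> i} \<and> k \<in> {1..m}}"
    using box by (auto simp: diagram_of_def)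
  then have "\<not> (\<forall>i i' c k. (i, c, k) \<in> ?D \<and> (i', c, k) \<in> ?D \<longrightarrow> i = i')"
    using D by (auto simp: marked_diagrams_def diagram_of_def)
  then obtain i i' c k where *: "(i, c, k) \<in> ?D" "(i', c, k) \<in> ?D" "i \<noteq> i'"
    by blast
  have "prod_list (map ?th (lex1 s (\<mu> 1) m ?D)) = 0"
    by (rule prod_list_repeated[of _ "(i, c, k)" "(i', c, k)"])
       (use * box mp lex_distinct lex_set[OF box] in \<open>auto intro!: homog_th\<close>)
  then have "oprod 1 s (\<lambda>i. oprod 1 (\<mu> 1) (\<lambda>c. oprod 1 m (\<lambda>k. if (i, c, k) \<in> ?D then detX p c {k} else 1))) = 0"
    unfolding prod_lex1[symmetric] prod.case .
  then have "Delta p ^ (\<Sum>i=1..s. ncol (\<mu> i) (\<kappa> i)) * oprod 1 s (\<lambda>i. oprod 1 (\<mu> i) (\<lambda>c. coef p c (\<kappa> i c))) = 0"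
    using coef_product[OF \<kappa> mp mu] by simp
  then show ?thesis
    using nzd_power[OF nzd_Delta] unfolding nzd_def by blast
qed

lemma bij_diagram_of:
  "bij_betw (diagram_of s \<mu>) {\<kappa> \<in> choices m s \<mu>. diagram_of s \<mu> \<kappa> \<in> marked_diagrams m s \<mu>} (marked_diagrams m s \<mu>)"
proof (rule bij_betw_imageI)
  show "inj_on (diagram_of s \<mu>) {\<kappa> \<in> choices m s \<mu>. diagram_of s \<mu> \<kappa> \<in> marked_diagrams m s \<mu>}"
  proof (rule inj_onI, clarify)
    fix \<kappa> \<kappa>' assume \<kappa>: "\<kappa> \<in> choices m s \<mu>" "\<kappa>' \<in> choices m s \<mu>" and eq: "diagram_of s \<mu> \<kappa> = diagram_of s \<mu> \<kappa>'"
    show "\<kappa> = \<kappa>'"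
    proof (rule PiE_ext)
      show "\<kappa> \<in> Pi\<^sub>E {1..s} (\<lambda>i. {1..\<mu> i} \<rightarrow>\<^sub>E {0..m})" "\<kappa>' \<in> Pi\<^sub>E {1..s} (\<lambda>i. {1..\<mu> i} \<rightarrow>\<^sub>E {0..m})"
        using \<kappa> by (simp_all only: choices_def)
      fix i assume i: "i \<in> {1..s}"
      show "\<kappa> i = \<kappa>' i"
      proof (rule PiE_ext)
        show "\<kappa> i \<in> {1..\<mu> i} \<rightarrow>\<^sub>E {0..m}" "\<kappa>' i \<in> {1..\<mu> i} \<rightarrow>\<^sub>E {0..m}"
          using \<kappa> i unfolding choices_def by (blast dest: PiE_mem)+
        fix c assume c: "c \<in> {1..\<mu> i}"
        have "(i, c, k) \<in> diagram_of s \<mu> \<kappa> \<longleftrightarrow> k \<noteq> 0 \<and> \<kappa> i c = k" "(i, c, k) \<in> diagram_of s \<mu> \<kappa>' \<longleftrightarrow> k \<noteq> 0 \<and> \<kappa>' i c = k" for k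
          using i c by (auto simp: diagram_of_def)
        then show "\<kappa> i c = \<kappa>' i c"
          unfolding eq by (metis gr_zeroI)
      qed
    qed
  qed
  show "diagram_of s \<mu> ` {\<kappa> \<in> choices m s \<mu>. diagram_of s \<mu> \<kappa> \<in> marked_diagrams m s \<mu>} = marked_diagrams m s \<mu>"
  proof (intro subset_antisym subsetI)
    fix D assume D: "D \<in> marked_diagrams m s \<mu>"
    define \<kappa> where "\<kappa> = (\<lambda>i\<in>{1..s}. \<lambda>c\<in>{1..\<mu> i}. if \<exists>k. (i, c, k) \<in> D then THE k. (i, c, k) \<in> D else 0)"
    have box: "D \<subseteq> {(i, c, k). i \<in> {1..s} \<and> c \<in> {1..\<mu> i} \<and> k \<in> {1..m}}"
      using D by (auto simp: marked_diagrams_def)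
    have the: "(THE k. (i, c, k) \<in> D) = k" if "(i, c, k) \<in> D" for i c k
      using D that by (intro the_equality) (auto simp: marked_diagrams_def)
    have val: "\<kappa> i c = k \<longleftrightarrow> (i, c, k) \<in> D" if "i \<in> {1..s}" "c \<in> {1..\<mu> i}" "k \<noteq> 0" for i c k
      using that the box by (auto simp: \<kappa>_def)
    have eq: "diagram_of s \<mu> \<kappa> = D"
      using box val by (fastforce simp: diagram_of_def)
    have "\<kappa> i c \<le> m" if "i \<in> {1..s}" "c \<in> {1..\<mu> i}" for i c
      using that val[OF that, of "\<kappa> i c"] box by (cases "\<kappa> i c = 0") auto
    then have "\<kappa> \<in> choices m s \<mu>"
      unfolding choices_def by (auto simp: \<kappa>_def)
    with eq D show "D \<in> diagram_of s \<mu> ` {\<kappa> \<in> choices m s \<mu>. diagram_of s \<mu> \<kappa> \<in> marked_diagrams m s \<mu>}"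
      by force
  qed auto
qed

lemma finite_choices: "finite (choices m s \<mu>)"
  unfolding choices_def by (intro finite_PiE) auto

lemma Gamma_sum:
  assumes mp: "m \<le> p" and mu: "\<forall>i\<in>{1..s}. \<mu> i \<le> \<mu> 1"
  shows "Delta p ^ (\<Sum>i=1..s. \<mu> i) * (\<Sum>D\<in>marked_diagrams m s \<mu>. smul (coeff_D m s \<mu> D) (detX_D p \<mu> D * detY_D s \<mu> D))
    = Delta p ^ \<mu> 1 * oprod 1 s (\<lambda>i. sdet (\<mu> i) (yhat p m))"
proof -
  let ?K = "{\<kappa> \<in> choices m s \<mu>. diagram_of s \<mu> \<kappa> \<in> marked_diagrams m s \<mu>}"
  let ?F = "\<lambda>\<kappa>. smul ((-1) ^ ((\<Sum>i=1..s. ncol (\<mu> i) (\<kappa> i)) choose 2))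
     (oprod 1 s (\<lambda>i. oprod 1 (\<mu> i) (\<lambda>c. coef p c (\<kappa> i c))) * oprod 1 s (\<lambda>i. sdet (\<mu> i) (\<lambda>c. vrow c (\<kappa> i c))))"
  have "oprod 1 s (\<lambda>i. sdet (\<mu> i) (yhat p m)) = (\<Sum>\<kappa>\<in>choices m s \<mu>. ?F \<kappa>)"
    by (rule oprod_sdet_yhat[OF mp])
  also have "\<dots> = (\<Sum>\<kappa>\<in>?K. ?F \<kappa>)"
    by (rule sum.mono_neutral_right) (use finite_choices Gamma_term_0[OF mp mu] in auto)
  finally have "Delta p ^ \<mu> 1 * oprod 1 s (\<lambda>i. sdet (\<mu> i) (yhat p m)) = (\<Sum>\<kappa>\<in>?K. Delta p ^ \<mu> 1 * ?F \<kappa>)"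
    by (simp add: sum_distrib_left)
  also have "\<dots> = (\<Sum>D\<in>marked_diagrams m s \<mu>. Delta p ^ (\<Sum>i=1..s. \<mu> i) * smul (coeff_D m s \<mu> D) (detX_D p \<mu> D * detY_D s \<mu> D))"
  proof -
    let ?G = "\<lambda>D. Delta p ^ (\<Sum>i=1..s. \<mu> i) * smul (coeff_D m s \<mu> D) (detX_D p \<mu> D * detY_D s \<mu> D)"
    have "(\<Sum>\<kappa>\<in>?K. Delta p ^ \<mu> 1 * ?F \<kappa>) = (\<Sum>\<kappa>\<in>?K. ?G (diagram_of s \<mu> \<kappa>))"
    proof (rule sum.cong[OF refl])
      fix \<kappa> assume "\<kappa> \<in> ?K"
      then show "Delta p ^ \<mu> 1 * ?F \<kappa> = ?G (diagram_of s \<mu> \<kappa>)"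
        using Gamma_term[OF mp mu, of \<kappa>] by simp
    qed
    also have "\<dots> = (\<Sum>D\<in>marked_diagrams m s \<mu>. ?G D)"
      by (rule sum.reindex_bij_betw[OF bij_diagram_of])
    finally show ?thesis .
  qed
  finally show ?thesis
    by (simp add: sum_distrib_left)
qed

text \<open>Both factors are, up to a power of \<open>det X\<close>, products of disjoint sets of \<open>\<theta>\<^sub>j\<^sup>k\<close>; one factor
  \<open>det X\<close> is saved when they are united.\<close>

lemma Delta2_detX_divisible:
  assumes mp: "m \<le> p" and I: "I \<subseteq> {1..m}"
  shows "\<exists>c. Delta2 m j p * detX p j I = smul c (Delta p * detX p j (I \<union> {m+1..p}))"
proof -
  let ?d = "Delta p" and ?M = "{m+1..p}"
  let ?f = "\<lambda>J k. if k \<in> J then detX p j {k} else 1"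
  have fin: "finite I" and IM: "I \<inter> ?M = {}" and Ip: "I \<subseteq> {1..p}" "?M \<subseteq> {1..p}" "I \<union> ?M \<subseteq> {1..p}"
    using I mp by (auto intro: finite_subset)
  have dc: "x * ?d ^ n = ?d ^ n * x" "x * ?d = ?d * x" for x n
    using homog_central[OF homog_power[OF homog_Delta], of p n x] homog_central[OF homog_Delta, of p x] by simp_all
  have split: "oprod 1 p f = oprod 1 m f * oprod (Suc m) p f" for f
    by (rule oprod_append) (use mp in auto)
  have "oprod (Suc m) p (?f I) = 1"
    by (rule oprod_1) (use I in auto)
  then have OI: "oprod 1 p (?f I) = oprod 1 m (?f I)"
    by (simp add: split)
  have "oprod 1 m (?f ?M) = 1"
    by (rule oprod_1) auto
  then have OM: "oprod 1 p (?f ?M) = oprod (Suc m) p (?f ?M)"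
    by (simp add: split)
  have "oprod 1 m (?f (I \<union> ?M)) = oprod 1 m (?f I)" "oprod (Suc m) p (?f (I \<union> ?M)) = oprod (Suc m) p (?f ?M)"
    by (rule oprod_cong; use I in auto)+
  then have OU: "oprod 1 p (?f (I \<union> ?M)) = oprod 1 p (?f I) * oprod 1 p (?f ?M)"
    unfolding OI OM by (simp add: split)
  have hom: "\<exists>\<epsilon>. homog \<epsilon> (oprod 1 p (?f J))" if "J \<subseteq> {1..p}" for J
  proof -
    have "homog (odd (\<Sum>k=1..p. if k \<in> J then 1 else 0 :: nat)) (oprod 1 p (?f J))"
      by (rule homog_oprod) (use that homog_th in auto)
    then show ?thesis by blast
  qed
  obtain c1 where c1: "oprod 1 p (?f ?M) * oprod 1 p (?f I) = smul c1 (oprod 1 p (?f I) * oprod 1 p (?f ?M))"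
  proof -
    obtain \<epsilon> \<delta> where "homog \<epsilon> (oprod 1 p (?f ?M))" "homog \<delta> (oprod 1 p (?f I))"
      using hom[OF Ip(1)] hom[OF Ip(2)] by auto
    then show ?thesis
      using that homog_swap by blast
  qed
  let ?a = "card ?M" and ?b = "card I"
  have card: "card (I \<union> ?M) = ?a + ?b"
    using fin IM by (subst card_Un_disjoint) auto
  have "?d ^ (?a + ?b) * (Delta2 m j p * detX p j I) = (?d ^ ?a * detX p j ?M) * (?d ^ ?b * detX p j I)"
  proof -
    have "?d ^ ?b * (detX p j ?M * x) = detX p j ?M * (?d ^ ?b * x)" for x
      by (rule homog_central_left[OF homog_power[OF homog_Delta], symmetric])
    then show ?thesis
      unfolding Delta2_detX by (simp only: power_add mult.assoc)
  qed
  also have "\<dots> = smul (fact ?a * fact ?b * c1) (?d * (?d * oprod 1 p (?f (I \<union> ?M))))"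
  proof -
    have "oprod 1 p (?f ?M) * (?d * x) = ?d * (oprod 1 p (?f ?M) * x)" for x
      by (rule homog_central_left[OF homog_Delta])
    then show ?thesis
      unfolding detX_product[OF Ip(1)] detX_product[OF Ip(2)] OU
      by (simp only: smul_mult mult.assoc c1 spoly.scale_scale mult.left_commute[where 'a = complex])
  qed
  also have "\<dots> = ?d ^ (?a + ?b) * smul (fact ?a * fact ?b * c1 / fact (?a + ?b)) (?d * detX p j (I \<union> ?M))"
  proof -
    have "?d ^ (?a + ?b) * (?d * detX p j (I \<union> ?M)) = ?d * (?d ^ (?a + ?b) * detX p j (I \<union> ?M))"
      by (rule homog_central_left[OF homog_Delta])
    then show ?thesis
      using detX_product[OF Ip(3), of j] unfolding card by simp
  qed
  finally show ?thesis
    using nzd_cancel[OF nzd_power[OF nzd_Delta]] by blast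
qed

lemma poly_vars_mem:
  "l \<in> {1..m} \<Longrightarrow> i \<in> {1..p} \<Longrightarrow> Inl (X l i) \<in> poly_vars p q m n"
  "k \<in> {1..n} \<Longrightarrow> j \<in> {1..q} \<Longrightarrow> Inl (Y k j) \<in> poly_vars p q m n"
  "l \<in> {1..m} \<Longrightarrow> j \<in> {1..q} \<Longrightarrow> Inr (Xi l j) \<in> poly_vars p q m n"
  "k \<in> {1..n} \<Longrightarrow> i \<in> {1..p} \<Longrightarrow> Inr (Eta k i) \<in> poly_vars p q m n"
proof -
  have *: "zvar s c \<in> poly_vars p q m n" if "s \<in> gl_ix m n" "c \<in> gl_ix p q" for s c
    using that unfolding poly_vars_def by blast
  show "l \<in> {1..m} \<Longrightarrow> i \<in> {1..p} \<Longrightarrow> Inl (X l i) \<in> poly_vars p q m n"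
    using *[of "Inl l" "Inl i"] by (simp add: gl_ix_def)
  show "k \<in> {1..n} \<Longrightarrow> j \<in> {1..q} \<Longrightarrow> Inl (Y k j) \<in> poly_vars p q m n"
    using *[of "Inr k" "Inr j"] by (simp add: gl_ix_def)
  show "l \<in> {1..m} \<Longrightarrow> j \<in> {1..q} \<Longrightarrow> Inr (Xi l j) \<in> poly_vars p q m n"
    using *[of "Inl l" "Inr j"] by (simp add: gl_ix_def)
  show "k \<in> {1..n} \<Longrightarrow> i \<in> {1..p} \<Longrightarrow> Inr (Eta k i) \<in> poly_vars p q m n"
    using *[of "Inr k" "Inl i"] by (simp add: gl_ix_def)
qed

text \<open>The factors of one column are adjacent up to sign, and each column gains a factor \<open>det X\<close>. The
  quotient does not involve the extra variables, as their rows are all replaced.\<close>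

lemma Zprod_detX_D_divisible:
  assumes mp: "m \<le> p" and I: "\<And>j. I j \<subseteq> {1..m}"
  shows "u \<le> n \<Longrightarrow> \<exists>H\<in>polyin (poly_vars p q m n). oprod 1 u (\<lambda>j. Delta2 m j p) * oprod 1 u (\<lambda>j. detX p j (I j)) = Delta p ^ u * H"
proof (induction u)
  case 0
  show ?case by (auto intro!: bexI[of _ 1])
next
  case (Suc u)
  let ?Z = "oprod 1 u (\<lambda>j. Delta2 m j p)" and ?T = "oprod 1 u (\<lambda>j. detX p j (I j))" and ?d = "Delta p"
  obtain H where H: "H \<in> polyin (poly_vars p q m n)" "?Z * ?T = ?d ^ u * H"
    using Suc by auto
  obtain c where c: "Delta2 m (Suc u) p * detX p (Suc u) (I (Suc u)) = smul c (?d * detX p (Suc u) (I (Suc u) \<union> {m+1..p}))"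
    using Delta2_detX_divisible[OF mp I] by blast
  have Ip: "I j \<subseteq> {1..p}" for j
    by (rule subset_trans[OF I]) (use mp in auto)
  have "homog (odd (\<Sum>j=1..u. card (I j))) ?T"
    by (rule homog_oprod) (auto intro!: homog_detX Ip simp del: atLeastatMost_subset_iff)
  moreover have "homog (odd (card {m+1..p})) (Delta2 m (Suc u) p)"
    unfolding Delta2_detX by (rule homog_detX) auto
  ultimately obtain e where e: "Delta2 m (Suc u) p * ?T = smul e (?T * Delta2 m (Suc u) p)"
    using homog_swap by blast
  have "oprod 1 (Suc u) (\<lambda>j. Delta2 m j p) * oprod 1 (Suc u) (\<lambda>j. detX p j (I j))
      = ?Z * (Delta2 m (Suc u) p * ?T) * detX p (Suc u) (I (Suc u))"
    by (simp add: oprod_Suc mult.assoc)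
  also have "\<dots> = smul e (?Z * ?T * (Delta2 m (Suc u) p * detX p (Suc u) (I (Suc u))))"
    unfolding e by (simp add: mult.assoc)
  also have "\<dots> = smul (e * c) (?d ^ u * (H * ?d) * detX p (Suc u) (I (Suc u) \<union> {m+1..p}))"
    unfolding H c by (simp add: mult.assoc)
  also have "\<dots> = ?d ^ Suc u * smul (e * c) (H * detX p (Suc u) (I (Suc u) \<union> {m+1..p}))"
    by (simp add: homog_central[OF homog_Delta, of p H, symmetric] mult.assoc power_Suc2 del: power_Suc)
  finally have *: "oprod 1 (Suc u) (\<lambda>j. Delta2 m j p) * oprod 1 (Suc u) (\<lambda>j. detX p j (I j)) = ?d ^ Suc u * smul (e * c) (H * detX p (Suc u) (I (Suc u) \<union> {m+1..p}))" .
  have "detX p (Suc u) (I (Suc u) \<union> {m+1..p}) \<in> polyin (poly_vars p q m n)"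
    unfolding detX_def
  proof (rule polyin_sdet)
    fix l i assume l: "l \<in> {1..p}" and i: "i \<in> {1..p}"
    show "(if l \<in> I (Suc u) \<union> {m+1..p} then etav (Suc u) i else xv l i) \<in> polyin (poly_vars p q m n)"
      using l i Suc.prems by (auto intro!: polyin_gen poly_vars_mem)
  qed
  with H(1) have "smul (e * c) (H * detX p (Suc u) (I (Suc u) \<union> {m+1..p})) \<in> polyin (poly_vars p q m n)"
    by (intro polyin_smul polyin_mult)
  with * show ?case by blast
qed

lemma polyin_detY_D:
  assumes D: "D \<in> marked_diagrams m s \<mu>" and mu: "\<And>i. i \<in> {1..s} \<Longrightarrow> \<mu> i \<le> n \<and> \<mu> i \<le> q"
  shows "detY_D s \<mu> D \<in> polyin (poly_vars p q m n)"
  unfolding detY_D_def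
proof (rule polyin_oprod)
  fix i assume i: "1 \<le> i" "i \<le> s"
  show "detY_diagram \<mu> D i \<in> polyin (poly_vars p q m n)"
    unfolding detY_diagram_def
  proof (rule polyin_sdet)
    fix c j assume c: "c \<in> {1..\<mu> i}" and j: "j \<in> {1..\<mu> i}"
    show "(if \<exists>k. (i, c, k) \<in> D then xiv (THE k. (i, c, k) \<in> D) j else yv c j) \<in> polyin (poly_vars p q m n)"
    proof (cases "\<exists>k. (i, c, k) \<in> D")
      case True
      then obtain k where k: "(i, c, k) \<in> D" by blast
      then have "(THE k. (i, c, k) \<in> D) = k"
        using D by (intro the_equality) (auto simp: marked_diagrams_def)
      moreover have "k \<in> {1..m}"
        using D k by (auto simp: marked_diagrams_def)
      ultimately show ?thesis
        using True mu[of i] i j by (auto intro!: polyin_gen poly_vars_mem)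
    next
      case False
      with mu[of i] i j c show ?thesis
        by (auto intro!: polyin_gen poly_vars_mem)
    qed
  qed
qed

text \<open>Divisibility makes the quotient that defines \<open>\<Gamma>\<close> exist, and \<open>det X\<close> is not a zero divisor; the
  remaining power of \<open>det X\<close> clears the denominators of the changed variables.\<close>

theorem Gamma_factorisation:
  assumes mp: "m \<le> p" and mu: "\<forall>i\<in>{1..s}. \<mu> i \<le> \<mu> 1" and nq: "\<mu> 1 \<le> n" "\<mu> 1 \<le> q"
  shows "Gamma p m s \<mu> \<in> polyin (poly_vars p q m n)"
    and "Delta p ^ (\<Sum>i=1..s. \<mu> i) * Gamma p m s \<mu> = oprod 1 (\<mu> 1) (\<lambda>j. Delta2 m j p) * oprod 1 s (\<lambda>i. sdet (\<mu> i) (yhat p m))"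
proof -
  let ?S = "poly_vars p q m n" and ?d = "Delta p" and ?nb = "\<Sum>i=1..s. \<mu> i"
  let ?M = "marked_diagrams m s \<mu>"
  have Z: "Zprod p m \<mu> = oprod 1 (\<mu> 1) (\<lambda>j. Delta2 m j p)"
    by (simp add: Zprod_def Delta2_detX)
  have "\<exists>H. H \<in> polyin ?S \<and> Zprod p m \<mu> * detX_D p \<mu> D = ?d ^ \<mu> 1 * H" if "D \<in> ?M" for D
  proof -
    have "marked_rows D j \<subseteq> {1..m}" for j
      using that by (auto simp: marked_diagrams_def marked_rows_def)
    then show ?thesis
      using Zprod_detX_D_divisible[OF mp _ nq(1), of "marked_rows D" q] unfolding Z detX_D_def by blast
  qed
  then obtain H where H: "\<And>D. D \<in> ?M \<Longrightarrow> H D \<in> polyin ?S \<and> Zprod p m \<mu> * detX_D p \<mu> D = ?d ^ \<mu> 1 * H D"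
    by metis
  define S where "S = (\<Sum>D\<in>?M. smul (coeff_D m s \<mu> D) (Zprod p m \<mu> * detX_D p \<mu> D * detY_D s \<mu> D))"
  define G where "G = (\<Sum>D\<in>?M. smul (coeff_D m s \<mu> D) (H D * detY_D s \<mu> D))"
  have G: "?d ^ \<mu> 1 * G = S"
    unfolding G_def S_def sum_distrib_left
    by (rule sum.cong[OF refl]) (use H in \<open>simp add: mult.assoc\<close>)
  have "Gamma p m s \<mu> = G"
    unfolding Gamma_def
  proof (rule the_equality)
    show "sdet p xv ^ \<mu> 1 * G = (\<Sum>D\<in>?M. smul (coeff_D m s \<mu> D) (Zprod p m \<mu> * detX_D p \<mu> D * detY_D s \<mu> D))"
      using G by (simp add: S_def Delta_def)
    fix G' assume "sdet p xv ^ \<mu> 1 * G' = (\<Sum>D\<in>?M. smul (coeff_D m s \<mu> D) (Zprod p m \<mu> * detX_D p \<mu> D * detY_D s \<mu> D))"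
    then have "?d ^ \<mu> 1 * G' = ?d ^ \<mu> 1 * G"
      using G by (simp add: S_def Delta_def)
    then show "G' = G"
      by (rule nzd_cancel[OF nzd_power[OF nzd_Delta]])
  qed
  moreover have "G \<in> polyin ?S"
    unfolding G_def
    by (intro polyin_sum polyin_smul polyin_mult polyin_detY_D)
       (use H mu nq in \<open>auto intro: order_trans dest: bspec\<close>)
  ultimately show "Gamma p m s \<mu> \<in> polyin ?S"
    by simp
  have dc: "x * ?d ^ k = ?d ^ k * x" for x k
    by (rule homog_central[symmetric]) (rule homog_power, rule homog_Delta)
  have S: "S = Zprod p m \<mu> * (\<Sum>D\<in>?M. smul (coeff_D m s \<mu> D) (detX_D p \<mu> D * detY_D s \<mu> D))"
    unfolding S_def sum_distrib_left by (rule sum.cong[OF refl]) (simp add: mult.assoc)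
  have "?d ^ \<mu> 1 * (?d ^ ?nb * G) = ?d ^ ?nb * S"
    unfolding G[symmetric] by (rule homog_central_left[OF homog_power[OF homog_Delta]])
  also have "\<dots> = Zprod p m \<mu> * (?d ^ ?nb * (\<Sum>D\<in>?M. smul (coeff_D m s \<mu> D) (detX_D p \<mu> D * detY_D s \<mu> D)))"
    unfolding S by (rule homog_central_left[OF homog_power[OF homog_Delta], symmetric])
  also have "\<dots> = ?d ^ \<mu> 1 * (Zprod p m \<mu> * oprod 1 s (\<lambda>i. sdet (\<mu> i) (yhat p m)))"
    unfolding Gamma_sum[OF mp mu] by (rule homog_central_left[OF homog_power[OF homog_Delta]])
  finally have "?d ^ ?nb * G = Zprod p m \<mu> * oprod 1 s (\<lambda>i. sdet (\<mu> i) (yhat p m))"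
    by (rule nzd_cancel[OF nzd_power[OF nzd_Delta]])
  with \<open>Gamma p m s \<mu> = G\<close> show "?d ^ ?nb * Gamma p m s \<mu> = oprod 1 (\<mu> 1) (\<lambda>j. Delta2 m j p) * oprod 1 s (\<lambda>i. sdet (\<mu> i) (yhat p m))"
    by (simp add: Z)
qed

section \<open>The two commuting actions\<close>

lemma zvar_eq [simp]: "zvar s c = zvar s' c' \<longleftrightarrow> s = s' \<and> c = c'"
  by (cases s; cases c; cases s'; cases c') auto

lemma par_simps [simp]: "par (Inl i) = False" "par (Inr j) = True"
  by (simp_all add: par_def)

lemma gpar_zvar: "gpar (zvar s c) \<longleftrightarrow> (par s \<noteq> par c)"
  by (cases s; cases c) (auto simp: gpar_def)

lemma finite_gl_ix [simp]: "finite (gl_ix p q)"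
  by (simp add: gl_ix_def)

lemma gl_ix_iff [simp]: "Inl i \<in> gl_ix p q \<longleftrightarrow> 1 \<le> i \<and> i \<le> p" "Inr j \<in> gl_ix p q \<longleftrightarrow> 1 \<le> j \<and> j \<le> q"
  by (auto simp: gl_ix_def)

lemma zvar_poly_vars [simp]: "zvar s c \<in> poly_vars p q m n \<longleftrightarrow> s \<in> gl_ix m n \<and> c \<in> gl_ix p q"
  by (auto simp: poly_vars_def)

lemma var_cases: obtains s c where "v = zvar s c" | i k c where "v = Inr (Mark i k c)"
proof (cases v)
  case (Inl u)
  then show ?thesis
  proof (cases u)
    case (X l i)
    then show ?thesis using Inl that(1)[of "Inl l" "Inl i"] by simp
  next
    case (Y k j)
    then show ?thesis using Inl that(1)[of "Inr k" "Inr j"] by simp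
  qed
next
  case (Inr u)
  then show ?thesis
  proof (cases u)
    case (Xi l j)
    then show ?thesis using Inr that(1)[of "Inl l" "Inr j"] by simp
  next
    case (Eta k i)
    then show ?thesis using Inr that(1)[of "Inr k" "Inl i"] by simp
  qed (use Inr that(2) in simp)
qed

lemma zvar_Mark [simp]: "zvar s c \<noteq> Inr (Mark i k d)" "Inr (Mark i k d) \<noteq> zvar s c"
  by (cases s; cases c; simp)+

lemma epar_sym: "epar a b = epar b a"
  by (auto simp: epar_def)

lemma sder_left: "sder (epar a b) (left_action m n a b)"
  unfolding left_action_def
proof (rule sder_Sum)
  fix s
  have "sder (gpar (zvar s a) \<noteq> gpar (zvar s b)) (\<lambda>f. gen (zvar s a) * pdiff (zvar s b) f)"
    by (intro sder_times sder_pdiff homog_gen)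
  moreover have "(gpar (zvar s a) \<noteq> gpar (zvar s b)) = epar a b"
    by (auto simp: gpar_zvar epar_def)
  ultimately show "sder (epar a b) (\<lambda>f. gen (zvar s a) * pdiff (zvar s b) f)"
    by simp
qed

lemma sder_right: "sder (epar s t) (right_action p q s t)"
  unfolding right_action_def
proof (rule sder_Sum, rule sder_scale)
  fix c
  have "sder (gpar (zvar s c) \<noteq> gpar (zvar t c)) (\<lambda>f. gen (zvar s c) * pdiff (zvar t c) f)"
    by (intro sder_times sder_pdiff homog_gen)
  moreover have "(gpar (zvar s c) \<noteq> gpar (zvar t c)) = epar s t"
    by (auto simp: gpar_zvar epar_def)
  ultimately show "sder (epar s t) (\<lambda>f. gen (zvar s c) * pdiff (zvar t c) f)"
    by simp
qed

lemma left_gen: "left_action m n a b (gen (zvar s c)) = (if c = b \<and> s \<in> gl_ix m n then gen (zvar s a) else 0)"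
proof -
  have "left_action m n a b (gen (zvar s c)) = (\<Sum>s'\<in>gl_ix m n. if s' = s then (if c = b then gen (zvar s a) else 0) else 0)"
    unfolding left_action_def by (rule sum.cong) (auto simp: pdiff_gen_gen)
  then show ?thesis by simp
qed

lemma left_gen_Mark: "left_action m n a b (gen (Inr (Mark i k c))) = 0"
  unfolding left_action_def by (rule sum.neutral) (simp add: pdiff_gen_gen del: pdiff_simps)

lemma right_gen: "right_action p q s t (gen (zvar u c)) = (if u = t \<and> c \<in> gl_ix p q then smul (ksign (epar s t) (par c)) (gen (zvar s c)) else 0)"
proof -
  have "right_action p q s t (gen (zvar u c)) = (\<Sum>c'\<in>gl_ix p q. if c' = c then (if u = t then smul (ksign (epar s t) (par c)) (gen (zvar s c)) else 0) else 0)"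
    unfolding right_action_def by (rule sum.cong) (auto simp: pdiff_gen_gen)
  then show ?thesis by simp
qed

lemma right_gen_Mark: "right_action p q s t (gen (Inr (Mark i k c))) = 0"
  unfolding right_action_def by (rule sum.neutral) (simp add: pdiff_gen_gen del: pdiff_simps)

lemmas act_gens = left_gen left_gen_Mark right_gen right_gen_Mark

lemma homog_gen_eq: "\<epsilon> = gpar v \<Longrightarrow> homog \<epsilon> (gen v)"
  using homog_gen by simp

lemma pshift_left: "pshift (epar a b) (left_action m n a b)"
proof (rule pshift_sderI[OF sder_left])
  fix v show "homog (epar a b \<noteq> gpar v) (left_action m n a b (gen v))"
    by (cases v rule: var_cases) (auto simp: act_gens gpar_zvar epar_def intro!: homog_gen_eq)
qed

lemma pshift_right: "pshift (epar s t) (right_action p q s t)"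
proof (rule pshift_sderI[OF sder_right])
  fix v show "homog (epar s t \<noteq> gpar v) (right_action p q s t (gen v))"
    by (cases v rule: var_cases) (auto simp: act_gens gpar_zvar epar_def intro!: homog_gen_eq homog_smul)
qed

lemma sder_if: "(P \<Longrightarrow> sder \<epsilon> D) \<Longrightarrow> sder \<epsilon> (\<lambda>f. if P then D f else 0)"
  by (cases P) (auto simp: sder_zero)

text \<open>Both sides are superderivations, so only the values on the variables matter; likewise for the
  other relations between the two actions.\<close>

lemma left_comm:
  "left_action m n a b (left_action m n c d f) - smul (ksign (epar a b) (epar c d)) (left_action m n c d (left_action m n a b f))
   = (if b = c then left_action m n a d f else 0) - smul (ksign (epar a b) (epar c d)) (if a = d then left_action m n c b f else 0)"
proof (rule sder_eqI[where D = "\<lambda>f. left_action m n a b (left_action m n c d f) - smul (ksign (epar a b) (epar c d)) (left_action m n c d (left_action m n a b f))"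
      and D' = "\<lambda>f. (if b = c then left_action m n a d f else 0) - smul (ksign (epar a b) (epar c d)) (if a = d then left_action m n c b f else 0)"
      and \<epsilon> = "epar a b \<noteq> epar c d"])
  show "sder (epar a b \<noteq> epar c d) (\<lambda>f. left_action m n a b (left_action m n c d f) - smul (ksign (epar a b) (epar c d)) (left_action m n c d (left_action m n a b f)))"
    by (intro sder_supercommutator sder_left pshift_left)
  have "sder (epar a b \<noteq> epar c d) (left_action m n a d)" if "b = c"
  proof -
    have "epar a d = (epar a b \<noteq> epar c d)"
      using that by (auto simp: epar_def)
    then show ?thesis
      using sder_left[of a d m n] by (simp only:)
  qed
  moreover have "sder (epar a b \<noteq> epar c d) (left_action m n c b)" if "a = d"
  proof -
    have "epar c b = (epar a b \<noteq> epar c d)"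
      using that by (auto simp: epar_def)
    then show ?thesis
      using sder_left[of c b m n] by (simp only:)
  qed
  ultimately show "sder (epar a b \<noteq> epar c d) (\<lambda>f. (if b = c then left_action m n a d f else 0) - smul (ksign (epar a b) (epar c d)) (if a = d then left_action m n c b f else 0))"
    by (intro sder_diff sder_scale sder_if)
  fix v
  show "left_action m n a b (left_action m n c d (gen v)) - smul (ksign (epar a b) (epar c d)) (left_action m n c d (left_action m n a b (gen v)))
   = (if b = c then left_action m n a d (gen v) else 0) - smul (ksign (epar a b) (epar c d)) (if a = d then left_action m n c b (gen v) else 0)"
    by (cases v rule: var_cases) (auto simp: act_gens sder_0[OF sder_left])
qed

lemma ksign_epar: "ksign (epar u v) (par c) * ksign (epar s u) (par c) = ksign (epar s v) (par c)"
  by (auto simp: ksign_def epar_def)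

lemma right_comm:
  "right_action p q a b (right_action p q c d f) - smul (ksign (epar a b) (epar c d)) (right_action p q c d (right_action p q a b f))
   = (if b = c then right_action p q a d f else 0) - smul (ksign (epar a b) (epar c d)) (if a = d then right_action p q c b f else 0)"
proof (rule sder_eqI[where D = "\<lambda>f. right_action p q a b (right_action p q c d f) - smul (ksign (epar a b) (epar c d)) (right_action p q c d (right_action p q a b f))"
      and D' = "\<lambda>f. (if b = c then right_action p q a d f else 0) - smul (ksign (epar a b) (epar c d)) (if a = d then right_action p q c b f else 0)"
      and \<epsilon> = "epar a b \<noteq> epar c d"])
  show "sder (epar a b \<noteq> epar c d) (\<lambda>f. right_action p q a b (right_action p q c d f) - smul (ksign (epar a b) (epar c d)) (right_action p q c d (right_action p q a b f)))"
    by (intro sder_supercommutator sder_right pshift_right)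
  have "sder (epar a b \<noteq> epar c d) (right_action p q a d)" if "b = c"
  proof -
    have "epar a d = (epar a b \<noteq> epar c d)"
      using that by (auto simp: epar_def)
    then show ?thesis
      using sder_right[of a d p q] by (simp only:)
  qed
  moreover have "sder (epar a b \<noteq> epar c d) (right_action p q c b)" if "a = d"
  proof -
    have "epar c b = (epar a b \<noteq> epar c d)"
      using that by (auto simp: epar_def)
    then show ?thesis
      using sder_right[of c b p q] by (simp only:)
  qed
  ultimately show "sder (epar a b \<noteq> epar c d) (\<lambda>f. (if b = c then right_action p q a d f else 0) - smul (ksign (epar a b) (epar c d)) (if a = d then right_action p q c b f else 0))"
    by (intro sder_diff sder_scale sder_if)
  fix v
  show "right_action p q a b (right_action p q c d (gen v)) - smul (ksign (epar a b) (epar c d)) (right_action p q c d (right_action p q a b (gen v)))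
   = (if b = c then right_action p q a d (gen v) else 0) - smul (ksign (epar a b) (epar c d)) (if a = d then right_action p q c b (gen v) else 0)"
  proof (cases v rule: var_cases)
    case (1 s e)
    have "ksign (epar c d) (par e) * ksign (epar a c) (par e) = ksign (epar a d) (par e)"
      "ksign (epar a b) (par e) * ksign (epar c a) (par e) = ksign (epar c b) (par e)"
      by (rule ksign_epar)+
    then show ?thesis
      using 1 by (auto simp: act_gens sder_0[OF sder_right] sder_smul[OF sder_right])
  qed (auto simp: act_gens sder_0[OF sder_right])
qed

text \<open>The sign in the right action is chosen to make the two actions supercommute.\<close>

lemma left_right:
  assumes "a \<in> gl_ix p q" "b \<in> gl_ix p q" "s \<in> gl_ix m n" "t \<in> gl_ix m n"
  shows "left_action m n a b (right_action p q s t f) = smul (ksign (epar a b) (epar s t)) (right_action p q s t (left_action m n a b f))"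
proof -
  have "left_action m n a b (right_action p q s t f) - smul (ksign (epar a b) (epar s t)) (right_action p q s t (left_action m n a b f)) = 0"
  proof (rule sder_eqI[where D = "\<lambda>f. left_action m n a b (right_action p q s t f) - smul (ksign (epar a b) (epar s t)) (right_action p q s t (left_action m n a b f))"
        and D' = "\<lambda>f. 0"])
    show "sder (epar a b \<noteq> epar s t) (\<lambda>f. left_action m n a b (right_action p q s t f) - smul (ksign (epar a b) (epar s t)) (right_action p q s t (left_action m n a b f)))"
      by (intro sder_supercommutator sder_left sder_right pshift_left pshift_right)
    fix v
    have "ksign (epar s t) (par b) = ksign (epar a b) (epar s t) * ksign (epar s t) (par a)"
      by (auto simp: ksign_def epar_def)
    then show "left_action m n a b (right_action p q s t (gen v)) - smul (ksign (epar a b) (epar s t)) (right_action p q s t (left_action m n a b (gen v))) = 0"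
      using assms by (cases v rule: var_cases) (auto simp: act_gens sder_0[OF sder_left] sder_0[OF sder_right] sder_smul[OF sder_left])
  qed (rule sder_zero)
  then show ?thesis by simp
qed

lemma left_adj: "ip (left_action m n a b f) g = ip f (left_action m n b a g)"
  unfolding left_action_def by (simp add: ip_sum_left ip_sum_right ip_gen ip_gen_right)

lemma right_adj: "ip (right_action p q s t f) g = ip f (right_action p q t s g)"
  unfolding right_action_def
  by (simp add: ip_sum_left ip_sum_right ip_smul_left ip_smul_right ip_gen ip_gen_right)
     (auto intro!: sum.cong simp: ksign_def epar_sym)

lemma left_polyin: "a \<in> gl_ix p q \<Longrightarrow> f \<in> polyin (poly_vars p q m n) \<Longrightarrow> left_action m n a b f \<in> polyin (poly_vars p q m n)"
  unfolding left_action_def by (intro polyin_sum polyin_gen_mult polyin_pdiff) auto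

lemma right_polyin: "s \<in> gl_ix m n \<Longrightarrow> f \<in> polyin (poly_vars p q m n) \<Longrightarrow> right_action p q s t f \<in> polyin (poly_vars p q m n)"
  unfolding right_action_def by (intro polyin_sum polyin_smul polyin_gen_mult polyin_pdiff) auto

lemma poly_part_iff: "f \<in> poly_part p q m n \<epsilon> \<longleftrightarrow> f \<in> polyin (poly_vars p q m n) \<and> homog \<epsilon> f"
proof -
  have "homog \<epsilon> f \<longleftrightarrow> (\<forall>k. coeff f k \<noteq> 0 \<longrightarrow> (odd (fcard (snd k)) \<longleftrightarrow> \<epsilon>))"
  proof
    assume *: "homog \<epsilon> f"
    show "\<forall>k. coeff f k \<noteq> 0 \<longrightarrow> (odd (fcard (snd k)) \<longleftrightarrow> \<epsilon>)"
    proof (intro allI impI)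
      fix k assume k: "coeff f k \<noteq> 0"
      have "coeff (iota f) k = coeff (smul (ksign \<epsilon> True) f) k"
        using * by (simp only: homog_def)
      with k have "(-1) ^ fcard (snd k) = ksign \<epsilon> True"
        by (simp add: coeff_iota)
      then show "odd (fcard (snd k)) \<longleftrightarrow> \<epsilon>"
        by (cases \<epsilon>; cases "even (fcard (snd k))") auto
    qed
  next
    assume *: "\<forall>k. coeff f k \<noteq> 0 \<longrightarrow> (odd (fcard (snd k)) \<longleftrightarrow> \<epsilon>)"
    show "homog \<epsilon> f"
      unfolding homog_def
    proof (rule spoly_eqI)
      fix k show "coeff (iota f) k = coeff (smul (ksign \<epsilon> True) f) k"
        using *[rule_format, of k] by (cases "coeff f k = 0"; cases \<epsilon>) (auto simp: coeff_iota)
    qed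
  qed
  then show ?thesis
    unfolding poly_part_def polyin_def keys_coeffs mem_Collect_eq by blast
qed

text \<open>The component of parity \<open>\<epsilon>\<close>.\<close>

definition epart :: "bool \<Rightarrow> spoly \<Rightarrow> spoly" where
  "epart \<epsilon> f = smul (1/2) (f + smul (ksign \<epsilon> True) (iota f))"

lemma epart_sum: "epart False f + epart True f = f"
proof -
  have "epart False f + epart True f = smul (1/2) (f + f)"
    by (simp add: epart_def flip: spoly.scale_right_distrib)
  also have "\<dots> = f"
    by (simp add: spoly.scale_right_distrib flip: spoly.scale_left_distrib)
  finally show ?thesis .
qed

lemma homog_epart: "homog \<epsilon> (epart \<epsilon> f)"
  by (cases \<epsilon>) (simp_all add: homog_def epart_def iota_smul iota_add iota_uminus iota_diff add.commute flip: spoly.scale_minus_right)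

lemma polyin_iota: "f \<in> polyin S \<Longrightarrow> iota f \<in> polyin S"
  by (auto simp: polyin_coeff coeff_iota)

lemma polyin_epart: "f \<in> polyin S \<Longrightarrow> epart \<epsilon> f \<in> polyin S"
  unfolding epart_def by (intro polyin_smul polyin_add polyin_iota)

lemma homog_sum_0:
  assumes "homog \<epsilon> x" "homog (\<not> \<epsilon>) y" "x + y = 0"
  shows "x = 0" "y = 0"
proof -
  have "iota (x + y) = 0" using assms(3) by simp
  then have "x - y = 0"
    using assms(1,2) by (cases \<epsilon>) (auto simp: iota_add homog_def)
  with assms(3) have "x + x = 0 + 0"
    by (metis add.right_neutral add_diff_cancel_left' diff_0_right diff_add_cancel diff_eq_eq)
  then show "x = 0" by (rule half_twice)
  with assms(3) show "y = 0" by simp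
qed

lemma carr_left_poly: "carr (left_poly p q m n) = polyin (poly_vars p q m n)"
proof (intro subset_antisym subsetI)
  fix x assume x: "x \<in> polyin (poly_vars p q m n)"
  then have "epart False x \<in> poly_part p q m n False" "epart True x \<in> poly_part p q m n True"
    by (auto simp: poly_part_iff homog_epart polyin_epart)
  then show "x \<in> carr (left_poly p q m n)"
    unfolding carr_def left_poly_def using epart_sum[of x] by force
qed (auto simp: carr_def left_poly_def poly_part_iff polyin_add)

lemma carr_right_poly: "carr (right_poly p q m n) = polyin (poly_vars p q m n)"
  using carr_left_poly by (simp add: carr_def left_poly_def right_poly_def)

subsection \<open>The Euler operator\<close>

lift_definition Deg :: "spoly \<Rightarrow> spoly" is
  "\<lambda>f. \<Sum>k\<in>Poly_Mapping.keys f. Poly_Mapping.single k (of_nat (mono_degree k) * Poly_Mapping.lookup f k)" .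

lemma coeff_Deg: "coeff (Deg f) k = of_nat (mono_degree k) * coeff f k"
  unfolding coeff_def Deg.rep_eq
  by (simp add: lookup_sum lookup_single when_def in_keys_iff)

lemma Deg_lin: "Deg (f + g) = Deg f + Deg g" "Deg (smul c f) = smul c (Deg f)"
  by (rule spoly_eqI; simp add: coeff_Deg algebra_simps)+

lemma Deg_smonom: "Deg (smonom a A) = smul (of_nat (mono_degree (a, A))) (smonom a A)"
  by (rule spoly_eqI) (auto simp: coeff_Deg coeff_smonom)

lemma mono_degree_single_add: "mono_degree (Poly_Mapping.single v 1 + a, A) = Suc (mono_degree (a, A))"
proof -
  let ?K = "insert v (Poly_Mapping.keys a)"
  have "(\<Sum>u\<in>Poly_Mapping.keys a. Poly_Mapping.lookup a u) = (\<Sum>u\<in>?K. Poly_Mapping.lookup a u)"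
    by (rule sum.mono_neutral_left) (auto simp: in_keys_iff)
  moreover have "(\<Sum>u\<in>?K. Poly_Mapping.lookup (Poly_Mapping.single v 1 + a) u) = (\<Sum>u\<in>?K. Poly_Mapping.lookup a u + (if u = v then 1 else 0))"
    by (rule sum.cong) (auto simp: lookup_add lookup_single when_def)
  ultimately show ?thesis
    by (simp add: mono_degree_def keys_single_add sum.distrib)
qed

lemma Deg_gen: "Deg (gen v * f) = gen v * f + gen v * Deg f"
proof (induction f rule: spoly_lin_induct)
  case (mono a A)
  show ?case
  proof (cases v)
    case (Inl u)
    then show ?thesis
      by (simp add: gen_Inl_smonom Deg_smonom mono_degree_single_add spoly.scale_left_distrib)
  next
    case (Inr u)
    have "mono_degree (a, finsert u A) = Suc (mono_degree (a, A))" if "u |\<notin>| A"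
      using that by (simp add: mono_degree_def fcard_finsert_disjoint)
    moreover have "Deg 0 = 0"
      by (rule spoly_eqI) (simp add: coeff_Deg)
    ultimately show ?thesis
      using Inr by (simp add: gen_Inr_smonom Deg_smonom Deg_lin spoly.scale_left_distrib spoly.scale_right_distrib distrib_left mult.commute)
  qed
qed (simp_all add: Deg_lin distrib_left spoly.scale_right_distrib)

lemma euler_left:
  assumes "f \<in> polyin (poly_vars p q m n)"
  shows "(\<Sum>a\<in>gl_ix p q. left_action m n a a f) = Deg f"
proof -
  let ?E = "\<lambda>f. \<Sum>a\<in>gl_ix p q. left_action m n a a f"
  have "sder (epar a a) (left_action m n a a)" for a
    by (rule sder_left)
  then have "sder False (left_action m n a a)" for a
    by (simp add: epar_def)
  then have E: "sder False ?E"
    by (intro sder_Sum)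
  have g: "?E (gen v) = gen v" if v: "v \<in> poly_vars p q m n" for v
  proof -
    obtain s c where *: "v = zvar s c" "s \<in> gl_ix m n" "c \<in> gl_ix p q"
      using v by (auto simp: poly_vars_def)
    then have "?E (gen v) = (\<Sum>a\<in>gl_ix p q. if a = c then gen v else 0)"
      by (intro sum.cong) (auto simp: act_gens)
    with * show ?thesis by simp
  qed
  have D1: "Deg 1 = 0"
    by (simp add: one_smonom Deg_smonom mono_degree_def fcard_fempty)
  show ?thesis
    using assms
    by (induction f rule: polyin_induct)
       (simp_all add: sder_1[OF E] sder_add[OF E] sder_smul[OF E] sder_mult[OF E] Deg_lin Deg_gen D1 g)
qed

lemma euler_right:
  assumes "f \<in> polyin (poly_vars p q m n)"
  shows "(\<Sum>s\<in>gl_ix m n. right_action p q s s f) = Deg f"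
proof -
  let ?E = "\<lambda>f. \<Sum>s\<in>gl_ix m n. right_action p q s s f"
  have "sder (epar a a) (right_action p q a a)" for a
    by (rule sder_right)
  then have "sder False (right_action p q a a)" for a
    by (simp add: epar_def)
  then have E: "sder False ?E"
    by (intro sder_Sum)
  have g: "?E (gen v) = gen v" if v: "v \<in> poly_vars p q m n" for v
  proof -
    obtain s c where *: "v = zvar s c" "s \<in> gl_ix m n" "c \<in> gl_ix p q"
      using v by (auto simp: poly_vars_def)
    then have "?E (gen v) = (\<Sum>a\<in>gl_ix m n. if a = s then gen v else 0)"
      by (intro sum.cong) (auto simp: act_gens epar_def)
    with * show ?thesis by simp
  qed
  have D1: "Deg 1 = 0"
    by (simp add: one_smonom Deg_smonom mono_degree_def fcard_fempty)
  show ?thesis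
    using assms
    by (induction f rule: polyin_induct)
       (simp_all add: sder_1[OF E] sder_add[OF E] sder_smul[OF E] sder_mult[OF E] Deg_lin Deg_gen D1 g)
qed

lemma homogeneous_Deg: "f \<in> homogeneous d \<longleftrightarrow> Deg f = smul (of_nat d) f"
proof
  assume *: "f \<in> homogeneous d"
  show "Deg f = smul (of_nat d) f"
  proof (rule spoly_eqI)
    fix k show "coeff (Deg f) k = coeff (smul (of_nat d) f) k"
      using * by (cases k; cases "coeff f k = 0") (auto simp: coeff_Deg homogeneous_def keys_coeffs)
  qed
next
  assume *: "Deg f = smul (of_nat d) f"
  show "f \<in> homogeneous d"
    unfolding homogeneous_def keys_coeffs
  proof (clarify)
    fix a A assume "coeff f (a, A) \<noteq> 0"
    moreover have "coeff (Deg f) (a, A) = coeff (smul (of_nat d) f) (a, A)"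
      using * by simp
    ultimately show "mono_degree (a, A) = d"
      by (simp add: coeff_Deg)
  qed
qed

section \<open>Cyclic modules generated by highest weight vectors\<close>

text \<open>The position in the order of the simple roots: \<open>E\<^sub>a\<^sub>b\<close> is a positive root vector if \<open>a\<close> comes before
  \<open>b\<close>.\<close>

definition pos :: "nat \<Rightarrow> idx \<Rightarrow> nat" where
  "pos p = case_sum (\<lambda>i. i) (\<lambda>j. p + j)"

lemma pos_inj: "a \<in> gl_ix p q \<Longrightarrow> b \<in> gl_ix p q \<Longrightarrow> pos p a = pos p b \<Longrightarrow> a = b"
  by (cases a; cases b) (auto simp: pos_def)

lemma pos_surj: "1 \<le> k \<Longrightarrow> k \<le> p + q \<Longrightarrow> \<exists>c\<in>gl_ix p q. pos p c = k"
  by (rule bexI[of _ "if k \<le> p then Inl k else Inr (k - p)"]) (auto simp: pos_def)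

lemma pos_range: "a \<in> gl_ix p q \<Longrightarrow> 1 \<le> pos p a \<and> pos p a \<le> p + q"
  by (cases a) (auto simp: pos_def)

lemma simple_root_pos:
  assumes "a \<in> gl_ix p q" "b \<in> gl_ix p q" "pos p b = Suc (pos p a)"
  shows "(a, b) \<in> simple_roots p q"
proof (cases a; cases b)
  fix i j assume "a = Inl i" "b = Inl j"
  with assms show ?thesis by (auto simp: pos_def simple_roots_def)
next
  fix i j assume "a = Inr i" "b = Inr j"
  with assms show ?thesis by (auto simp: pos_def simple_roots_def)
qed (use assms in \<open>auto simp: pos_def simple_roots_def\<close>)

text \<open>The elements of parity \<open>\<epsilon>\<close> of the algebra of operators generated by the \<open>E\<^sub>a\<^sub>b\<close>.\<close>

inductive gl_alg :: "nat \<Rightarrow> nat \<Rightarrow> (idx \<Rightarrow> idx \<Rightarrow> spoly \<Rightarrow> spoly) \<Rightarrow> bool \<Rightarrow> (spoly \<Rightarrow> spoly) \<Rightarrow> bool" for p q E where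
  id: "gl_alg p q E False (\<lambda>x. x)"
| zero: "gl_alg p q E \<epsilon> (\<lambda>x. 0)"
| comp: "a \<in> gl_ix p q \<Longrightarrow> b \<in> gl_ix p q \<Longrightarrow> gl_alg p q E \<epsilon> A \<Longrightarrow> gl_alg p q E (epar a b \<noteq> \<epsilon>) (\<lambda>x. E a b (A x))"
| add: "gl_alg p q E \<epsilon> A \<Longrightarrow> gl_alg p q E \<epsilon> B \<Longrightarrow> gl_alg p q E \<epsilon> (\<lambda>x. A x + B x)"
| smul: "gl_alg p q E \<epsilon> A \<Longrightarrow> gl_alg p q E \<epsilon> (\<lambda>x. smul c (A x))"

text \<open>Words in negative root vectors, indexed by their total height.\<close>

inductive neg_word :: "nat \<Rightarrow> nat \<Rightarrow> (idx \<Rightarrow> idx \<Rightarrow> spoly \<Rightarrow> spoly) \<Rightarrow> nat \<Rightarrow> (spoly \<Rightarrow> spoly) \<Rightarrow> bool" for p q E where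
  id: "neg_word p q E 0 (\<lambda>x. x)"
| step: "a \<in> gl_ix p q \<Longrightarrow> b \<in> gl_ix p q \<Longrightarrow> pos p b < pos p a \<Longrightarrow> neg_word p q E k Z \<Longrightarrow>
    neg_word p q E (k + (pos p a - pos p b)) (\<lambda>x. E a b (Z x))"

text \<open>The properties shared by the two actions; the theory of cyclic modules is developed once for both.\<close>

locale gl_ops =
  fixes p q :: nat and E :: "idx \<Rightarrow> idx \<Rightarrow> spoly \<Rightarrow> spoly" and S :: "(evar + ovar) set"
  assumes E_sder: "sder (epar a b) (E a b)"
    and E_pshift: "pshift (epar a b) (E a b)"
    and E_comm: "E a b (E c d x) - smul (ksign (epar a b) (epar c d)) (E c d (E a b x))
      = (if b = c then E a d x else 0) - smul (ksign (epar a b) (epar c d)) (if a = d then E c b x else 0)"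
    and E_adj: "ip (E a b x) y = ip x (E b a y)"
    and E_polyin: "a \<in> gl_ix p q \<Longrightarrow> b \<in> gl_ix p q \<Longrightarrow> x \<in> polyin S \<Longrightarrow> E a b x \<in> polyin S"
begin

lemma E_add: "E a b (x + y) = E a b x + E a b y" and E_smul: "E a b (smul c x) = smul c (E a b x)" and E_0: "E a b 0 = 0"
  using sder_add[OF E_sder] sder_smul[OF E_sder] sder_0[OF E_sder] by auto

abbreviation "alg \<equiv> gl_alg p q E"
abbreviation "negw \<equiv> neg_word p q E"

lemma alg_lin: "alg \<epsilon> A \<Longrightarrow> A (x + y) = A x + A y \<and> A (smul c x) = smul c (A x)"
  by (induction rule: gl_alg.induct) (auto simp: E_add E_smul spoly.scale_right_distrib mult.commute)

lemma alg_polyin: "alg \<epsilon> A \<Longrightarrow> x \<in> polyin S \<Longrightarrow> A x \<in> polyin S"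
  by (induction rule: gl_alg.induct) (auto intro: E_polyin polyin_add polyin_smul)

lemma alg_homog: "alg \<epsilon> A \<Longrightarrow> homog \<delta> x \<Longrightarrow> homog (\<epsilon> \<noteq> \<delta>) (A x)"
proof (induction rule: gl_alg.induct)
  case (comp a b \<epsilon> A)
  then have "homog (\<epsilon> \<noteq> \<delta>) (A x)"
    by blast
  then have "homog (epar a b \<noteq> (\<epsilon> \<noteq> \<delta>)) (E a b (A x))"
    by (rule pshift_homog[OF E_pshift E_smul])
  moreover have "(epar a b \<noteq> (\<epsilon> \<noteq> \<delta>)) = ((epar a b \<noteq> \<epsilon>) \<noteq> \<delta>)" by auto
  ultimately show ?case by simp
qed (auto intro: homog_add homog_smul)

lemma alg_E: "a \<in> gl_ix p q \<Longrightarrow> b \<in> gl_ix p q \<Longrightarrow> alg (epar a b) (E a b)"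
  using gl_alg.comp[OF _ _ gl_alg.id, of a p q b E] by (simp add: eta_contract_eq)

lemma alg_comp: "alg \<epsilon> A \<Longrightarrow> alg \<delta> B \<Longrightarrow> alg (\<epsilon> \<noteq> \<delta>) (\<lambda>x. A (B x))"
proof (induction rule: gl_alg.induct)
  case (comp a b \<epsilon> A)
  then have "alg (epar a b \<noteq> (\<epsilon> \<noteq> \<delta>)) (\<lambda>x. E a b (A (B x)))"
    by (intro gl_alg.comp) auto
  moreover have "(epar a b \<noteq> (\<epsilon> \<noteq> \<delta>)) = ((epar a b \<noteq> \<epsilon>) \<noteq> \<delta>)" by auto
  ultimately show ?case by simp
qed (auto intro: gl_alg.intros)

lemma alg_adj: "alg \<epsilon> A \<Longrightarrow> \<exists>B. alg \<epsilon> B \<and> (\<forall>x y. ip (A x) y = ip x (B y))"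
proof (induction rule: gl_alg.induct)
  case (comp a b \<epsilon> A)
  then obtain B where B: "alg \<epsilon> B" "\<And>x y. ip (A x) y = ip x (B y)" by blast
  have "alg (\<epsilon> \<noteq> epar b a) (\<lambda>x. B (E b a x))"
    by (rule alg_comp[OF B(1) alg_E]) (use comp in auto)
  moreover have "(\<epsilon> \<noteq> epar b a) = (epar a b \<noteq> \<epsilon>)"
    by (auto simp: epar_def)
  ultimately show ?case
    by (intro exI[of _ "\<lambda>x. B (E b a x)"]) (simp add: E_adj B)
next
  case (add \<epsilon> A A')
  then obtain B B' where "alg \<epsilon> B" "\<And>x y. ip (A x) y = ip x (B y)" "alg \<epsilon> B'" "\<And>x y. ip (A' x) y = ip x (B' y)" by blast
  then show ?case
    by (intro exI[of _ "\<lambda>x. B x + B' x"]) (auto intro: gl_alg.intros simp: ip_add_left ip_add_right)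
next
  case (smul \<epsilon> A c)
  then obtain B where "alg \<epsilon> B" "\<And>x y. ip (A x) y = ip x (B y)" by blast
  then show ?case
    by (intro exI[of _ "\<lambda>x. smul (cnj c) (B x)"]) (auto intro: gl_alg.intros simp: ip_smul_left ip_smul_right)
qed (auto intro: gl_alg.intros)

text \<open>Operators of mixed parity; a separate record of the even and the odd part keeps signs computable.\<close>

definition ops :: "(spoly \<Rightarrow> spoly) set" where
  "ops = {A. \<exists>A0 A1. alg False A0 \<and> alg True A1 \<and> A = (\<lambda>x. A0 x + A1 x)}"

lemma ops_alg: "alg \<epsilon> A \<Longrightarrow> A \<in> ops"
  unfolding ops_def mem_Collect_eq
  by (cases \<epsilon>) (force intro: gl_alg.zero exI[of _ "\<lambda>x. 0"])+

lemma ops_id: "(\<lambda>x. x) \<in> ops" and ops_E: "a \<in> gl_ix p q \<Longrightarrow> b \<in> gl_ix p q \<Longrightarrow> E a b \<in> ops"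
  using ops_alg[OF gl_alg.id] ops_alg[OF alg_E] by auto

lemma ops_add: assumes "A \<in> ops" "B \<in> ops" shows "(\<lambda>x. A x + B x) \<in> ops"
proof -
  obtain A0 A1 B0 B1 where *: "alg False A0" "alg True A1" "A = (\<lambda>x. A0 x + A1 x)" "alg False B0" "alg True B1" "B = (\<lambda>x. B0 x + B1 x)"
    using assms unfolding ops_def by blast
  have "(\<lambda>x. A x + B x) = (\<lambda>x. (A0 x + B0 x) + (A1 x + B1 x))"
    by (simp add: * algebra_simps)
  then show ?thesis
    unfolding ops_def using * gl_alg.add by blast
qed

lemma ops_smul: assumes "A \<in> ops" shows "(\<lambda>x. smul c (A x)) \<in> ops"
proof -
  obtain A0 A1 where *: "alg False A0" "alg True A1" "A = (\<lambda>x. A0 x + A1 x)"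
    using assms unfolding ops_def by blast
  have "(\<lambda>x. smul c (A x)) = (\<lambda>x. smul c (A0 x) + smul c (A1 x))"
    by (simp add: * spoly.scale_right_distrib)
  then show ?thesis
    unfolding ops_def using * gl_alg.smul by blast
qed

lemma ops_lin: "A \<in> ops \<Longrightarrow> A (x + y) = A x + A y" "A \<in> ops \<Longrightarrow> A (smul c x) = smul c (A x)"
  unfolding ops_def using alg_lin by (auto simp: spoly.scale_right_distrib algebra_simps)

lemma ops_comp: assumes "A \<in> ops" "B \<in> ops" shows "(\<lambda>x. A (B x)) \<in> ops"
proof -
  obtain A0 A1 B0 B1 where *: "alg False A0" "alg True A1" "A = (\<lambda>x. A0 x + A1 x)" "alg False B0" "alg True B1" "B = (\<lambda>x. B0 x + B1 x)"
    using assms unfolding ops_def by blast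
  have "(\<lambda>x. A (B x)) = (\<lambda>x. (A0 (B0 x) + A1 (B0 x)) + (A0 (B1 x) + A1 (B1 x)))"
    using alg_lin[OF *(1)] alg_lin[OF *(2)] by (simp add: *(3,6) algebra_simps)
  moreover have "(\<lambda>x. A0 (B0 x)) \<in> ops" "(\<lambda>x. A1 (B0 x)) \<in> ops" "(\<lambda>x. A0 (B1 x)) \<in> ops" "(\<lambda>x. A1 (B1 x)) \<in> ops"
    using * by (auto intro: ops_alg alg_comp)
  ultimately show ?thesis
    by (simp add: ops_add)
qed

lemma ops_adj: assumes "A \<in> ops" shows "\<exists>B\<in>ops. \<forall>x y. ip (A x) y = ip x (B y)"
proof -
  obtain A0 A1 where *: "alg False A0" "alg True A1" "A = (\<lambda>x. A0 x + A1 x)"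
    using assms unfolding ops_def by blast
  then obtain B0 B1 where "alg False B0" "\<And>x y. ip (A0 x) y = ip x (B0 y)" "alg True B1" "\<And>x y. ip (A1 x) y = ip x (B1 y)"
    using alg_adj by metis
  then show ?thesis
    using * by (intro bexI[of _ "\<lambda>x. B0 x + B1 x"]) (auto simp: ip_add_left ip_add_right ops_def)
qed

lemma ops_polyin: "A \<in> ops \<Longrightarrow> x \<in> polyin S \<Longrightarrow> A x \<in> polyin S"
  unfolding ops_def by (auto intro: polyin_add alg_polyin)

end

locale hw_ops = gl_ops +
  fixes f :: spoly and \<Lambda> :: "idx \<Rightarrow> nat" and \<pi> :: bool
  assumes f_polyin: "f \<in> polyin S" and f_nz: "f \<noteq> 0" and f_homog: "homog \<pi> f"
    and f_wt: "a \<in> gl_ix p q \<Longrightarrow> E a a f = smul (of_nat (\<Lambda> a)) f"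
    and f_simple: "(a, b) \<in> simple_roots p q \<Longrightarrow> E a b f = 0"
begin

lemma f_pos: "a \<in> gl_ix p q \<Longrightarrow> b \<in> gl_ix p q \<Longrightarrow> pos p a < pos p b \<Longrightarrow> E a b f = 0"
proof (induction "pos p b - pos p a" arbitrary: b rule: less_induct)
  case less
  show ?case
  proof (cases "pos p b = Suc (pos p a)")
    case True
    with less show ?thesis by (intro f_simple simple_root_pos)
  next
    case False
    have "1 \<le> pos p b - 1" "pos p b - 1 \<le> p + q"
      using pos_range[OF less(2)] pos_range[OF less(3)] less(4) by linarith+
    then obtain c where c: "c \<in> gl_ix p q" "pos p c = pos p b - 1"
      using pos_surj by blast
    have "E a c f = 0"
      using less False c by (intro less(1)) auto
    moreover have "E c b f = 0"
      using less c by (intro f_simple simple_root_pos) auto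
    moreover have "a \<noteq> b"
      using less(4) by auto
    ultimately show ?thesis
      using E_comm[of a c c b f] by (simp add: E_0)
  qed
qed

definition V :: "spoly set" where "V = {A f | A. A \<in> ops}"

lemma V_I: "A \<in> ops \<Longrightarrow> A f \<in> V"
  by (auto simp: V_def)

lemma f_V: "f \<in> V"
  using V_I[OF ops_id] .

lemma V_subspace: "spoly.subspace V"
proof (rule spoly.subspaceI)
  show "0 \<in> V"
    using V_I[OF ops_alg[OF gl_alg.zero]] by simp
  show "x + y \<in> V" if "x \<in> V" "y \<in> V" for x y
  proof -
    from that obtain A B where "A \<in> ops" "x = A f" "B \<in> ops" "y = B f"
      by (auto simp: V_def)
    then show ?thesis
      using V_I[OF ops_add, of A B] by simp
  qed
  show "smul c x \<in> V" if "x \<in> V" for c x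
  proof -
    from that obtain A where "A \<in> ops" "x = A f"
      by (auto simp: V_def)
    then show ?thesis
      using V_I[OF ops_smul, of A c] by simp
  qed
qed

lemma V_ops: assumes "A \<in> ops" "v \<in> V" shows "A v \<in> V"
proof -
  from assms(2) obtain B where "B \<in> ops" "v = B f"
    by (auto simp: V_def)
  then show ?thesis
    using V_I[OF ops_comp[OF assms(1)], of B] by simp
qed

lemma V_E: "a \<in> gl_ix p q \<Longrightarrow> b \<in> gl_ix p q \<Longrightarrow> v \<in> V \<Longrightarrow> E a b v \<in> V"
  by (rule V_ops[OF ops_E])

lemma V_polyin: "v \<in> V \<Longrightarrow> v \<in> polyin S"
  unfolding V_def using ops_polyin f_polyin by blast

text \<open>The span of the negative words applied to \<open>f\<close>; it turns out to be the whole module, since the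
  commutation relations move all other \<open>E\<^sub>a\<^sub>b\<close> to \<open>f\<close>.\<close>

definition NS :: "spoly set" where "NS = spoly.span {Z f | k Z. negw k Z}"

lemma NS_word: "negw k Z \<Longrightarrow> Z f \<in> NS"
  unfolding NS_def by (rule spoly.span_base) blast

lemma NS_subspace: "spoly.subspace NS"
  unfolding NS_def by (rule spoly.subspace_span)

lemma NS_closed:
  assumes "\<And>k Z. negw k Z \<Longrightarrow> E a b (Z f) \<in> NS" "v \<in> NS"
  shows "E a b v \<in> NS"
  using assms(2) unfolding NS_def
proof (induction rule: spoly.span_induct_alt)
  case base
  show ?case by (simp add: E_0 spoly.span_zero)
next
  case (step c x y)
  then show ?case
    using assms(1) unfolding NS_def E_add E_smul by (blast intro: spoly.span_add spoly.span_scale)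
qed

lemma NS_E_word: "negw k Z \<Longrightarrow> a \<in> gl_ix p q \<Longrightarrow> b \<in> gl_ix p q \<Longrightarrow> E a b (Z f) \<in> NS"
proof (induction arbitrary: a b rule: neg_word.induct)
  case id
  consider "pos p a < pos p b" | "a = b" | "pos p b < pos p a"
    using pos_inj[OF id] by linarith
  then show ?case
  proof cases
    case 1
    with id show ?thesis by (simp add: f_pos spoly.subspace_0[OF NS_subspace])
  next
    case 2
    with id show ?thesis
      using NS_word[OF neg_word.id] by (simp add: f_wt spoly.subspace_scale[OF NS_subspace])
  next
    case 3
    show ?thesis
      using NS_word[OF neg_word.step[OF id 3 neg_word.id]] .
  qed
next
  case (step c d k Z)
  have IH: "E a b (Z f) \<in> NS" if "a \<in> gl_ix p q" "b \<in> gl_ix p q" for a b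
    using step that by blast
  have "E c d (E a b (Z f)) \<in> NS"
  proof (rule NS_closed)
    fix k' Z1 assume "negw k' Z1"
    then show "E c d (Z1 f) \<in> NS"
      using NS_word[OF neg_word.step[OF step(1,2,3)]] by simp
  qed (use IH step in auto)
  moreover have "E a d (Z f) \<in> NS" "E c b (Z f) \<in> NS"
    using IH step by auto
  moreover have "E a b (E c d (Z f)) = smul (ksign (epar a b) (epar c d)) (E c d (E a b (Z f)))
    + ((if b = c then E a d (Z f) else 0) - smul (ksign (epar a b) (epar c d)) (if a = d then E c b (Z f) else 0))"
    using E_comm[of a b c d "Z f"] by (metis add.commute diff_add_cancel)
  ultimately show ?case
    by (auto intro!: spoly.subspace_add[OF NS_subspace] spoly.subspace_diff[OF NS_subspace] spoly.subspace_scale[OF NS_subspace] spoly.subspace_0[OF NS_subspace])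
qed

lemma V_NS: assumes "v \<in> V" shows "v \<in> NS"
proof -
  have *: "A f \<in> NS" if "alg \<epsilon> A" for \<epsilon> A
    using that
  proof (induction rule: gl_alg.induct)
    case id
    show ?case using NS_word[OF neg_word.id] .
  next
    case (comp a b \<epsilon> A)
    show ?case
      by (rule NS_closed) (use comp NS_E_word in blast)+
  qed (auto intro: spoly.subspace_add[OF NS_subspace] spoly.subspace_scale[OF NS_subspace] spoly.subspace_0[OF NS_subspace])
  from assms obtain A where "A \<in> ops" "v = A f"
    by (auto simp: V_def)
  then obtain A0 A1 where "alg False A0" "alg True A1" "v = A0 f + A1 f"
    unfolding ops_def by auto
  then show ?thesis
    using * spoly.subspace_add[OF NS_subspace] by simp
qed

lemma negw_ops: "negw k Z \<Longrightarrow> Z \<in> ops"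
  by (induction rule: neg_word.induct) (auto intro: ops_id ops_comp[OF ops_E])

lemma negw_0: "negw k Z \<Longrightarrow> k = 0 \<Longrightarrow> Z = (\<lambda>x. x)"
  by (induction rule: neg_word.induct) auto

text \<open>Operators that begin with a negative root vector. Modulo these, every operator acts on \<open>f\<close> as a
  scalar, and the adjoint of such an operator kills \<open>f\<close> in its first step.\<close>

inductive low :: "(spoly \<Rightarrow> spoly) \<Rightarrow> bool" where
  zero: "low (\<lambda>x. 0)"
| add: "low A \<Longrightarrow> low B \<Longrightarrow> low (\<lambda>x. A x + B x)"
| smul: "low A \<Longrightarrow> low (\<lambda>x. smul c (A x))"
| neg: "a \<in> gl_ix p q \<Longrightarrow> b \<in> gl_ix p q \<Longrightarrow> pos p b < pos p a \<Longrightarrow> A \<in> ops \<Longrightarrow> low (\<lambda>x. E a b (A x))"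

lemma low_ops: "low A \<Longrightarrow> A \<in> ops"
  by (induction rule: low.induct) (auto intro: ops_add ops_smul ops_comp[OF ops_E] ops_alg[OF gl_alg.zero])

lemma low_decomp: assumes "v \<in> V" shows "\<exists>c Z. low Z \<and> v = smul c f + Z f"
proof -
  have "v \<in> NS" by (rule V_NS[OF assms])
  then show ?thesis
    unfolding NS_def
  proof (induction rule: spoly.span_induct_alt)
    case base
    show ?case by (intro exI[of _ 0] exI[of _ "\<lambda>x. 0"]) (simp add: low.zero)
  next
    case (step c x y)
    then obtain k Z where Z: "negw k Z" "x = Z f" by blast
    obtain c' Z1 where Z1: "low Z1" "y = smul c' f + Z1 f" using step by blast
    from Z(1) show ?case
    proof cases
      case id
      show ?thesis
        using Z1 Z(2) id by (intro exI[of _ "c + c'"] exI[of _ Z1]) (simp add: spoly.scale_left_distrib)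
    next
      case (step a b k' W)
      then have "low (\<lambda>x. smul c (E a b (W x)))"
        by (intro low.smul low.neg negw_ops)
      then have "low (\<lambda>x. smul c (Z x) + Z1 x)"
        using Z1 step by (simp add: low.add)
      then show ?thesis
        using Z1 Z(2) by (intro exI[of _ c'] exI[of _ "\<lambda>x. smul c (Z x) + Z1 x"]) simp
    qed
  qed
qed

subsection \<open>Irreducibility\<close>

text \<open>The adjoint of a negative root vector is positive and kills \<open>f\<close>.\<close>

lemma neg_word_orth: assumes "negw k Z" "0 < k" shows "ip (Z f) f = 0"
  using assms(1)
proof cases
  case (step a b k' W)
  then show ?thesis by (simp add: E_adj f_pos)
qed (use assms in simp)

text \<open>A Cartan element whose eigenvalue drops by 1 with each simple root that is subtracted.\<close>

definition height :: "spoly \<Rightarrow> spoly" where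
  "height x = - (\<Sum>a\<in>gl_ix p q. smul (of_nat (pos p a)) (E a a x))"

definition h0 :: complex where "h0 = - (\<Sum>a\<in>gl_ix p q. of_nat (pos p a) * of_nat (\<Lambda> a))"

lemma height_lin: "height (x + y) = height x + height y" "height (smul c x) = smul c (height x)"
  unfolding height_def
  by (simp_all add: E_add E_smul spoly.scale_right_distrib sum.distrib spoly.scale_sum_right mult.commute)

lemma height_E:
  assumes "c \<in> gl_ix p q" "d \<in> gl_ix p q"
  shows "height (E c d x) = E c d (height x) - smul (of_nat (pos p c) - of_nat (pos p d)) (E c d x)"
proof -
  have e: "E a a (E c d x) = E c d (E a a x) + ((if a = c then E c d x else 0) - (if a = d then E c d x else 0))" for a
    using E_comm[of a a c d x] by (auto simp: epar_def algebra_simps)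
  have "(\<Sum>a\<in>gl_ix p q. smul (of_nat (pos p a)) (E a a (E c d x)))
     = (\<Sum>a\<in>gl_ix p q. smul (of_nat (pos p a)) (E c d (E a a x))) + (\<Sum>a\<in>gl_ix p q. if a = c then smul (of_nat (pos p c)) (E c d x) else 0)
       - (\<Sum>a\<in>gl_ix p q. if a = d then smul (of_nat (pos p d)) (E c d x) else 0)"
    unfolding e sum.distrib[symmetric] sum_subtractf[symmetric]
    by (rule sum.cong) (auto simp: spoly.scale_right_distrib spoly.scale_right_diff_distrib)
  moreover have "E c d (height x) = - (\<Sum>a\<in>gl_ix p q. smul (of_nat (pos p a)) (E c d (E a a x)))"
    unfolding height_def by (simp add: sder_uminus[OF E_sder] sder_sum[OF E_sder] E_smul)
  ultimately show ?thesis
    using assms unfolding height_def by (simp add: spoly.scale_left_diff_distrib)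
qed

lemma height_f: "height f = smul h0 f"
proof -
  have "(\<Sum>a\<in>gl_ix p q. smul (of_nat (pos p a)) (E a a f)) = (\<Sum>a\<in>gl_ix p q. smul (of_nat (pos p a) * of_nat (\<Lambda> a)) f)"
    by (rule sum.cong) (auto simp: f_wt)
  then show ?thesis
    by (simp add: height_def h0_def flip: spoly.scale_sum_left)
qed

lemma height_word: "negw k Z \<Longrightarrow> height (Z f) = smul (h0 - of_nat k) (Z f)"
proof (induction rule: neg_word.induct)
  case id
  show ?case by (simp add: height_f)
next
  case (step a b k Z)
  have "of_nat (pos p a - pos p b) = (of_nat (pos p a) - of_nat (pos p b) :: complex)"
    using step by (simp add: of_nat_diff)
  then show ?case
    using step by (simp add: height_E E_smul algebra_simps flip: spoly.scale_left_diff_distrib)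
qed

text \<open>The product of \<open>K\<close> factors, the \<open>j\<close>-th of which annihilates the weight vectors at height \<open>j\<close> below
  \<open>f\<close>; it multiplies \<open>f\<close> by \<open>K!\<close>.\<close>

primrec cut :: "nat \<Rightarrow> spoly \<Rightarrow> spoly" where
  "cut 0 x = x"
| "cut (Suc K) x = height (cut K x) - smul (h0 - of_nat (Suc K)) (cut K x)"

lemma cut_lin: "cut K (x + y) = cut K x + cut K y" "cut K (smul c x) = smul c (cut K x)"
  by (induction K) (simp_all add: height_lin spoly.scale_right_distrib spoly.scale_right_diff_distrib mult.commute)

lemma cut_eigen: "height x = smul (h0 - of_nat k) x \<Longrightarrow> cut K x = smul (\<Prod>j=1..K. of_nat j - of_nat k) x"
  by (induction K) (simp_all add: height_lin flip: spoly.scale_left_diff_distrib, simp add: algebra_simps)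

text \<open>For large \<open>K\<close> this is a multiple of the projection to the line of \<open>f\<close>, orthogonal by
  \<open>neg_word_orth\<close>.\<close>

lemma cut_V:
  assumes "v \<in> NS"
  shows "\<exists>K0. \<forall>K\<ge>K0. cut K v = smul (fact K * ip v f / ip f f) f"
  using assms unfolding NS_def
proof (induction rule: spoly.span_induct_alt)
  case base
  have "cut K 0 = 0" for K
    using cut_lin(2)[of K 0 0] by simp
  then show ?case by simp
next
  case (step c x y)
  then obtain k Z where Z: "negw k Z" "x = Z f" by blast
  obtain K0 where K0: "\<forall>K\<ge>K0. cut K y = smul (fact K * ip y f / ip f f) f" using step by blast
  have x: "cut K x = smul (\<Prod>j=1..K. of_nat j - of_nat k) x" for K
    unfolding Z(2) by (rule cut_eigen[OF height_word[OF Z(1)]])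
  have x': "cut K x = smul (fact K * ip x f / ip f f) f" if "K \<ge> k" for K
  proof (cases "k = 0")
    case True
    then have "x = f"
      using negw_0[OF Z(1)] Z(2) by simp
    moreover have "(\<Prod>j=1..K. of_nat j :: complex) = fact K"
      by (simp add: fact_prod)
    ultimately show ?thesis
      using x[of K] True f_nz by (simp add: ip_self_eq_0)
  next
    case False
    then have "(\<Prod>j=1..K. of_nat j - of_nat k :: complex) = 0"
      using that by (intro prod_zero) auto
    then show ?thesis
      using x[of K] neg_word_orth[OF Z(1)] False Z(2) by simp
  qed
  show ?case
  proof (intro exI[of _ "max k K0"] allI impI)
    fix K assume "max k K0 \<le> K"
    then show "cut K (smul c x + y) = smul (fact K * ip (smul c x + y) f / ip f f) f"
      using K0 x' by (simp add: cut_lin ip_add_left ip_smul_left algebra_simps add_divide_distrib flip: spoly.scale_left_distrib)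
  qed
qed

text \<open>The parity may be shifted: an even isomorphism with a tensor product of two modules, each of which
  contains \<open>f\<close>, has to regard \<open>f\<close> as even in one of them.\<close>

definition Vmod :: "bool \<Rightarrow> spoly supermodule" where
  "Vmod \<sigma> = \<lparr>scal = smul, part = (\<lambda>\<epsilon>. {v \<in> V. homog (\<epsilon> \<noteq> \<sigma>) v}), act = E\<rparr>"

lemma Vmod_simps [simp]: "scal (Vmod \<sigma>) = smul" "part (Vmod \<sigma>) \<epsilon> = {v \<in> V. homog (\<epsilon> \<noteq> \<sigma>) v}" "act (Vmod \<sigma>) = E"
  by (simp_all add: Vmod_def)

lemma V_split:
  assumes "v \<in> V"
  obtains A0 A1 where "alg False A0" "alg True A1" "v = A0 f + A1 f" "A0 f \<in> V" "A1 f \<in> V" "homog \<pi> (A0 f)" "homog (\<not> \<pi>) (A1 f)"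
proof -
  from assms obtain A where "A \<in> ops" "v = A f"
    by (auto simp: V_def)
  then obtain A0 A1 where *: "alg False A0" "alg True A1" "v = A0 f + A1 f"
    unfolding ops_def by auto
  moreover have "homog \<pi> (A0 f)" "homog (\<not> \<pi>) (A1 f)"
    using alg_homog[OF *(1) f_homog] alg_homog[OF *(2) f_homog] by auto
  moreover have "A0 f \<in> V" "A1 f \<in> V"
    using * by (auto intro!: V_I ops_alg)
  ultimately show ?thesis
    using that by blast
qed

lemma carr_Vmod: "carr (Vmod \<sigma>) = V"
proof (intro subset_antisym subsetI)
  fix v assume "v \<in> carr (Vmod \<sigma>)"
  then show "v \<in> V"
    using spoly.subspace_add[OF V_subspace] by (auto simp: carr_def)
next
  fix v assume "v \<in> V"
  then obtain A0 A1 where *: "v = A0 f + A1 f" "A0 f \<in> V" "A1 f \<in> V" "homog \<pi> (A0 f)" "homog (\<not> \<pi>) (A1 f)"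
    by (rule V_split)
  show "v \<in> carr (Vmod \<sigma>)"
  proof (cases "\<sigma> = \<pi>")
    case True
    with * have "A0 f \<in> part (Vmod \<sigma>) False" "A1 f \<in> part (Vmod \<sigma>) True"
      by auto
    then show ?thesis
      unfolding carr_def *(1) by blast
  next
    case False
    with * have "A1 f \<in> part (Vmod \<sigma>) False" "A0 f \<in> part (Vmod \<sigma>) True"
      by auto
    then show ?thesis
      unfolding carr_def *(1) add.commute[of "A0 f"] by blast
  qed
qed

lemma V_part_subspace: "spoly.subspace {v \<in> V. homog \<epsilon> v}"
  by (rule spoly.subspaceI)
     (auto intro: homog_add homog_smul spoly.subspace_0[OF V_subspace] spoly.subspace_add[OF V_subspace] spoly.subspace_scale[OF V_subspace])

lemma gl_module_Vmod: "gl_module p q (Vmod \<sigma>)"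
proof -
  have "x = 0" if "homog \<epsilon> x" "homog (\<not> \<epsilon>) x" for \<epsilon> x
  proof -
    have "x = - x"
      using that by (cases \<epsilon>) (auto simp: homog_def)
    then have "x + x = x + - x"
      by (rule arg_cong)
    then have "x + x = 0 + 0"
      by (simp only: right_minus add_0)
    then show ?thesis by (rule half_twice)
  qed
  then have 1: "part (Vmod \<sigma>) False \<inter> part (Vmod \<sigma>) True = {0}"
    using spoly.subspace_0[OF V_subspace] by (cases \<sigma>) auto
  have "homog ((\<epsilon> \<noteq> epar a b) \<noteq> \<sigma>) (E a b v)" if "homog (\<epsilon> \<noteq> \<sigma>) v" for \<epsilon> a b v
  proof -
    have "homog (epar a b \<noteq> (\<epsilon> \<noteq> \<sigma>)) (E a b v)"
      by (rule pshift_homog[OF E_pshift E_smul that])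
    moreover have "(epar a b \<noteq> (\<epsilon> \<noteq> \<sigma>)) = ((\<epsilon> \<noteq> epar a b) \<noteq> \<sigma>)" by auto
    ultimately show ?thesis by simp
  qed
  then show ?thesis
    unfolding gl_module_def using 1 E_comm V_part_subspace
    by (auto simp: spoly.vector_space_axioms E_add E_smul V_E carr_Vmod simp del: not_iff)
qed

text \<open>A submodule with an element not orthogonal to \<open>f\<close> contains \<open>f\<close>; otherwise it is orthogonal to
  everything generated by \<open>f\<close>, in particular to itself.\<close>

lemma irreducible_Vmod: "irreducible_module p q (Vmod \<sigma>)"
  unfolding irreducible_module_def carr_Vmod
proof (intro conjI allI impI)
  show "V \<noteq> {0}"
    using f_V f_nz by auto
  fix U assume U: "gl_submodule p q (Vmod \<sigma>) U"
  then have Usub: "spoly.subspace U" and UE: "\<And>a b u. a \<in> gl_ix p q \<Longrightarrow> b \<in> gl_ix p q \<Longrightarrow> u \<in> U \<Longrightarrow> E a b u \<in> U"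
    unfolding gl_submodule_def by auto
  have UV: "U \<subseteq> V"
  proof
    fix u assume "u \<in> U"
    then have "u \<in> {u + w | u w. u \<in> U \<inter> part (Vmod \<sigma>) False \<and> w \<in> U \<inter> part (Vmod \<sigma>) True}"
      using U unfolding gl_submodule_def by blast
    then show "u \<in> V"
      using spoly.subspace_add[OF V_subspace] by auto
  qed
  show "U = {0} \<or> U = V"
  proof (rule disjCI)
    assume "U \<noteq> V"
    have "f \<notin> U"
    proof
      assume "f \<in> U"
      have "A f \<in> U" if "alg \<epsilon> A" for \<epsilon> A
        using that by (induction rule: gl_alg.induct)
          (auto intro: \<open>f \<in> U\<close> UE spoly.subspace_add[OF Usub] spoly.subspace_scale[OF Usub] spoly.subspace_0[OF Usub])
      then have "A f \<in> U" if "A \<in> ops" for A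
        using that spoly.subspace_add[OF Usub] unfolding ops_def by auto
      then have "V \<subseteq> U"
        by (auto simp: V_def)
      with UV \<open>U \<noteq> V\<close> show False by auto
    qed
    have orth: "ip u f = 0" if u: "u \<in> U" for u
    proof (rule ccontr)
      assume nz: "ip u f \<noteq> 0"
      obtain K where K: "cut K u = smul (fact K * ip u f / ip f f) f"
        using cut_V[OF V_NS] u UV by blast
      have "height x \<in> U" if "x \<in> U" for x
        unfolding height_def using that
        by (intro spoly.subspace_neg[OF Usub] spoly.subspace_sum[OF Usub] spoly.subspace_scale[OF Usub] UE)
      then have "cut K u \<in> U"
        by (induction K) (auto simp: u intro!: spoly.subspace_diff[OF Usub] spoly.subspace_scale[OF Usub])
      then have "smul (inverse (fact K * ip u f / ip f f)) (cut K u) \<in> U"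
        by (rule spoly.subspace_scale[OF Usub])
      moreover have "inverse (fact K * ip u f / ip f f) * (fact K * ip u f / ip f f) = 1"
        using nz f_nz by (intro left_inverse) (simp add: ip_self_eq_0)
      ultimately have "f \<in> U"
        unfolding K by (simp only: spoly.scale_scale spoly.scale_one)
      with \<open>f \<notin> U\<close> show False by simp
    qed
    have orthw: "negw k Z \<Longrightarrow> \<forall>u\<in>U. ip u (Z f) = 0" for k Z
    proof (induction rule: neg_word.induct)
      case (step a b k Z)
      then show ?case
        by (auto simp: E_adj[of b a, symmetric] UE)
    qed (simp add: orth)
    have "u = 0" if u: "u \<in> U" for u
    proof -
      have "ip u x = 0" if "x \<in> NS" for x
        using that unfolding NS_def
        by (induction rule: spoly.span_induct_alt) (use orthw u in \<open>auto simp: ip_add_right ip_smul_right\<close>)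
      then have "ip u u = 0"
        using V_NS u UV by blast
      then show ?thesis by (simp add: ip_self_eq_0)
    qed
    then show "U = {0}"
      using spoly.subspace_0[OF Usub] by auto
  qed
qed

lemma hwv_Vmod:
  assumes "\<And>a. a \<in> gl_ix p q \<Longrightarrow> \<Lambda> a = hweight p lam a"
  shows "is_V p q lam (Vmod \<sigma>)"
  unfolding is_V_def highest_weight_vector_def carr_Vmod
  using gl_module_Vmod irreducible_Vmod f_V f_nz f_wt f_simple assms by (auto intro!: exI[of _ f])

end

section \<open>The tensor product generated by a joint highest weight vector\<close>

lemma gl_ops_left: "gl_ops p q (left_action m n) (poly_vars p q m n)"
  by standard (rule sder_left, rule pshift_left, rule left_comm, rule left_adj, rule left_polyin)

lemma gl_ops_right: "gl_ops m n (right_action p q) (poly_vars p q m n)"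
  by standard (rule sder_right, rule pshift_right, rule right_comm, rule right_adj, rule right_polyin)

lemma homogeneous_subspace: "spoly.subspace (homogeneous d)"
  by (rule spoly.subspaceI)
     (auto simp: homogeneous_Deg Deg_lin spoly.scale_right_distrib mult.commute intro: spoly_eqI simp: coeff_Deg)

lemma left_homogeneous:
  assumes cd: "c \<in> gl_ix p q" "d \<in> gl_ix p q" and x: "x \<in> polyin (poly_vars p q m n)" "x \<in> homogeneous k"
  shows "left_action m n c d x \<in> homogeneous k"
proof -
  let ?E = "left_action m n"
  have e: "?E a a (?E c d x) = ?E c d (?E a a x) + ((if a = c then ?E c d x else 0) - (if a = d then ?E c d x else 0))" for a
    using left_comm[of m n a a c d x] by (auto simp: epar_def algebra_simps)
  have "Deg (?E c d x) = (\<Sum>a\<in>gl_ix p q. ?E a a (?E c d x))"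
    by (rule euler_left[symmetric]) (use cd x in \<open>auto intro: left_polyin\<close>)
  also have "\<dots> = (\<Sum>a\<in>gl_ix p q. ?E c d (?E a a x))"
    unfolding e sum.distrib sum_subtractf using cd by simp
  also have "\<dots> = ?E c d (Deg x)"
    using euler_left[OF x(1)] by (simp flip: sder_sum[OF sder_left])
  finally show ?thesis
    using x(2) by (simp add: homogeneous_Deg sder_smul[OF sder_left])
qed

lemma right_homogeneous:
  assumes cd: "c \<in> gl_ix m n" "d \<in> gl_ix m n" and x: "x \<in> polyin (poly_vars p q m n)" "x \<in> homogeneous k"
  shows "right_action p q c d x \<in> homogeneous k"
proof -
  let ?E = "right_action p q"
  have e: "?E a a (?E c d x) = ?E c d (?E a a x) + ((if a = c then ?E c d x else 0) - (if a = d then ?E c d x else 0))" for a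
    using right_comm[of p q a a c d x] by (auto simp: epar_def algebra_simps)
  have "Deg (?E c d x) = (\<Sum>a\<in>gl_ix m n. ?E a a (?E c d x))"
    by (rule euler_right[symmetric]) (use cd x in \<open>auto intro: right_polyin\<close>)
  also have "\<dots> = (\<Sum>a\<in>gl_ix m n. ?E c d (?E a a x))"
    unfolding e sum.distrib sum_subtractf using cd by simp
  also have "\<dots> = ?E c d (Deg x)"
    using euler_right[OF x(1)] by (simp flip: sder_sum[OF sder_right])
  finally show ?thesis
    using x(2) by (simp add: homogeneous_Deg sder_smul[OF sder_right])
qed

locale hw_pair =
  fixes p q m n :: nat and f :: spoly and lam :: "nat \<Rightarrow> nat" and \<pi> :: bool
  assumes corr: "hwv_corresponds p q m n lam f" and hom: "homog \<pi> f"

sublocale hw_pair \<subseteq> L: hw_ops p q "left_action m n" "poly_vars p q m n" f "hweight p lam" \<pi>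
proof -
  interpret gl_ops p q "left_action m n" "poly_vars p q m n"
    by (rule gl_ops_left)
  show "hw_ops p q (left_action m n) (poly_vars p q m n) f (hweight p lam) \<pi>"
    by standard (use corr hom in \<open>auto simp: hwv_corresponds_def highest_weight_vector_def carr_left_poly\<close>,
       auto simp: left_poly_def)
qed

sublocale hw_pair \<subseteq> R: hw_ops m n "right_action p q" "poly_vars p q m n" f "hweight m lam" \<pi>
proof -
  interpret gl_ops m n "right_action p q" "poly_vars p q m n"
    by (rule gl_ops_right)
  show "hw_ops m n (right_action p q) (poly_vars p q m n) f (hweight m lam) \<pi>"
    by standard (use corr hom in \<open>auto simp: hwv_corresponds_def highest_weight_vector_def carr_right_poly\<close>,
       auto simp: right_poly_def)
qed

context hw_pair
begin

lemma E_alg: "R.alg \<delta> B \<Longrightarrow> a \<in> gl_ix p q \<Longrightarrow> b \<in> gl_ix p q \<Longrightarrow>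
   left_action m n a b (B x) = smul (ksign (epar a b) \<delta>) (B (left_action m n a b x))"
proof (induction arbitrary: x rule: gl_alg.induct)
  case (comp s t \<delta> B)
  have "ksign (epar a b) (epar s t) * ksign (epar a b) \<delta> = ksign (epar a b) (epar s t \<noteq> \<delta>)"
    by (auto simp: ksign_def)
  with comp show ?case
    by (simp add: left_right R.E_smul)
qed (auto simp: L.E_add L.E_smul L.E_0 spoly.scale_right_distrib mult.commute)

lemma alg_alg: "L.alg \<epsilon> A \<Longrightarrow> R.alg \<delta> B \<Longrightarrow> A (B x) = smul (ksign \<epsilon> \<delta>) (B (A x))"
proof (induction rule: gl_alg.induct)
  case (comp a b \<epsilon> A)
  have "ksign (epar a b) \<delta> * ksign \<epsilon> \<delta> = ksign (epar a b \<noteq> \<epsilon>) \<delta>"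
    by (auto simp: ksign_def)
  with comp show ?case
    by (simp add: E_alg L.E_smul mult.commute)
next
  case (zero \<epsilon>)
  then have "B 0 = 0"
    using R.alg_lin[of \<delta> B 0 0 0] by simp
  then show ?case by simp
qed (use R.alg_lin in \<open>auto simp: spoly.scale_right_distrib mult.commute\<close>)

text \<open>An element of the right module is \<open>B f\<close>, and \<open>A (B f)\<close> is \<open>B (A f)\<close> up to signs of the homogeneous
  parts. So an operator of the left algebra is determined on the right module by its value at \<open>f\<close>.\<close>

lemma ops_0:
  assumes A: "A \<in> L.ops" "A f = 0" and w: "w \<in> R.V"
  shows "A w = 0"
proof -
  obtain A0 A1 where A': "L.alg False A0" "L.alg True A1" "A = (\<lambda>x. A0 x + A1 x)"
    using A(1) unfolding L.ops_def by blast
  obtain B0 B1 where B: "R.alg False B0" "R.alg True B1" "w = B0 f + B1 f"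
    using w unfolding R.V_def R.ops_def by auto
  have h: "homog \<pi> (A0 f)" "homog (\<not> \<pi>) (A1 f)"
    using L.alg_homog[OF A'(1) hom] L.alg_homog[OF A'(2) hom] by auto
  have "A0 f + A1 f = 0"
    using A(2) A'(3) by simp
  with homog_sum_0[OF h] have 0: "A0 f = 0" "A1 f = 0"
    by auto
  have B00: "B0 0 = 0" "B1 0 = 0"
    using R.alg_lin[OF B(1), of 0 0 0] R.alg_lin[OF B(2), of 0 0 0] by simp_all
  have "A0 w = 0" "A1 w = 0"
    using L.alg_lin[OF A'(1)] L.alg_lin[OF A'(2)] alg_alg[OF A'(1) B(1)] alg_alg[OF A'(1) B(2)] alg_alg[OF A'(2) B(1)] alg_alg[OF A'(2) B(2)]
    by (simp_all add: B(3) 0 B00)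
  then show ?thesis
    by (simp add: A'(3))
qed

lemma ops_eq:
  assumes "A \<in> L.ops" "A' \<in> L.ops" "A f = A' f" "w \<in> R.V"
  shows "A w = A' w"
proof -
  have "(\<lambda>x. A x + smul (-1) (A' x)) \<in> L.ops"
    using assms by (intro L.ops_add L.ops_smul)
  from ops_0[OF this _ assms(4)] show ?thesis
    using assms(3) by simp
qed

lemma low_ip: "L.low Z \<Longrightarrow> w \<in> R.V \<Longrightarrow> w' \<in> R.V \<Longrightarrow> ip (Z w) w' = 0"
proof (induction rule: L.low.induct)
  case (neg a b A)
  have "left_action m n b a w' = 0"
    by (rule ops_0[OF L.ops_E]) (use neg L.f_pos in auto)
  then show ?case
    by (simp add: left_adj)
qed (auto simp: ip_add_left ip_smul_left)

text \<open>On the right module \<open>A\<close> is a scalar plus an operator that begins with a negative left root vector;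
  its adjoint is positive and vanishes on the right module as it vanishes at \<open>f\<close>.\<close>

lemma ip_ops:
  assumes X: "A \<in> L.ops" and w: "w \<in> R.V" "w' \<in> R.V"
  shows "ip (A w) w' * ip f f = ip (A f) f * ip w w'"
proof -
  obtain c Z where Z: "L.low Z" "A f = smul c f + Z f"
    using L.low_decomp[OF L.V_I[OF X]] by blast
  have A: "A v = smul c v + Z v" if "v \<in> R.V" for v
    by (rule ops_eq[OF X L.ops_add[OF L.ops_smul[OF L.ops_id] L.low_ops[OF Z(1)]] _ that]) (rule Z(2))
  show ?thesis
    using low_ip[OF Z(1)] w R.f_V by (simp add: A ip_add_left ip_smul_left)
qed

text \<open>The value does not depend on the choice of the operator, by \<open>ops_eq\<close>.\<close>

definition tau :: "spoly \<Rightarrow> spoly \<Rightarrow> spoly" where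
  "tau v w = (SOME A. A \<in> L.ops \<and> A f = v) w"

lemma tau: "A \<in> L.ops \<Longrightarrow> w \<in> R.V \<Longrightarrow> tau (A f) w = A w"
  unfolding tau_def
  by (rule ops_eq) (auto intro: someI2[of "\<lambda>B. B \<in> L.ops \<and> B f = A f" A])

lemma L_V: "v \<in> L.V \<Longrightarrow> \<exists>A\<in>L.ops. v = A f"
  by (auto simp: L.V_def)

lemma tau_add_left: assumes "v \<in> L.V" "v' \<in> L.V" "w \<in> R.V" shows "tau (v + v') w = tau v w + tau v' w"
proof -
  obtain A B where "A \<in> L.ops" "v = A f" "B \<in> L.ops" "v' = B f"
    using L_V assms by blast
  then show ?thesis
    using tau[OF L.ops_add, of A B w] assms by (simp add: tau)
qed

lemma tau_smul_left: assumes "v \<in> L.V" "w \<in> R.V" shows "tau (smul c v) w = smul c (tau v w)"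
proof -
  obtain A where "A \<in> L.ops" "v = A f"
    using L_V assms by blast
  then show ?thesis
    using tau[OF L.ops_smul, of A w c] assms by (simp add: tau)
qed

lemma tau_right:
  assumes "v \<in> L.V" "w \<in> R.V" "w' \<in> R.V"
  shows "tau v (w + w') = tau v w + tau v w'" "tau v (smul c w) = smul c (tau v w)"
proof -
  obtain A where A: "A \<in> L.ops" "v = A f"
    using L_V assms by blast
  then show "tau v (w + w') = tau v w + tau v w'" "tau v (smul c w) = smul c (tau v w)"
    using assms spoly.subspace_add[OF R.V_subspace] spoly.subspace_scale[OF R.V_subspace] L.ops_lin[OF A(1)]
    by (simp_all add: tau)
qed

lemma tau_left_action: assumes "v \<in> L.V" "w \<in> R.V" "a \<in> gl_ix p q" "b \<in> gl_ix p q"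
  shows "left_action m n a b (tau v w) = tau (left_action m n a b v) w"
proof -
  obtain A where A: "A \<in> L.ops" "v = A f"
    using L_V assms by blast
  then show ?thesis
    using assms tau[OF L.ops_comp[OF L.ops_E], of a b A w] by (simp add: tau)
qed

lemma V_homog:
  assumes "v \<in> L.V" "homog (\<epsilon> \<noteq> \<pi>) v"
  obtains A where "L.alg \<epsilon> A" "v = A f"
proof -
  obtain A0 A1 where A: "L.alg False A0" "L.alg True A1" "v = A0 f + A1 f" "homog \<pi> (A0 f)" "homog (\<not> \<pi>) (A1 f)"
    using L.V_split[OF assms(1)] by metis
  show ?thesis
  proof (cases \<epsilon>)
    case True
    then have "homog (\<not> \<pi>) (A0 f + A1 f - A1 f)"
      using assms(2) A(3) A(5) homog_add[OF _ homog_uminus, of "\<not> \<pi>" v "A1 f"] by auto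
    then have "homog (\<not> \<pi>) (- A0 f)"
      by (metis add_diff_cancel_right' homog_uminus)
    with A(4) have "A0 f = 0"
      using homog_sum_0[of \<pi> "A0 f" "- A0 f"] by auto
    with A True that show ?thesis by auto
  next
    case False
    then have "homog \<pi> (A0 f + A1 f - A0 f)"
      using assms(2) A(3) A(4) homog_add[OF _ homog_uminus, of "\<pi>" v "A0 f"] by auto
    then have "homog \<pi> (- A1 f)"
      by (metis add_diff_cancel_left' homog_uminus)
    with A(5) have "A1 f = 0"
      using homog_sum_0[of "\<not> \<pi>" "A1 f" "- A1 f"] by auto
    with A False that show ?thesis by auto
  qed
qed

lemma tau_right_action: assumes v: "v \<in> L.V" "homog (\<epsilon> \<noteq> \<pi>) v" and w: "w \<in> R.V" and st: "s \<in> gl_ix m n" "t \<in> gl_ix m n"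
  shows "right_action p q s t (tau v w) = smul (ksign (epar s t) \<epsilon>) (tau v (right_action p q s t w))"
proof -
  obtain A where A: "L.alg \<epsilon> A" "v = A f"
    using V_homog[OF v] by blast
  have "A (right_action p q s t w) = smul (ksign \<epsilon> (epar s t)) (right_action p q s t (A w))"
    by (rule alg_alg[OF A(1) R.alg_E[OF st]])
  then have "right_action p q s t (A w) = smul (ksign (epar s t) \<epsilon>) (A (right_action p q s t w))"
    by (cases \<epsilon>; cases "epar s t") auto
  then show ?thesis
    using A w R.V_E[OF st w] by (simp add: tau L.ops_alg)
qed

lemma tau_homog: assumes v: "v \<in> L.V" "homog (\<epsilon> \<noteq> \<pi>) v" and w: "w \<in> R.V" "homog \<delta> w"
  shows "homog (\<epsilon> \<noteq> \<delta>) (tau v w)"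
proof -
  obtain A where A: "L.alg \<epsilon> A" "v = A f"
    using V_homog[OF v] by blast
  then show ?thesis
    using L.alg_homog[OF A(1) w(2)] w(1) by (simp add: tau L.ops_alg)
qed

lemma tau_polyin: "v \<in> L.V \<Longrightarrow> w \<in> R.V \<Longrightarrow> tau v w \<in> polyin (poly_vars p q m n)"
  using L_V tau L.ops_polyin R.V_polyin by metis

text \<open>Moving one operator to the other side by adjointness reduces to \<open>ip_ops\<close>.\<close>

lemma ip_tau:
  assumes "v \<in> L.V" "v' \<in> L.V" "w \<in> R.V" "w' \<in> R.V"
  shows "ip (tau v w) (tau v' w') * ip f f = ip v v' * ip w w'"
proof -
  obtain A A' where A: "A \<in> L.ops" "v = A f" "A' \<in> L.ops" "v' = A' f"
    using L_V assms by blast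
  obtain B where B: "B \<in> L.ops" "\<And>x y. ip (A' x) y = ip x (B y)"
    using L.ops_adj[OF A(3)] by blast
  have B': "ip x (A' y) = ip (B x) y" for x y
    by (metis B(2) ip_cnj)
  have "ip (tau v w) (tau v' w') * ip f f = ip (B (A w)) w' * ip f f"
    using A assms by (simp add: tau B')
  also have "\<dots> = ip (B (A f)) f * ip w w'"
    by (rule ip_ops[OF L.ops_comp[OF B(1) A(1)]]) (use assms in auto)
  finally show ?thesis
    using A by (simp add: B')
qed

text \<open>A linear relation, paired with all \<open>tau v' w'\<close>, gives relations between the coordinates first in the
  right and then in the left module, because the form is multiplicative and positive definite.\<close>

lemma tau_independent:
  assumes B: "B \<subseteq> L.V" "spoly.independent B" and C: "C \<subseteq> R.V" "spoly.independent C"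
    and T: "finite T" "T \<subseteq> B \<times> C" and 0: "(\<Sum>(b, c)\<in>T. smul (u (b, c)) (tau b c)) = 0"
    and bc: "(b0, c0) \<in> T"
  shows "u (b0, c0) = 0"
proof -
  let ?B = "fst ` T" and ?C = "snd ` T"
  define u' where "u' x = (if x \<in> T then u x else 0)" for x
  have fin: "finite ?B" "finite ?C"
    using T(1) by auto
  have BC: "?B \<subseteq> B" "?C \<subseteq> C"
    using T(2) by auto
  have TBC: "T \<subseteq> ?B \<times> ?C" by force
  define v where "v c = (\<Sum>b\<in>?B. smul (u' (b, c)) b)" for c
  have vV: "v c \<in> L.V" for c
    unfolding v_def using BC B by (intro spoly.subspace_sum[OF L.V_subspace] spoly.subspace_scale[OF L.V_subspace]) auto
  have "(\<Sum>(b, c)\<in>T. smul (u (b, c)) (tau b c)) = (\<Sum>x\<in>?B \<times> ?C. smul (u' x) (tau (fst x) (snd x)))"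
    by (rule sum.mono_neutral_cong_left) (use fin TBC in \<open>auto simp: u'_def\<close>)
  then have 1: "(\<Sum>c\<in>?C. \<Sum>b\<in>?B. smul (u' (b, c)) (tau b c)) = 0"
    using 0 by (simp add: sum.cartesian_product' sum.swap[of _ ?C])
  have ipt: "ip (tau b c) (tau v' w') = ip b v' * ip c w' / ip f f" if "b \<in> L.V" "v' \<in> L.V" "c \<in> R.V" "w' \<in> R.V" for b v' c w'
    using ip_tau[OF that] L.f_nz by (simp add: ip_self_eq_0 field_simps)
  have bV: "b \<in> L.V" if "b \<in> ?B" for b
    using that BC(1) B(1) by blast
  have cV: "c \<in> R.V" if "c \<in> ?C" for c
    using that BC(2) C(1) by blast
  have 2: "(\<Sum>c\<in>?C. ip (v c) v' * ip c w') = 0" if "v' \<in> L.V" "w' \<in> R.V" for v' w'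
  proof -
    have "0 = ip (\<Sum>c\<in>?C. \<Sum>b\<in>?B. smul (u' (b, c)) (tau b c)) (tau v' w')"
      using 1 by simp
    also have "\<dots> = (\<Sum>c\<in>?C. \<Sum>b\<in>?B. u' (b, c) * (ip b v' * ip c w' / ip f f))"
      unfolding ip_sum_left ip_smul_left by (intro sum.cong refl) (simp only: ipt bV cV that)
    also have "\<dots> = (\<Sum>c\<in>?C. ip (v c) v' * ip c w') / ip f f"
      unfolding v_def ip_sum_left ip_smul_left by (simp add: sum_distrib_right sum_divide_distrib mult.assoc)
    finally show ?thesis
      using L.f_nz by (simp add: ip_self_eq_0)
  qed
  have c0: "c0 \<in> ?C" "b0 \<in> ?B"
    using bc by force+
  have "ip (v c) v' = 0" if v': "v' \<in> L.V" and c: "c \<in> ?C" for v' c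
  proof -
    \<comment> \<open>\<open>z\<close> is orthogonal to the right module, which contains it\<close>
    define z where "z = (\<Sum>c\<in>?C. smul (ip (v c) v') c)"
    have "z \<in> R.V"
      unfolding z_def using BC C by (intro spoly.subspace_sum[OF R.V_subspace] spoly.subspace_scale[OF R.V_subspace]) auto
    moreover have "ip z w' = (\<Sum>c\<in>?C. ip (v c) v' * ip c w')" for w'
      unfolding z_def by (simp add: ip_sum_left ip_smul_left)
    ultimately have "ip z z = 0"
      using 2[OF v'] by simp
    then have "(\<Sum>c\<in>?C. smul (ip (v c) v') c) = 0"
      by (simp add: ip_self_eq_0 z_def)
    then show ?thesis
      using spoly.independentD[OF C(2) fin(2) BC(2), of "\<lambda>c. ip (v c) v'" c] c by simp
  qed
  from this[OF vV[of c0] c0(1)] have "v c0 = 0"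
    by (simp only: ip_self_eq_0)
  then have "u' (b0, c0) = 0"
    unfolding v_def using spoly.independentD[OF B(2) fin(1) BC(1), of "\<lambda>b. u' (b, c0)" b0] c0(2) by simp
  then show ?thesis
    using bc by (simp add: u'_def)
qed

lemma alg_homogeneous: "L.alg \<epsilon> A \<Longrightarrow> x \<in> polyin (poly_vars p q m n) \<Longrightarrow> x \<in> homogeneous d \<Longrightarrow> A x \<in> homogeneous d"
  by (induction rule: gl_alg.induct)
     (auto intro: left_homogeneous L.alg_polyin spoly.subspace_add[OF homogeneous_subspace] spoly.subspace_scale[OF homogeneous_subspace] spoly.subspace_0[OF homogeneous_subspace])

lemma alg_homogeneous': "R.alg \<epsilon> A \<Longrightarrow> x \<in> polyin (poly_vars p q m n) \<Longrightarrow> x \<in> homogeneous d \<Longrightarrow> A x \<in> homogeneous d"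
  by (induction rule: gl_alg.induct)
     (auto intro: right_homogeneous R.alg_polyin spoly.subspace_add[OF homogeneous_subspace] spoly.subspace_scale[OF homogeneous_subspace] spoly.subspace_0[OF homogeneous_subspace])

lemma tau_homogeneous:
  assumes "v \<in> L.V" "w \<in> R.V" "f \<in> homogeneous d"
  shows "tau v w \<in> homogeneous d"
proof -
  obtain B where B: "B \<in> R.ops" "w = B f"
    using assms(2) by (auto simp: R.V_def)
  then have w: "w \<in> homogeneous d"
    unfolding R.ops_def using alg_homogeneous' L.f_polyin assms(3) spoly.subspace_add[OF homogeneous_subspace] by auto
  obtain A where A: "A \<in> L.ops" "v = A f"
    using L_V assms(1) by blast
  then have "A w \<in> homogeneous d"
    unfolding L.ops_def using alg_homogeneous w R.V_polyin assms(2) spoly.subspace_add[OF homogeneous_subspace] by auto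
  with A assms(2) show ?thesis by (simp add: tau)
qed

text \<open>The span of the \<open>tau v w\<close> is a submodule for both actions and is spanned by the images of pairs of
  basis elements. As \<^const>\<open>tau\<close> sends \<open>(f, f)\<close> to \<open>f\<close>, the left module carries the shifted parity.\<close>

theorem appears_homogeneous:
  assumes "f \<in> homogeneous d"
  shows "appears p q m n lam (homogeneous d)"
proof -
  let ?S = "poly_vars p q m n"
  obtain B where B: "B \<subseteq> L.V" "spoly.independent B" "L.V \<subseteq> spoly.span B"
    using spoly.maximal_independent_subset by blast
  obtain C where C: "C \<subseteq> R.V" "spoly.independent C" "R.V \<subseteq> spoly.span C"
    using spoly.maximal_independent_subset by blast
  have spanB: "spoly.span B = L.V"
    using B spoly.span_minimal[OF B(1) L.V_subspace] by auto
  have spanC: "spoly.span C = R.V"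
    using C spoly.span_minimal[OF C(1) R.V_subspace] by auto
  let ?t = "\<lambda>(b, c). tau b c"
  define U where "U = spoly.span (?t ` (B \<times> C))"
  have Usub: "spoly.subspace U"
    unfolding U_def by (rule spoly.subspace_span)
  have tB: "tau b c \<in> U" if "b \<in> B" "c \<in> C" for b c
    unfolding U_def using that by (intro spoly.span_base) auto
  have tV1: "tau b w \<in> U" if b: "b \<in> B" and w: "w \<in> R.V" for b w
  proof -
    have "w \<in> spoly.span C" using w spanC by simp
    then have "w \<in> R.V \<and> tau b w \<in> U"
    proof (induction rule: spoly.span_induct_alt)
      case base
      have "tau b 0 = 0"
        using tau_right(2)[of b f f 0] b B R.f_V by auto
      then show ?case
        using spoly.subspace_0[OF Usub] spoly.subspace_0[OF R.V_subspace] by simp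
    next
      case (step c x y)
      have V: "b \<in> L.V" "x \<in> R.V" "smul c x \<in> R.V" "y \<in> R.V"
        using b B(1) C(1) step spoly.subspace_scale[OF R.V_subspace] by auto
      then have "tau b (smul c x + y) = smul c (tau b x) + tau b y"
        by (simp add: tau_right)
      then show ?case
        using V step tB[OF b] by (simp add: spoly.subspace_add[OF Usub] spoly.subspace_scale[OF Usub] spoly.subspace_add[OF R.V_subspace])
    qed
    then show ?thesis by blast
  qed
  have tV: "tau v w \<in> U" if v: "v \<in> L.V" and w: "w \<in> R.V" for v w
  proof -
    have "v \<in> spoly.span B" using v spanB by simp
    then have "v \<in> L.V \<and> tau v w \<in> U"
    proof (induction rule: spoly.span_induct_alt)
      case base
      have "tau 0 w = 0"
        using tau_smul_left[of f w 0] w L.f_V by simp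
      then show ?case
        using spoly.subspace_0[OF Usub] spoly.subspace_0[OF L.V_subspace] by simp
    next
      case (step c x y)
      have V: "x \<in> L.V" "smul c x \<in> L.V" "y \<in> L.V"
        using B(1) step spoly.subspace_scale[OF L.V_subspace] by auto
      then have "tau (smul c x + y) w = smul c (tau x w) + tau y w"
        using w by (simp add: tau_add_left tau_smul_left)
      then show ?case
        using V step tV1[OF _ w] by (simp add: spoly.subspace_add[OF Usub] spoly.subspace_scale[OF Usub] spoly.subspace_add[OF L.V_subspace])
    qed
    then show ?thesis by blast
  qed
  have Uind: "P x" if x: "x \<in> U" and base: "\<And>v w. v \<in> L.V \<Longrightarrow> w \<in> R.V \<Longrightarrow> P (tau v w)"
     and add: "\<And>x y. P x \<Longrightarrow> P y \<Longrightarrow> P (x + y)" and scale: "\<And>c x. P x \<Longrightarrow> P (smul c x)" for P x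
    using x unfolding U_def
  proof (induction rule: spoly.span_induct_alt)
    case base
    have "P (smul 0 (tau f f))"
      using that(2)[OF L.f_V R.f_V] by (rule scale)
    then show ?case by simp
  next
    case (step c x y)
    then obtain b c' where "x = tau b c'" "b \<in> B" "c' \<in> C"
      by auto
    then have "P x"
      using that(2)[of b c'] B(1) C(1) by blast
    then show ?case
      using step by (intro add scale)
  qed
  have Lpart: "\<exists>v0 v1. v = v0 + v1 \<and> v0 \<in> L.V \<and> v1 \<in> L.V \<and> homog \<pi> v0 \<and> homog (\<not> \<pi>) v1" if "v \<in> L.V" for v
    using L.V_split[OF that] by metis
  have Rpart: "\<exists>w0 w1. w = w0 + w1 \<and> w0 \<in> R.V \<and> w1 \<in> R.V \<and> homog False w0 \<and> homog True w1" if w: "w \<in> R.V" for w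
  proof -
    obtain A0 A1 where A: "w = A0 f + A1 f" "A0 f \<in> R.V" "A1 f \<in> R.V" "homog \<pi> (A0 f)" "homog (\<not> \<pi>) (A1 f)"
      using R.V_split[OF w] by blast
    show ?thesis
    proof (cases \<pi>)
      case True
      moreover from A(1) have "w = A1 f + A0 f" by (simp only: add.commute)
      ultimately show ?thesis using A(2-5) by auto
    next
      case False
      with A show ?thesis by auto
    qed
  qed
  have Ugraded: "\<exists>x0 x1. x = x0 + x1 \<and> x0 \<in> U \<and> x1 \<in> U \<and> x0 \<in> poly_part p q m n False \<and> x1 \<in> poly_part p q m n True" if "x \<in> U" for x
    using that
  proof (rule Uind)
    fix v w assume v: "v \<in> L.V" and w: "w \<in> R.V"
    obtain v0 v1 where v': "v = v0 + v1" "v0 \<in> L.V" "v1 \<in> L.V" "homog \<pi> v0" "homog (\<not> \<pi>) v1"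
      using Lpart[OF v] by blast
    obtain w0 w1 where w': "w = w0 + w1" "w0 \<in> R.V" "w1 \<in> R.V" "homog False w0" "homog True w1"
      using Rpart[OF w] by blast
    have "tau v w = (tau v0 w0 + tau v1 w1) + (tau v0 w1 + tau v1 w0)"
      using v' w' w by (simp add: tau_add_left tau_right algebra_simps)
    moreover have "homog False (tau v0 w0)" "homog False (tau v1 w1)" "homog True (tau v0 w1)" "homog True (tau v1 w0)"
      using tau_homog[of v0 False] tau_homog[of v1 True] v' w' by fastforce+
    moreover have "tau v0 w0 + tau v1 w1 \<in> U" "tau v0 w1 + tau v1 w0 \<in> U"
      by (intro spoly.subspace_add[OF Usub] tV v' w')+
    moreover have "tau v0 w0 + tau v1 w1 \<in> polyin ?S" "tau v0 w1 + tau v1 w0 \<in> polyin ?S"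
      by (intro polyin_add tau_polyin v' w')+
    ultimately show "\<exists>x0 x1. tau v w = x0 + x1 \<and> x0 \<in> U \<and> x1 \<in> U \<and> x0 \<in> poly_part p q m n False \<and> x1 \<in> poly_part p q m n True"
      unfolding poly_part_iff by (blast intro: homog_add)
  next
    fix x y
    assume "\<exists>x0 x1. x = x0 + x1 \<and> x0 \<in> U \<and> x1 \<in> U \<and> x0 \<in> poly_part p q m n False \<and> x1 \<in> poly_part p q m n True"
      and "\<exists>x0 x1. y = x0 + x1 \<and> x0 \<in> U \<and> x1 \<in> U \<and> x0 \<in> poly_part p q m n False \<and> x1 \<in> poly_part p q m n True"
    then obtain x0 x1 y0 y1 where "x = x0 + x1 \<and> x0 \<in> U \<and> x1 \<in> U \<and> x0 \<in> poly_part p q m n False \<and> x1 \<in> poly_part p q m n True"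
      "y = y0 + y1 \<and> y0 \<in> U \<and> y1 \<in> U \<and> y0 \<in> poly_part p q m n False \<and> y1 \<in> poly_part p q m n True"
      by blast
    then show "\<exists>x0 x1. x + y = x0 + x1 \<and> x0 \<in> U \<and> x1 \<in> U \<and> x0 \<in> poly_part p q m n False \<and> x1 \<in> poly_part p q m n True"
      by (intro exI[of _ "x0 + y0"] exI[of _ "x1 + y1"])
         (auto simp: poly_part_iff algebra_simps intro: homog_add polyin_add spoly.subspace_add[OF Usub])
  next
    fix c x
    assume "\<exists>x0 x1. x = x0 + x1 \<and> x0 \<in> U \<and> x1 \<in> U \<and> x0 \<in> poly_part p q m n False \<and> x1 \<in> poly_part p q m n True"
    then obtain x0 x1 where "x = x0 + x1 \<and> x0 \<in> U \<and> x1 \<in> U \<and> x0 \<in> poly_part p q m n False \<and> x1 \<in> poly_part p q m n True"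
      by blast
    then show "\<exists>x0 x1. smul c x = x0 + x1 \<and> x0 \<in> U \<and> x1 \<in> U \<and> x0 \<in> poly_part p q m n False \<and> x1 \<in> poly_part p q m n True"
      by (intro exI[of _ "smul c x0"] exI[of _ "smul c x1"])
         (auto simp: poly_part_iff spoly.scale_right_distrib intro: homog_smul polyin_smul spoly.subspace_scale[OF Usub])
  qed
  have UL: "left_action m n a b x \<in> U" if ab: "a \<in> gl_ix p q" "b \<in> gl_ix p q" and x: "x \<in> U" for a b x
    using x by (rule Uind)
      (auto simp: tau_left_action ab L.E_add L.E_smul L.V_E intro: tV spoly.subspace_add[OF Usub] spoly.subspace_scale[OF Usub])
  have UR: "right_action p q s t x \<in> U" if st: "s \<in> gl_ix m n" "t \<in> gl_ix m n" and x: "x \<in> U" for s t x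
    using x
  proof (rule Uind)
    fix v w assume v: "v \<in> L.V" and w: "w \<in> R.V"
    obtain v0 v1 where v': "v = v0 + v1" "v0 \<in> L.V" "v1 \<in> L.V" "homog \<pi> v0" "homog (\<not> \<pi>) v1"
      using Lpart[OF v] by blast
    have "right_action p q s t (tau v0 w) \<in> U" "right_action p q s t (tau v1 w) \<in> U"
      using tau_right_action[of v0 False, OF _ _ w st] tau_right_action[of v1 True, OF _ _ w st] v' R.V_E[OF st w]
      by (auto intro: tV spoly.subspace_scale[OF Usub])
    then show "right_action p q s t (tau v w) \<in> U"
      using v' w by (simp add: tau_add_left R.E_add spoly.subspace_add[OF Usub])
  qed (auto simp: R.E_add R.E_smul intro: spoly.subspace_add[OF Usub] spoly.subspace_scale[OF Usub])
  have Ueq: "U = {u + w |u w. u \<in> U \<inter> poly_part p q m n False \<and> w \<in> U \<inter> poly_part p q m n True}"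
    using Ugraded spoly.subspace_add[OF Usub] by blast
  have sub: "poly_submodule p q m n U"
    unfolding poly_submodule_def gl_submodule_def left_poly_def right_poly_def
    using Usub Ueq UL UR by simp
  have "U \<subseteq> homogeneous d"
  proof
    fix x assume "x \<in> U"
    then show "x \<in> homogeneous d"
      by (rule Uind) (auto intro: tau_homogeneous assms spoly.subspace_add[OF homogeneous_subspace] spoly.subspace_scale[OF homogeneous_subspace])
  qed
  have inj: "inj_on ?t (B \<times> C)"
  proof (rule inj_onI, rule ccontr)
    fix x y assume x: "x \<in> B \<times> C" and y: "y \<in> B \<times> C" and eq: "?t x = ?t y" and ne: "x \<noteq> y"
    have "(if (fst x, snd x) = x then 1 else -1 :: complex) = 0"
    proof (rule tau_independent[OF B(1,2) C(1,2), of "{x, y}" "\<lambda>z. if z = x then 1 else -1" "fst x" "snd x"])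
      show "(\<Sum>(b, c)\<in>{x, y}. smul (if (b, c) = x then 1 else -1) (tau b c)) = 0"
        using eq ne by (auto simp: case_prod_beta)
    qed (use x y in auto)
    then show False by simp
  qed
  have ind: "spoly.independent (?t ` (B \<times> C))"
    unfolding spoly.independent_explicit_module
  proof (intro allI impI)
    fix T u v assume T: "finite T" "T \<subseteq> ?t ` (B \<times> C)" "(\<Sum>v\<in>T. smul (u v) v) = 0" "v \<in> T"
    then obtain T' where T': "T' \<subseteq> B \<times> C" "T = ?t ` T'"
      by (meson subset_imageE)
    then have inj': "inj_on ?t T'"
      using inj inj_on_subset by blast
    then have "finite T'"
      using T(1) T' by (simp add: finite_image_iff)
    obtain b c where bc: "(b, c) \<in> T'" "v = tau b c"
      using T(4) T' by auto
    have "(\<Sum>(b, c)\<in>T'. smul (u (tau b c)) (tau b c)) = 0"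
      using T(3) unfolding T'(2) sum.reindex[OF inj'] by (simp add: case_prod_beta comp_def)
    then have "(\<lambda>x. u (?t x)) (b, c) = 0"
      by (intro tau_independent[OF B(1,2) C(1,2) \<open>finite T'\<close> T'(1) _ bc(1)]) simp
    then show "u v = 0"
      using bc(2) by simp
  qed
  have "tensor_iso p q m n (L.Vmod \<pi>) (R.Vmod False) U tau"
    unfolding tensor_iso_def L.carr_Vmod R.carr_Vmod
  proof (intro conjI)
    show "\<exists>B C. \<not> module.dependent (scal (L.Vmod \<pi>)) B \<and> module.span (scal (L.Vmod \<pi>)) B = L.V \<and>
            \<not> module.dependent (scal (R.Vmod False)) C \<and> module.span (scal (R.Vmod False)) C = R.V \<and>
            inj_on (\<lambda>(b, c). tau b c) (B \<times> C) \<and> spoly.independent ((\<lambda>(b, c). tau b c) ` (B \<times> C)) \<and>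
            spoly.span ((\<lambda>(b, c). tau b c) ` (B \<times> C)) = U"
      by (rule exI[of _ B], rule exI[of _ C]) (use B C spanB spanC inj ind U_def in simp)
    show "\<forall>\<epsilon> \<delta>. \<forall>v\<in>part (L.Vmod \<pi>) \<epsilon>. \<forall>w\<in>part (R.Vmod False) \<delta>. tau v w \<in> poly_part p q m n (\<epsilon> \<noteq> \<delta>)"
      using tau_homog tau_polyin by (simp add: poly_part_iff)
    show "\<forall>s\<in>gl_ix m n. \<forall>t\<in>gl_ix m n. \<forall>\<epsilon>. \<forall>v\<in>part (L.Vmod \<pi>) \<epsilon>. \<forall>w\<in>R.V.
        right_action p q s t (tau v w) = smul (ksign (epar s t) \<epsilon>) (tau v (act (R.Vmod False) s t w))"
      using tau_right_action by simp
  qed (auto simp: tau_add_left tau_smul_left tau_right tau_left_action)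
  then show ?thesis
    unfolding appears_def using L.hwv_Vmod[of lam \<pi>] R.hwv_Vmod[of lam False] sub \<open>U \<subseteq> homogeneous d\<close> by blast
qed

end

section \<open>Young diagrams\<close>

lemma young_antimono:
  assumes "young_diagram lam" "1 \<le> i" "i \<le> j"
  shows "lam j \<le> lam i"
  using assms(3)
  by (induction rule: dec_induct) (use assms(1,2) in \<open>auto simp: young_diagram_def intro: order_trans\<close>)

lemma young_finite:
  assumes "young_diagram lam" "1 \<le> j"
  shows "finite {i. 1 \<le> i \<and> j \<le> lam i}"
  by (rule finite_subset[of _ "{i. 1 \<le> i \<and> 0 < lam i}"]) (use assms in \<open>auto simp: young_diagram_def\<close>)

text \<open>The boxes of a column form an initial segment.\<close>

lemma conj_iff:
  assumes y: "young_diagram lam" and j: "1 \<le> j" and i: "1 \<le> i"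
  shows "i \<le> conj_diagram lam j \<longleftrightarrow> j \<le> lam i"
proof
  assume h: "j \<le> lam i"
  have "{1..i} \<subseteq> {i. 1 \<le> i \<and> j \<le> lam i}"
    using young_antimono[OF y] h by (auto intro: order_trans)
  from card_mono[OF young_finite[OF y j] this] show "i \<le> conj_diagram lam j"
    by (simp add: conj_diagram_def)
next
  assume h: "i \<le> conj_diagram lam j"
  show "j \<le> lam i"
  proof (rule ccontr)
    assume n: "\<not> j \<le> lam i"
    have "{i. 1 \<le> i \<and> j \<le> lam i} \<subseteq> {1..<i}"
    proof
      fix k assume k: "k \<in> {i. 1 \<le> i \<and> j \<le> lam i}"
      then have "\<not> i \<le> k"
        using young_antimono[OF y i, of k] n by auto
      with k show "k \<in> {1..<i}" by auto
    qed
    from card_mono[OF _ this] have "conj_diagram lam j \<le> i - 1"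
      by (simp add: conj_diagram_def)
    with h i show False by simp
  qed
qed

lemma conj_0_length: "diagram_length (conj_diagram lam) = lam 1" if y: "young_diagram lam"
proof -
  have "{j. 1 \<le> j \<and> 0 < conj_diagram lam j} = {1..lam 1}"
    using conj_iff[OF y, of _ 1] by (auto simp: Suc_le_eq One_nat_def)
  then show ?thesis
    by (simp add: diagram_length_def)
qed

lemma length_iff:
  assumes y: "young_diagram lam" and i: "1 \<le> i"
  shows "i \<le> diagram_length lam \<longleftrightarrow> 0 < lam i"
proof -
  have "diagram_length lam = conj_diagram lam 1"
    by (simp add: diagram_length_def conj_diagram_def Suc_le_eq One_nat_def)
  then show ?thesis
    using conj_iff[OF y order_refl i] by (simp add: Suc_le_eq One_nat_def)
qed

lemma conj_antimono: "young_diagram lam \<Longrightarrow> 1 \<le> i \<Longrightarrow> i \<le> j \<Longrightarrow> conj_diagram lam j \<le> conj_diagram lam i"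
  unfolding conj_diagram_def by (rule card_mono[OF young_finite]) auto

lemma sum_indicator_card: "(\<Sum>i\<in>A. if P i then 1 else 0) = (of_nat (card {i \<in> A. P i}) :: complex)" if "finite A"
  using that by (simp add: sum.If_cases Int_def)

section \<open>Annihilation by the simple root vectors\<close>

lemma left_vars:
  "left_action m n a b (xv l i) = (if b = Inl i \<and> 1 \<le> l \<and> l \<le> m then gen (zvar (Inl l) a) else 0)"
  "left_action m n a b (xiv l j) = (if b = Inr j \<and> 1 \<le> l \<and> l \<le> m then gen (zvar (Inl l) a) else 0)"
  "left_action m n a b (etav k i) = (if b = Inl i \<and> 1 \<le> k \<and> k \<le> n then gen (zvar (Inr k) a) else 0)"
  "left_action m n a b (yv k j) = (if b = Inr j \<and> 1 \<le> k \<and> k \<le> n then gen (zvar (Inr k) a) else 0)"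
  using left_gen[of m n a b "Inl l" "Inl i"] left_gen[of m n a b "Inl l" "Inr j"] left_gen[of m n a b "Inr k" "Inl i"] left_gen[of m n a b "Inr k" "Inr j"]
  by (auto simp del: zvar_eq)

lemma right_vars:
  "right_action p q s t (xv l i) = (if t = Inl l \<and> 1 \<le> i \<and> i \<le> p then gen (zvar s (Inl i)) else 0)"
  "right_action p q s t (xiv l j) = (if t = Inl l \<and> 1 \<le> j \<and> j \<le> q then smul (ksign (epar s t) True) (gen (zvar s (Inr j))) else 0)"
  "right_action p q s t (etav k i) = (if t = Inr k \<and> 1 \<le> i \<and> i \<le> p then gen (zvar s (Inl i)) else 0)"
  "right_action p q s t (yv k j) = (if t = Inr k \<and> 1 \<le> j \<and> j \<le> q then smul (ksign (epar s t) True) (gen (zvar s (Inr j))) else 0)"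
  using right_gen[of p q s t "Inl l" "Inl i"] right_gen[of p q s t "Inl l" "Inr j"] right_gen[of p q s t "Inr k" "Inl i"] right_gen[of p q s t "Inr k" "Inr j"]
  by (auto simp del: zvar_eq)

lemma pdiff_outside: "f \<in> polyin S \<Longrightarrow> v \<notin> S \<Longrightarrow> pdiff v f = 0"
proof (induction f rule: polyin_induct)
  case (gen u f)
  then have "u \<noteq> v" by blast
  with gen show ?case by (simp add: pdiff_gen del: pdiff_simps)
qed (simp_all add: pdiff_1 pdiff_add pdiff_smul del: pdiff_simps)

text \<open>The extra variables occur in \<open>det X\<close>, so the left action is studied on all \<open>x\<^sub>l\<^sup>i\<close> with \<open>l \<le> p\<close>;
  on polynomials without them nothing changes.\<close>

lemma left_extend:
  assumes "m \<le> p" "f \<in> polyin (poly_vars p q m n)"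
  shows "left_action m n a b f = left_action p n a b f"
  unfolding left_action_def
proof (rule sum.mono_neutral_left)
  show "gl_ix m n \<subseteq> gl_ix p n"
    using assms(1) by (auto simp: gl_ix_def)
  show "\<forall>s\<in>gl_ix p n - gl_ix m n. gen (zvar s a) * pdiff (zvar s b) f = 0"
    using pdiff_outside[OF assms(2)] by auto
qed simp

lemma sder_oprod_0: "sder \<epsilon> D \<Longrightarrow> (\<And>i. a \<le> i \<Longrightarrow> i \<le> b \<Longrightarrow> D (f i) = 0) \<Longrightarrow> D (oprod a b f) = 0"
  by (rule oprod_induct[of "\<lambda>x. D x = 0"]) (auto simp: sder_1 sder_mult)

text \<open>Even factors in front of a derivative do not prevent \<open>z\<close> from reaching it.\<close>

lemma sder_oprod_kill:
  assumes D: "sder \<epsilon> D" and f: "\<And>i. 1 \<le> i \<Longrightarrow> i \<le> r \<Longrightarrow> homog False (f i) \<and> z * D (f i) = 0"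
  shows "z * D (oprod 1 r f) = 0"
  using f
proof (induction r)
  case 0
  then show ?case by (simp add: sder_1[OF D])
next
  case (Suc r)
  have "homog False (oprod 1 r f)"
    by (rule homog_oprod_False) (use Suc.prems in auto)
  then have "iot \<epsilon> (oprod 1 r f) = oprod 1 r f" "z * oprod 1 r f = oprod 1 r f * z"
    by (auto simp: iot_def homog_False homog_central)
  moreover have "z * D (oprod 1 r f) = 0" "z * D (f (Suc r)) = 0"
    using Suc by auto
  ultimately show ?case
    by (simp add: oprod_Suc sder_mult[OF D] distrib_left flip: mult.assoc) (simp add: mult.assoc)
qed

lemma sder_sdet_kill:
  assumes D: "sder \<epsilon> D" and a: "\<And>l i. l \<in> {1..r} \<Longrightarrow> i \<in> {1..r} \<Longrightarrow> homog False (a l i) \<and> z * D (a l i) = 0"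
  shows "z * D (sdet r a) = 0"
proof -
  have "z * D (oprod 1 r (\<lambda>l. a l (\<sigma> l))) = 0" if "\<sigma> permutes {1..r}" for \<sigma>
    by (rule sder_oprod_kill[OF D]) (use that a permutes_range[OF that] in auto)
  then have "z * D (of_int (sign \<sigma>) * oprod 1 r (\<lambda>l. a l (\<sigma> l))) = 0" if "\<sigma> permutes {1..r}" for \<sigma>
    using that by (simp add: sder_of_int_mult[OF D] of_int_spoly sder_smul[OF D])
  then show ?thesis
    unfolding sdet_def sder_sum[OF D] sum_distrib_left by (simp add: sum.neutral)
qed

lemma iot_Delta: "iot \<epsilon> (Delta r) = Delta r"
  using homog_Delta[of r] by (simp add: iot_def homog_False)

lemma iot_th: "k \<in> {1..r} \<Longrightarrow> iot \<epsilon> (detX r j {k}) = smul (ksign \<epsilon> True) (detX r j {k})"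
  using homog_th[of k r j] by (simp add: iot_def homog_True)

lemma sder_yhat:
  assumes D: "sder \<epsilon> D" and mp: "m \<le> p" and d: "D (Delta p) = 0"
  shows "D (yhat p m c j) = Delta p * D (yv c j) + (\<Sum>k=1..m. D (detX p c {k}) * xiv k j + smul (ksign \<epsilon> True) (detX p c {k} * D (xiv k j)))"
proof -
  have "D (detX p c {k} * xiv k j) = D (detX p c {k}) * xiv k j + smul (ksign \<epsilon> True) (detX p c {k} * D (xiv k j))" if "k \<in> {1..m}" for k
    using that mp by (simp add: sder_mult[OF D] iot_th)
  then show ?thesis
    by (simp add: yhat_def sder_add[OF D] sder_mult[OF D] sder_sum[OF D] d iot_Delta)
qed

subsection \<open>The left action\<close>

lemma sder_actions: "sder False (left_action m n (Inl a) (Inl b))" "sder False (left_action m n (Inr a) (Inr b))"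
  "sder True (left_action m n (Inl a) (Inr b))"
  "sder False (right_action m n (Inl a) (Inl b))" "sder False (right_action m n (Inr a) (Inr b))"
  "sder True (right_action m n (Inl a) (Inr b))"
  using sder_left[of "Inl a" "Inl b" m n] sder_left[of "Inr a" "Inr b" m n] sder_left[of "Inl a" "Inr b" m n]
    sder_right[of "Inl a" "Inl b" m n] sder_right[of "Inr a" "Inr b" m n] sder_right[of "Inl a" "Inr b" m n]
  by (simp_all add: epar_def)

lemma left_even_detX:
  assumes i: "1 < i" "r \<le> p" "j \<in> {1..n}"
  shows "left_action p n (Inl (i - 1)) (Inl i) (detX r j I) = 0"
proof (cases "i \<le> r")
  case True
  show ?thesis
    unfolding detX_def
    by (rule sder_column[of _ "i - 1" r i, OF sder_actions(1)]) (use i True in \<open>auto simp: left_vars\<close>)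
next
  case False
  then show ?thesis
    unfolding detX_def by (intro sder_sdet_0[OF sder_actions(1)]) (auto simp: left_vars)
qed

lemma left_even_Delta: "1 < i \<Longrightarrow> r \<le> p \<Longrightarrow> left_action p n (Inl (i - 1)) (Inl i) (Delta r) = 0"
proof (cases "i \<le> r")
  case True
  assume "1 < i" "r \<le> p"
  with True show ?thesis
    unfolding Delta_def
    by (intro sder_column[of _ "i - 1" r i, OF sder_actions(1)]) (auto simp: left_vars)
next
  case False
  then show ?thesis
    unfolding Delta_def by (intro sder_sdet_0[OF sder_actions(1)]) (auto simp: left_vars)
qed

lemma left_even_yhat:
  assumes "1 < i" "m \<le> p" "c \<in> {1..n}"
  shows "left_action p n (Inl (i - 1)) (Inl i) (yhat p m c j) = 0"
  using assms left_even_detX[OF assms(1) order_refl assms(3)] left_even_Delta[OF assms(1), of p p n]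
  by (subst sder_yhat[OF sder_actions(1)]) (auto simp: left_vars)

lemma left_Inr_0: "left_action p n a (Inr l) (detX r j I) = 0" "left_action p n a (Inr l) (Delta r) = 0"
  unfolding detX_def Delta_def by (rule sder_sdet_0[OF sder_left]; auto simp: left_vars)+

lemma left_Inr_yhat:
  assumes "m \<le> p" "c \<in> {1..n}"
  shows "left_action p n (Inr l') (Inr l) (yhat p m c j) = (if j = l then yhat p m c l' else 0)"
proof -
  have "(\<Sum>k=1..m. detX p c {k} * left_action p n (Inr l') (Inr l) (xiv k j)) = (if j = l then (\<Sum>k=1..m. detX p c {k} * xiv k l') else 0)"
    using assms(1) by (auto simp: left_vars intro!: sum.cong sum.neutral)
  then show ?thesis
    using assms by (subst sder_yhat[OF sder_actions(2)]) (auto simp: left_Inr_0 left_vars yhat_def)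
qed

text \<open>By Cramer's rule for \<open>\<eta>\<^sub>c\<close>, the terms with \<open>k \<le> m\<close> cancel against those from the \<open>\<xi>\<^sub>k\<close>.\<close>

lemma left_odd_yhat:
  assumes "m \<le> p" "1 \<le> p" "c \<in> {1..n}"
  shows "left_action p n (Inl p) (Inr 1) (yhat p m c j) = (if j = 1 then (\<Sum>k=m+1..p. detX p c {k} * xv k p) else 0)"
proof (cases "j = 1")
  case True
  have "left_action p n (Inl p) (Inr 1) (yhat p m c j) = Delta p * etav c p - (\<Sum>k=1..m. detX p c {k} * xv k p)"
    using assms True by (subst sder_yhat[OF sder_actions(3)]) (auto simp: left_Inr_0 left_vars sum_negf intro!: sum.cong)
  also have "Delta p * etav c p = (\<Sum>k=1..m. detX p c {k} * xv k p) + (\<Sum>k=m+1..p. detX p c {k} * xv k p)"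
    using assms sum.ub_add_nat[of 1 m "\<lambda>k. detX p c {k} * xv k p" "p - m"] by (subst cramer) auto
  finally show ?thesis
    using True by simp
next
  case False
  then show ?thesis
    using assms by (subst sder_yhat[OF sder_actions(3)]) (auto simp: left_Inr_0 left_vars)
qed

subsection \<open>The right action\<close>

lemma right_even_detX:
  assumes s: "1 < s" and I: "s \<notin> I" "s - 1 \<notin> I" and rp: "r \<le> p"
  shows "right_action p q (Inl (s - 1)) (Inl s) (detX r j I) = 0"
proof -
  let ?D = "right_action p q (Inl (s - 1)) (Inl s)"
  let ?a = "\<lambda>l i. if l \<in> I then etav j i else xv l i"
  have "?D (detX r j I) = (\<Sum>k=1..r. sdet r (?a(k := \<lambda>i. ?D (?a k i))))"
    unfolding detX_def by (rule sder_sdet[OF sder_actions(4)]) simp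
  also have "\<dots> = 0"
  proof (rule sum.neutral, rule ballI)
    fix k assume k: "k \<in> {1..r}"
    show "sdet r (?a(k := \<lambda>i. ?D (?a k i))) = 0"
    proof (cases "k = s")
      case True
      have "sdet r (?a(k := \<lambda>i. ?D (?a k i))) = sdet r (?a(s := xv (s - 1)))"
        by (rule sdet_cong) (use True I rp in \<open>auto simp: right_vars\<close>)
      also have "\<dots> = 0"
        by (rule sdet_equal_rows[of "s - 1" _ s]) (use s I k True homog_vars in auto)
      finally show ?thesis .
    next
      case False
      then show ?thesis
        by (intro sdet_zero_row[OF k]) (auto simp: right_vars)
    qed
  qed
  finally show ?thesis .
qed

lemma right_even_th:
  assumes s: "1 < s" "s \<le> r" and rp: "r \<le> p" and k: "k \<in> {1..r}"
  shows "right_action p q (Inl (s - 1)) (Inl s) (detX r j {k}) = (if k = s - 1 then - detX r j {s} else 0)"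
proof -
  let ?D = "right_action p q (Inl (s - 1)) (Inl s)"
  let ?a = "\<lambda>l i. if l \<in> {k} then etav j i else xv l i"
  consider "k = s" | "k = s - 1" | "s \<notin> {k}" "s - 1 \<notin> {k}" by auto
  then show ?thesis
  proof cases
    case 1
    then have "?D (detX r j {k}) = 0"
      using s unfolding detX_def by (intro sder_sdet_0[OF sder_actions(4)]) (auto simp: right_vars)
    with 1 s show ?thesis by auto
  next
    case 2
    have "?D (detX r j {k}) = (\<Sum>h=1..r. sdet r (?a(h := \<lambda>i. ?D (?a h i))))"
      unfolding detX_def by (rule sder_sdet[OF sder_actions(4)]) simp
    also have "\<dots> = (\<Sum>h=1..r. if h = s then sdet r ((xv(s - 1 := etav j))(s := xv (s - 1))) else 0)"
    proof (rule sum.cong[OF refl])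
      fix h assume h: "h \<in> {1..r}"
      show "sdet r (?a(h := \<lambda>i. ?D (?a h i))) = (if h = s then sdet r ((xv(s - 1 := etav j))(s := xv (s - 1))) else 0)"
      proof (cases "h = s")
        case True
        with 2 s rp show ?thesis by (auto intro!: sdet_cong simp: right_vars)
      next
        case False
        then have "sdet r (?a(h := \<lambda>i. ?D (?a h i))) = 0"
          by (intro sdet_zero_row[OF h]) (auto simp: right_vars)
        with False show ?thesis by simp
      qed
    qed
    also have "\<dots> = sdet r ((xv(s - 1 := etav j))(s := xv (s - 1)))"
      using s by simp
    also have "\<dots> = - sdet r (xv(s := etav j))"
    proof (rule sdet_swap_rows[of "s - 1" s])
      fix \<sigma>
      have "oprod (Suc (s - 1)) (s - 1) (\<lambda>h. (xv(s := etav j)) h (\<sigma> h)) = 1"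
        by simp
      then show "(xv(s := etav j)) (s - 1) (\<sigma> (s - 1)) * oprod (Suc (s - 1)) (s - 1) (\<lambda>h. (xv(s := etav j)) h (\<sigma> h)) * (xv(s := etav j)) s (\<sigma> s) =
        (xv(s := etav j)) s (\<sigma> s) * oprod (Suc (s - 1)) (s - 1) (\<lambda>h. (xv(s := etav j)) h (\<sigma> h)) * (xv(s := etav j)) (s - 1) (\<sigma> (s - 1))"
        using s homog_central[OF homog_vars(1)] by auto
    qed (use s in auto)
    finally show ?thesis
      using 2 by (simp add: th_upd)
  next
    case 3
    then show ?thesis
      using right_even_detX[OF s(1) 3 rp] by auto
  qed
qed

text \<open>The change of the coordinates of \<open>\<eta>\<^sub>c\<close> is contragredient to that of the \<open>\<xi>\<^sub>k\<close>.\<close>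

lemma right_even_yhat:
  assumes s: "1 < s" "s \<le> m" and mp: "m \<le> p" and j: "j \<in> {1..q}"
  shows "right_action p q (Inl (s - 1)) (Inl s) (yhat p m c j) = 0"
proof -
  let ?D = "right_action p q (Inl (s - 1)) (Inl s)"
  have d: "?D (Delta p) = 0"
    using right_even_detX[of s "{}" p p q] s by (simp add: detX_empty)
  have "?D (yhat p m c j) = (\<Sum>k=1..m. ?D (detX p c {k}) * xiv k j + detX p c {k} * ?D (xiv k j))"
    by (subst sder_yhat[OF sder_actions(4) mp d]) (simp add: right_vars)
  also have "\<dots> = (\<Sum>k=1..m. (if k = s - 1 then - (detX p c {s} * xiv (s - 1) j) else 0) + (if k = s then detX p c {s} * xiv (s - 1) j else 0))"
    by (rule sum.cong[OF refl]) (use s mp j in \<open>auto simp: right_even_th right_vars epar_def\<close>)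
  also have "\<dots> = 0"
    using s by (auto simp: sum.distrib)
  finally show ?thesis .
qed

lemma right_eta_x: "right_action p q (Inr a) (Inr b) (xv l i) = 0" "right_action p q (Inl a) (Inr b) (xv l i) = 0"
  by (auto simp: right_vars)

lemma right_eta_th:
  assumes "r \<le> p" "k \<in> {1..r}"
  shows "right_action p q (Inr b') (Inr b) (detX r j {k}) = (if j = b then detX r b' {k} else 0)"
proof -
  have "right_action p q (Inr b') (Inr b) (detX r j {k}) = sdet r (xv(k := \<lambda>i. right_action p q (Inr b') (Inr b) (etav j i)))"
    by (rule sder_th[OF sder_actions(5) right_eta_x(1) assms(2)])
  also have "\<dots> = (if j = b then detX r b' {k} else 0)"
  proof (cases "j = b")
    case True
    with assms show ?thesis
      by (auto simp: th_upd right_vars intro!: sdet_cong)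
  next
    case False
    then show ?thesis
      using assms by (auto simp: right_vars intro!: sdet_zero_row[of k])
  qed
  finally show ?thesis .
qed

lemma right_eta_Delta: "right_action p q (Inr a) (Inr b) (Delta r) = 0" "right_action p q (Inl a) (Inr b) (Delta r) = 0"
  by (rule sder_Delta_0[OF sder_right], simp add: right_eta_x)+

lemma right_eta_yhat:
  assumes "m \<le> p" "j \<in> {1..q}"
  shows "right_action p q (Inr b') (Inr b) (yhat p m c j) = (if c = b then yhat p m b' j else 0)"
  using assms by (subst sder_yhat[OF sder_actions(5)])
    (auto simp: right_eta_Delta right_eta_th right_vars yhat_def epar_def intro!: sum.cong)

lemma right_odd_th:
  assumes "r \<le> p" "k \<in> {1..r}" "1 \<le> m" "m \<le> r"
  shows "right_action p q (Inl m) (Inr 1) (detX r j {k}) = (if j = 1 \<and> k = m then Delta r else 0)"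
proof -
  have "right_action p q (Inl m) (Inr 1) (detX r j {k}) = sdet r (xv(k := \<lambda>i. right_action p q (Inl m) (Inr 1) (etav j i)))"
    by (rule sder_th[OF sder_actions(6) right_eta_x(2) assms(2)])
  also have "\<dots> = (if j = 1 \<and> k = m then Delta r else 0)"
  proof (cases "j = 1")
    case True
    have "sdet r (xv(k := \<lambda>i. right_action p q (Inl m) (Inr 1) (etav j i))) = sdet r (xv(k := xv m))"
      by (rule sdet_cong) (use assms True in \<open>auto simp: right_vars\<close>)
    also have "\<dots> = (if k = m then Delta r else 0)"
    proof (cases "k = m")
      case True
      then show ?thesis by (simp add: Delta_def fun_upd_idem)
    next
      case False
      then have "sdet r (xv(k := xv m)) = 0"
        by (intro sdet_equal_rows[of m r k]) (use assms homog_vars in auto)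
      with False show ?thesis by simp
    qed
    finally show ?thesis
      using True by simp
  next
    case False
    then show ?thesis
      using assms by (auto simp: right_vars intro!: sdet_zero_row[of k])
  qed
  finally show ?thesis .
qed

text \<open>The change of the coordinates of \<open>\<eta>\<^sub>1\<close> compensates that of \<open>y\<^sub>1\<close>.\<close>

lemma right_odd_yhat:
  assumes "m \<le> p" "1 \<le> m" "j \<in> {1..q}"
  shows "right_action p q (Inl m) (Inr 1) (yhat p m c j) = 0"
proof -
  let ?D = "right_action p q (Inl m) (Inr 1)"
  have "?D (yhat p m c j) = Delta p * ?D (yv c j) + (\<Sum>k=1..m. ?D (detX p c {k}) * xiv k j)"
    by (subst sder_yhat[OF sder_actions(6) assms(1)]) (auto simp: right_eta_Delta right_vars)
  also have "(\<Sum>k=1..m. ?D (detX p c {k}) * xiv k j) = (\<Sum>k=1..m. if k = m then (if c = 1 then Delta p * xiv m j else 0) else 0)"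
    by (rule sum.cong[OF refl]) (use assms in \<open>auto simp: right_odd_th\<close>)
  also have "\<dots> = (if c = 1 then Delta p * xiv m j else 0)"
    using assms by simp
  finally show ?thesis
    using assms by (auto simp: right_vars epar_def)
qed

section \<open>The highest weight vectors\<close>

subsection \<open>Weights\<close>

text \<open>All Cartan elements are derivations that multiply the variable \<open>e\<^sub>s \<otimes> e\<^sup>c\<close> by \<open>\<alpha> s + \<beta> c\<close>. Weights
  are computed for arbitrary \<open>\<alpha>\<close> and \<open>\<beta>\<close>, which are indicator functions in the end.\<close>

locale cartan =
  fixes p q n :: nat and H :: "spoly \<Rightarrow> spoly" and \<alpha> \<beta> :: "idx \<Rightarrow> complex"
  assumes H: "sder False H"
    and H_gen: "s \<in> gl_ix p n \<Longrightarrow> c \<in> gl_ix p q \<Longrightarrow> H (gen (zvar s c)) = smul (\<alpha> s + \<beta> c) (gen (zvar s c))"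
begin

lemma H_vars:
  "l \<in> {1..p} \<Longrightarrow> i \<in> {1..p} \<Longrightarrow> H (xv l i) = smul (\<alpha> (Inl l) + \<beta> (Inl i)) (xv l i)"
  "l \<in> {1..p} \<Longrightarrow> j \<in> {1..q} \<Longrightarrow> H (xiv l j) = smul (\<alpha> (Inl l) + \<beta> (Inr j)) (xiv l j)"
  "k \<in> {1..n} \<Longrightarrow> i \<in> {1..p} \<Longrightarrow> H (etav k i) = smul (\<alpha> (Inr k) + \<beta> (Inl i)) (etav k i)"
  "k \<in> {1..n} \<Longrightarrow> j \<in> {1..q} \<Longrightarrow> H (yv k j) = smul (\<alpha> (Inr k) + \<beta> (Inr j)) (yv k j)"
  using H_gen[of "Inl l" "Inl i"] H_gen[of "Inl l" "Inr j"] H_gen[of "Inr k" "Inl i"] H_gen[of "Inr k" "Inr j"]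
  by auto

lemma H_mult:
  assumes "H f = smul a f" "H g = smul b g"
  shows "H (f * g) = smul (a + b) (f * g)"
  using assms by (simp add: sder_mult[OF H] spoly.scale_left_distrib)

lemma H_Delta:
  assumes "r \<le> p"
  shows "H (Delta r) = smul ((\<Sum>l=1..r. \<alpha> (Inl l)) + (\<Sum>i=1..r. \<beta> (Inl i))) (Delta r)"
  unfolding Delta_def by (rule sder_sdet_weight[OF H]) (use assms H_vars in auto)

lemma H_Delta_power:
  assumes "r \<le> p"
  shows "H (Delta r ^ N) = smul (of_nat N * ((\<Sum>l=1..r. \<alpha> (Inl l)) + (\<Sum>i=1..r. \<beta> (Inl i)))) (Delta r ^ N)"
proof (induction N)
  case 0
  then show ?case by (simp add: sder_1[OF H])
next
  case (Suc N)
  then show ?case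
    using H_mult[OF H_Delta[OF assms] Suc] by (simp add: algebra_simps)
qed

lemma H_Delta2:
  assumes "m \<le> r" "r \<le> p" "j \<in> {1..n}"
  shows "H (Delta2 m j r) = smul ((\<Sum>l=1..m. \<alpha> (Inl l)) + of_nat (r - m) * \<alpha> (Inr j) + (\<Sum>i=1..r. \<beta> (Inl i))) (Delta2 m j r)"
proof -
  let ?u = "\<lambda>l. if l \<le> m then \<alpha> (Inl l) else \<alpha> (Inr j)"
  have "H (Delta2 m j r) = smul ((\<Sum>l=1..r. ?u l) + (\<Sum>i=1..r. \<beta> (Inl i))) (Delta2 m j r)"
    unfolding Delta2_def by (rule sder_sdet_weight[OF H]) (use assms H_vars in auto)
  also have "(\<Sum>l=1..r. ?u l) = (\<Sum>l=1..m. ?u l) + (\<Sum>l=m+1..r. ?u l)"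
    using assms(1) sum.ub_add_nat[of 1 m ?u "r - m"] by simp
  also have "(\<Sum>l=1..m. ?u l) = (\<Sum>l=1..m. \<alpha> (Inl l))"
    by (rule sum.cong) auto
  also have "(\<Sum>l=m+1..r. ?u l) = (\<Sum>l=m+1..r. \<alpha> (Inr j))"
    by (rule sum.cong) auto
  finally show ?thesis
    by simp
qed

lemma H_th:
  assumes "k \<in> {1..p}" "j \<in> {1..n}"
  shows "H (detX p j {k}) = smul ((\<Sum>l=1..p. \<alpha> (Inl l)) - \<alpha> (Inl k) + \<alpha> (Inr j) + (\<Sum>i=1..p. \<beta> (Inl i))) (detX p j {k})"
proof -
  let ?u = "\<lambda>l. if l \<in> {k} then \<alpha> (Inr j) else \<alpha> (Inl l)"
  have "H (detX p j {k}) = smul ((\<Sum>l=1..p. ?u l) + (\<Sum>i=1..p. \<beta> (Inl i))) (detX p j {k})"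
    unfolding detX_def by (rule sder_sdet_weight[OF H]) (use assms H_vars in auto)
  also have "(\<Sum>l=1..p. ?u l) = \<alpha> (Inr j) + (\<Sum>l\<in>{1..p} - {k}. ?u l)"
    using assms by (simp add: sum.remove[of _ k])
  also have "(\<Sum>l\<in>{1..p} - {k}. ?u l) = (\<Sum>l\<in>{1..p} - {k}. \<alpha> (Inl l))"
    by (rule sum.cong) auto
  also have "\<dots> = (\<Sum>l=1..p. \<alpha> (Inl l)) - \<alpha> (Inl k)"
    using assms by (simp add: sum_diff1)
  finally show ?thesis
    by (simp add: algebra_simps)
qed

lemma H_yhat:
  assumes "m \<le> p" "c \<in> {1..n}" "j \<in> {1..q}"
  shows "H (yhat p m c j) = smul ((\<Sum>l=1..p. \<alpha> (Inl l)) + (\<Sum>i=1..p. \<beta> (Inl i)) + \<alpha> (Inr c) + \<beta> (Inr j)) (yhat p m c j)"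
    (is "_ = smul ?w _")
proof -
  have "H (Delta p * yv c j) = smul ?w (Delta p * yv c j)"
    using H_mult[OF H_Delta[OF order_refl] H_vars(4)[OF assms(2,3)]] by (simp add: algebra_simps)
  moreover have "H (detX p c {k} * xiv k j) = smul ?w (detX p c {k} * xiv k j)" if "k \<in> {1..m}" for k
  proof -
    have "k \<in> {1..p}" using that assms by auto
    then show ?thesis
      using H_mult[OF H_th[OF _ assms(2)] H_vars(2)[OF _ assms(3)], of k k] by (simp add: algebra_simps)
  qed
  ultimately show ?thesis
    by (simp add: yhat_def sder_add[OF H] sder_sum[OF H] spoly.scale_right_distrib spoly.scale_sum_right)
qed

lemma H_sdet_yhat:
  assumes "m \<le> p" "N \<le> n" "N \<le> q"
  shows "H (sdet N (yhat p m)) = smul (of_nat N * ((\<Sum>l=1..p. \<alpha> (Inl l)) + (\<Sum>i=1..p. \<beta> (Inl i))) + (\<Sum>c=1..N. \<alpha> (Inr c) + \<beta> (Inr c))) (sdet N (yhat p m))"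
proof -
  have "H (sdet N (yhat p m)) = smul ((\<Sum>c=1..N. (\<Sum>l=1..p. \<alpha> (Inl l)) + (\<Sum>i=1..p. \<beta> (Inl i)) + \<alpha> (Inr c)) + (\<Sum>j=1..N. \<beta> (Inr j))) (sdet N (yhat p m))"
    by (rule sder_sdet_weight[OF H]) (use assms H_yhat in auto)
  then show ?thesis
    by (simp add: sum.distrib algebra_simps)
qed

end

lemma cartan_left: "a \<in> gl_ix p q \<Longrightarrow> cartan p q n (left_action p n a a) (\<lambda>_. 0) (\<lambda>c. if c = a then 1 else 0)"
  using sder_left[of a a p n] by unfold_locales (auto simp: epar_def left_gen simp del: zvar_eq)

lemma cartan_right: "s \<in> gl_ix m n \<Longrightarrow> cartan p q n' (right_action p q s s) (\<lambda>u. if u = s then 1 else 0) (\<lambda>_. 0)"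
  using sder_right[of s s p q] by unfold_locales (auto simp: epar_def right_gen simp del: zvar_eq)

subsection \<open>Construction\<close>

lemma ev_th: assumes "i \<in> {1..r}" shows "ev (detX r j {i}) = etav j i"
proof -
  have "ev (Delta r * etav j i) = (\<Sum>k=1..r. ev (detX r j {k}) * ev (xv k i))"
    using assms by (simp only: cramer ev_sum ev_mult)
  also have "\<dots> = (\<Sum>k=1..r. if k = i then ev (detX r j {k}) else 0)"
    by (rule sum.cong) (auto simp: ev_gens)
  also have "\<dots> = ev (detX r j {i})"
    using assms by simp
  finally show ?thesis
    by (simp add: ev_mult ev_Delta ev_gens)
qed

text \<open>A determinant with equal odd rows becomes, at the unit matrix, a multiple of a product of distinct
  variables \<open>\<eta>\<close>.\<close>

lemma ev_Delta2:
  assumes "m \<le> r"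
  shows "ev (Delta2 m j r) = smul (fact (r - m)) (oprod (Suc m) r (etav j))"
proof -
  have "ev (Delta2 m j r) = ev (Delta r ^ (r - m) * Delta2 m j r)"
    by (simp add: ev_mult ev_power ev_Delta)
  also have "\<dots> = smul (fact (r - m)) (oprod 1 r (\<lambda>k. ev (if m < k then detX r j {k} else 1)))"
    by (simp add: Delta2_product ev_smul ev_mult ev_Delta ev_oprod)
  also have "oprod 1 r (\<lambda>k. ev (if m < k then detX r j {k} else 1)) = oprod 1 r (\<lambda>k. if m < k then etav j k else 1)"
    by (rule oprod_cong) (auto simp: ev_th)
  also have "\<dots> = oprod 1 m (\<lambda>k. if m < k then etav j k else 1) * oprod (Suc m) r (\<lambda>k. if m < k then etav j k else 1)"
    using assms by (intro oprod_append) auto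
  also have "oprod 1 m (\<lambda>k. if m < k then etav j k else 1) = 1"
    by (rule oprod_1) auto
  also have "oprod (Suc m) r (\<lambda>k. if m < k then etav j k else 1) = oprod (Suc m) r (etav j)"
    by (rule oprod_cong) auto
  finally show ?thesis
    by simp
qed

lemma eta_product_nonzero: "oprod 1 N (\<lambda>j. oprod (Suc m) (c j) (etav j)) \<noteq> 0"
proof -
  \<comment> \<open>the variables \<open>\<eta>\<close> in the order in which they occur\<close>
  define us where "us N = concat (map (\<lambda>j. map (Eta j) [Suc m..<Suc (c j)]) [1..<Suc N])" for N
  have "us (Suc N) = us N @ map (Eta (Suc N)) [Suc m..<Suc (c (Suc N))]" for N
    by (simp add: us_def)
  moreover have "us 0 = []"
    by (simp add: us_def)
  moreover have us_mem: "u \<in> set (us N) \<Longrightarrow> \<exists>j\<le>N. \<exists>i. u = Eta j i" for u N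
    by (auto simp: us_def)
  ultimately have "distinct (us N) \<and> prod_list (map (\<lambda>u. gen (Inr u)) (us N)) = oprod 1 N (\<lambda>j. oprod (Suc m) (c j) (etav j))"
  proof (induction N)
    case (Suc N)
    have "prod_list (map (\<lambda>u. gen (Inr u)) (map (Eta (Suc N)) [Suc m..<Suc (c (Suc N))])) = oprod (Suc m) (c (Suc N)) (etav (Suc N))"
      by (simp add: oprod_def comp_def)
    moreover have "distinct (map (Eta (Suc N)) [Suc m..<Suc (c (Suc N))])"
      by (simp add: distinct_map inj_on_def)
    ultimately show ?case
      using Suc us_mem[of _ N] by (fastforce simp: oprod_Suc simp del: upt_Suc)
  qed simp
  then show ?thesis
    using prod_list_gens_neq_0[of "us N"] by simp
qed

lemma ev_yhat: assumes "m \<le> p" shows "ev (yhat p m c j) = (if j = c then 1 else 0)"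
  by (auto simp: yhat_def ev_add ev_sum ev_mult ev_Delta ev_gens)

text \<open>The quotient by an even non-zero-divisor inherits the parity.\<close>

lemma homog_cancel:
  assumes d: "homog False d" "nzd d" and f: "homog \<epsilon> (d * f)"
  shows "homog \<epsilon> f"
proof -
  have "d * iota f = iota (d * f)"
    using d by (simp add: iota_mult homog_False)
  also have "\<dots> = d * smul (ksign \<epsilon> True) f"
    using f by (simp add: homog_def)
  finally show ?thesis
    unfolding homog_def by (rule nzd_cancel[OF d(2)])
qed

lemma homog_Delta2: "homog (odd (r - m)) (Delta2 m j r)"
  using homog_detX[of "{m+1..r}" r j] by (simp add: Delta2_detX)

text \<open>One vector covers the three cases of the theorem: \<open>s\<close> may be any number such that the rows after row
  \<open>p + s\<close> are empty, and empty products are 1.\<close>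

locale hook_diagram =
  fixes p q m n s :: nat and lam :: "nat \<Rightarrow> nat"
  assumes mp: "m \<le> p" and young: "young_diagram lam" and hook_n: "lam (m + 1) \<le> n" and hook_q: "lam (p + 1) \<le> q"
    and below: "\<And>i. s < i \<Longrightarrow> lam (p + i) = 0"
begin

abbreviation "\<mu> \<equiv> \<lambda>i. lam (p + i)"
abbreviation "col \<equiv> conj_diagram lam"
abbreviation "r \<equiv> lam (p + 1)"
abbreviation "r' \<equiv> lam (m + 1)"
abbreviation "t \<equiv> lam 1"

definition "F = Gamma p m s \<mu> * oprod (r + 1) r' (\<lambda>i. Delta2 m i (col i)) * oprod (r' + 1) t (\<lambda>i. Delta (col i))"

text \<open>The factors of the multiple of \<open>F\<close> in \<open>F_multiple\<close>: \<open>Om\<close> collects the determinants with rows \<open>\<eta>\<close>,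
  including the factors \<open>\<Delta>\<^sub>j\<^sub>,\<^sub>p\<close> of \<open>\<Gamma>\<close>, which belong to the columns longer than \<open>p\<close>.\<close>

definition "c j = min p (col j)"
definition "Om = oprod 1 r' (\<lambda>j. Delta2 m j (c j))"
definition "Yh = oprod 1 s (\<lambda>i. sdet (\<mu> i) (yhat p m))"
definition "De = oprod (r' + 1) t (\<lambda>i. Delta (col i))"
definition "N = (\<Sum>i=1..s. \<mu> i)"

lemma ranges: "r \<le> r'" "r' \<le> t" "r \<le> n" "i \<ge> 1 \<Longrightarrow> \<mu> i \<le> r"
  using young_antimono[OF young, of "m + 1" "p + 1"] young_antimono[OF young, of 1 "m + 1"]
    young_antimono[OF young, of "p + 1" "p + i"] mp hook_n by auto

lemma col_iff: "1 \<le> j \<Longrightarrow> 1 \<le> i \<Longrightarrow> i \<le> col j \<longleftrightarrow> j \<le> lam i"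
  by (rule conj_iff[OF young])

lemma col_De: "r' + 1 \<le> j \<Longrightarrow> col j \<le> m"
  using col_iff[of j "m + 1"] by auto

lemma col_Om: "1 \<le> j \<Longrightarrow> j \<le> r' \<Longrightarrow> m + 1 \<le> col j"
  using col_iff[of j "m + 1"] by auto

lemma col_r: "1 \<le> j \<Longrightarrow> j \<le> r \<longleftrightarrow> p + 1 \<le> col j"
  using col_iff[of j "p + 1"] by auto

lemma c_range: "1 \<le> j \<Longrightarrow> j \<le> r' \<Longrightarrow> m \<le> c j \<and> c j \<le> p"
  using col_Om[of j] mp by (auto simp: c_def)

lemma c_antimono: "1 \<le> i \<Longrightarrow> i \<le> j \<Longrightarrow> c j \<le> c i"
  using conj_antimono[OF young, of i j] by (auto simp: c_def)

lemma Om_split: "Om = oprod 1 r (\<lambda>j. Delta2 m j p) * oprod (r + 1) r' (\<lambda>j. Delta2 m j (col j))"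
proof -
  have "Om = oprod 1 r (\<lambda>j. Delta2 m j (c j)) * oprod (Suc r) r' (\<lambda>j. Delta2 m j (c j))"
    unfolding Om_def using ranges by (intro oprod_append) auto
  also have "oprod 1 r (\<lambda>j. Delta2 m j (c j)) = oprod 1 r (\<lambda>j. Delta2 m j p)"
    by (rule oprod_cong) (use col_r in \<open>auto simp: c_def min_def\<close>)
  also have "oprod (Suc r) r' (\<lambda>j. Delta2 m j (c j)) = oprod (Suc r) r' (\<lambda>j. Delta2 m j (col j))"
  proof (rule oprod_cong)
    fix j assume "Suc r \<le> j" "j \<le> r'"
    then have "col j \<le> p"
      using col_r[of j] by auto
    then show "Delta2 m j (c j) = Delta2 m j (col j)"
      by (simp add: c_def)
  qed
  finally show ?thesis
    by (simp only: Suc_eq_plus1)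
qed

lemma Gamma_facts:
  "Gamma p m s \<mu> \<in> polyin (poly_vars p q m n)"
  "Delta p ^ N * Gamma p m s \<mu> = oprod 1 r (\<lambda>j. Delta2 m j p) * Yh"
proof -
  have *: "\<forall>i\<in>{1..s}. \<mu> i \<le> \<mu> 1"
    using ranges by auto
  show "Gamma p m s \<mu> \<in> polyin (poly_vars p q m n)"
    by (rule Gamma_factorisation(1)[OF mp *]) (use ranges hook_q in auto)
  show "Delta p ^ N * Gamma p m s \<mu> = oprod 1 r (\<lambda>j. Delta2 m j p) * Yh"
    unfolding N_def Yh_def by (rule Gamma_factorisation(2)[OF mp *]) (use ranges hook_q in auto)
qed

lemma homog_Yh: "homog False Yh"
  unfolding Yh_def by (intro homog_oprod_False homog_sdet_False homog_yhat mp)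

lemma homog_De: "homog False De"
  unfolding De_def by (intro homog_oprod_False homog_Delta)

lemma homog_Om: "homog (odd (\<Sum>j=1..r'. c j - m)) Om"
  unfolding Om_def by (rule homog_oprod[OF order_refl homog_Delta2])

lemma F_multiple: "Delta p ^ N * F = Om * Yh * De"
proof -
  have "Delta p ^ N * F = (Delta p ^ N * Gamma p m s \<mu>) * oprod (r + 1) r' (\<lambda>i. Delta2 m i (col i)) * De"
    by (simp add: F_def De_def mult.assoc)
  also have "\<dots> = oprod 1 r (\<lambda>j. Delta2 m j p) * (Yh * oprod (r + 1) r' (\<lambda>i. Delta2 m i (col i))) * De"
    by (simp add: Gamma_facts mult.assoc)
  also have "\<dots> = Om * Yh * De"
    by (simp add: homog_central[OF homog_Yh] Om_split mult.assoc)
  finally show ?thesis .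
qed

lemma homog_power_Delta: "homog False (Delta p ^ N)"
  by (rule homog_power[OF homog_Delta])

lemma nzd_power_Delta: "nzd (Delta p ^ N)"
  by (rule nzd_power[OF nzd_Delta])

lemma homog_F: "homog (odd (\<Sum>j=1..r'. c j - m)) F"
proof (rule homog_cancel[OF homog_power_Delta nzd_power_Delta])
  show "homog (odd (\<Sum>j=1..r'. c j - m)) (Delta p ^ N * F)"
    using homog_mult[OF homog_mult[OF homog_Om homog_Yh] homog_De] by (simp add: F_multiple)
qed

lemma F_poly: "F \<in> polyin (poly_vars p q m n)"
proof -
  have x: "xv l i \<in> polyin (poly_vars p q m n)" if "l \<in> {1..m}" "i \<in> {1..p}" for l i
    using that by (intro polyin_gen poly_vars_mem)
  have e: "etav k i \<in> polyin (poly_vars p q m n)" if "k \<in> {1..n}" "i \<in> {1..p}" for k i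
    using that by (intro polyin_gen poly_vars_mem)
  have "Delta2 m i (col i) \<in> polyin (poly_vars p q m n)" if i: "r + 1 \<le> i" "i \<le> r'" for i
  proof -
    have "col i \<le> p" using col_r[of i] i by auto
    then show ?thesis
      unfolding Delta2_def using i hook_n by (intro polyin_sdet) (auto intro!: x e)
  qed
  moreover have "Delta (col i) \<in> polyin (poly_vars p q m n)" if i: "r' + 1 \<le> i" for i
    unfolding Delta_def using col_De[OF i] mp by (intro polyin_sdet x) auto
  ultimately show ?thesis
    unfolding F_def by (intro polyin_mult polyin_oprod Gamma_facts)
qed

lemma F_nonzero: "F \<noteq> 0"
proof
  assume "F = 0"
  then have "ev (Om * Yh * De) = 0"
    by (simp flip: F_multiple)
  moreover have "ev De = 1"
    unfolding De_def ev_oprod by (rule oprod_1) (rule ev_Delta)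
  moreover have "ev Yh = 1"
    unfolding Yh_def ev_oprod by (rule oprod_1) (simp add: ev_sdet ev_yhat[OF mp] sdet_unit)
  moreover have "ev Om = smul (\<Prod>j=1..r'. fact (c j - m)) (oprod 1 r' (\<lambda>j. oprod (Suc m) (c j) (etav j)))"
    unfolding Om_def ev_oprod oprod_smul[symmetric]
    by (rule oprod_cong) (use c_range in \<open>simp add: ev_Delta2\<close>)
  ultimately show False
    using eta_product_nonzero[of r' m c] by (simp add: ev_mult)
qed

subsection \<open>Simple root vectors\<close>

text \<open>A derivation that kills \<open>det X\<close> may be tested on the multiple of \<open>F\<close>.\<close>

lemma F_killed:
  assumes D: "sder \<epsilon> D" "D (Delta p) = 0" and 0: "D (Om * Yh * De) = 0"
  shows "D F = 0"
proof -
  have "Delta p ^ N * D F = D (Delta p ^ N * F)"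
    by (rule sder_central_mult[symmetric, OF D(1) homog_power_Delta sder_power_0[OF D]])
  also have "\<dots> = Delta p ^ N * 0"
    by (simp add: F_multiple 0)
  finally show ?thesis
    by (rule nzd_cancel[OF nzd_power_Delta])
qed

lemma iot_Om: "iot \<epsilon> Om * z = 0 \<longleftrightarrow> Om * z = 0"
proof -
  have "iot \<epsilon> Om = Om \<or> iot \<epsilon> Om = - Om"
    using homog_Om by (cases "odd (\<Sum>j=1..r'. c j - m)"; cases \<epsilon>) (auto simp: iot_def homog_False homog_True)
  then show ?thesis by auto
qed

lemma D_factors:
  assumes D: "sder \<epsilon> D" and 0: "D Om = 0" "Om * D Yh = 0" "D De = 0"
  shows "D (Om * Yh * De) = 0"
proof -
  have "iot \<epsilon> Om * D Yh = 0"
    using 0 by (simp add: iot_Om)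
  then show ?thesis
    by (simp add: sder_mult[OF D] 0)
qed

lemma D_Om_0: "sder \<epsilon> D \<Longrightarrow> (\<And>j. j \<in> {1..r'} \<Longrightarrow> D (Delta2 m j (c j)) = 0) \<Longrightarrow> D Om = 0"
  unfolding Om_def by (rule sder_oprod_0) auto

lemma D_De_0: "sder \<epsilon> D \<Longrightarrow> (\<And>k. k \<le> p \<Longrightarrow> D (Delta k) = 0) \<Longrightarrow> D De = 0"
  unfolding De_def
proof (rule sder_oprod_0)
  fix i assume "r' + 1 \<le> i" "\<And>k. k \<le> p \<Longrightarrow> D (Delta k) = 0"
  then show "D (Delta (col i)) = 0"
    using col_De[of i] mp by auto
qed

lemma D_Yh_0: "sder \<epsilon> D \<Longrightarrow> (\<And>i. i \<in> {1..s} \<Longrightarrow> D (sdet (\<mu> i) (yhat p m)) = 0) \<Longrightarrow> D Yh = 0"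
  unfolding Yh_def by (rule sder_oprod_0) auto

lemma mu_bounds: "i \<in> {1..s} \<Longrightarrow> \<mu> i \<le> r \<and> \<mu> i \<le> n \<and> \<mu> i \<le> q"
  using ranges(3) ranges(4)[of i] hook_q by auto

lemma F_left_p:
  assumes "1 < i" "i \<le> p"
  shows "left_action p n (Inl (i - 1)) (Inl i) F = 0"
proof (rule F_killed[OF sder_actions(1)], rule left_even_Delta[OF assms(1) order_refl], rule D_factors[OF sder_actions(1)])
  let ?D = "left_action p n (Inl (i - 1)) (Inl i)"
  show "?D Om = 0"
  proof (rule D_Om_0[OF sder_actions(1)])
    fix j assume "j \<in> {1..r'}"
    then show "?D (Delta2 m j (c j)) = 0"
      using c_range[of j] hook_n by (simp add: Delta2_detX left_even_detX assms)
  qed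
  have "?D Yh = 0"
  proof (rule D_Yh_0[OF sder_actions(1)])
    fix k assume "k \<in> {1..s}"
    then show "?D (sdet (\<mu> k) (yhat p m)) = 0"
      using mu_bounds[of k] by (intro sder_sdet_0[OF sder_actions(1)] left_even_yhat[OF assms(1) mp]) auto
  qed
  then show "Om * ?D Yh = 0" by simp
  show "?D De = 0"
    by (rule D_De_0[OF sder_actions(1)]) (rule left_even_Delta[OF assms(1)])
qed

text \<open>Here a column of a determinant of the changed variables is replaced by the column before it.\<close>

lemma F_left_q:
  assumes "1 < l" "l \<le> q"
  shows "left_action p n (Inr (l - 1)) (Inr l) F = 0"
proof (rule F_killed[OF sder_actions(2)], rule left_Inr_0, rule D_factors[OF sder_actions(2)])
  let ?D = "left_action p n (Inr (l - 1)) (Inr l)"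
  show "?D Om = 0"
    by (rule D_Om_0[OF sder_actions(2)]) (simp add: Delta2_detX left_Inr_0)
  show "?D De = 0"
    by (rule D_De_0[OF sder_actions(2)]) (rule left_Inr_0)
  have "?D Yh = 0"
  proof (rule D_Yh_0[OF sder_actions(2)])
    fix k assume k: "k \<in> {1..s}"
    have *: "?D (yhat p m a j) = (if j = l then yhat p m a (l - 1) else 0)" if "a \<in> {1..\<mu> k}" for a j
      using mu_bounds[OF k] that by (intro left_Inr_yhat[OF mp]) auto
    show "?D (sdet (\<mu> k) (yhat p m)) = 0"
    proof (cases "l - 1 \<in> {1..\<mu> k}")
      case True
      then show ?thesis
        by (rule sder_column[OF sder_actions(2)]) (use assms * in auto)
    next
      case False
      then show ?thesis
        by (intro sder_sdet_0[OF sder_actions(2)]) (use assms * in auto)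
    qed
  qed
  then show "Om * ?D Yh = 0" by simp
qed

text \<open>The factor \<open>\<Delta>\<^sub>j\<^sub>,\<^sub>p\<close> of \<open>Om\<close> kills the odd determinant.\<close>

lemma Om_th:
  assumes "j \<in> {1..r}" "m < k" "k \<le> p"
  shows "Om * detX p j {k} = 0"
proof -
  have j: "1 \<le> j" "j \<le> r'" "c j = p"
    using assms ranges col_r[of j] by (auto simp: c_def)
  let ?f = "\<lambda>j. Delta2 m j (c j)"
  have "homog True (detX p j {k})"
    using assms by (intro homog_th) auto
  then have "oprod (Suc j) r' ?f * detX p j {k} = detX p j {k} * iota (oprod (Suc j) r' ?f)"
    by (rule odd_right)
  moreover have "?f j * detX p j {k} = 0"
    unfolding j(3) using assms by (intro Delta2_th_same) auto
  moreover have "Om = oprod 1 (j - 1) ?f * ?f j * oprod (Suc j) r' ?f"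
    unfolding Om_def by (rule oprod_split) (use j in auto)
  moreover have "O1 = A * B * C \<Longrightarrow> C * T = T * T' \<Longrightarrow> B * T = 0 \<Longrightarrow> O1 * T = 0" for A B C O1 T T' :: spoly
    by (simp add: mult.assoc) (simp flip: mult.assoc)
  ultimately show ?thesis
    by blast
qed

text \<open>The entries of \<open>Yh\<close> are not killed, but mapped to combinations of the odd determinants that occur in
  \<open>Om\<close>.\<close>

lemma F_left_odd:
  assumes "1 \<le> p" "1 \<le> q"
  shows "left_action p n (Inl p) (Inr 1) F = 0"
proof (rule F_killed[OF sder_actions(3)], rule left_Inr_0, rule D_factors[OF sder_actions(3)])
  let ?D = "left_action p n (Inl p) (Inr 1)"
  show "?D Om = 0"
    by (rule D_Om_0[OF sder_actions(3)]) (simp add: Delta2_detX left_Inr_0)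
  show "?D De = 0"
    by (rule D_De_0[OF sder_actions(3)]) (rule left_Inr_0)
  have y: "Om * ?D (yhat p m a j) = 0" if a: "a \<in> {1..r}" for a j
  proof -
    have "Om * (detX p a {k} * xv k p) = 0" if "k \<in> {m+1..p}" for k
      using Om_th[OF a, of k] that by (simp flip: mult.assoc)
    then show ?thesis
      using a ranges assms by (subst left_odd_yhat[OF mp]) (auto simp: sum_distrib_left)
  qed
  show "Om * ?D Yh = 0"
    unfolding Yh_def
  proof (rule sder_oprod_kill[OF sder_actions(3)], rule conjI)
    fix i assume "1 \<le> i" "i \<le> s"
    then have "\<mu> i \<le> r" by (intro ranges(4))
    then show "Om * ?D (sdet (\<mu> i) (yhat p m)) = 0"
      by (intro sder_sdet_kill[OF sder_actions(3)] conjI homog_yhat mp y) auto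
  qed (intro homog_sdet_False homog_yhat mp)
qed

lemma F_right_m:
  assumes "1 < a" "a \<le> m"
  shows "right_action p q (Inl (a - 1)) (Inl a) F = 0"
proof -
  let ?D = "right_action p q (Inl (a - 1)) (Inl a)"
  have d: "?D (Delta k) = 0" if "k \<le> p" for k
    using right_even_detX[of a "{}" k p q 0] assms that by (simp add: detX_empty)
  show ?thesis
  proof (rule F_killed[OF sder_actions(4)], rule d[OF order_refl], rule D_factors[OF sder_actions(4)])
    show "?D Om = 0"
    proof (rule D_Om_0[OF sder_actions(4)])
      fix j assume "j \<in> {1..r'}"
      then show "?D (Delta2 m j (c j)) = 0"
        using c_range[of j] assms by (simp add: Delta2_detX right_even_detX)
    qed
    have "?D Yh = 0"
    proof (rule D_Yh_0[OF sder_actions(4)])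
      fix k assume "k \<in> {1..s}"
      then show "?D (sdet (\<mu> k) (yhat p m)) = 0"
        using mu_bounds[of k] by (intro sder_sdet_0[OF sder_actions(4)] right_even_yhat[OF assms mp]) auto
    qed
    then show "Om * ?D Yh = 0" by simp
    show "?D De = 0"
      by (rule D_De_0[OF sder_actions(4)]) (rule d)
  qed
qed

text \<open>The \<open>k\<close>-th factor of \<open>Om\<close> is not killed, but its derivative is killed by the factor in front of it,
  which has at least the same size.\<close>

lemma F_right_n:
  assumes "1 < k" "k \<le> n"
  shows "right_action p q (Inr (k - 1)) (Inr k) F = 0"
proof (rule F_killed[OF sder_actions(5)], rule right_eta_Delta, rule D_factors[OF sder_actions(5)])
  let ?D = "right_action p q (Inr (k - 1)) (Inr k)"
  let ?f = "\<lambda>j. Delta2 m j (c j)"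
  show "?D De = 0"
    by (rule D_De_0[OF sder_actions(5)]) (rule right_eta_Delta)
  have "oprod 1 r' (?f(j := ?D (?f j))) = 0" if j: "j \<in> {1..r'}" for j
  proof (cases "j = k")
    case False
    have "?D (?f j) = 0"
      by (rule sder_Delta2_0[OF sder_actions(5) right_eta_Delta(1)])
        (use False c_range[of j] j right_eta_th in auto)
    then show ?thesis
      using j by (intro oprod_zero[of 1 j]) auto
  next
    case True
    have "?f (k - 1) * ?D (?f k) = 0"
      by (rule Delta2_sder[OF sder_actions(5) right_eta_Delta(1)])
        (use assms c_range[of k] j True c_antimono[of "k - 1" k] right_eta_th in auto)
    moreover have "oprod 1 r' (?f(k := ?D (?f k))) = oprod 1 (k - 1) ?f * ?D (?f k) * oprod (Suc k) r' ?f"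
      by (rule oprod_upd) (use j True in auto)
    moreover have "oprod 1 (k - 1) ?f = oprod 1 (k - 2) ?f * ?f (k - 1)"
    proof -
      have "k - 1 = Suc (k - 2)" using assms by simp
      then show ?thesis by (simp only: oprod_Suc)
    qed
    moreover have "A * B * T * C = 0" if "B * T = 0" for A B C T :: spoly
      by (simp add: mult.assoc[of A B T] that)
    ultimately show ?thesis
      unfolding True by metis
  qed
  then show "?D Om = 0"
    unfolding Om_def sder_even_oprod[OF sder_actions(5)] by (intro sum.neutral) blast
  have "?D Yh = 0"
  proof (rule D_Yh_0[OF sder_actions(5)])
    fix i assume i: "i \<in> {1..s}"
    let ?y = "yhat p m"
    have *: "?D (?y a j) = (if a = k then ?y (k - 1) j else 0)" if "j \<in> {1..\<mu> i}" for a j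
      using mu_bounds[OF i] that by (intro right_eta_yhat[OF mp]) auto
    have "?D (sdet (\<mu> i) ?y) = (\<Sum>h=1..\<mu> i. sdet (\<mu> i) (?y(h := \<lambda>j. ?D (?y h j))))"
      by (rule sder_sdet[OF sder_actions(5)]) simp
    also have "\<dots> = 0"
    proof (rule sum.neutral, rule ballI)
      fix h assume h: "h \<in> {1..\<mu> i}"
      show "sdet (\<mu> i) (?y(h := \<lambda>j. ?D (?y h j))) = 0"
      proof (cases "h = k")
        case True
        have "sdet (\<mu> i) (?y(h := \<lambda>j. ?D (?y h j))) = sdet (\<mu> i) (?y(k := ?y (k - 1)))"
          by (rule sdet_cong) (use True * in auto)
        also have "\<dots> = 0"
          by (rule sdet_equal_rows[of "k - 1" _ k]) (use assms h True homog_yhat[OF mp] in auto)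
        finally show ?thesis .
      next
        case False
        then show ?thesis
          using * by (intro sdet_zero_row[OF h]) auto
      qed
    qed
    finally show "?D (sdet (\<mu> i) ?y) = 0" .
  qed
  then show "Om * ?D Yh = 0" by simp
qed

lemma F_right_odd:
  assumes "1 \<le> m" "1 \<le> n"
  shows "right_action p q (Inl m) (Inr 1) F = 0"
proof (rule F_killed[OF sder_actions(6)], rule right_eta_Delta, rule D_factors[OF sder_actions(6)])
  let ?D = "right_action p q (Inl m) (Inr 1)"
  show "?D De = 0"
    by (rule D_De_0[OF sder_actions(6)]) (rule right_eta_Delta)
  show "?D Om = 0"
  proof (rule D_Om_0[OF sder_actions(6)])
    fix j assume j: "j \<in> {1..r'}"
    show "?D (Delta2 m j (c j)) = 0"
      by (rule sder_Delta2_0[OF sder_actions(6) right_eta_Delta(2)])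
        (use c_range[of j] j right_odd_th assms in auto)
  qed
  have "?D Yh = 0"
  proof (rule D_Yh_0[OF sder_actions(6)])
    fix k assume "k \<in> {1..s}"
    then show "?D (sdet (\<mu> k) (yhat p m)) = 0"
      using mu_bounds[of k] by (intro sder_sdet_0[OF sder_actions(6)] right_odd_yhat[OF mp assms(1)]) auto
  qed
  then show "Om * ?D Yh = 0" by simp
qed

subsection \<open>The weight\<close>

text \<open>For each column of the diagram, the weight of its determinant; the determinants in \<open>Yh\<close> contribute
  the columns below row \<open>p\<close>, and the powers of \<open>det X\<close> have been subtracted.\<close>

definition weight :: "(idx \<Rightarrow> complex) \<Rightarrow> (idx \<Rightarrow> complex) \<Rightarrow> complex" where
  "weight \<alpha> \<beta> =
     (\<Sum>j=1..r'. (\<Sum>l=1..m. \<alpha> (Inl l)) + of_nat (c j - m) * \<alpha> (Inr j) + (\<Sum>i=1..c j. \<beta> (Inl i))) +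
     (\<Sum>i=1..s. \<Sum>k=1..\<mu> i. \<alpha> (Inr k) + \<beta> (Inr k)) +
     (\<Sum>j=r'+1..t. (\<Sum>l=1..col j. \<alpha> (Inl l)) + (\<Sum>i=1..col j. \<beta> (Inl i)))"

lemma F_weight:
  assumes "cartan p q n H \<alpha> \<beta>"
  shows "H F = smul (weight \<alpha> \<beta>) F"
proof -
  interpret cartan p q n H \<alpha> \<beta> by fact
  let ?w = "(\<Sum>l=1..p. \<alpha> (Inl l)) + (\<Sum>i=1..p. \<beta> (Inl i))"
  let ?o = "\<Sum>j=1..r'. (\<Sum>l=1..m. \<alpha> (Inl l)) + of_nat (c j - m) * \<alpha> (Inr j) + (\<Sum>i=1..c j. \<beta> (Inl i))"
  let ?y = "\<Sum>i=1..s. \<Sum>k=1..\<mu> i. \<alpha> (Inr k) + \<beta> (Inr k)"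
  let ?d = "\<Sum>j=r'+1..t. (\<Sum>l=1..col j. \<alpha> (Inl l)) + (\<Sum>i=1..col j. \<beta> (Inl i))"
  have "H Om = smul ?o Om"
    unfolding Om_def
  proof (rule sder_oprod_weight[OF H])
    fix j assume "j \<in> {1..r'}"
    then show "H (Delta2 m j (c j)) = smul ((\<Sum>l=1..m. \<alpha> (Inl l)) + of_nat (c j - m) * \<alpha> (Inr j) + (\<Sum>i=1..c j. \<beta> (Inl i))) (Delta2 m j (c j))"
      using c_range[of j] hook_n by (intro H_Delta2) auto
  qed simp
  moreover have "H Yh = smul (\<Sum>i=1..s. of_nat (\<mu> i) * ?w + (\<Sum>k=1..\<mu> i. \<alpha> (Inr k) + \<beta> (Inr k))) Yh"
    unfolding Yh_def
  proof (rule sder_oprod_weight[OF H])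
    fix i assume "i \<in> {1..s}"
    then show "H (sdet (\<mu> i) (yhat p m)) = smul (of_nat (\<mu> i) * ?w + (\<Sum>k=1..\<mu> i. \<alpha> (Inr k) + \<beta> (Inr k))) (sdet (\<mu> i) (yhat p m))"
      using mu_bounds[of i] by (intro H_sdet_yhat mp) auto
  qed simp
  then have "H Yh = smul (of_nat N * ?w + ?y) Yh"
    by (simp add: sum.distrib N_def of_nat_sum sum_distrib_right distrib_left)
  moreover have "H De = smul ?d De"
    unfolding De_def
  proof (rule sder_oprod_weight[OF H])
    fix j assume "j \<in> {r'+1..t}"
    then show "H (Delta (col j)) = smul ((\<Sum>l=1..col j. \<alpha> (Inl l)) + (\<Sum>i=1..col j. \<beta> (Inl i))) (Delta (col j))"
      using col_De[of j] mp by (intro H_Delta) auto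
  qed simp
  ultimately have "H (Om * Yh * De) = smul (?o + (of_nat N * ?w + ?y) + ?d) (Om * Yh * De)"
    by (intro H_mult)
  then have "H (Delta p ^ N * F) = smul (of_nat N * ?w + weight \<alpha> \<beta>) (Delta p ^ N * F)"
    by (simp add: F_multiple weight_def algebra_simps)
  moreover have "H (Delta p ^ N * F) = smul (of_nat N * ?w) (Delta p ^ N * F) + Delta p ^ N * H F"
    by (simp only: sder_mult[OF H] H_Delta_power[OF order_refl] iot_simps smul_mult)
  ultimately have "Delta p ^ N * H F = Delta p ^ N * smul (weight \<alpha> \<beta>) F"
    by (simp add: spoly.scale_left_distrib)
  then show ?thesis
    by (rule nzd_cancel[OF nzd_power_Delta])
qed

lemma sum_point: "(\<Sum>l=1..b. if l = a then 1 else 0) = (if 1 \<le> a \<and> a \<le> b then 1 else (0 :: complex))" for a b :: nat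
  by simp

lemma sum_split: "(\<Sum>j=1..r'. f j) + (\<Sum>j=r'+1..t. f j) = (\<Sum>j=1..t. f j)" for f :: "nat \<Rightarrow> complex"
  using sum.ub_add_nat[of 1 r' f "t - r'"] ranges by simp

lemma sum_row: assumes "1 \<le> i" shows "(\<Sum>j=1..t. if j \<le> lam i then 1 else 0) = (of_nat (lam i) :: complex)"
proof -
  have "lam i \<le> t" using young_antimono[OF young, of 1 i] assms by simp
  then have "{j \<in> {1..t}. j \<le> lam i} = {1..lam i}" by auto
  then show ?thesis by (simp add: sum_indicator_card)
qed

lemma sum_col: assumes "1 \<le> j" shows "(\<Sum>i=1..s. if j \<le> \<mu> i then 1 else 0) = (of_nat (col j - p) :: complex)"
proof -
  have iff: "j \<le> \<mu> i \<longleftrightarrow> i \<le> col j - p" if "1 \<le> i" for i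
    using col_iff[OF assms, of "p + i"] that by auto
  have "col j - p \<le> s"
  proof (rule ccontr)
    assume "\<not> col j - p \<le> s"
    with iff[of "s + 1"] below[of "s + 1"] assms show False by simp
  qed
  then have "{i \<in> {1..s}. j \<le> \<mu> i} = {1..col j - p}"
    using iff by auto
  then show ?thesis by (simp add: sum_indicator_card)
qed

lemma weight_left: assumes "a \<in> gl_ix p q" shows "weight (\<lambda>_. 0) (\<lambda>c. if c = a then 1 else 0) = of_nat (hweight p lam a)"
proof (cases a)
  case (Inl i)
  then have i: "1 \<le> i" "i \<le> p" using assms by auto
  have 1: "(\<Sum>j=1..r'. if 1 \<le> i \<and> i \<le> c j then 1 else (0::complex)) = (\<Sum>j=1..r'. if j \<le> lam i then 1 else 0)"
    by (rule sum.cong) (use i col_iff[of _ i] in \<open>auto simp: c_def\<close>)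
  have 2: "(\<Sum>j=r'+1..t. if 1 \<le> i \<and> i \<le> col j then 1 else (0::complex)) = (\<Sum>j=r'+1..t. if j \<le> lam i then 1 else 0)"
    by (rule sum.cong) (use i col_iff[of _ i] in auto)
  have "weight (\<lambda>_. 0) (\<lambda>c. if c = a then 1 else 0) =
      (\<Sum>j=1..r'. if 1 \<le> i \<and> i \<le> c j then 1 else 0) + (\<Sum>j=r'+1..t. if 1 \<le> i \<and> i \<le> col j then 1 else 0)"
    unfolding weight_def Inl by (simp only: sum.neutral_const mult_zero_right add_0_left add_0_right sum.inject sum_point Inl_Inr_False Inr_not_Inl old.sum.inject if_False)
  also have "\<dots> = of_nat (lam i)"
    unfolding 1 2 sum_split using i by (rule_tac sum_row)
  finally show ?thesis
    by (simp add: Inl hweight_def)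
next
  case (Inr j)
  then have j: "1 \<le> j" using assms by auto
  have "weight (\<lambda>_. 0) (\<lambda>c. if c = a then 1 else 0) = (\<Sum>i=1..s. if 1 \<le> j \<and> j \<le> \<mu> i then 1 else 0)"
    unfolding weight_def Inr by (simp only: sum.neutral_const mult_zero_right add_0_left add_0_right sum_point Inl_Inr_False Inr_not_Inl old.sum.inject if_False)
  also have "\<dots> = of_nat (col j - p)"
    using sum_col[OF j] j by simp
  finally show ?thesis
    by (simp add: Inr hweight_def)
qed

lemma weight_right: assumes "a \<in> gl_ix m n" shows "weight (\<lambda>u. if u = a then 1 else 0) (\<lambda>_. 0) = of_nat (hweight m lam a)"
proof (cases a)
  case (Inl i)
  then have i: "1 \<le> i" "i \<le> m" using assms by auto
  have "r' \<le> lam i"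
    using young_antimono[OF young, of i "m + 1"] i by simp
  then have 1: "(\<Sum>j=1..r'. if 1 \<le> i \<and> i \<le> m then 1 else (0::complex)) = (\<Sum>j=1..r'. if j \<le> lam i then 1 else 0)"
    by (intro sum.cong) (use i in auto)
  have 2: "(\<Sum>j=r'+1..t. if 1 \<le> i \<and> i \<le> col j then 1 else (0::complex)) = (\<Sum>j=r'+1..t. if j \<le> lam i then 1 else 0)"
    by (rule sum.cong) (use i col_iff[of _ i] in auto)
  have "weight (\<lambda>u. if u = a then 1 else 0) (\<lambda>_. 0) =
      (\<Sum>j=1..r'. if 1 \<le> i \<and> i \<le> m then 1 else 0) + (\<Sum>j=r'+1..t. if 1 \<le> i \<and> i \<le> col j then 1 else 0)"
    unfolding weight_def Inl by (simp only: sum.neutral_const mult_zero_right add_0_left add_0_right sum_point Inl_Inr_False Inr_not_Inl old.sum.inject if_False)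
  also have "\<dots> = of_nat (lam i)"
    unfolding 1 2 sum_split using i by (rule_tac sum_row)
  finally show ?thesis
    by (simp add: Inl hweight_def)
next
  case (Inr j)
  then have j: "1 \<le> j" using assms by auto
  have "weight (\<lambda>u. if u = a then 1 else 0) (\<lambda>_. 0) =
      (\<Sum>k=1..r'. of_nat (c k - m) * (if k = j then 1 else 0)) + (\<Sum>i=1..s. if 1 \<le> j \<and> j \<le> \<mu> i then 1 else 0)"
    unfolding weight_def Inr by (simp only: sum.neutral_const mult_zero_right add_0_left add_0_right sum_point Inl_Inr_False Inr_not_Inl old.sum.inject if_False)
  also have "(\<Sum>k=1..r'. of_nat (c k - m) * (if k = j then 1 else (0::complex))) = (if j \<le> r' then of_nat (c j - m) else 0)"
    using j by (simp add: if_distrib cong: if_cong)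
  also have "(\<Sum>i=1..s. if 1 \<le> j \<and> j \<le> \<mu> i then 1 else (0::complex)) = of_nat (col j - p)"
    using sum_col[OF j] j by simp
  also have "(if j \<le> r' then of_nat (c j - m) else 0) + of_nat (col j - p) = (of_nat (col j - m) :: complex)"
  proof (cases "j \<le> r'")
    case True
    then have "c j - m + (col j - p) = col j - m"
      using col_Om[OF j] mp by (auto simp: c_def min_def)
    then show ?thesis
      using True by (simp flip: of_nat_add)
  next
    case False
    then have "col j \<le> m" using col_De[of j] by simp
    with False mp show ?thesis by simp
  qed
  finally show ?thesis
    by (simp add: Inr hweight_def)
qed

theorem F_hwv: "hwv_corresponds p q m n lam F"
proof -
  have L: "left_action m n a b F = left_action p n a b F" for a b
    by (rule left_extend[OF mp F_poly])
  have "left_action m n a a F = smul (of_nat (hweight p lam a)) F" if "a \<in> gl_ix p q" for a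
    using F_weight[OF cartan_left[OF that]] weight_left[OF that] by (simp add: L)
  moreover have "right_action p q a a F = smul (of_nat (hweight m lam a)) F" if "a \<in> gl_ix m n" for a
    using F_weight[OF cartan_right[OF that]] weight_right[OF that] by simp
  moreover have "left_action m n a b F = 0" if "(a, b) \<in> simple_roots p q" for a b
    using that F_left_p F_left_q F_left_odd by (auto simp: simple_roots_def L split: if_splits)
  moreover have "right_action p q a b F = 0" if "(a, b) \<in> simple_roots m n" for a b
    using that F_right_m F_right_n F_right_odd by (auto simp: simple_roots_def split: if_splits)
  ultimately show ?thesis
    unfolding hwv_corresponds_def highest_weight_vector_def carr_left_poly carr_right_poly
    using F_poly F_nonzero by (auto simp: left_poly_def right_poly_def)
qed

end

section \<open>Which modules appear\<close>

subsection \<open>The degree of a highest weight vector\<close>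

lemma sum_gl_ix: "(\<Sum>a\<in>gl_ix p q. g a) = (\<Sum>i=1..p. g (Inl i)) + (\<Sum>j=1..q. g (Inr j))"
  unfolding gl_ix_def by (subst sum.union_disjoint) (auto simp: sum.reindex inj_on_def)

text \<open>The boxes that the weights take into account: below row \<open>p\<close>, those in the first \<open>q\<close> columns.\<close>

definition seen :: "nat \<Rightarrow> nat \<Rightarrow> (nat \<Rightarrow> nat) \<Rightarrow> nat \<Rightarrow> nat" where
  "seen p q lam i = (if i \<le> p then lam i else min (lam i) q)"

lemma conj_minus:
  assumes y: "young_diagram lam" and M: "\<forall>i>M. lam i = 0" and j: "1 \<le> j"
  shows "conj_diagram lam j - p = card {i \<in> {p+1..M}. j \<le> lam i}"
proof -
  have "conj_diagram lam j \<le> M"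
  proof (rule ccontr)
    assume *: "\<not> conj_diagram lam j \<le> M"
    then have "j \<le> lam (conj_diagram lam j)"
      using conj_iff[OF y j, of "conj_diagram lam j"] by simp
    with * M j show False by simp
  qed
  then have "{i \<in> {p+1..M}. j \<le> lam i} = {p+1..conj_diagram lam j}"
    using conj_iff[OF y j] by auto
  then show ?thesis by simp
qed

text \<open>Below row \<open>p\<close>, the weights count the boxes of the first \<open>q\<close> columns by columns; here they are counted by
  rows.\<close>

lemma hweight_total:
  assumes y: "young_diagram lam" and M: "\<forall>i>M. lam i = 0" and p: "p \<le> M"
  shows "(\<Sum>a\<in>gl_ix p q. hweight p lam a) = (\<Sum>i=1..M. seen p q lam i)"
proof -
  have "(\<Sum>j=1..q. conj_diagram lam j - p) = (\<Sum>j=1..q. \<Sum>i=p+1..M. if j \<le> lam i then 1 else 0)"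
    by (rule sum.cong) (auto simp: conj_minus[OF y M] sum.If_cases Int_def)
  also have "\<dots> = (\<Sum>i=p+1..M. \<Sum>j=1..q. if j \<le> lam i then 1 else 0)"
    by (rule sum.swap)
  also have "\<dots> = (\<Sum>i=p+1..M. seen p q lam i)"
  proof (rule sum.cong[OF refl])
    fix i assume i: "i \<in> {p+1..M}"
    have "{j. (1 \<le> j \<and> j \<le> q) \<and> j \<le> lam i} = {1..min (lam i) q}" by auto
    with i show "(\<Sum>j=1..q. if j \<le> lam i then 1 else 0) = seen p q lam i"
      by (simp add: seen_def sum.If_cases Int_def)
  qed
  finally have "(\<Sum>a\<in>gl_ix p q. hweight p lam a) = (\<Sum>i=1..p. lam i) + (\<Sum>i=p+1..M. seen p q lam i)"
    by (simp add: sum_gl_ix hweight_def)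
  also have "(\<Sum>i=1..p. lam i) = (\<Sum>i=1..p. seen p q lam i)"
    by (rule sum.cong) (auto simp: seen_def)
  finally show ?thesis
    using p sum.ub_add_nat[of 1 p "seen p q lam" "M - p"] by simp
qed

lemma diagram_size_sum:
  assumes y: "young_diagram lam" and M: "\<forall>i>M. lam i = 0"
  shows "diagram_size lam = (\<Sum>i=1..M. lam i)"
proof -
  have "diagram_length lam \<le> M"
  proof (rule ccontr)
    assume "\<not> diagram_length lam \<le> M"
    then show False
      using length_iff[OF y, of "diagram_length lam"] M by simp
  qed
  then show ?thesis
    unfolding diagram_size_def
    by (intro sum.mono_neutral_left) (use length_iff[OF y] in auto)
qed

lemma seen_le: "seen p q lam i \<le> lam i"
  by (simp add: seen_def)

lemma seen_eqD:
  assumes "(\<Sum>i=1..M. seen p q lam i) = (\<Sum>i=1..M. lam i)" "p < M"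
  shows "lam (p + 1) \<le> q"
proof -
  have "seen p q lam (p + 1) = lam (p + 1)"
    using sum_mono_inv[OF assms(1) seen_le, of "p + 1"] assms(2) by simp
  then show ?thesis
    by (simp add: seen_def min_def split: if_splits)
qed

lemma seen_eqI:
  assumes "young_diagram lam" "lam (p + 1) \<le> q"
  shows "seen p q lam i = lam i"
proof (cases "i \<le> p")
  case False
  then have "lam i \<le> lam (p + 1)"
    by (intro young_antimono[OF assms(1)]) auto
  with assms(2) False show ?thesis by (simp add: seen_def)
qed (simp add: seen_def)

lemma young_bound:
  assumes "young_diagram lam"
  obtains M where "K < M" "\<forall>i>M. lam i = 0"
proof (rule that[of "K + 1 + diagram_length lam"], simp, intro allI impI)
  fix i assume "K + 1 + diagram_length lam < i"
  then show "lam i = 0"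
    using length_iff[OF assms, of i] by auto
qed

lemma Deg_left:
  assumes "f \<in> polyin (poly_vars p q m n)" "\<And>a. a \<in> gl_ix p q \<Longrightarrow> left_action m n a a f = smul (of_nat (w a)) f"
  shows "Deg f = smul (of_nat (\<Sum>a\<in>gl_ix p q. w a)) f"
  using euler_left[OF assms(1)] assms(2) by (simp add: of_nat_sum spoly.scale_sum_left)

lemma Deg_right:
  assumes "f \<in> polyin (poly_vars p q m n)" "\<And>a. a \<in> gl_ix m n \<Longrightarrow> right_action p q a a f = smul (of_nat (w a)) f"
  shows "Deg f = smul (of_nat (\<Sum>a\<in>gl_ix m n. w a)) f"
  using euler_right[OF assms(1)] assms(2) by (simp add: of_nat_sum spoly.scale_sum_left)

subsection \<open>The highest weight vector of a constituent\<close>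

text \<open>The vector is the image of the tensor product of the two highest weight vectors; it is not zero since
  the images of the products of basis vectors are linearly independent.\<close>

lemma appears_vector:
  assumes "appears p q m n lam H"
  obtains f where "f \<in> H" "f \<noteq> 0" "f \<in> polyin (poly_vars p q m n)"
    "\<And>a. a \<in> gl_ix p q \<Longrightarrow> left_action m n a a f = smul (of_nat (hweight p lam a)) f"
    "\<And>a. a \<in> gl_ix m n \<Longrightarrow> right_action p q a a f = smul (of_nat (hweight m lam a)) f"
    "\<And>a b. (a, b) \<in> simple_roots p q \<Longrightarrow> left_action m n a b f = 0"
proof -
  from assms obtain V W :: "spoly supermodule" and U \<tau> where V: "is_V p q lam V" and W: "is_V m n lam W"
    and sub: "poly_submodule p q m n U" and UH: "U \<subseteq> H" and iso: "tensor_iso p q m n V W U \<tau>"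
    unfolding appears_def by blast
  interpret V: vector_space "scal V"
    using V by (simp add: is_V_def gl_module_def)
  interpret W: vector_space "scal W"
    using W by (simp add: is_V_def gl_module_def)
  note i = iso[unfolded tensor_iso_def]
  have add_l: "\<tau> (v + v') w = \<tau> v w + \<tau> v' w" if "v \<in> carr V" "v' \<in> carr V" "w \<in> carr W" for v v' w
    using i[THEN conjunct1] that by blast
  have add_r: "\<tau> v (w + w') = \<tau> v w + \<tau> v w'" if "v \<in> carr V" "w \<in> carr W" "w' \<in> carr W" for v w w'
    using i[THEN conjunct2, THEN conjunct1] that by blast
  have smul_l: "\<tau> (scal V c v) w = smul c (\<tau> v w)" and smul_r: "\<tau> v (scal W c w) = smul c (\<tau> v w)"
    if "v \<in> carr V" "w \<in> carr W" for c v w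
    using i[THEN conjunct2, THEN conjunct2, THEN conjunct1] that by blast+
  have act_l: "left_action m n a b (\<tau> v w) = \<tau> (act V a b v) w"
    if "a \<in> gl_ix p q" "b \<in> gl_ix p q" "v \<in> carr V" "w \<in> carr W" for a b v w
    using i[THEN conjunct2, THEN conjunct2, THEN conjunct2, THEN conjunct2, THEN conjunct2, THEN conjunct1] that by blast
  have act_r: "right_action p q a b (\<tau> v w) = smul (ksign (epar a b) \<epsilon>) (\<tau> v (act W a b w))"
    if "a \<in> gl_ix m n" "b \<in> gl_ix m n" "v \<in> part V \<epsilon>" "w \<in> carr W" for a b v w \<epsilon>
    using i[THEN conjunct2, THEN conjunct2, THEN conjunct2, THEN conjunct2, THEN conjunct2, THEN conjunct2] that by blast
  from i[THEN conjunct2, THEN conjunct2, THEN conjunct2, THEN conjunct1] obtain B C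
    where B: "V.span B = carr V" and C: "W.span C = carr W"
      and inj: "inj_on (\<lambda>(b, c). \<tau> b c) (B \<times> C)" and ind: "spoly.independent ((\<lambda>(b, c). \<tau> b c) ` (B \<times> C))"
      and span: "spoly.span ((\<lambda>(b, c). \<tau> b c) ` (B \<times> C)) = U"
    by blast
  let ?T = "\<lambda>(b, c). \<tau> b c"
  have BV: "b \<in> carr V" if "b \<in> B" for b
    using that B V.span_base by blast
  have CW: "c \<in> carr W" if "c \<in> C" for c
    using that C W.span_base by blast
  have V0: "0 \<in> carr V" and W0: "0 \<in> carr W"
    using V.span_zero W.span_zero by (auto simp: B[symmetric] C[symmetric])
  have sum_l: "(\<Sum>b\<in>S. scal V (x b) b) \<in> carr V \<and> (\<forall>w\<in>carr W. \<tau> (\<Sum>b\<in>S. scal V (x b) b) w = (\<Sum>b\<in>S. smul (x b) (\<tau> b w)))"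
    if "finite S" "S \<subseteq> B" for S x
    using that
  proof (induction S rule: finite_induct)
    case empty
    show ?case using smul_l[OF V0, of _ 0] V0 by auto
  next
    case (insert b S)
    then have "(\<Sum>b\<in>S. scal V (x b) b) \<in> carr V" "scal V (x b) b \<in> carr V" "b \<in> carr V"
      using BV V.span_scale[of b B "x b"] by (auto simp: B)
    then show ?case
      using insert V.span_add[of "scal V (x b) b" B] by (simp add: B add_l smul_l)
  qed
  have sum_r: "(\<Sum>c\<in>S. scal W (x c) c) \<in> carr W \<and> (\<forall>v\<in>carr V. \<tau> v (\<Sum>c\<in>S. scal W (x c) c) = (\<Sum>c\<in>S. smul (x c) (\<tau> v c)))"
    if "finite S" "S \<subseteq> C" for S x
    using that
  proof (induction S rule: finite_induct)
    case empty
    show ?case using smul_r[OF _ W0, of _ 0] W0 by auto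
  next
    case (insert c S)
    then have "(\<Sum>c\<in>S. scal W (x c) c) \<in> carr W" "scal W (x c) c \<in> carr W" "c \<in> carr W"
      using CW W.span_scale[of c C "x c"] by (auto simp: C)
    then show ?case
      using insert W.span_add[of "scal W (x c) c" C] by (simp add: C add_r smul_r)
  qed
  from V W obtain v w where v: "highest_weight_vector p q V (hweight p lam) v" and w: "highest_weight_vector m n W (hweight m lam) w"
    unfolding is_V_def by blast
  then have vV: "v \<in> carr V" "v \<noteq> 0" and wW: "w \<in> carr W" "w \<noteq> 0"
    by (auto simp: highest_weight_vector_def)
  from vV(1) obtain S x where S: "finite S" "S \<subseteq> B" "v = (\<Sum>b\<in>S. scal V (x b) b)"
    unfolding B[symmetric] V.span_explicit by blast
  from wW(1) obtain S' x' where S': "finite S'" "S' \<subseteq> C" "w = (\<Sum>c\<in>S'. scal W (x' c) c)"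
    unfolding C[symmetric] W.span_explicit by blast
  have f: "\<tau> v w = (\<Sum>y\<in>S \<times> S'. smul (x (fst y) * x' (snd y)) (?T y))"
  proof -
    have "\<tau> v w = (\<Sum>b\<in>S. smul (x b) (\<tau> b w))"
      using sum_l[OF S(1,2), of x] wW(1) unfolding S(3)[symmetric] by blast
    also have "\<dots> = (\<Sum>b\<in>S. \<Sum>c\<in>S'. smul (x b * x' c) (\<tau> b c))"
    proof (rule sum.cong[OF refl])
      fix b assume "b \<in> S"
      then have "b \<in> carr V" using S BV by blast
      then have "\<tau> b w = (\<Sum>c\<in>S'. smul (x' c) (\<tau> b c))"
        using sum_r[OF S'(1,2), of x'] unfolding S'(3)[symmetric] by blast
      then show "smul (x b) (\<tau> b w) = (\<Sum>c\<in>S'. smul (x b * x' c) (\<tau> b c))"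
        by (simp add: spoly.scale_sum_right)
    qed
    also have "\<dots> = (\<Sum>y\<in>S \<times> S'. smul (x (fst y) * x' (snd y)) (?T y))"
      by (simp add: sum.cartesian_product case_prod_unfold)
    finally show ?thesis .
  qed
  have SB: "S \<times> S' \<subseteq> B \<times> C" using S S' by blast
  have "\<tau> v w \<noteq> 0"
  proof
    assume 0: "\<tau> v w = 0"
    \<comment> \<open>the inverse of the map on pairs of basis vectors, to index a linear combination by their images\<close>
    define g where "g = inv_into (B \<times> C) ?T"
    have g: "g (?T y) = y" if "y \<in> B \<times> C" for y
      unfolding g_def using inj that by (rule inv_into_f_f)
    define u where "u z = x (fst (g z)) * x' (snd (g z))" for z
    have "(\<Sum>z\<in>?T ` (S \<times> S'). smul (u z) z) = (\<Sum>y\<in>S \<times> S'. smul (u (?T y)) (?T y))"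
      using inj_on_subset[OF inj SB] by (simp add: sum.reindex)
    also have "\<dots> = \<tau> v w"
      unfolding f by (rule sum.cong) (use g SB in \<open>auto simp: u_def\<close>)
    finally have "(\<Sum>z\<in>?T ` (S \<times> S'). smul (u z) z) = 0"
      using 0 by simp
    then have u0: "u (?T y) = 0" if "y \<in> S \<times> S'" for y
      using spoly.independentD[OF ind, of "?T ` (S \<times> S')" u "?T y"] S S' SB that by blast
    have "\<exists>b\<in>S. x b \<noteq> 0"
      using vV(2) S(3) by (metis (no_types, lifting) V.scale_zero_left sum.neutral)
    moreover have "\<exists>c\<in>S'. x' c \<noteq> 0"
      using wW(2) S'(3) by (metis (no_types, lifting) W.scale_zero_left sum.neutral)
    ultimately obtain b c where "b \<in> S" "c \<in> S'" "x b \<noteq> 0" "x' c \<noteq> 0"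
      by blast
    with u0[of "(b, c)"] g[of "(b, c)"] SB show False
      by (auto simp: u_def)
  qed
  moreover have fU: "\<tau> v w \<in> U"
    unfolding f span[symmetric] using SB by (intro spoly.span_sum spoly.span_scale spoly.span_base imageI) blast
  moreover have "\<tau> v w \<in> polyin (poly_vars p q m n)"
  proof -
    have "gl_submodule p q (left_poly p q m n) U"
      using sub by (simp add: poly_submodule_def)
    then have "U \<subseteq> carr (left_poly p q m n)"
      unfolding gl_submodule_def carr_def by blast
    with fU show ?thesis by (auto simp: carr_left_poly)
  qed
  moreover have "left_action m n a a (\<tau> v w) = smul (of_nat (hweight p lam a)) (\<tau> v w)" if "a \<in> gl_ix p q" for a
    using v that vV wW by (simp add: act_l smul_l highest_weight_vector_def)
  moreover have "left_action m n a b (\<tau> v w) = 0" if ab: "(a, b) \<in> simple_roots p q" for a b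
  proof -
    have "a \<in> gl_ix p q" "b \<in> gl_ix p q"
      using ab by (auto simp: simple_roots_def split: if_splits)
    moreover have "act V a b v = 0"
      using v ab by (auto simp: highest_weight_vector_def)
    moreover have "\<tau> 0 w = 0"
      using smul_l[OF V0 wW(1), of 0] by simp
    ultimately show ?thesis
      using vV wW by (simp add: act_l)
  qed
  moreover have "right_action p q a a (\<tau> v w) = smul (of_nat (hweight m lam a)) (\<tau> v w)" if a: "a \<in> gl_ix m n" for a
  proof -
    \<comment> \<open>the sign rule for the right action is stated for homogeneous elements of the left module only\<close>
    obtain v0 v1 where v01: "v = v0 + v1" "v0 \<in> part V False" "v1 \<in> part V True"
      using vV(1) by (auto simp: carr_def)
    have "V.subspace (part V \<epsilon>)" for \<epsilon>
      using V by (simp add: is_V_def gl_module_def)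
    then have "0 \<in> part V \<epsilon>" for \<epsilon>
      by (rule V.subspace_0)
    then have v01': "v0 \<in> carr V" "v1 \<in> carr V"
      unfolding carr_def using v01 by (force intro: exI[of _ v0] exI[of _ v1])+
    have W': "act W a a w = scal W (of_nat (hweight m lam a)) w"
      using w a by (simp add: highest_weight_vector_def)
    have 1: "right_action p q a a (\<tau> v0 w) = smul (of_nat (hweight m lam a)) (\<tau> v0 w)"
      using act_r[OF a a v01(2) wW(1)] v01' wW by (simp add: W' smul_r epar_def)
    have 2: "right_action p q a a (\<tau> v1 w) = smul (of_nat (hweight m lam a)) (\<tau> v1 w)"
      using act_r[OF a a v01(3) wW(1)] v01' wW by (simp add: W' smul_r epar_def)
    show ?thesis
      unfolding v01(1) add_l[OF v01' wW(1)] by (simp add: sder_add[OF sder_right] 1 2 spoly.scale_right_distrib)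
  qed
  ultimately show thesis
    using that[of "\<tau> v w"] UH by blast
qed

subsection \<open>The bound on the rows below the \<open>m\<close>-th\<close>

lemma pdiff_minus: "pdiff v (f - g) = pdiff v f - pdiff v g"
  using sder_add[OF sder_pdiff, of v f "- g"] sder_uminus[OF sder_pdiff, of v g] by simp

lemma odd_derivative_square: assumes "gpar u" shows "pdiff u (pdiff u f) = 0"
proof (induction f rule: spoly_induct)
  case (gen w f)
  with assms show ?case
    by (cases "gpar w") (auto simp: pdiff_gen pdiff_add pdiff_smul pdiff_minus sder_uminus[OF sder_pdiff] sder_0[OF sder_pdiff] simp del: pdiff_simps)
qed (simp_all add: pdiff_1 pdiff_add pdiff_smul pdiff_0 del: pdiff_simps)

lemma odd_derivatives_anticommute:
  assumes "gpar u" "gpar v"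
  shows "pdiff u (pdiff v f) = - pdiff v (pdiff u f)"
proof (cases "u = v")
  case True
  then show ?thesis using odd_derivative_square[OF assms(1)] by simp
next
  case False
  show ?thesis
  proof (induction f rule: spoly_induct)
    case (gen w f)
    with assms False show ?case
      by (cases "gpar w") (auto simp: pdiff_gen pdiff_add pdiff_smul pdiff_minus sder_uminus[OF sder_pdiff] sder_0[OF sder_pdiff] simp del: pdiff_simps)
  qed (simp_all add: pdiff_1 pdiff_add pdiff_smul pdiff_0 del: pdiff_simps)
qed

text \<open>The operator \<open>\<Sum>\<^sub>k \<theta>\<^sub>k \<partial>\<^sub>k\<close>, with \<open>\<theta>\<^sub>k\<close> conjugate to \<open>\<partial>\<^sub>k\<close> up to the factor \<open>C\<close>, counts odd
  variables. Applying \<open>\<partial>\<^sub>k\<close> removes one of them and lowers the eigenvalue by 1, which is possible at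
  most \<open>|K|\<close> times; the eigenvalue at the end is 0.\<close>

lemma odd_number_eigenvalue:
  fixes \<theta> :: "nat \<Rightarrow> spoly" and e :: "nat \<Rightarrow> evar + ovar"
  assumes e: "\<And>k. gpar (e k)" and C: "nzd C" "homog False C" "\<And>k. pdiff (e k) C = 0"
    and \<theta>: "\<And>k. homog True (\<theta> k)" "\<And>k k'. pdiff (e k) (\<theta> k') = (if k = k' then C else 0)"
    and "finite K" "g \<noteq> 0" "C * smul a g = (\<Sum>k\<in>K. \<theta> k * pdiff (e k) g)"
  shows "\<exists>b\<le>card K. a = of_nat b"
  using assms(7-)
proof (induction "card K" arbitrary: K g a)
  case 0
  then have "C * smul a g = 0" by simp
  then have "smul a g = 0" using C(1) unfolding nzd_def by blast
  with 0 show ?case by simp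
next
  case (Suc N)
  show ?case
  proof (cases "\<forall>k\<in>K. pdiff (e k) g = 0")
    case True
    then have "C * smul a g = 0" using Suc by simp
    then have "smul a g = 0" using C(1) unfolding nzd_def by blast
    with Suc show ?thesis by simp
  next
    case False
    then obtain k0 where k0: "k0 \<in> K" "pdiff (e k0) g \<noteq> 0" by blast
    let ?D = "\<lambda>k. pdiff (e k)"
    let ?h = "?D k0 g"
    have D: "sder True (?D k)" for k
      using sder_pdiff[of "e k"] e[of k] by simp
    have h0: "?D k0 ?h = 0"
      by (rule odd_derivative_square[OF e])
    have "C * smul a ?h = ?D k0 (C * smul a g)"
      by (simp add: sder_central_mult[OF D C(2)] C(3) sder_smul[OF D] del: pdiff_simps)
    also have "\<dots> = (\<Sum>k\<in>K. ?D k0 (\<theta> k * ?D k g))"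
      using Suc by (simp add: sder_sum[OF D] del: pdiff_simps)
    also have "\<dots> = (\<Sum>k\<in>K. (if k = k0 then C * ?h else 0) + \<theta> k * ?D k ?h)"
    proof (rule sum.cong[OF refl])
      fix k assume "k \<in> K"
      have "?D k0 (\<theta> k * ?D k g) = ?D k0 (\<theta> k) * ?D k g - \<theta> k * ?D k0 (?D k g)"
        using \<theta>(1)[of k] by (simp add: sder_mult[OF D] iot_True homog_True del: pdiff_simps)
      also have "?D k0 (?D k g) = - ?D k ?h"
        by (rule odd_derivatives_anticommute[OF e e])
      finally show "?D k0 (\<theta> k * ?D k g) = (if k = k0 then C * ?h else 0) + \<theta> k * ?D k ?h"
        by (simp add: \<theta>(2) del: pdiff_simps)
    qed
    also have "\<dots> = C * ?h + (\<Sum>k\<in>K - {k0}. \<theta> k * ?D k ?h)"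
      using Suc(3) k0(1) h0 by (simp add: sum.distrib sum.remove[of K k0 "\<lambda>k. \<theta> k * ?D k ?h"] del: pdiff_simps)
    finally have "C * smul (a - 1) ?h = (\<Sum>k\<in>K - {k0}. \<theta> k * ?D k ?h)"
      by (simp add: spoly.scale_left_diff_distrib right_diff_distrib)
    moreover have "N = card (K - {k0})"
      using Suc k0 by simp
    ultimately obtain b where "b \<le> N" "a - 1 = of_nat b"
      using Suc(1)[of "K - {k0}" ?h "a - 1"] Suc(3) k0(2) by auto
    then show ?thesis
      using Suc(2) by (intro exI[of _ "Suc b"]) (simp add: algebra_simps)
  qed
qed

text \<open>All positive root vectors are commutators of simple ones.\<close>

lemma left_upper_0:
  assumes E: "\<And>j. 1 < j \<Longrightarrow> j \<le> p \<Longrightarrow> left_action m n (Inl (j - 1)) (Inl j) f = 0"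
    and "1 \<le> j" "j < i" "i \<le> p"
  shows "left_action m n (Inl j) (Inl i) f = 0"
  using assms(3,2)
proof (induction j rule: strict_inc_induct)
  case (base j)
  then show ?case
    using E[of i] assms(4) by (metis Suc_eq_plus1 diff_Suc_1 less_eq_Suc_le One_nat_def Suc_le_mono)
next
  case (step j)
  let ?L = "\<lambda>a b. left_action m n (Inl a) (Inl b)"
  have "?L j (Suc j) f = 0"
    using E[of "Suc j"] step assms(4) by simp
  moreover have "?L (Suc j) i f = 0"
    using step by simp
  moreover have "?L j (Suc j) (?L (Suc j) i f) - ?L (Suc j) i (?L j (Suc j) f) = ?L j i f"
    using left_comm[of m n "Inl j" "Inl (Suc j)" "Inl (Suc j)" "Inl i" f] step by (auto simp: epar_def)
  ultimately show ?case
    by (simp add: sder_0[OF sder_left])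
qed

text \<open>Let \<open>i = m + 1\<close>. Combine the operators \<open>E\<^sub>j\<^sub>i\<close> for \<open>j \<le> i\<close> with the cofactors of the last row of the
  generic \<open>i \<times> i\<close> matrix: the terms with the variables \<open>x\<close> drop out, being determinants with two equal
  rows, and those with \<open>\<eta>\<close> form a number operator. On \<open>f\<close> only the term with \<open>j = i\<close> survives.\<close>

lemma row_bound:
  assumes mp: "m < p" and f: "f \<noteq> 0" "f \<in> polyin (poly_vars p q m n)"
    and w: "left_action m n (Inl (m + 1)) (Inl (m + 1)) f = smul (of_nat b) f"
    and E: "\<And>j. 1 < j \<Longrightarrow> j \<le> p \<Longrightarrow> left_action m n (Inl (j - 1)) (Inl j) f = 0"
  shows "b \<le> n"
proof -
  let ?i = "m + 1"
  let ?C = "cof ?i ?i"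
  let ?e = "\<lambda>k. Inr (Eta k ?i) :: evar + ovar"
  have C_poly: "?C j \<in> polyin (range Inl)" for j
    unfolding cof_def by (intro polyin_sdet) (auto intro: polyin_gen)
  have C0: "pdiff (Inr v) (?C j) = 0" for v j
    by (rule pdiff_outside[OF C_poly]) auto
  have row: "(\<Sum>j=1..?i. v j * ?C j) = sdet ?i (xv(?i := v))" for v
    by (rule cof_row[symmetric]) simp
  have "ev (?C ?i) = sdet ?i (\<lambda>l i. if i = l then 1 else 0)"
    unfolding cof_def ev_sdet by (rule sdet_cong) (auto simp: ev_gens)
  then have "?C ?i \<noteq> 0"
    using sdet_unit by force
  then have nzd: "nzd (?C ?i)"
    by (rule nzd_polyin[OF C_poly])
  have x: "(\<Sum>j=1..?i. xv l j * ?C j) = 0" if "l \<in> {1..m}" for l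
    unfolding row by (rule sdet_equal_rows[of l _ ?i]) (use that homog_vars in auto)
  have \<eta>: "(\<Sum>j=1..?i. etav k j * ?C j) = detX ?i k {?i}" for k
    unfolding row th_upd ..
  have L0: "left_action m n (Inl j) (Inl ?i) f = 0" if "1 \<le> j" "j < ?i" for j
    by (rule left_upper_0[of p]) (use E that mp in auto)
  have "?C ?i * smul (of_nat b) f = (\<Sum>j=1..?i. if j = ?i then ?C ?i * smul (of_nat b) f else 0)"
    by simp
  also have "\<dots> = (\<Sum>j=1..?i. ?C j * left_action m n (Inl j) (Inl ?i) f)"
  proof (rule sum.cong[OF refl])
    fix j assume "j \<in> {1..?i}"
    then show "(if j = ?i then ?C ?i * smul (of_nat b) f else 0) = ?C j * left_action m n (Inl j) (Inl ?i) f"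
      using L0[of j] w mp by (cases "j = ?i") auto
  qed
  also have "\<dots> = (\<Sum>j=1..?i. \<Sum>a\<in>gl_ix m n. gen (zvar a (Inl j)) * ?C j * pdiff (zvar a (Inl ?i)) f)"
    unfolding left_action_def sum_distrib_left
    by (intro sum.cong refl) (simp add: homog_central[OF homog_cof] flip: mult.assoc del: zvar_eq)
  also have "\<dots> = (\<Sum>a\<in>gl_ix m n. (\<Sum>j=1..?i. gen (zvar a (Inl j)) * ?C j) * pdiff (zvar a (Inl ?i)) f)"
    by (subst sum.swap) (simp only: sum_distrib_right)
  also have "\<dots> = (\<Sum>l=1..m. (\<Sum>j=1..?i. xv l j * ?C j) * pdiff (zvar (Inl l) (Inl ?i)) f) +
      (\<Sum>k=1..n. (\<Sum>j=1..?i. etav k j * ?C j) * pdiff (zvar (Inr k) (Inl ?i)) f)"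
    by (simp only: sum_gl_ix zvar.simps)
  also have "\<dots> = (\<Sum>k=1..n. detX ?i k {?i} * pdiff (?e k) f)"
    unfolding \<eta> by (simp only: x sum.neutral_const mult_zero_left add_0_left zvar.simps cong: sum.cong)
  finally have main: "?C ?i * smul (of_nat b) f = (\<Sum>k\<in>{1..n}. detX ?i k {?i} * pdiff (?e k) f)" .
  have "\<exists>b'\<le>card {1..n}. (of_nat b :: complex) = of_nat b'"
  proof (rule odd_number_eigenvalue[OF _ nzd homog_cof _ _ _ _ f(1) main])
    show "gpar (?e k)" for k
      by (simp add: gpar_def)
    show "pdiff (?e k) (?C ?i) = 0" for k
      by (rule C0)
    show "homog True (detX ?i k {?i})" for k
      by (rule homog_th) simp
    show "pdiff (?e k) (detX ?i k' {?i}) = (if k = k' then ?C ?i else 0)" for k k'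
    proof -
      have "pdiff (?e k) (etav k' j * ?C j) = (if j = ?i then if k = k' then ?C ?i else 0 else 0)" for j
        by (simp add: pdiff_gen C0 del: pdiff_simps)
      then show ?thesis
        unfolding \<eta>[symmetric] sder_sum[OF sder_pdiff] by simp
    qed
  qed simp
  then show ?thesis by auto
qed

subsection \<open>The modules\<close>

lemma hook_appears:
  assumes mp: "m \<le> p" and y: "young_diagram lam" and h: "lam (m + 1) \<le> n" "lam (p + 1) \<le> q"
  shows "appears p q m n lam (homogeneous (diagram_size lam))"
proof -
  obtain M where M: "p < M" "\<forall>i>M. lam i = 0"
    using young_bound[OF y] by blast
  interpret hook_diagram p q m n M lam
    by unfold_locales (use assms M in auto)
  interpret P: hw_pair p q m n F lam "odd (\<Sum>j=1..r'. c j - m)"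
    by unfold_locales (rule F_hwv homog_F)+
  have "left_action m n a a F = smul (of_nat (hweight p lam a)) F" if "a \<in> gl_ix p q" for a
    using F_hwv that by (simp add: hwv_corresponds_def highest_weight_vector_def left_poly_def)
  then have "Deg F = smul (of_nat (\<Sum>a\<in>gl_ix p q. hweight p lam a)) F"
    by (rule Deg_left[OF F_poly])
  also have "(\<Sum>a\<in>gl_ix p q. hweight p lam a) = diagram_size lam"
    using hweight_total[OF y M(2), of p q] diagram_size_sum[OF y M(2)] M(1) by (simp add: seen_eqI[OF y h(2)])
  finally have "F \<in> homogeneous (diagram_size lam)"
    by (simp add: homogeneous_Deg)
  then show ?thesis
    by (rule P.appears_homogeneous)
qed

text \<open>The diagram enters the definition of the modules only through its weights.\<close>

lemma same_modules_appears:
  assumes "same_modules p q m n lam mu" "appears p q m n mu H" "H \<subseteq> H'"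
  shows "appears p q m n lam H'"
proof -
  have "highest_weight_vector p q V (hweight p lam) = highest_weight_vector p q V (hweight p mu)"
    "highest_weight_vector m n V (hweight m lam) = highest_weight_vector m n V (hweight m mu)" for V :: "spoly supermodule"
    using assms(1) by (auto simp: same_modules_def highest_weight_vector_def fun_eq_iff)
  then have "is_V p q lam = (is_V p q mu :: spoly supermodule \<Rightarrow> bool)" "is_V m n lam = (is_V m n mu :: spoly supermodule \<Rightarrow> bool)"
    by (auto simp: is_V_def fun_eq_iff)
  then show ?thesis
    using assms(2,3) unfolding appears_def by (metis order_trans)
qed

text \<open>The Euler operator, being the sum of the Cartan elements of either algebra, has both sums of weights
  as its eigenvalue.\<close>

lemma appears_totals:
  assumes "appears p q m n lam H"
  shows "(\<Sum>a\<in>gl_ix p q. hweight p lam a) = (\<Sum>a\<in>gl_ix m n. hweight m lam a)"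
    and "H = homogeneous d \<Longrightarrow> (\<Sum>a\<in>gl_ix p q. hweight p lam a) = d"
    and "m < p \<Longrightarrow> lam (m + 1) \<le> n"
proof -
  obtain f where f: "f \<in> H" "f \<noteq> 0" "f \<in> polyin (poly_vars p q m n)"
    "\<And>a. a \<in> gl_ix p q \<Longrightarrow> left_action m n a a f = smul (of_nat (hweight p lam a)) f"
    "\<And>a. a \<in> gl_ix m n \<Longrightarrow> right_action p q a a f = smul (of_nat (hweight m lam a)) f"
    "\<And>a b. (a, b) \<in> simple_roots p q \<Longrightarrow> left_action m n a b f = 0"
    using appears_vector[OF assms] by blast
  have cancel: "k = l" if "smul (of_nat k) f = smul (of_nat l) f" for k l :: nat
    using that f(2) by (simp only: spoly.scale_cancel_right of_nat_eq_iff simp_thms)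
  show "(\<Sum>a\<in>gl_ix p q. hweight p lam a) = (\<Sum>a\<in>gl_ix m n. hweight m lam a)"
    by (rule cancel, rule trans[OF Deg_left[OF f(3,4), symmetric] Deg_right[OF f(3,5)]])
  show "(\<Sum>a\<in>gl_ix p q. hweight p lam a) = d" if "H = homogeneous d"
    by (rule cancel, rule trans[OF Deg_left[OF f(3,4), symmetric]]) (use f(1) that in \<open>simp_all add: homogeneous_Deg\<close>)
  show "lam (m + 1) \<le> n" if "m < p"
  proof (rule row_bound[OF that f(2,3)])
    show "left_action m n (Inl (m + 1)) (Inl (m + 1)) f = smul (of_nat (lam (m + 1))) f"
      using f(4)[of "Inl (m + 1)"] that by (simp add: hweight_def)
    show "left_action m n (Inl (j - 1)) (Inl j) f = 0" if "1 < j" "j \<le> p" for j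
      by (rule f(6)) (use that in \<open>auto simp: simple_roots_def\<close>)
  qed
qed

lemma appears_homogeneous_hook:
  assumes mp: "m \<le> p" and y: "young_diagram lam" and a: "appears p q m n lam (homogeneous (diagram_size lam))"
  shows "lam (m + 1) \<le> n \<and> lam (p + 1) \<le> q"
proof -
  obtain M where M: "p < M" "\<forall>i>M. lam i = 0"
    using young_bound[OF y] by blast
  note size = appears_totals(2)[OF a refl, unfolded diagram_size_sum[OF y M(2)]]
  have "(\<Sum>i=1..M. seen p q lam i) = (\<Sum>i=1..M. lam i)"
    using size hweight_total[OF y M(2), of p q] M(1) by simp
  moreover have "(\<Sum>i=1..M. seen m n lam i) = (\<Sum>i=1..M. lam i)"
    using size appears_totals(1)[OF a] hweight_total[OF y M(2), of m n] M(1) mp by simp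
  ultimately show ?thesis
    using seen_eqD M(1) mp by (meson le_less_trans)
qed

text \<open>For \<open>m < p\<close> the diagram itself satisfies the inequalities. For \<open>m = p\<close> it is cut off, below row \<open>p\<close>, at
  the smaller of \<open>q\<close> and \<open>n\<close>; the sums of weights agree only if the larger one sees no further boxes.\<close>

lemma appears_hook:
  assumes mp: "m \<le> p" and y: "young_diagram lam" and a: "appears p q m n lam UNIV"
  shows "\<exists>mu. young_diagram mu \<and> same_modules p q m n lam mu \<and> mu (m + 1) \<le> n \<and> mu (p + 1) \<le> q"
proof -
  obtain M where M: "p < M" "\<forall>i>M. lam i = 0"
    using young_bound[OF y] by blast
  have eq: "(\<Sum>i=1..M. seen p q lam i) = (\<Sum>i=1..M. seen m n lam i)"
    using appears_totals(1)[OF a] hweight_total[OF y M(2), of p q] hweight_total[OF y M(2), of m n] M(1) mp by simp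
  show ?thesis
  proof (cases "m < p")
    case True
    then have h: "lam (m + 1) \<le> n"
      by (rule appears_totals(3)[OF a])
    then have "(\<Sum>i=1..M. seen p q lam i) = (\<Sum>i=1..M. lam i)"
      using eq by (simp add: seen_eqI[OF y h])
    then have "lam (p + 1) \<le> q"
      using M(1) by (rule seen_eqD)
    with h y show ?thesis
      by (intro exI[of _ lam]) (auto simp: same_modules_def)
  next
    case False
    with mp have mp: "m = p" by simp
    have seen_eq: "seen p q lam i = seen p n lam i" if "i \<in> {1..M}" for i
    proof (cases "q \<le> n")
      case True
      then have "seen p q lam k \<le> seen p n lam k" for k
        by (auto simp: seen_def min_def)
      then show ?thesis
        by (intro sum_mono_inv[OF eq[unfolded mp] _ that]) simp_all
    next
      case False
      then have "seen p n lam k \<le> seen p q lam k" for k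
        by (auto simp: seen_def min_def)
      then show ?thesis
        by (intro sum_mono_inv[OF eq[unfolded mp, symmetric] _ that, symmetric]) simp_all
    qed
    \<comment> \<open>equal to \<open>\<lambda>\<close> as far as either algebra can see\<close>
    define mu where "mu = seen p (min q n) lam"
    have mu: "mu i = seen p q lam i" "mu i = seen p n lam i" if "1 \<le> i" for i
    proof -
      have "seen p q lam i = seen p n lam i"
        using seen_eq[of i] M(2) that by (cases "i \<le> M") (auto simp: seen_def)
      then show "mu i = seen p q lam i" "mu i = seen p n lam i"
        by (auto simp: mu_def seen_def min_def split: if_splits)
    qed
    have ymu: "young_diagram mu"
      unfolding young_diagram_def
    proof (intro conjI allI impI)
      fix i :: nat assume "1 \<le> i"
      then have "lam (Suc i) \<le> lam i" using y by (simp add: young_diagram_def)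
      then show "mu (Suc i) \<le> mu i"
        by (auto simp: mu_def seen_def min_def)
    next
      show "finite {i. 1 \<le> i \<and> 0 < mu i}"
        by (rule finite_subset[of _ "{i. 1 \<le> i \<and> 0 < lam i}"])
          (use y in \<open>auto simp: mu_def seen_def young_diagram_def split: if_splits\<close>)
    qed
    have muM: "\<forall>i>M. mu i = 0"
      using M(2) by (simp add: mu_def seen_def)
    have col: "conj_diagram lam j - p = conj_diagram mu j - p" if j: "1 \<le> j" "j \<le> Q" and Q: "\<And>i. 1 \<le> i \<Longrightarrow> mu i = seen p Q lam i" for j Q
    proof -
      have "{i \<in> {p+1..M}. j \<le> lam i} = {i \<in> {p+1..M}. j \<le> mu i}"
        using j Q by (auto simp: seen_def)
      then show ?thesis
        by (simp only: conj_minus[OF y M(2) j(1)] conj_minus[OF ymu muM j(1)])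
    qed
    have "hweight p lam a = hweight p mu a" if "a \<in> gl_ix p Q" and Q: "\<And>i. 1 \<le> i \<Longrightarrow> mu i = seen p Q lam i" for a Q
      using that(1) col[OF _ _ Q] Q by (cases a) (auto simp: hweight_def seen_def)
    from this[OF _ mu(1)] this[OF _ mu(2)] have "same_modules p q m n lam mu"
      by (auto simp: same_modules_def mp)
    moreover have "mu (m + 1) \<le> n" "mu (p + 1) \<le> q"
      by (auto simp: mu_def seen_def mp)
    ultimately show ?thesis
      using ymu by blast
  qed
qed

lemma (in hook_diagram) Gamma_trivial: "s = 0 \<Longrightarrow> r = 0 \<Longrightarrow> Gamma p m s \<mu> = 1"
  using Gamma_facts(2) unfolding N_def Yh_def by simp

theorem theorem4p5:
  fixes p q m n :: nat and lam :: "nat \<Rightarrow> nat"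
  assumes pm: "m \<le> p" and young: "young_diagram lam"
  defines "lam' \<equiv> conj_diagram lam"
  defines "t \<equiv> diagram_length lam'"
  shows
    "(appears p q m n lam (homogeneous (diagram_size lam)) \<longleftrightarrow>
        lam (m + 1) \<le> n \<and> lam (p + 1) \<le> q) \<and>
     (appears p q m n lam UNIV \<longleftrightarrow>
        (\<exists>mu. young_diagram mu \<and> same_modules p q m n lam mu \<and>
              mu (m + 1) \<le> n \<and> mu (p + 1) \<le> q)) \<and>
     (lam (m + 1) \<le> n \<and> lam (p + 1) \<le> q \<longrightarrow>
        (lam (m + 1) = 0 \<longrightarrow>
           hwv_corresponds p q m n lam (oprod 1 t (\<lambda>i. Delta (lam' i)))) \<and>
        (lam (m + 1) > 0 \<and> lam (p + 1) = 0 \<longrightarrow>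
           (\<forall>r. 1 \<le> r \<and> r \<le> n \<and> lam' r > m \<and> lam' (r + 1) \<le> m \<longrightarrow>
              hwv_corresponds p q m n lam
                (oprod 1 r (\<lambda>i. Delta2 m i (lam' i)) * oprod (r + 1) t (\<lambda>i. Delta (lam' i))))) \<and>
        (lam (p + 1) > 0 \<longrightarrow>
           (\<forall>r r' s. 1 \<le> r \<and> lam' r > p \<and> lam' (r + 1) \<le> p \<and>
              1 \<le> r' \<and> lam' r' > m \<and> lam' (r' + 1) \<le> m \<and> p + s = diagram_length lam \<longrightarrow>
              hwv_corresponds p q m n lam
                (Gamma p m s (\<lambda>i. lam (p + i))
                 * oprod (r + 1) r' (\<lambda>i. Delta2 m i (lam' i))
                 * oprod (r' + 1) t (\<lambda>i. Delta (lam' i))))))"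
proof (intro conjI impI allI)
  show "appears p q m n lam (homogeneous (diagram_size lam)) \<longleftrightarrow> lam (m + 1) \<le> n \<and> lam (p + 1) \<le> q"
    using appears_homogeneous_hook[OF pm young] hook_appears[OF pm young] by blast
  show "appears p q m n lam UNIV \<longleftrightarrow> (\<exists>mu. young_diagram mu \<and> same_modules p q m n lam mu \<and> mu (m + 1) \<le> n \<and> mu (p + 1) \<le> q)"
  proof
    assume "appears p q m n lam UNIV"
    then show "\<exists>mu. young_diagram mu \<and> same_modules p q m n lam mu \<and> mu (m + 1) \<le> n \<and> mu (p + 1) \<le> q"
      by (rule appears_hook[OF pm young])
  next
    assume "\<exists>mu. young_diagram mu \<and> same_modules p q m n lam mu \<and> mu (m + 1) \<le> n \<and> mu (p + 1) \<le> q"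
    then obtain mu where mu: "young_diagram mu" "same_modules p q m n lam mu" "mu (m + 1) \<le> n" "mu (p + 1) \<le> q"
      by blast
    from hook_appears[OF pm mu(1,3,4)] show "appears p q m n lam UNIV"
      by (rule same_modules_appears[OF mu(2)]) simp
  qed
  have t: "t = lam 1"
    unfolding t_def lam'_def by (rule conj_0_length[OF young])
  have row: "r = lam (k + 1)" if "1 \<le> r" "lam' r > k" "lam' (r + 1) \<le> k" for r k
    using conj_iff[OF young, of r "k + 1"] conj_iff[OF young, of "r + 1" "k + 1"] that by (simp add: lam'_def)
  assume "lam (m + 1) \<le> n \<and> lam (p + 1) \<le> q"
  then have h: "lam (m + 1) \<le> n" "lam (p + 1) \<le> q" by auto
  have below0: "lam (p + i) = 0" if "lam (p + 1) = 0" "0 < i" for i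
    using young_antimono[OF young, of "p + 1" "p + i"] that by simp
  {
    assume 0: "lam (m + 1) = 0"
    then have p0: "lam (p + 1) = 0"
      using young_antimono[OF young, of "m + 1" "p + 1"] pm by simp
    interpret hook_diagram p q m n 0 lam
      by unfold_locales (use pm young h below0[OF p0] in auto)
    have "F = oprod 1 t (\<lambda>i. Delta (lam' i))"
      unfolding F_def using Gamma_trivial[OF refl p0] by (simp add: 0 p0 t lam'_def)
    then show "hwv_corresponds p q m n lam (oprod 1 t (\<lambda>i. Delta (lam' i)))"
      using F_hwv by simp
  next
    fix r assume 0: "lam (m + 1) > 0 \<and> lam (p + 1) = 0" and "1 \<le> r \<and> r \<le> n \<and> lam' r > m \<and> lam' (r + 1) \<le> m"
    then have r: "r = lam (m + 1)" and p0: "lam (p + 1) = 0"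
      using row by auto
    interpret hook_diagram p q m n 0 lam
      by unfold_locales (use pm young h below0[OF p0] in auto)
    have "F = oprod 1 r (\<lambda>i. Delta2 m i (lam' i)) * oprod (r + 1) t (\<lambda>i. Delta (lam' i))"
      unfolding F_def using Gamma_trivial[OF refl p0] by (simp add: r p0 t lam'_def)
    then show "hwv_corresponds p q m n lam (oprod 1 r (\<lambda>i. Delta2 m i (lam' i)) * oprod (r + 1) t (\<lambda>i. Delta (lam' i)))"
      using F_hwv by simp
  next
    fix r r' s assume "lam (p + 1) > 0" and *: "1 \<le> r \<and> lam' r > p \<and> lam' (r + 1) \<le> p \<and>
      1 \<le> r' \<and> lam' r' > m \<and> lam' (r' + 1) \<le> m \<and> p + s = diagram_length lam"
    then have r: "r = lam (p + 1)" "r' = lam (m + 1)"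
      using row by auto
    have "lam (p + i) = 0" if "s < i" for i
      using length_iff[OF young, of "p + i"] * that by auto
    then interpret H: hook_diagram p q m n s lam
      by unfold_locales (use pm young h in auto)
    show "hwv_corresponds p q m n lam
       (Gamma p m s (\<lambda>i. lam (p + i)) * oprod (r + 1) r' (\<lambda>i. Delta2 m i (lam' i)) * oprod (r' + 1) t (\<lambda>i. Delta (lam' i)))"
      using H.F_hwv by (simp only: H.F_def r t lam'_def)
  }
qed

end
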